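(* Let $G$ be a finite group, $H\subset G$ a subgroup, $F\lhd H$ a normal subgroup, $\gamma\in Z^2(F,k^* )$ a normalised 2-cocycle, and $\varepsilon:H\times F\to k^*$ a map satisfying $$\varepsilon_{gh}(f)=\varepsilon_g(hfh^{-1})\,\varepsilon_h(f),\qquad g,h\in H,\ f\in F,$$ $$\gamma(f,g)\,\varepsilon_h(fg)=\varepsilon_h(f)\,\varepsilon_h(g)\,\gamma(hfh^{-1},hgh^{-1}),\qquad h\in H,\ f,g\in F,$$ $$\gamma(f,g)=\varepsilon_f(g)\,\gamma(fgf^{-1},f),\qquad f,g\in F.$$ Then the algebra $A(H,F,\gamma,\varepsilon)$ in the category $\mathcal{Z}(G)$ is trivialising if and only if $F=H$.
   Context: $k$ is an algebraically closed field of characteristic zero. For a finite group $G$ with unit $e$, $\mathcal{Z}(G)$ is the category of finite-dimensional $G$-graded $k$-vector spaces $X=\bigoplus_{g\in G}X_g$ with a linear $G$-action satisfying $f(X_g)=X_{fgf^{-1}}$; morphisms preserve grading and action. The tensor product is the graded tensor product with diagonal action; the unit object is $k$ in degree $e$ with trivial action; the braiding is $c_{X,Y}(x\otimes y)=f(y)\otimes x$ for $x\in X_f$. A 2-cocycle $\gamma$ is normalised if $\gamma(e,g)=\gamma(f,e)=1$. The algebra $A(H,F,\gamma,\varepsilon)$ is the vector space spanned by symbols $a_{g,f}$, $g\in G$, $f\in F$, modulo the relations $a_{gh,f}=\varepsilon_h(f)\,a_{g,hfh^{-1}}$ for all $h\in H$, with $G$-grading $|a_{g,f}|=gfg^{-1}$,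 $G$-action $g'(a_{g,f})=a_{g'g,f}$, and multiplication determined by $a_{g,f}a_{g,f'}=\gamma(f,f')a_{g,ff'}$ and $a_{g,f}a_{g',f'}=0$ if $gH\neq g'H$. It is an indecomposable separable commutative algebra in $\mathcal{Z}(G)$ (an algebra in $\mathcal{Z}(G)$ is commutative if $ab=f(b)a$ for $a\in A_f$). A right module $(M,\nu:M\otimes A\to M)$ over a commutative algebra $A$ in a braided category $\mathcal{C}$ is local if $\nu\circ c_{A,M}\circ c_{M,A}=\nu$. Local modules form a braided monoidal category $\mathcal{C}_A^{loc}$ with tensor product $\otimes_A$ and braiding induced from $\mathcal{C}$. A separable indecomposable commutative algebra $A$ is trivialising if $\mathcal{C}_A^{loc}$ is equivalent, as a braided monoidal category, to the category of finite-dimensional $k$-vector spaces. *)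

theory Defs
  imports
    "HOL-Algebra.Coset"
    "HOL-Library.Function_Algebras"
    "HOL-Library.Nat_Bijection"
    "HOL-Computational_Algebra.Polynomial"
begin

section \<open>Braided monoidal categories and braided monoidal equivalences\<close>

record ('o, 'a) braided_monoidal =
  obj :: "'o set"
  Hom :: "'o \<Rightarrow> 'o \<Rightarrow> 'a set"
  ident :: "'o \<Rightarrow> 'a"
  comp :: "'a \<Rightarrow> 'a \<Rightarrow> 'a" (infixr \<open>\<cdot>\<index>\<close> 65)
  tens :: "'o \<Rightarrow> 'o \<Rightarrow> 'o" (infixr \<open>\<odot>\<index>\<close> 75)
  tens_arr :: "'a \<Rightarrow> 'a \<Rightarrow> 'a" (infixr \<open>\<star>\<index>\<close> 75)
  unit_obj :: "'o"
  assoc :: "'o \<Rightarrow> 'o \<Rightarrow> 'o \<Rightarrow> 'a"  \<comment> \<open>\<open>(X \<odot> Y) \<odot> Z \<rightarrow> X \<odot> (Y \<odot> Z)\<close>\<close>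
  lunit :: "'o \<Rightarrow> 'a"  \<comment> \<open>\<open>I \<odot> X \<rightarrow> X\<close>\<close>
  runit :: "'o \<Rightarrow> 'a"  \<comment> \<open>\<open>X \<odot> I \<rightarrow> X\<close>\<close>
  braid :: "'o \<Rightarrow> 'o \<Rightarrow> 'a"  \<comment> \<open>\<open>X \<odot> Y \<rightarrow> Y \<odot> X\<close>\<close>

text \<open>
  Recording source and target keeps the hom-sets disjoint, which lets composition and tensor
  product of arrows be functions of the arrows alone.
\<close>

datatype ('o, 'f) arrow = Arrow (src: 'o) (trg: 'o) (fn: 'f)

definition inverse_arrows ::
  "('o, 'a, 'z) braided_monoidal_scheme \<Rightarrow> 'o \<Rightarrow> 'o \<Rightarrow> 'a \<Rightarrow> 'a \<Rightarrow> bool" where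
  "inverse_arrows C X Y f g \<longleftrightarrow> f \<in> Hom C X Y \<and> g \<in> Hom C Y X \<and>
     g \<cdot>\<^bsub>C\<^esub> f = ident C X \<and> f \<cdot>\<^bsub>C\<^esub> g = ident C Y"

definition iso_arrow ::
  "('o, 'a, 'z) braided_monoidal_scheme \<Rightarrow> 'o \<Rightarrow> 'o \<Rightarrow> 'a \<Rightarrow> bool" where
  "iso_arrow C X Y f \<longleftrightarrow> (\<exists>g. inverse_arrows C X Y f g)"

definition inv_arrow ::
  "('o, 'a, 'z) braided_monoidal_scheme \<Rightarrow> 'o \<Rightarrow> 'o \<Rightarrow> 'a \<Rightarrow> 'a" where
  "inv_arrow C X Y f = (THE g. inverse_arrows C X Y f g)"

definition functorial ::
  "('o, 'a, 'z) braided_monoidal_scheme \<Rightarrow> ('p, 'b, 'y) braided_monoidal_scheme \<Rightarrow>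
   ('o \<Rightarrow> 'p) \<Rightarrow> ('a \<Rightarrow> 'b) \<Rightarrow> bool" where
  "functorial C D Fo Fa \<longleftrightarrow>
     (\<forall>X\<in>obj C. Fo X \<in> obj D) \<and>
     (\<forall>X\<in>obj C. \<forall>Y\<in>obj C. \<forall>f\<in>Hom C X Y. Fa f \<in> Hom D (Fo X) (Fo Y)) \<and>
     (\<forall>X\<in>obj C. Fa (ident C X) = ident D (Fo X)) \<and>
     (\<forall>X\<in>obj C. \<forall>Y\<in>obj C. \<forall>Z\<in>obj C. \<forall>f\<in>Hom C X Y. \<forall>g\<in>Hom C Y Z.
        Fa (g \<cdot>\<^bsub>C\<^esub> f) = Fa g \<cdot>\<^bsub>D\<^esub> Fa f)"

definition natural_iso ::
  "('o, 'a, 'z) braided_monoidal_scheme \<Rightarrow> ('p, 'b, 'y) braided_monoidal_scheme \<Rightarrow>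
   ('o \<Rightarrow> 'p) \<Rightarrow> ('a \<Rightarrow> 'b) \<Rightarrow> ('o \<Rightarrow> 'p) \<Rightarrow> ('a \<Rightarrow> 'b) \<Rightarrow> ('o \<Rightarrow> 'b) \<Rightarrow> bool" where
  "natural_iso C D Fo Fa Go Ga \<eta> \<longleftrightarrow>
     (\<forall>X\<in>obj C. iso_arrow D (Fo X) (Go X) (\<eta> X)) \<and>
     (\<forall>X\<in>obj C. \<forall>Y\<in>obj C. \<forall>f\<in>Hom C X Y. \<eta> Y \<cdot>\<^bsub>D\<^esub> Fa f = Ga f \<cdot>\<^bsub>D\<^esub> \<eta> X)"

definition equivalence_of_categories ::
  "('o, 'a, 'z) braided_monoidal_scheme \<Rightarrow> ('p, 'b, 'y) braided_monoidal_scheme \<Rightarrow>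
   ('o \<Rightarrow> 'p) \<Rightarrow> ('a \<Rightarrow> 'b) \<Rightarrow> bool" where
  "equivalence_of_categories C D Fo Fa \<longleftrightarrow>
     functorial C D Fo Fa \<and>
     (\<exists>Go Ga \<eta> \<theta>. functorial D C Go Ga \<and>
        natural_iso C C (\<lambda>X. X) (\<lambda>f. f) (Go \<circ> Fo) (Ga \<circ> Fa) \<eta> \<and>
        natural_iso D D (Fo \<circ> Go) (Fa \<circ> Ga) (\<lambda>X. X) (\<lambda>f. f) \<theta>)"

definition braided_monoidal_functor ::
  "('o, 'a, 'z) braided_monoidal_scheme \<Rightarrow> ('p, 'b, 'y) braided_monoidal_scheme \<Rightarrow>
   ('o \<Rightarrow> 'p) \<Rightarrow> ('a \<Rightarrow> 'b) \<Rightarrow> ('o \<Rightarrow> 'o \<Rightarrow> 'b) \<Rightarrow> 'b \<Rightarrow> bool" where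
  "braided_monoidal_functor C D Fo Fa J J0 \<longleftrightarrow>
     functorial C D Fo Fa \<and>
     iso_arrow D (unit_obj D) (Fo (unit_obj C)) J0 \<and>
     (\<forall>X\<in>obj C. \<forall>Y\<in>obj C. iso_arrow D (Fo X \<odot>\<^bsub>D\<^esub> Fo Y) (Fo (X \<odot>\<^bsub>C\<^esub> Y)) (J X Y)) \<and>
     (\<forall>X\<in>obj C. \<forall>X'\<in>obj C. \<forall>Y\<in>obj C. \<forall>Y'\<in>obj C. \<forall>f\<in>Hom C X X'. \<forall>g\<in>Hom C Y Y'.
        Fa (f \<star>\<^bsub>C\<^esub> g) \<cdot>\<^bsub>D\<^esub> J X Y = J X' Y' \<cdot>\<^bsub>D\<^esub> (Fa f \<star>\<^bsub>D\<^esub> Fa g)) \<and>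
     (\<forall>X\<in>obj C. \<forall>Y\<in>obj C. \<forall>Z\<in>obj C.
        Fa (assoc C X Y Z) \<cdot>\<^bsub>D\<^esub> J (X \<odot>\<^bsub>C\<^esub> Y) Z \<cdot>\<^bsub>D\<^esub> (J X Y \<star>\<^bsub>D\<^esub> ident D (Fo Z)) =
        J X (Y \<odot>\<^bsub>C\<^esub> Z) \<cdot>\<^bsub>D\<^esub> (ident D (Fo X) \<star>\<^bsub>D\<^esub> J Y Z) \<cdot>\<^bsub>D\<^esub> assoc D (Fo X) (Fo Y) (Fo Z)) \<and>
     (\<forall>X\<in>obj C.
        Fa (lunit C X) \<cdot>\<^bsub>D\<^esub> J (unit_obj C) X \<cdot>\<^bsub>D\<^esub> (J0 \<star>\<^bsub>D\<^esub> ident D (Fo X)) = lunit D (Fo X) \<and>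
        Fa (runit C X) \<cdot>\<^bsub>D\<^esub> J X (unit_obj C) \<cdot>\<^bsub>D\<^esub> (ident D (Fo X) \<star>\<^bsub>D\<^esub> J0) = runit D (Fo X)) \<and>
     (\<forall>X\<in>obj C. \<forall>Y\<in>obj C.
        Fa (braid C X Y) \<cdot>\<^bsub>D\<^esub> J X Y = J Y X \<cdot>\<^bsub>D\<^esub> braid D (Fo X) (Fo Y))"

definition braided_monoidal_equivalent ::
  "('o, 'a, 'z) braided_monoidal_scheme \<Rightarrow> ('p, 'b, 'y) braided_monoidal_scheme \<Rightarrow> bool" where
  "braided_monoidal_equivalent C D \<longleftrightarrow>
     (\<exists>Fo Fa J J0. braided_monoidal_functor C D Fo Fa J J0 \<and> equivalence_of_categories C D Fo Fa)"


section \<open>Algebras in a braided monoidal category\<close>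

record ('o, 'a) algebra_data =
  alg_obj :: "'o"
  alg_mult :: "'a"
  alg_unit :: "'a"

definition algebra_in ::
  "('o, 'a, 'z) braided_monoidal_scheme \<Rightarrow> ('o, 'a) algebra_data \<Rightarrow> bool" where
  "algebra_in C \<A> \<longleftrightarrow> (let A = alg_obj \<A>; \<mu> = alg_mult \<A>; \<iota> = alg_unit \<A> in
     A \<in> obj C \<and> \<mu> \<in> Hom C (A \<odot>\<^bsub>C\<^esub> A) A \<and> \<iota> \<in> Hom C (unit_obj C) A \<and>
     \<mu> \<cdot>\<^bsub>C\<^esub> (\<mu> \<star>\<^bsub>C\<^esub> ident C A) = \<mu> \<cdot>\<^bsub>C\<^esub> (ident C A \<star>\<^bsub>C\<^esub> \<mu>) \<cdot>\<^bsub>C\<^esub> assoc C A A A \<and>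
     \<mu> \<cdot>\<^bsub>C\<^esub> (\<iota> \<star>\<^bsub>C\<^esub> ident C A) = lunit C A \<and>
     \<mu> \<cdot>\<^bsub>C\<^esub> (ident C A \<star>\<^bsub>C\<^esub> \<iota>) = runit C A)"

definition commutative_alg ::
  "('o, 'a, 'z) braided_monoidal_scheme \<Rightarrow> ('o, 'a) algebra_data \<Rightarrow> bool" where
  "commutative_alg C \<A> \<longleftrightarrow> alg_mult \<A> \<cdot>\<^bsub>C\<^esub> braid C (alg_obj \<A>) (alg_obj \<A>) = alg_mult \<A>"

text \<open>The splitting \<open>\<sigma>\<close> of the multiplication is a map of bimodules.\<close>

definition separable_alg ::
  "('o, 'a, 'z) braided_monoidal_scheme \<Rightarrow> ('o, 'a) algebra_data \<Rightarrow> bool" where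
  "separable_alg C \<A> \<longleftrightarrow> (let A = alg_obj \<A>; \<mu> = alg_mult \<A>; AA = A \<odot>\<^bsub>C\<^esub> A in
     \<exists>\<sigma>\<in>Hom C A AA.
       \<mu> \<cdot>\<^bsub>C\<^esub> \<sigma> = ident C A \<and>
       \<sigma> \<cdot>\<^bsub>C\<^esub> \<mu> = (\<mu> \<star>\<^bsub>C\<^esub> ident C A) \<cdot>\<^bsub>C\<^esub>
         inv_arrow C (AA \<odot>\<^bsub>C\<^esub> A) (A \<odot>\<^bsub>C\<^esub> AA) (assoc C A A A) \<cdot>\<^bsub>C\<^esub> (ident C A \<star>\<^bsub>C\<^esub> \<sigma>) \<and>
       \<sigma> \<cdot>\<^bsub>C\<^esub> \<mu> = (ident C A \<star>\<^bsub>C\<^esub> \<mu>) \<cdot>\<^bsub>C\<^esub> assoc C A A A \<cdot>\<^bsub>C\<^esub> (\<sigma> \<star>\<^bsub>C\<^esub> ident C A))"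

definition algebra_hom ::
  "('o, 'a, 'z) braided_monoidal_scheme \<Rightarrow> ('o, 'a) algebra_data \<Rightarrow> ('o, 'a) algebra_data \<Rightarrow> 'a \<Rightarrow> bool" where
  "algebra_hom C \<A> \<B> p \<longleftrightarrow> p \<in> Hom C (alg_obj \<A>) (alg_obj \<B>) \<and>
     p \<cdot>\<^bsub>C\<^esub> alg_mult \<A> = alg_mult \<B> \<cdot>\<^bsub>C\<^esub> (p \<star>\<^bsub>C\<^esub> p) \<and>
     p \<cdot>\<^bsub>C\<^esub> alg_unit \<A> = alg_unit \<B>"

definition zero_obj :: "('o, 'a, 'z) braided_monoidal_scheme \<Rightarrow> 'o \<Rightarrow> bool" where
  "zero_obj C Z \<longleftrightarrow> Z \<in> obj C \<and>
     (\<forall>X\<in>obj C. (\<exists>!f. f \<in> Hom C X Z) \<and> (\<exists>!f. f \<in> Hom C Z X))"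

definition product_cone ::
  "('o, 'a, 'z) braided_monoidal_scheme \<Rightarrow> 'o \<Rightarrow> 'o \<Rightarrow> 'o \<Rightarrow> 'a \<Rightarrow> 'a \<Rightarrow> bool" where
  "product_cone C P X Y p q \<longleftrightarrow> p \<in> Hom C P X \<and> q \<in> Hom C P Y \<and>
     (\<forall>Z\<in>obj C. \<forall>f\<in>Hom C Z X. \<forall>g\<in>Hom C Z Y.
        \<exists>!h. h \<in> Hom C Z P \<and> p \<cdot>\<^bsub>C\<^esub> h = f \<and> q \<cdot>\<^bsub>C\<^esub> h = g)"

text \<open>
  In an additive category the product is the direct sum, so a product cone of algebra maps
  says that the algebra is isomorphic to the direct sum of the two algebras.
\<close>

definition indecomposable_alg ::
  "('o, 'a, 'z) braided_monoidal_scheme \<Rightarrow> ('o, 'a) algebra_data \<Rightarrow> bool" where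
  "indecomposable_alg C \<A> \<longleftrightarrow> \<not> zero_obj C (alg_obj \<A>) \<and>
     \<not> (\<exists>\<B>1 \<B>2 p1 p2. algebra_in C \<B>1 \<and> algebra_in C \<B>2 \<and>
          \<not> zero_obj C (alg_obj \<B>1) \<and> \<not> zero_obj C (alg_obj \<B>2) \<and>
          algebra_hom C \<A> \<B>1 p1 \<and> algebra_hom C \<A> \<B>2 p2 \<and>
          product_cone C (alg_obj \<A>) (alg_obj \<B>1) (alg_obj \<B>2) p1 p2)"


section \<open>The category of local modules\<close>

text \<open>A module is a pair of its underlying object \<open>M\<close> and its action \<open>\<nu> : M \<odot> A \<rightarrow> M\<close>.\<close>

definition right_module ::
  "('o, 'a, 'z) braided_monoidal_scheme \<Rightarrow> ('o, 'a) algebra_data \<Rightarrow> 'o \<times> 'a \<Rightarrow> bool" where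
  "right_module C \<A> = (\<lambda>(M, \<nu>). let A = alg_obj \<A> in
     M \<in> obj C \<and> \<nu> \<in> Hom C (M \<odot>\<^bsub>C\<^esub> A) M \<and>
     \<nu> \<cdot>\<^bsub>C\<^esub> (\<nu> \<star>\<^bsub>C\<^esub> ident C A) = \<nu> \<cdot>\<^bsub>C\<^esub> (ident C M \<star>\<^bsub>C\<^esub> alg_mult \<A>) \<cdot>\<^bsub>C\<^esub> assoc C M A A \<and>
     \<nu> \<cdot>\<^bsub>C\<^esub> (ident C M \<star>\<^bsub>C\<^esub> alg_unit \<A>) = runit C M)"

definition local_module ::
  "('o, 'a, 'z) braided_monoidal_scheme \<Rightarrow> ('o, 'a) algebra_data \<Rightarrow> 'o \<times> 'a \<Rightarrow> bool" where
  "local_module C \<A> = (\<lambda>(M, \<nu>). right_module C \<A> (M, \<nu>) \<and>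
     \<nu> \<cdot>\<^bsub>C\<^esub> braid C (alg_obj \<A>) M \<cdot>\<^bsub>C\<^esub> braid C M (alg_obj \<A>) = \<nu>)"

definition module_hom_arrows ::
  "('o, 'a, 'z) braided_monoidal_scheme \<Rightarrow> ('o, 'a) algebra_data \<Rightarrow> 'o \<times> 'a \<Rightarrow> 'o \<times> 'a \<Rightarrow>
   ('o \<times> 'a, 'a) arrow set" where
  "module_hom_arrows C \<A> = (\<lambda>(M, \<nu>) (N, \<rho>).
     {Arrow (M, \<nu>) (N, \<rho>) f | f. f \<in> Hom C M N \<and>
        f \<cdot>\<^bsub>C\<^esub> \<nu> = \<rho> \<cdot>\<^bsub>C\<^esub> (f \<star>\<^bsub>C\<^esub> ident C (alg_obj \<A>))})"

definition coequaliser ::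
  "('o, 'a, 'z) braided_monoidal_scheme \<Rightarrow> 'o \<Rightarrow> 'o \<Rightarrow> 'a \<Rightarrow> 'a \<Rightarrow> 'o \<times> 'a \<Rightarrow> bool" where
  "coequaliser C X Y f g = (\<lambda>(Q, \<pi>). Q \<in> obj C \<and> \<pi> \<in> Hom C Y Q \<and>
     \<pi> \<cdot>\<^bsub>C\<^esub> f = \<pi> \<cdot>\<^bsub>C\<^esub> g \<and>
     (\<forall>Z\<in>obj C. \<forall>h\<in>Hom C Y Z. h \<cdot>\<^bsub>C\<^esub> f = h \<cdot>\<^bsub>C\<^esub> g \<longrightarrow>
        (\<exists>!u. u \<in> Hom C Q Z \<and> u \<cdot>\<^bsub>C\<^esub> \<pi> = h)))"

text \<open>
  On local modules the inverse braiding \<open>A \<odot> N \<rightarrow> N \<odot> A\<close> would give the same left action.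
\<close>

definition left_action ::
  "('o, 'a, 'z) braided_monoidal_scheme \<Rightarrow> ('o, 'a) algebra_data \<Rightarrow> 'o \<times> 'a \<Rightarrow> 'a" where
  "left_action C \<A> = (\<lambda>(N, \<rho>). \<rho> \<cdot>\<^bsub>C\<^esub> braid C (alg_obj \<A>) N)"

text \<open>
  The tensor product over the algebra is a chosen coequaliser of the two maps
  \<open>(M \<odot> A) \<odot> N \<rightarrow> M \<odot> N\<close> given by the actions; the second component is the projection
  from \<open>M \<odot> N\<close>.
\<close>

definition rel_tensor_coeq ::
  "('o, 'a, 'z) braided_monoidal_scheme \<Rightarrow> ('o, 'a) algebra_data \<Rightarrow> 'o \<times> 'a \<Rightarrow> 'o \<times> 'a \<Rightarrow> 'o \<times> 'a" where
  "rel_tensor_coeq C \<A> M N = (let A = alg_obj \<A> in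
     SOME Q. coequaliser C ((fst M \<odot>\<^bsub>C\<^esub> A) \<odot>\<^bsub>C\<^esub> fst N) (fst M \<odot>\<^bsub>C\<^esub> fst N)
       (snd M \<star>\<^bsub>C\<^esub> ident C (fst N))
       ((ident C (fst M) \<star>\<^bsub>C\<^esub> left_action C \<A> N) \<cdot>\<^bsub>C\<^esub> assoc C (fst M) A (fst N)) Q)"

abbreviation "rel_obj C \<A> M N \<equiv> fst (rel_tensor_coeq C \<A> M N)"
abbreviation "rel_proj C \<A> M N \<equiv> snd (rel_tensor_coeq C \<A> M N)"

definition rel_tensor ::
  "('o, 'a, 'z) braided_monoidal_scheme \<Rightarrow> ('o, 'a) algebra_data \<Rightarrow> 'o \<times> 'a \<Rightarrow> 'o \<times> 'a \<Rightarrow> 'o \<times> 'a" where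
  "rel_tensor C \<A> M N = (let A = alg_obj \<A>; Q = rel_obj C \<A> M N; \<pi> = rel_proj C \<A> M N in
     (Q, THE \<nu>. \<nu> \<in> Hom C (Q \<odot>\<^bsub>C\<^esub> A) Q \<and>
           \<nu> \<cdot>\<^bsub>C\<^esub> (\<pi> \<star>\<^bsub>C\<^esub> ident C A) =
           \<pi> \<cdot>\<^bsub>C\<^esub> (ident C (fst M) \<star>\<^bsub>C\<^esub> snd N) \<cdot>\<^bsub>C\<^esub> assoc C (fst M) (fst N) A))"

definition rel_tensor_arr ::
  "('o, 'a, 'z) braided_monoidal_scheme \<Rightarrow> ('o, 'a) algebra_data \<Rightarrow>
   ('o \<times> 'a, 'a) arrow \<Rightarrow> ('o \<times> 'a, 'a) arrow \<Rightarrow> ('o \<times> 'a, 'a) arrow" where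
  "rel_tensor_arr C \<A> f g =
     Arrow (rel_tensor C \<A> (src f) (src g)) (rel_tensor C \<A> (trg f) (trg g))
       (THE h. h \<in> Hom C (rel_obj C \<A> (src f) (src g)) (rel_obj C \<A> (trg f) (trg g)) \<and>
          h \<cdot>\<^bsub>C\<^esub> rel_proj C \<A> (src f) (src g) =
          rel_proj C \<A> (trg f) (trg g) \<cdot>\<^bsub>C\<^esub> (fn f \<star>\<^bsub>C\<^esub> fn g))"

definition rel_assoc ::
  "('o, 'a, 'z) braided_monoidal_scheme \<Rightarrow> ('o, 'a) algebra_data \<Rightarrow>
   'o \<times> 'a \<Rightarrow> 'o \<times> 'a \<Rightarrow> 'o \<times> 'a \<Rightarrow> ('o \<times> 'a, 'a) arrow" where
  "rel_assoc C \<A> M N P =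
    (let MN = rel_tensor C \<A> M N; NP = rel_tensor C \<A> N P in
     Arrow (rel_tensor C \<A> MN P) (rel_tensor C \<A> M NP)
       (THE h. h \<in> Hom C (rel_obj C \<A> MN P) (rel_obj C \<A> M NP) \<and>
          h \<cdot>\<^bsub>C\<^esub> rel_proj C \<A> MN P \<cdot>\<^bsub>C\<^esub> (rel_proj C \<A> M N \<star>\<^bsub>C\<^esub> ident C (fst P)) =
          rel_proj C \<A> M NP \<cdot>\<^bsub>C\<^esub> (ident C (fst M) \<star>\<^bsub>C\<^esub> rel_proj C \<A> N P) \<cdot>\<^bsub>C\<^esub>
            assoc C (fst M) (fst N) (fst P)))"

definition regular_module :: "('o, 'a) algebra_data \<Rightarrow> 'o \<times> 'a" where
  "regular_module \<A> = (alg_obj \<A>, alg_mult \<A>)"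

definition rel_lunit ::
  "('o, 'a, 'z) braided_monoidal_scheme \<Rightarrow> ('o, 'a) algebra_data \<Rightarrow> 'o \<times> 'a \<Rightarrow> ('o \<times> 'a, 'a) arrow" where
  "rel_lunit C \<A> M = Arrow (rel_tensor C \<A> (regular_module \<A>) M) M
     (THE h. h \<in> Hom C (rel_obj C \<A> (regular_module \<A>) M) (fst M) \<and>
        h \<cdot>\<^bsub>C\<^esub> rel_proj C \<A> (regular_module \<A>) M = left_action C \<A> M)"

definition rel_runit ::
  "('o, 'a, 'z) braided_monoidal_scheme \<Rightarrow> ('o, 'a) algebra_data \<Rightarrow> 'o \<times> 'a \<Rightarrow> ('o \<times> 'a, 'a) arrow" where
  "rel_runit C \<A> M = Arrow (rel_tensor C \<A> M (regular_module \<A>)) M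
     (THE h. h \<in> Hom C (rel_obj C \<A> M (regular_module \<A>)) (fst M) \<and>
        h \<cdot>\<^bsub>C\<^esub> rel_proj C \<A> M (regular_module \<A>) = snd M)"

definition rel_braid ::
  "('o, 'a, 'z) braided_monoidal_scheme \<Rightarrow> ('o, 'a) algebra_data \<Rightarrow>
   'o \<times> 'a \<Rightarrow> 'o \<times> 'a \<Rightarrow> ('o \<times> 'a, 'a) arrow" where
  "rel_braid C \<A> M N = Arrow (rel_tensor C \<A> M N) (rel_tensor C \<A> N M)
     (THE h. h \<in> Hom C (rel_obj C \<A> M N) (rel_obj C \<A> N M) \<and>
        h \<cdot>\<^bsub>C\<^esub> rel_proj C \<A> M N = rel_proj C \<A> N M \<cdot>\<^bsub>C\<^esub> braid C (fst M) (fst N))"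

definition local_modules ::
  "('o, 'a, 'z) braided_monoidal_scheme \<Rightarrow> ('o, 'a) algebra_data \<Rightarrow>
   ('o \<times> 'a, ('o \<times> 'a, 'a) arrow) braided_monoidal" where
  "local_modules C \<A> = \<lparr>
     obj = {M. local_module C \<A> M},
     Hom = module_hom_arrows C \<A>,
     ident = (\<lambda>M. Arrow M M (ident C (fst M))),
     comp = (\<lambda>g f. Arrow (src f) (trg g) (fn g \<cdot>\<^bsub>C\<^esub> fn f)),
     tens = rel_tensor C \<A>,
     tens_arr = rel_tensor_arr C \<A>,
     unit_obj = regular_module \<A>,
     assoc = rel_assoc C \<A>,
     lunit = rel_lunit C \<A>,
     runit = rel_runit C \<A>,
     braid = rel_braid C \<A>\<rparr>"


section \<open>Finite-dimensional vector spaces\<close>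

definition fscale :: "'k::field \<Rightarrow> ('i \<Rightarrow> 'k) \<Rightarrow> 'i \<Rightarrow> 'k" where
  "fscale c x = (\<lambda>i. c * x i)"

global_interpretation vs: vector_space fscale
  by unfold_locales (auto simp: fscale_def plus_fun_def algebra_simps)

text \<open>
  The finite-dimensional vector spaces are the finite-dimensional subspaces of the space of all
  functions \<open>nat \<Rightarrow> 'k\<close>; every finite-dimensional vector space is isomorphic to one of them.
  The pairing bijection on \<^typ>\<open>nat\<close> makes the collection closed under tensor products: the
  space spanned by the products \<open>x i * y j\<close> is the usual tensor product.
\<close>

type_synonym 'k vec = "nat \<Rightarrow> 'k"

definition fd_space :: "'k::field vec set \<Rightarrow> bool" where
  "fd_space V \<longleftrightarrow> (\<exists>B. finite B \<and> V = vs.span B)"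

definition linear_on :: "('i \<Rightarrow> 'k::field) set \<Rightarrow> (('i \<Rightarrow> 'k) \<Rightarrow> ('j \<Rightarrow> 'k)) \<Rightarrow> bool" where
  "linear_on V h \<longleftrightarrow> (\<forall>x\<in>V. \<forall>y\<in>V. h (x + y) = h x + h y) \<and>
     (\<forall>c. \<forall>x\<in>V. h (fscale c x) = fscale c (h x))"

text \<open>
  Used only where \<open>P\<close> fixes the values on a spanning set of \<open>V\<close>, consistently with its linear
  relations; extensionality fixes the values outside \<open>V\<close>.
\<close>

definition the_linear :: "'k::field vec set \<Rightarrow> (('k vec \<Rightarrow> 'k vec) \<Rightarrow> bool) \<Rightarrow> 'k vec \<Rightarrow> 'k vec" where
  "the_linear V P = (THE h. h \<in> extensional V \<and> linear_on V h \<and> P h)"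

definition vtensor :: "'k::field vec \<Rightarrow> 'k vec \<Rightarrow> 'k vec" (infixr \<open>\<otimes>\<^sub>v\<close> 75) where
  "x \<otimes>\<^sub>v y = (\<lambda>n. case prod_decode n of (i, j) \<Rightarrow> x i * y j)"

definition tensor_space :: "'k::field vec set \<Rightarrow> 'k vec set \<Rightarrow> 'k vec set" where
  "tensor_space V W = vs.span {x \<otimes>\<^sub>v y | x y. x \<in> V \<and> y \<in> W}"

definition tensor_map ::
  "'k::field vec set \<Rightarrow> 'k vec set \<Rightarrow> ('k vec \<Rightarrow> 'k vec) \<Rightarrow> ('k vec \<Rightarrow> 'k vec) \<Rightarrow> 'k vec \<Rightarrow> 'k vec" where
  "tensor_map V W f g = the_linear (tensor_space V W)
     (\<lambda>h. \<forall>x\<in>V. \<forall>y\<in>W. h (x \<otimes>\<^sub>v y) = f x \<otimes>\<^sub>v g y)"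

definition one_vec :: "'k::field vec" where
  "one_vec = (\<lambda>i. if i = 0 then 1 else 0)"

definition unit_space :: "'k::field vec set" where
  "unit_space = vs.span {one_vec}"

definition assoc_map :: "'k::field vec set \<Rightarrow> 'k vec set \<Rightarrow> 'k vec set \<Rightarrow> 'k vec \<Rightarrow> 'k vec" where
  "assoc_map U V W = the_linear (tensor_space (tensor_space U V) W)
     (\<lambda>h. \<forall>x\<in>U. \<forall>y\<in>V. \<forall>z\<in>W. h ((x \<otimes>\<^sub>v y) \<otimes>\<^sub>v z) = x \<otimes>\<^sub>v (y \<otimes>\<^sub>v z))"

definition lunit_map :: "'k::field vec set \<Rightarrow> 'k vec \<Rightarrow> 'k vec" where
  "lunit_map V = the_linear (tensor_space unit_space V) (\<lambda>h. \<forall>x\<in>V. h (one_vec \<otimes>\<^sub>v x) = x)"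

definition runit_map :: "'k::field vec set \<Rightarrow> 'k vec \<Rightarrow> 'k vec" where
  "runit_map V = the_linear (tensor_space V unit_space) (\<lambda>h. \<forall>x\<in>V. h (x \<otimes>\<^sub>v one_vec) = x)"

definition flip_map :: "'k::field vec set \<Rightarrow> 'k vec set \<Rightarrow> 'k vec \<Rightarrow> 'k vec" where
  "flip_map V W = the_linear (tensor_space V W) (\<lambda>h. \<forall>x\<in>V. \<forall>y\<in>W. h (x \<otimes>\<^sub>v y) = y \<otimes>\<^sub>v x)"

definition Vect :: "('k::field vec set, ('k vec set, 'k vec \<Rightarrow> 'k vec) arrow) braided_monoidal" where
  "Vect = \<lparr>
     obj = {V. fd_space V},
     Hom = (\<lambda>V W. {Arrow V W f | f. f \<in> V \<rightarrow>\<^sub>E W \<and> linear_on V f}),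
     ident = (\<lambda>V. Arrow V V (\<lambda>x\<in>V. x)),
     comp = (\<lambda>b a. Arrow (src a) (trg b) (compose (src a) (fn b) (fn a))),
     tens = tensor_space,
     tens_arr = (\<lambda>a b. Arrow (tensor_space (src a) (src b)) (tensor_space (trg a) (trg b))
        (tensor_map (src a) (src b) (fn a) (fn b))),
     unit_obj = unit_space,
     assoc = (\<lambda>U V W. Arrow (tensor_space (tensor_space U V) W) (tensor_space U (tensor_space V W))
        (assoc_map U V W)),
     lunit = (\<lambda>V. Arrow (tensor_space unit_space V) V (lunit_map V)),
     runit = (\<lambda>V. Arrow (tensor_space V unit_space) V (runit_map V)),
     braid = (\<lambda>V W. Arrow (tensor_space V W) (tensor_space W V) (flip_map V W))\<rparr>"


section \<open>The category Z(G)\<close>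

record ('g, 'k) zobj =
  space :: "'k vec set"
  deg :: "'g \<Rightarrow> 'k vec set"
  act :: "'g \<Rightarrow> 'k vec \<Rightarrow> 'k vec"

text \<open>
  The fields are unconstrained on degrees outside \<open>carrier G\<close> and the action also outside
  \<open>space X\<close>; this only adds isomorphic copies of objects.
\<close>

definition is_zobj :: "('g, 'm) monoid_scheme \<Rightarrow> ('g, 'k::field) zobj \<Rightarrow> bool" where
  "is_zobj G X \<longleftrightarrow>
     fd_space (space X) \<and>
     (\<forall>g\<in>carrier G. vs.subspace (deg X g) \<and> deg X g \<subseteq> space X) \<and>
     (\<forall>x\<in>space X. \<exists>!c. c \<in> (\<Pi>\<^sub>E g\<in>carrier G. deg X g) \<and> x = (\<Sum>g\<in>carrier G. c g)) \<and>
     (\<forall>g\<in>carrier G. act X g \<in> space X \<rightarrow> space X \<and> linear_on (space X) (act X g)) \<and>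
     (\<forall>x\<in>space X. act X \<one>\<^bsub>G\<^esub> x = x) \<and>
     (\<forall>g\<in>carrier G. \<forall>h\<in>carrier G. \<forall>x\<in>space X. act X (g \<otimes>\<^bsub>G\<^esub> h) x = act X g (act X h x)) \<and>
     (\<forall>f\<in>carrier G. \<forall>g\<in>carrier G. act X f ` deg X g = deg X (f \<otimes>\<^bsub>G\<^esub> g \<otimes>\<^bsub>G\<^esub> inv\<^bsub>G\<^esub> f))"

definition zhom ::
  "('g, 'm) monoid_scheme \<Rightarrow> ('g, 'k::field) zobj \<Rightarrow> ('g, 'k) zobj \<Rightarrow>
   (('g, 'k) zobj, 'k vec \<Rightarrow> 'k vec) arrow set" where
  "zhom G X Y = {Arrow X Y \<phi> | \<phi>. \<phi> \<in> space X \<rightarrow>\<^sub>E space Y \<and> linear_on (space X) \<phi> \<and>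
     (\<forall>g\<in>carrier G. \<phi> ` deg X g \<subseteq> deg Y g) \<and>
     (\<forall>g\<in>carrier G. \<forall>x\<in>space X. \<phi> (act X g x) = act Y g (\<phi> x))}"

definition ztensor ::
  "('g, 'm) monoid_scheme \<Rightarrow> ('g, 'k::field) zobj \<Rightarrow> ('g, 'k) zobj \<Rightarrow> ('g, 'k) zobj" where
  "ztensor G X Y = \<lparr>
     space = tensor_space (space X) (space Y),
     deg = (\<lambda>g. vs.span {x \<otimes>\<^sub>v y | x y a b. a \<in> carrier G \<and> b \<in> carrier G \<and>
        a \<otimes>\<^bsub>G\<^esub> b = g \<and> x \<in> deg X a \<and> y \<in> deg Y b}),
     act = (\<lambda>g. tensor_map (space X) (space Y) (act X g) (act Y g))\<rparr>"

definition zunit :: "('g, 'm) monoid_scheme \<Rightarrow> ('g, 'k::field) zobj" where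
  "zunit G = \<lparr>
     space = unit_space,
     deg = (\<lambda>g. if g = \<one>\<^bsub>G\<^esub> then unit_space else {0}),
     act = (\<lambda>g x. x)\<rparr>"

definition zbraid_map ::
  "('g, 'm) monoid_scheme \<Rightarrow> ('g, 'k::field) zobj \<Rightarrow> ('g, 'k) zobj \<Rightarrow> 'k vec \<Rightarrow> 'k vec" where
  "zbraid_map G X Y = the_linear (tensor_space (space X) (space Y))
     (\<lambda>h. \<forall>f\<in>carrier G. \<forall>x\<in>deg X f. \<forall>y\<in>space Y. h (x \<otimes>\<^sub>v y) = act Y f y \<otimes>\<^sub>v x)"

definition ZG ::
  "('g, 'm) monoid_scheme \<Rightarrow>
   (('g, 'k::field) zobj, (('g, 'k) zobj, 'k vec \<Rightarrow> 'k vec) arrow) braided_monoidal" where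
  "ZG G = \<lparr>
     obj = {X. is_zobj G X},
     Hom = zhom G,
     ident = (\<lambda>X. Arrow X X (\<lambda>x\<in>space X. x)),
     comp = (\<lambda>b a. Arrow (src a) (trg b) (compose (space (src a)) (fn b) (fn a))),
     tens = ztensor G,
     tens_arr = (\<lambda>a b. Arrow (ztensor G (src a) (src b)) (ztensor G (trg a) (trg b))
        (tensor_map (space (src a)) (space (src b)) (fn a) (fn b))),
     unit_obj = zunit G,
     assoc = (\<lambda>X Y Z. Arrow (ztensor G (ztensor G X Y) Z) (ztensor G X (ztensor G Y Z))
        (assoc_map (space X) (space Y) (space Z))),
     lunit = (\<lambda>X. Arrow (ztensor G (zunit G) X) X (lunit_map (space X))),
     runit = (\<lambda>X. Arrow (ztensor G X (zunit G)) X (runit_map (space X))),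
     braid = (\<lambda>X Y. Arrow (ztensor G X Y) (ztensor G Y X) (zbraid_map G X Y))\<rparr>"

definition trivialising ::
  "('g, 'm) monoid_scheme \<Rightarrow>
   (('g, 'k::field) zobj, (('g, 'k) zobj, 'k vec \<Rightarrow> 'k vec) arrow) algebra_data \<Rightarrow> bool" where
  "trivialising G \<A> \<longleftrightarrow>
     algebra_in (ZG G) \<A> \<and> separable_alg (ZG G) \<A> \<and> indecomposable_alg (ZG G) \<A> \<and>
     commutative_alg (ZG G) \<A> \<and>
     braided_monoidal_equivalent (local_modules (ZG G) \<A>)
       (Vect :: ('k vec set, ('k vec set, 'k vec \<Rightarrow> 'k vec) arrow) braided_monoidal)"


section \<open>The algebra A(H,F,gamma,epsilon)\<close>

definition free_symbols :: "('g, 'm) monoid_scheme \<Rightarrow> 'g set \<Rightarrow> ('g \<times> 'g \<Rightarrow> 'k::field) set" where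
  "free_symbols G F = {p. \<forall>s. s \<notin> carrier G \<times> F \<longrightarrow> p s = 0}"

definition symbol :: "'g \<Rightarrow> 'g \<Rightarrow> 'g \<times> 'g \<Rightarrow> 'k::field" where
  "symbol g f = (\<lambda>s. if s = (g, f) then 1 else 0)"

definition symbol_relations ::
  "('g, 'm) monoid_scheme \<Rightarrow> 'g set \<Rightarrow> 'g set \<Rightarrow> ('g \<Rightarrow> 'g \<Rightarrow> 'k::field) \<Rightarrow> ('g \<times> 'g \<Rightarrow> 'k) set" where
  "symbol_relations G H F \<epsilon> = vs.span
     {symbol (g \<otimes>\<^bsub>G\<^esub> h) f - fscale (\<epsilon> h f) (symbol g (h \<otimes>\<^bsub>G\<^esub> f \<otimes>\<^bsub>G\<^esub> inv\<^bsub>G\<^esub> h)) | g h f.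
       g \<in> carrier G \<and> h \<in> H \<and> f \<in> F}"

text \<open>
  A linear map on the free space whose kernel is exactly the space of relations: its image is
  the quotient, realised inside the space of functions \<open>nat \<Rightarrow> 'k\<close>.
\<close>

definition quotient_map ::
  "('g, 'm) monoid_scheme \<Rightarrow> 'g set \<Rightarrow> 'g set \<Rightarrow> ('g \<Rightarrow> 'g \<Rightarrow> 'k::field) \<Rightarrow>
   ('g \<times> 'g \<Rightarrow> 'k) \<Rightarrow> 'k vec" where
  "quotient_map G H F \<epsilon> = (SOME q. linear_on (free_symbols G F) q \<and>
     (\<forall>p\<in>free_symbols G F. q p = 0 \<longleftrightarrow> p \<in> symbol_relations G H F \<epsilon>))"

definition gen ::
  "('g, 'm) monoid_scheme \<Rightarrow> 'g set \<Rightarrow> 'g set \<Rightarrow> ('g \<Rightarrow> 'g \<Rightarrow> 'k::field) \<Rightarrow> 'g \<Rightarrow> 'g \<Rightarrow> 'k vec" where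
  "gen G H F \<epsilon> g f = quotient_map G H F \<epsilon> (symbol g f)"

definition A_space ::
  "('g, 'm) monoid_scheme \<Rightarrow> 'g set \<Rightarrow> 'g set \<Rightarrow> ('g \<Rightarrow> 'g \<Rightarrow> 'k::field) \<Rightarrow> 'k vec set" where
  "A_space G H F \<epsilon> = quotient_map G H F \<epsilon> ` free_symbols G F"

definition A_zobj ::
  "('g, 'm) monoid_scheme \<Rightarrow> 'g set \<Rightarrow> 'g set \<Rightarrow> ('g \<Rightarrow> 'g \<Rightarrow> 'k::field) \<Rightarrow> ('g, 'k) zobj" where
  "A_zobj G H F \<epsilon> = \<lparr>
     space = A_space G H F \<epsilon>,
     deg = (\<lambda>x. vs.span {gen G H F \<epsilon> g f | g f. g \<in> carrier G \<and> f \<in> F \<and>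
        g \<otimes>\<^bsub>G\<^esub> f \<otimes>\<^bsub>G\<^esub> inv\<^bsub>G\<^esub> g = x}),
     act = (\<lambda>g'. the_linear (A_space G H F \<epsilon>) (\<lambda>h. \<forall>g\<in>carrier G. \<forall>f\<in>F.
        h (gen G H F \<epsilon> g f) = gen G H F \<epsilon> (g' \<otimes>\<^bsub>G\<^esub> g) f))\<rparr>"

definition A_mult_map ::
  "('g, 'm) monoid_scheme \<Rightarrow> 'g set \<Rightarrow> 'g set \<Rightarrow> ('g \<Rightarrow> 'g \<Rightarrow> 'k::field) \<Rightarrow> ('g \<Rightarrow> 'g \<Rightarrow> 'k) \<Rightarrow>
   'k vec \<Rightarrow> 'k vec" where
  "A_mult_map G H F \<gamma> \<epsilon> = the_linear (tensor_space (A_space G H F \<epsilon>) (A_space G H F \<epsilon>))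
     (\<lambda>m. (\<forall>g\<in>carrier G. \<forall>f\<in>F. \<forall>f'\<in>F.
              m (gen G H F \<epsilon> g f \<otimes>\<^sub>v gen G H F \<epsilon> g f') =
              fscale (\<gamma> f f') (gen G H F \<epsilon> g (f \<otimes>\<^bsub>G\<^esub> f'))) \<and>
          (\<forall>g\<in>carrier G. \<forall>g'\<in>carrier G. \<forall>f\<in>F. \<forall>f'\<in>F. g <#\<^bsub>G\<^esub> H \<noteq> g' <#\<^bsub>G\<^esub> H \<longrightarrow>
              m (gen G H F \<epsilon> g f \<otimes>\<^sub>v gen G H F \<epsilon> g' f') = 0))"

text \<open>
  The unit is the sum of the \<open>gen g \<one>\<close> over representatives \<open>g\<close> of the left cosets of \<open>H\<close>.
\<close>

definition A_one ::
  "('g, 'm) monoid_scheme \<Rightarrow> 'g set \<Rightarrow> 'g set \<Rightarrow> ('g \<Rightarrow> 'g \<Rightarrow> 'k::field) \<Rightarrow> ('g \<Rightarrow> 'g \<Rightarrow> 'k) \<Rightarrow> 'k vec" where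
  "A_one G H F \<gamma> \<epsilon> = (THE u. u \<in> A_space G H F \<epsilon> \<and>
     (\<forall>x\<in>A_space G H F \<epsilon>. A_mult_map G H F \<gamma> \<epsilon> (u \<otimes>\<^sub>v x) = x \<and> A_mult_map G H F \<gamma> \<epsilon> (x \<otimes>\<^sub>v u) = x))"

definition A_alg ::
  "('g, 'm) monoid_scheme \<Rightarrow> 'g set \<Rightarrow> 'g set \<Rightarrow> ('g \<Rightarrow> 'g \<Rightarrow> 'k::field) \<Rightarrow> ('g \<Rightarrow> 'g \<Rightarrow> 'k) \<Rightarrow>
   (('g, 'k) zobj, (('g, 'k) zobj, 'k vec \<Rightarrow> 'k vec) arrow) algebra_data" where
  "A_alg G H F \<gamma> \<epsilon> = (let A = A_zobj G H F \<epsilon> in \<lparr>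
     alg_obj = A,
     alg_mult = Arrow (ztensor G A A) A (A_mult_map G H F \<gamma> \<epsilon>),
     alg_unit = Arrow (zunit G) A
       (the_linear unit_space (\<lambda>h. h one_vec = A_one G H F \<gamma> \<epsilon>))\<rparr>)"


section \<open>Normalised 2-cocycles\<close>

definition normalised_2cocycle ::
  "('g, 'm) monoid_scheme \<Rightarrow> 'g set \<Rightarrow> ('g \<Rightarrow> 'g \<Rightarrow> 'k::field) \<Rightarrow> bool" where
  "normalised_2cocycle G F \<gamma> \<longleftrightarrow>
     (\<forall>f\<in>F. \<forall>g\<in>F. \<gamma> f g \<noteq> 0) \<and>
     (\<forall>f\<in>F. \<forall>g\<in>F. \<forall>h\<in>F. \<gamma> f g * \<gamma> (f \<otimes>\<^bsub>G\<^esub> g) h = \<gamma> g h * \<gamma> f (g \<otimes>\<^bsub>G\<^esub> h)) \<and>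
     (\<forall>f\<in>F. \<gamma> \<one>\<^bsub>G\<^esub> f = 1 \<and> \<gamma> f \<one>\<^bsub>G\<^esub> = 1)"

end

theory Submission
  imports Defs
begin

text \<open>
  Let \<open>R\<close> be the projection of an object of \<open>Z(G)\<close> onto its \<open>G\<close>-invariants of degree \<open>e\<close>.
  For \<open>F = H\<close> every element \<open>m\<close> of a local module is, up to a constant factor, the sum of the
  \<open>R(m a\<^sub>g\<^sub>,\<^sub>f) a'\<^sub>g\<^sub>,\<^sub>f\<close>, where the \<open>a'\<^sub>g\<^sub>,\<^sub>f\<close> are the scaled symbols with inverse \<open>f\<close> that make
  \<open>\<Sum> a\<^sub>g\<^sub>,\<^sub>f \<otimes> a'\<^sub>g\<^sub>,\<^sub>f\<close> commute with the algebra. So a local module is free on its invariants,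
  and since those of the algebra itself are the scalars, taking invariants is a braided
  monoidal equivalence with vector spaces.

  The symbols taken modulo \<open>F\<close> instead of \<open>H\<close> always form a local module \<open>N\<close>, and its
  invariants are spanned by one vector \<open>w\<close>. If local modules are equivalent to vector spaces,
  then \<open>N\<close> is generated by \<open>w\<close>. For \<open>h \<in> H - F\<close> the functional that is \<open>1\<close> on the symbols
  \<open>(g, e)\<close> with \<open>g \<in> F\<close>, \<open>-1\<close> on those with \<open>g \<in> hF\<close> and zero on the others
  vanishes on the multiples of \<open>w\<close> but not on \<open>N\<close>, so \<open>F = H\<close>.
\<close>

text \<open>Both directions turn on how degrees meet cosets. For \<open>m\<close> of degree
  \<open>x\<close> in a local module, \<open>m\<close> times the symbol \<open>(g, f)\<close> has
  degree \<open>e\<close> only for \<open>f = g^-1 x^-1 g\<close>, which asks for an element of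
  \<open>F\<close>; locality makes \<open>m\<close> times the symbol \<open>(g, e)\<close> vanish
  unless \<open>g^-1 x g\<close> lies in \<open>H\<close>. For \<open>F = H\<close> the two
  conditions coincide, and this is why \<open>m\<close> can be rebuilt from invariants. The sum in
  the overview is a Casimir element: since it commutes with the algebra, sending
  \<open>m \<otimes> n\<close> to the sum of the \<open>R(m a) \<otimes> R(a' n)\<close> is balanced
  and inverts the comparison map of tensor products. Its scalar \<open>|G| / |H|^2\<close>
  compensates the factor \<open>|H| / |G|\<close> produced by \<open>R\<close> and the
  \<open>|H|\<close>-fold counting of cosets in sums over \<open>G\<close>. A formal obstacle shapes
  the rest: tensor products over the algebra are chosen coequalisers and the structure arrows
  definite descriptions, so only universal properties are available. They are converted into
  statements on elements and checked on pure tensors.\<close>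

section \<open>Linear maps on subspaces\<close>

text \<open>
  Induction rules eta-expand terms of function type; the pointwise rules would then rewrite
  below the abstraction.
\<close>

lemmas fun_eval = plus_fun_apply zero_fun_apply uminus_apply minus_apply
declare fun_eval [simp del]

lemma sum_fun_eval: "(\<Sum>i\<in>I. f i) x = (\<Sum>i\<in>I. f i x)"
  for f :: "'a \<Rightarrow> 'b \<Rightarrow> 'c::comm_monoid_add"
  by (induction I rule: infinite_finite_induct) (auto simp: fun_eval)

lemma fscale_scale [simp]: "fscale a (fscale b x) = fscale (a * b) x"
  by (simp add: fscale_def mult.assoc)

lemma fscale_1 [simp]: "fscale 1 x = x"
  by (simp add: fscale_def)

lemma fscale_eval: "fscale c x i = c * x i"
  by (simp add: fscale_def)

lemma linear_onI:
  assumes "\<And>x y. x \<in> V \<Longrightarrow> y \<in> V \<Longrightarrow> h (x + y) = h x + h y"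
    and "\<And>c x. x \<in> V \<Longrightarrow> h (fscale c x) = fscale c (h x)"
  shows "linear_on V h"
  using assms by (auto simp: linear_on_def)

lemma linear_on_add: "linear_on V h \<Longrightarrow> x \<in> V \<Longrightarrow> y \<in> V \<Longrightarrow> h (x + y) = h x + h y"
  by (auto simp: linear_on_def)

lemma linear_on_scale: "linear_on V h \<Longrightarrow> x \<in> V \<Longrightarrow> h (fscale c x) = fscale c (h x)"
  by (auto simp: linear_on_def)

lemma linear_on_zero: "linear_on V h \<Longrightarrow> vs.subspace V \<Longrightarrow> h 0 = 0"
  using linear_on_scale[of V h 0 0] by (auto simp: vs.subspace_0)

lemma linear_on_sum:
  assumes "linear_on V h" "vs.subspace V" "\<And>i. i \<in> I \<Longrightarrow> x i \<in> V"
  shows "h (\<Sum>i\<in>I. x i) = (\<Sum>i\<in>I. h (x i))"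
  using assms(3)
proof (induction I rule: infinite_finite_induct)
  case (insert i I)
  then show ?case
    using assms(2) by (simp add: linear_on_add[OF assms(1)] vs.subspace_sum)
qed (use linear_on_zero[OF assms(1,2)] in auto)

lemma linear_on_diff:
  assumes "linear_on V h" "vs.subspace V" "x \<in> V" "y \<in> V"
  shows "h (x - y) = h x - h y"
proof -
  have "h (x - y) + h y = h x"
    using linear_on_add[OF assms(1), of "x - y" y] assms by (simp add: vs.subspace_diff)
  then show ?thesis by (simp add: algebra_simps)
qed

lemma linear_on_comp:
  assumes "linear_on V f" "linear_on W g" "\<And>x. x \<in> V \<Longrightarrow> f x \<in> W"
  shows "linear_on V (\<lambda>x. g (f x))"
  using assms by (auto simp: linear_on_def)

lemma linear_on_subset: "linear_on V h \<Longrightarrow> W \<subseteq> V \<Longrightarrow> linear_on W h"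
  unfolding linear_on_def by blast

lemma linear_on_cong:
  assumes "vs.subspace V" "\<And>x. x \<in> V \<Longrightarrow> f x = g x"
  shows "linear_on V f \<longleftrightarrow> linear_on V g"
  using assms by (auto simp: linear_on_def vs.subspace_add vs.subspace_scale)

lemma linear_on_restrict:
  "vs.subspace V \<Longrightarrow> linear_on V (restrict h V) \<longleftrightarrow> linear_on V h"
  by (rule linear_on_cong) auto

lemma linear_on_id: "linear_on V (\<lambda>x. x)"
  by (auto simp: linear_on_def)

lemma linear_on_const_zero: "linear_on V (\<lambda>x. 0)"
  by (auto simp: linear_on_def)

lemma linear_on_sum_fun:
  assumes "\<And>i. i \<in> I \<Longrightarrow> linear_on V (f i)"
  shows "linear_on V (\<lambda>x. \<Sum>i\<in>I. f i x)"
  by (rule linear_onI)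
    (simp_all add: linear_on_add[OF assms] linear_on_scale[OF assms] sum.distrib vs.scale_sum_right)

lemma linear_on_scale_fun: "linear_on V f \<Longrightarrow> linear_on V (\<lambda>x. fscale c (f x))"
  by (auto simp: linear_on_def vs.scale_right_distrib mult.commute)

lemma linear_on_add_fun:
  "linear_on V f \<Longrightarrow> linear_on V g \<Longrightarrow> linear_on V (\<lambda>x. f x + g x)"
  by (auto simp: linear_on_def vs.scale_right_distrib algebra_simps)

lemma linear_on_eq_span:
  assumes f: "linear_on (vs.span S) f" and g: "linear_on (vs.span S) g"
    and "\<And>s. s \<in> S \<Longrightarrow> f s = g s" and "x \<in> vs.span S"
  shows "f x = g x"
proof -
  have "vs.subspace {x \<in> vs.span S. f x = g x}"
    by (rule vs.subspaceI)
      (auto simp: linear_on_zero[OF f] linear_on_zero[OF g] linear_on_add[OF f] linear_on_add[OF g]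
        linear_on_scale[OF f] linear_on_scale[OF g] vs.span_zero vs.span_add vs.span_scale)
  then have "vs.span S \<subseteq> {x \<in> vs.span S. f x = g x}"
    using assms(3) by (intro vs.span_minimal) (auto intro: vs.span_base)
  then show ?thesis using assms(4) by blast
qed

lemma linear_on_mem_span:
  assumes f: "linear_on (vs.span S) f" and W: "vs.subspace W"
    and "\<And>s. s \<in> S \<Longrightarrow> f s \<in> W" and "x \<in> vs.span S"
  shows "f x \<in> W"
proof -
  have "vs.subspace {x \<in> vs.span S. f x \<in> W}"
    using W by (intro vs.subspaceI)
      (auto simp: linear_on_zero[OF f] linear_on_add[OF f] linear_on_scale[OF f]
        vs.subspace_0 vs.subspace_add vs.subspace_scale vs.span_zero vs.span_add vs.span_scale)
  then have "vs.span S \<subseteq> {x \<in> vs.span S. f x \<in> W}"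
    using assms(3) by (intro vs.span_minimal) (auto intro: vs.span_base)
  then show ?thesis using assms(4) by blast
qed

lemma linear_on_image_span:
  assumes f: "linear_on (vs.span S) f"
  shows "f ` vs.span S = vs.span (f ` S)"
proof
  show "f ` vs.span S \<subseteq> vs.span (f ` S)"
    using linear_on_mem_span[OF f vs.subspace_span, of "f ` S"] by (auto intro: vs.span_base)
  have "vs.subspace (f ` vs.span S)"
  proof (rule vs.subspaceI)
    show "0 \<in> f ` vs.span S"
      using linear_on_zero[OF f] vs.span_zero by (auto intro!: image_eqI[of _ _ 0])
  qed (auto simp: linear_on_add[OF f, symmetric] linear_on_scale[OF f, symmetric]
      intro!: imageI vs.span_add vs.span_scale)
  then show "vs.span (f ` S) \<subseteq> f ` vs.span S"
    by (intro vs.span_minimal) (auto intro: vs.span_base)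
qed

lemma subspace_image:
  assumes "linear_on V f" "vs.subspace V"
  shows "vs.subspace (f ` V)"
proof -
  have "vs.span V = V" using assms(2) by simp
  then show ?thesis
    using linear_on_image_span[of V f] assms(1) by (metis vs.subspace_span)
qed

lemma linear_on_UNIV: "Vector_Spaces.linear fscale fscale h \<Longrightarrow> linear_on UNIV h"
  by (simp add: linear_on_def Vector_Spaces.linear_iff)

lemma linear_pair:
  "vector_space_pair (fscale :: 'k::field \<Rightarrow> ('i \<Rightarrow> 'k) \<Rightarrow> _) (fscale :: 'k \<Rightarrow> ('j \<Rightarrow> 'k) \<Rightarrow> _)"
  by (intro vector_space_pair.intro vs.vector_space_axioms)

lemma linear_on_extend:
  fixes f :: "('i \<Rightarrow> 'k::field) \<Rightarrow> ('j \<Rightarrow> 'k)"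
  assumes "\<not> vs.dependent B"
  obtains h where "linear_on UNIV h" "\<And>b. b \<in> B \<Longrightarrow> h b = f b"
proof -
  obtain h where "Vector_Spaces.linear fscale fscale h" and h: "\<forall>b\<in>B. h b = f b"
    using vector_space_pair.linear_independent_extend[OF linear_pair assms] by blast
  then show thesis using h that linear_on_UNIV by blast
qed

lemma finite_basis_of_span:
  assumes "X = vs.span S" "finite S" "X \<supseteq> C" "\<not> vs.dependent C"
  obtains B where "finite B" "\<not> vs.dependent B" "X = vs.span B" "C \<subseteq> B"
proof -
  obtain B where B: "C \<subseteq> B" "B \<subseteq> X" "\<not> vs.dependent B" "X \<subseteq> vs.span B"
    using vs.maximal_independent_subset_extend[OF assms(3,4)] by blast
  have "finite B"
    using vs.independent_span_bound[OF assms(2) B(3)] B(2) assms(1) by blast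
  moreover have "X = vs.span B"
    using B assms(1) by (metis subset_antisym vs.span_minimal vs.subspace_span)
  ultimately show thesis using that B by blast
qed

text \<open>Realises \<open>X / K\<close> inside \<open>nat \<Rightarrow> 'k\<close>, where every
  space has to live: extend a basis of \<open>K\<close> to one of \<open>X\<close>, send the old
  basis vectors to zero and the new ones to distinct unit vectors. It serves the quotient objects of
  \<open>Z(G)\<close> and the space of symbols alike.\<close>

lemma exists_linear_with_kernel:
  fixes X K :: "('i \<Rightarrow> 'k::field) set"
  assumes X: "X = vs.span S" "finite S" and K: "vs.subspace K" "K \<subseteq> X"
  obtains p :: "('i \<Rightarrow> 'k) \<Rightarrow> 'k vec"
  where "linear_on UNIV p" "\<And>x. x \<in> X \<Longrightarrow> p x = 0 \<longleftrightarrow> x \<in> K"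
proof -
  obtain B1 where B1: "B1 \<subseteq> K" "\<not> vs.dependent B1" "K \<subseteq> vs.span B1"
    using vs.maximal_independent_subset by blast
  obtain B where B: "finite B" "\<not> vs.dependent B" "X = vs.span B" "B1 \<subseteq> B"
    using finite_basis_of_span[OF X _ B1(2)] B1(1) K(2) by blast
  obtain idx :: "('i \<Rightarrow> 'k) \<Rightarrow> nat" where idx: "inj_on idx B"
    using finite_imp_inj_to_nat_seg[OF B(1)] by blast
  obtain p :: "('i \<Rightarrow> 'k) \<Rightarrow> 'k vec" where p: "linear_on UNIV p"
    "\<And>b. b \<in> B \<Longrightarrow> p b = (if b \<in> B1 then 0 else (\<lambda>n. if n = idx b then 1 else 0))"
    using linear_on_extend[OF B(2), of "\<lambda>b. if b \<in> B1 then 0 else (\<lambda>n. if n = idx b then 1 else 0)"]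
    by blast
  have "p x = 0 \<longleftrightarrow> x \<in> K" if x: "x \<in> X" for x
  proof
    assume "x \<in> K"
    then show "p x = 0"
    proof (rule_tac linear_on_eq_span[of B1 p "\<lambda>_. 0"])
      show "linear_on (vs.span B1) p" using p(1) by (rule linear_on_subset) simp
    qed (use B1(3) B(4) p(2) in \<open>auto simp: linear_on_const_zero\<close>)
  next
    assume 0: "p x = 0"
    define r where "r = vs.representation B x"
    have xr: "x = (\<Sum>b\<in>B. fscale (r b) b)"
      using vs.sum_representation_eq[OF B(2) _ B(1)] x B(3) by (simp add: r_def)
    \<comment> \<open>Coordinate \<open>idx b\<close> of \<open>p x\<close> is the coefficient of
      \<open>b\<close>, because \<open>idx\<close> is injective on the basis; so
      \<open>p x = 0\<close> leaves only basis vectors from \<open>B1\<close>.\<close>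
    have "r b = 0" if b: "b \<in> B - B1" for b
    proof -
      have "0 = p x (idx b)" by (simp add: 0 fun_eval)
      also have "p x = (\<Sum>c\<in>B. fscale (r c) (p c))"
        by (subst xr) (simp add: linear_on_sum[OF p(1)] linear_on_scale[OF p(1)])
      also have "\<dots> (idx b) = (\<Sum>c\<in>B. if c = b then r b else 0)"
        unfolding sum_fun_eval
        by (rule sum.cong) (use b idx p(2) in \<open>auto simp: fscale_eval inj_on_def fun_eval\<close>)
      finally show ?thesis using b B(1) by simp
    qed
    then have "x = (\<Sum>b\<in>B1. fscale (r b) b)"
      using xr B(1,4) by (subst xr) (rule sum.mono_neutral_right, auto)
    then show "x \<in> K"
      using B1(1) K(1) by (auto intro!: vs.subspace_sum vs.subspace_scale)
  qed
  then show thesis using that p(1) by blast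
qed

section \<open>Finite-dimensional subspaces and linear maps between them\<close>

lemma fd_subspace: "fd_space V \<Longrightarrow> vs.subspace V"
  by (auto simp: fd_space_def)

lemma fd_basis:
  assumes "fd_space V"
  obtains B where "finite B" "\<not> vs.dependent B" "V = vs.span B"
proof -
  obtain S where "V = vs.span S" "finite S" using assms by (auto simp: fd_space_def)
  then show thesis
    by (rule finite_basis_of_span[of V S "{}"]) (use that vs.independent_empty in auto)
qed

lemma fd_subset:
  assumes "fd_space V" "vs.subspace W" "W \<subseteq> V"
  shows "fd_space W"
proof -
  obtain S where S: "V = vs.span S" "finite S" using assms by (auto simp: fd_space_def)
  obtain B where B: "B \<subseteq> W" "\<not> vs.dependent B" "W \<subseteq> vs.span B"
    using vs.maximal_independent_subset by blast
  have "finite B"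
    using vs.independent_span_bound[OF S(2) B(2)] B(1) assms(3) S(1) by blast
  moreover have "W = vs.span B"
    using B assms(2) by (metis subset_antisym vs.span_minimal)
  ultimately show ?thesis by (auto simp: fd_space_def)
qed

lemma fd_image:
  fixes f :: "'k::field vec \<Rightarrow> 'k vec"
  assumes "fd_space V" "linear_on V f"
  shows "fd_space (f ` V)"
proof -
  obtain S where S: "V = vs.span S" "finite S" using assms by (auto simp: fd_space_def)
  then have "f ` V = vs.span (f ` S)" using linear_on_image_span assms(2) by blast
  then show ?thesis using S(2) by (auto simp: fd_space_def)
qed

lemma linear_on_inv_into:
  assumes f: "linear_on V f" and V: "vs.subspace V" and inj: "inj_on f V"
  shows "linear_on (f ` V) (inv_into V f)"
proof (rule linear_onI)
  fix x y assume "x \<in> f ` V" "y \<in> f ` V"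
  then obtain u v where "u \<in> V" "v \<in> V" "x = f u" "y = f v" by blast
  moreover from this have "x + y = f (u + v)" by (simp add: linear_on_add[OF f])
  ultimately show "inv_into V f (x + y) = inv_into V f x + inv_into V f y"
    using inj V by (simp add: vs.subspace_add)
next
  fix c x assume "x \<in> f ` V"
  then obtain u where "u \<in> V" "x = f u" by blast
  moreover from this have "fscale c x = f (fscale c u)" by (simp add: linear_on_scale[OF f])
  ultimately show "inv_into V f (fscale c x) = fscale c (inv_into V f x)"
    using inj V by (simp add: vs.subspace_scale)
qed

lemma inj_on_linearI:
  assumes f: "linear_on V f" and V: "vs.subspace V" and "\<And>x. x \<in> V \<Longrightarrow> f x = 0 \<Longrightarrow> x = 0"
  shows "inj_on f V"
proof (rule inj_onI)
  fix x y assume xy: "x \<in> V" "y \<in> V" "f x = f y"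
  then have "f (x - y) = 0" using linear_on_diff[OF f V] by simp
  then show "x = y" using assms(3)[of "x - y"] V xy by (simp add: vs.subspace_diff)
qed

text \<open>A preimage is chosen by \<open>inv_into\<close>; two choices differ by an element of the
  kernel of \<open>q\<close>, on which \<open>f\<close> vanishes. Maps out of the various quotients
  come from here.\<close>

lemma linear_factor:
  assumes q: "linear_on V q" and f: "linear_on V f" and V: "vs.subspace V"
    and ker: "\<And>x. x \<in> V \<Longrightarrow> q x = 0 \<Longrightarrow> f x = 0"
  obtains h where "linear_on (q ` V) h" "\<And>x. x \<in> V \<Longrightarrow> h (q x) = f x"
proof -
  define h where "h y = f (inv_into V q y)" for y
  have h: "h (q x) = f x" if "x \<in> V" for x
  proof -
    let ?x = "inv_into V q (q x)"
    have x: "?x \<in> V" "q ?x = q x" using that by (auto simp: inv_into_into f_inv_into_f)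
    then have "q (?x - x) = 0" using linear_on_diff[OF q V] that by simp
    then have "f (?x - x) = 0" using ker V x that by (simp add: vs.subspace_diff)
    then show ?thesis using linear_on_diff[OF f V] x that by (simp add: h_def)
  qed
  have "linear_on (q ` V) h"
  proof (rule linear_onI)
    fix x y assume "x \<in> q ` V" "y \<in> q ` V"
    then obtain u v where uv: "u \<in> V" "v \<in> V" "x = q u" "y = q v" by blast
    then have "x + y = q (u + v)" by (simp add: linear_on_add[OF q])
    then show "h (x + y) = h x + h y"
      using h uv V by (simp add: vs.subspace_add linear_on_add[OF f])
  next
    fix c x assume "x \<in> q ` V"
    then obtain u where u: "u \<in> V" "x = q u" by blast
    then have "fscale c x = q (fscale c u)" by (simp add: linear_on_scale[OF q])
    then show "h (fscale c x) = fscale c (h x)"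
      using h u V by (simp add: vs.subspace_scale linear_on_scale[OF f])
  qed
  then show thesis using h that by blast
qed

text \<open>Extensionality leaves no freedom outside \<open>V\<close>, and on \<open>V\<close> the
  predicate pins down \<open>h\<close>, so exactly one map meets the description. \<open>P\<close>
  is compared on linear maps only, because its instances fix values on a spanning set alone.\<close>

lemma the_linear_works:
  fixes h :: "'k::field vec \<Rightarrow> 'k vec"
  assumes V: "vs.subspace V" and h: "linear_on V h"
    and P: "\<And>h'. linear_on V h' \<Longrightarrow> P h' \<longleftrightarrow> (\<forall>x\<in>V. h' x = h x)"
  shows "the_linear V P = restrict h V"
proof -
  have lin: "linear_on V (restrict h V)" using linear_on_restrict[OF V] h by blast
  show ?thesis
    unfolding the_linear_def
  proof (rule the_equality)
    show "restrict h V \<in> extensional V \<and> linear_on V (restrict h V) \<and> P (restrict h V)"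
      using lin P[OF lin] by auto
  next
    fix h' assume "h' \<in> extensional V \<and> linear_on V h' \<and> P h'"
    then show "h' = restrict h V"
      using P[of h'] by (intro extensionalityI[of _ V]) auto
  qed
qed


section \<open>Tensor products\<close>

definition bilinear_on ::
  "('i \<Rightarrow> 'k::field) set \<Rightarrow> ('j \<Rightarrow> 'k) set \<Rightarrow> (('i \<Rightarrow> 'k) \<Rightarrow> ('j \<Rightarrow> 'k) \<Rightarrow> ('l \<Rightarrow> 'k)) \<Rightarrow> bool" where
  "bilinear_on V W b \<longleftrightarrow> (\<forall>x\<in>V. linear_on W (b x)) \<and> (\<forall>y\<in>W. linear_on V (\<lambda>x. b x y))"

lemma bilinear_onI:
  assumes "\<And>x. x \<in> V \<Longrightarrow> linear_on W (b x)" "\<And>y. y \<in> W \<Longrightarrow> linear_on V (\<lambda>x. b x y)"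
  shows "bilinear_on V W b"
  using assms by (simp add: bilinear_on_def)

lemma bilinear_onD:
  assumes "bilinear_on V W b"
  shows "x \<in> V \<Longrightarrow> linear_on W (b x)" "y \<in> W \<Longrightarrow> linear_on V (\<lambda>x. b x y)"
  using assms by (simp_all add: bilinear_on_def)

lemma vtensor_add_left: "(x + y) \<otimes>\<^sub>v z = x \<otimes>\<^sub>v z + y \<otimes>\<^sub>v z"
  and vtensor_add_right: "z \<otimes>\<^sub>v (x + y) = z \<otimes>\<^sub>v x + z \<otimes>\<^sub>v y"
  and vtensor_scale_left: "fscale c x \<otimes>\<^sub>v z = fscale c (x \<otimes>\<^sub>v z)"
  and vtensor_scale_right: "z \<otimes>\<^sub>v fscale c x = fscale c (z \<otimes>\<^sub>v x)"
  by (auto simp: vtensor_def fscale_def fun_eq_iff algebra_simps fun_eval split: prod.splits)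

lemma vtensor_zero [simp]: "0 \<otimes>\<^sub>v z = 0" "z \<otimes>\<^sub>v 0 = 0"
  by (auto simp: vtensor_def fun_eq_iff fun_eval split: prod.splits)

lemma vtensor_sum_left: "(\<Sum>i\<in>I. f i) \<otimes>\<^sub>v z = (\<Sum>i\<in>I. f i \<otimes>\<^sub>v z)"
  by (induction I rule: infinite_finite_induct) (auto simp: vtensor_add_left)

lemma vtensor_sum_right: "z \<otimes>\<^sub>v (\<Sum>i\<in>I. f i) = (\<Sum>i\<in>I. z \<otimes>\<^sub>v f i)"
  by (induction I rule: infinite_finite_induct) (auto simp: vtensor_add_right)

lemma vtensor_mem: "x \<in> V \<Longrightarrow> y \<in> W \<Longrightarrow> x \<otimes>\<^sub>v y \<in> tensor_space V W"
  by (auto simp: tensor_space_def intro!: vs.span_base)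

lemma subspace_tensor [simp]: "vs.subspace (tensor_space V W)"
  by (simp add: tensor_space_def)

lemma vtensor_eq_0: "x \<otimes>\<^sub>v y = 0 \<Longrightarrow> x = 0 \<or> y = 0"
proof (rule ccontr)
  assume 0: "x \<otimes>\<^sub>v y = 0" and "\<not> (x = 0 \<or> y = 0)"
  then obtain i j where "x i \<noteq> 0" "y j \<noteq> 0" by (auto simp: fun_eq_iff fun_eval)
  moreover have "(x \<otimes>\<^sub>v y) (prod_encode (i, j)) = x i * y j" by (simp add: vtensor_def)
  ultimately show False using 0 by (simp add: fun_eval)
qed

lemma tensor_ext:
  assumes "linear_on (tensor_space V W) f" "linear_on (tensor_space V W) g"
    and "\<And>x y. x \<in> V \<Longrightarrow> y \<in> W \<Longrightarrow> f (x \<otimes>\<^sub>v y) = g (x \<otimes>\<^sub>v y)" and "t \<in> tensor_space V W"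
  shows "f t = g t"
  using linear_on_eq_span[of "{x \<otimes>\<^sub>v y | x y. x \<in> V \<and> y \<in> W}" f g t] assms
  unfolding tensor_space_def by blast

lemma tensor_mem:
  assumes "linear_on (tensor_space V W) f" "vs.subspace U"
    and "\<And>x y. x \<in> V \<Longrightarrow> y \<in> W \<Longrightarrow> f (x \<otimes>\<^sub>v y) \<in> U" and "t \<in> tensor_space V W"
  shows "f t \<in> U"
  using linear_on_mem_span[of "{x \<otimes>\<^sub>v y | x y. x \<in> V \<and> y \<in> W}" f U t] assms
  unfolding tensor_space_def by blast

lemma bilinear_on_tensor:
  assumes h: "linear_on (tensor_space V W) h"
  shows "bilinear_on V W (\<lambda>x y. h (x \<otimes>\<^sub>v y))"
  by (intro bilinear_onI linear_onI)
    (simp_all add: vtensor_add_right vtensor_scale_right vtensor_add_left vtensor_scale_left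
      linear_on_add[OF h] linear_on_scale[OF h] vtensor_mem)

lemma tensor_mono: "V \<subseteq> V' \<Longrightarrow> W \<subseteq> W' \<Longrightarrow> tensor_space V W \<subseteq> tensor_space V' W'"
  unfolding tensor_space_def by (rule vs.span_mono) auto

lemma tensor_span:
  "tensor_space (vs.span S) (vs.span T) = vs.span {s \<otimes>\<^sub>v t | s t. s \<in> S \<and> t \<in> T}" (is "_ = vs.span ?P")
proof
  have lin: "linear_on (vs.span T) ((\<otimes>\<^sub>v) s)" "linear_on (vs.span S) (\<lambda>x. x \<otimes>\<^sub>v y)" for s y
    by (auto simp: linear_on_def vtensor_add_left vtensor_add_right vtensor_scale_left vtensor_scale_right)
  have "s \<otimes>\<^sub>v y \<in> vs.span ?P" if "s \<in> S" "y \<in> vs.span T" for s y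
    using that by (intro linear_on_mem_span[OF lin(1) vs.subspace_span _ that(2)] vs.span_base) auto
  then have "x \<otimes>\<^sub>v y \<in> vs.span ?P" if "x \<in> vs.span S" "y \<in> vs.span T" for x y
    using that by (intro linear_on_mem_span[OF lin(2) vs.subspace_span _ that(1)]) auto
  then show "tensor_space (vs.span S) (vs.span T) \<subseteq> vs.span ?P"
    unfolding tensor_space_def by (intro vs.span_minimal) auto
  show "vs.span ?P \<subseteq> tensor_space (vs.span S) (vs.span T)"
    unfolding tensor_space_def by (intro vs.span_mono) (auto intro: vs.span_base)
qed

lemma fd_tensor:
  assumes "fd_space V" "fd_space W" shows "fd_space (tensor_space V W)"
proof -
  obtain S T where "V = vs.span S" "finite S" "W = vs.span T" "finite T"
    using assms by (auto simp: fd_space_def)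
  moreover from this have "finite {s \<otimes>\<^sub>v t | s t. s \<in> S \<and> t \<in> T}"
    by (intro finite_image_set2) auto
  ultimately show ?thesis using tensor_span[of S T] by (auto simp: fd_space_def)
qed

text \<open>
  Contracting the first factor of a tensor against the dual basis of \<open>V\<close> reduces a bilinear map
  to a finite sum of linear maps on \<open>W\<close>.
\<close>

lemma tensor_lift:
  fixes b :: "'k::field vec \<Rightarrow> 'k vec \<Rightarrow> ('l \<Rightarrow> 'k)"
  assumes V: "fd_space V" and W: "vs.subspace W" and b: "bilinear_on V W b"
  obtains h where "linear_on (tensor_space V W) h"
    "\<And>x y. x \<in> V \<Longrightarrow> y \<in> W \<Longrightarrow> h (x \<otimes>\<^sub>v y) = b x y"
proof -
  obtain B where B: "finite B" "\<not> vs.dependent B" "V = vs.span B"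
    using fd_basis[OF V] by blast
  \<comment> \<open>Freezing the second coordinate at \<open>j\<close> turns \<open>t\<close> into a
    vector of \<open>V\<close>, since on \<open>x \<otimes>\<^sub>v y\<close> it gives a multiple of
    \<open>x\<close>. The coefficients of these rows at \<open>v\<close>, taken over all
    \<open>j\<close>, form the vector \<open>c v t\<close> of \<open>W\<close>.\<close>
  define row where "row t j = (\<lambda>i. t (prod_encode (i, j)))" for t :: "'k vec" and j
  define c where "c v t = (\<lambda>j. vs.representation B (row t j) v)" for v t
  define h where "h t = (\<Sum>v\<in>B. b v (c v t))" for t
  have row_add: "row (s + t) j = row s j + row t j" and row_scale: "row (fscale a t) j = fscale a (row t j)"
    for s t j a by (auto simp: row_def fun_eq_iff fscale_def fun_eval)
  have row_t: "row (x \<otimes>\<^sub>v y) j = fscale (y j) x" for x y j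
    by (auto simp: row_def vtensor_def fscale_def mult.commute)
  have row: "row t j \<in> vs.span B" if "t \<in> tensor_space V W" for t j
  proof (rule tensor_mem[OF _ _ _ that])
    show "linear_on (tensor_space V W) (\<lambda>t. row t j)"
      by (rule linear_onI) (auto simp: row_add row_scale)
  qed (use B in \<open>auto simp: row_t vs.span_scale\<close>)
  have c_add: "c v (s + t) = c v s + c v t" if "s \<in> tensor_space V W" "t \<in> tensor_space V W" for v s t
    using row that by (simp add: c_def row_add vs.representation_add[OF B(2)] fun_eq_iff fun_eval)
  have c_scale: "c v (fscale a t) = fscale a (c v t)" if "t \<in> tensor_space V W" for v a t
    using row that by (simp add: c_def row_scale vs.representation_scale[OF B(2)] fun_eq_iff fscale_eval)
  have c_t: "c v (x \<otimes>\<^sub>v y) = fscale (vs.representation B x v) y" if "x \<in> V" for v x y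
    using that B by (simp add: c_def row_t vs.representation_scale[OF B(2)] fun_eq_iff fscale_eval mult.commute)
  have c_mem: "c v t \<in> W" if "t \<in> tensor_space V W" for v t
  proof (rule tensor_mem[OF _ W _ that])
    show "linear_on (tensor_space V W) (c v)"
      by (rule linear_onI) (auto simp: c_add c_scale)
  qed (use W in \<open>auto simp: c_t vs.subspace_scale\<close>)
  have bv: "linear_on W (b v)" if "v \<in> B" for v
    using bilinear_onD(1)[OF b] that B(3) vs.span_base by blast
  show thesis
  proof
    show "linear_on (tensor_space V W) h"
      by (rule linear_onI)
        (auto simp: h_def c_add c_scale linear_on_add[OF bv] linear_on_scale[OF bv] c_mem
          sum.distrib vs.scale_sum_right)
  next
    fix x y assume xy: "x \<in> V" "y \<in> W"
    have lin: "linear_on V (\<lambda>x. b x y)" using bilinear_onD(2)[OF b] xy by blast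
    have "h (x \<otimes>\<^sub>v y) = (\<Sum>v\<in>B. fscale (vs.representation B x v) (b v y))"
      using xy by (simp add: h_def c_t linear_on_scale[OF bv])
    also have "\<dots> = b (\<Sum>v\<in>B. fscale (vs.representation B x v) v) y"
      using B fd_subspace[OF V]
      by (subst linear_on_sum[OF lin]) (auto simp: linear_on_scale[OF lin] vs.span_base vs.span_scale)
    also have "\<dots> = b x y"
      using vs.sum_representation_eq[OF B(2) _ B(1)] xy B(3) by simp
    finally show "h (x \<otimes>\<^sub>v y) = b x y" .
  qed
qed

text \<open>\<open>P\<close> may prescribe values on fewer tensors than all
  \<open>x \<otimes>\<^sub>v y\<close>, as long as a linear map satisfies it exactly when it agrees
  with \<open>b\<close>. The maps described on tensor products of two factors are evaluated in this
  way.\<close>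

lemma the_linear_tensor:
  fixes b :: "'k::field vec \<Rightarrow> 'k vec \<Rightarrow> 'k vec"
  assumes V: "fd_space V" and W: "fd_space W" and b: "bilinear_on V W b"
    and P: "\<And>h. linear_on (tensor_space V W) h \<Longrightarrow>
      P h \<longleftrightarrow> (\<forall>x\<in>V. \<forall>y\<in>W. h (x \<otimes>\<^sub>v y) = b x y)"
  shows "the_linear (tensor_space V W) P \<in> extensional (tensor_space V W)"
    "linear_on (tensor_space V W) (the_linear (tensor_space V W) P)"
    "\<And>x y. x \<in> V \<Longrightarrow> y \<in> W \<Longrightarrow> the_linear (tensor_space V W) P (x \<otimes>\<^sub>v y) = b x y"
proof -
  obtain h where h: "linear_on (tensor_space V W) h"
    "\<And>x y. x \<in> V \<Longrightarrow> y \<in> W \<Longrightarrow> h (x \<otimes>\<^sub>v y) = b x y"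
    using tensor_lift[OF V fd_subspace[OF W] b] by blast
  have eq: "the_linear (tensor_space V W) P = restrict h (tensor_space V W)"
  proof (rule the_linear_works[OF _ h(1)])
    fix h' :: "'k vec \<Rightarrow> 'k vec" assume h': "linear_on (tensor_space V W) h'"
    show "P h' \<longleftrightarrow> (\<forall>x\<in>tensor_space V W. h' x = h x)"
      unfolding P[OF h'] using tensor_ext[OF h' h(1)] h(2) by (metis vtensor_mem)
  qed simp
  show "the_linear (tensor_space V W) P \<in> extensional (tensor_space V W)"
    by (simp add: eq)
  show "linear_on (tensor_space V W) (the_linear (tensor_space V W) P)"
    by (simp add: eq linear_on_restrict h(1))
  show "the_linear (tensor_space V W) P (x \<otimes>\<^sub>v y) = b x y" if "x \<in> V" "y \<in> W" for x y
    using that by (simp add: eq h(2) vtensor_mem)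
qed

lemma bilinear_tensor_map:
  assumes "linear_on V f" "linear_on W g"
  shows "bilinear_on V W (\<lambda>x y. f x \<otimes>\<^sub>v g y)"
  using assms
  by (auto simp: bilinear_on_def linear_on_def vtensor_add_left vtensor_add_right
      vtensor_scale_left vtensor_scale_right)

context
  fixes V W :: "'k::field vec set"
  assumes V: "fd_space V" and W: "fd_space W"
begin

lemma
  assumes "linear_on V f" "linear_on W g"
  shows tensor_map_ext: "tensor_map V W f g \<in> extensional (tensor_space V W)"
    and tensor_map_linear: "linear_on (tensor_space V W) (tensor_map V W f g)"
    and tensor_map_apply: "\<And>x y. x \<in> V \<Longrightarrow> y \<in> W \<Longrightarrow> tensor_map V W f g (x \<otimes>\<^sub>v y) = f x \<otimes>\<^sub>v g y"
  unfolding tensor_map_def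
  by (rule the_linear_tensor[OF V W bilinear_tensor_map[OF assms]]; simp)+

lemma tensor_map_mem:
  assumes "linear_on V f" "linear_on W g" "\<And>x. x \<in> V \<Longrightarrow> f x \<in> V'" "\<And>y. y \<in> W \<Longrightarrow> g y \<in> W'"
    and "t \<in> tensor_space V W"
  shows "tensor_map V W f g t \<in> tensor_space V' W'"
  by (rule tensor_mem[OF tensor_map_linear[OF assms(1,2)] _ _ assms(5)])
    (use assms in \<open>auto simp: tensor_map_apply vtensor_mem\<close>)

lemma
  shows flip_map_ext: "flip_map V W \<in> extensional (tensor_space V W)"
    and flip_map_linear: "linear_on (tensor_space V W) (flip_map V W)"
    and flip_map_apply: "\<And>x y. x \<in> V \<Longrightarrow> y \<in> W \<Longrightarrow> flip_map V W (x \<otimes>\<^sub>v y) = y \<otimes>\<^sub>v x"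
proof -
  have b: "bilinear_on V W (\<lambda>x y. y \<otimes>\<^sub>v x)"
    by (auto simp: bilinear_on_def linear_on_def vtensor_add_left vtensor_add_right
      vtensor_scale_left vtensor_scale_right)
  show "flip_map V W \<in> extensional (tensor_space V W)"
    "linear_on (tensor_space V W) (flip_map V W)"
    "\<And>x y. x \<in> V \<Longrightarrow> y \<in> W \<Longrightarrow> flip_map V W (x \<otimes>\<^sub>v y) = y \<otimes>\<^sub>v x"
    unfolding flip_map_def by (rule the_linear_tensor[OF V W b]; simp)+
qed

lemma flip_map_mem: "t \<in> tensor_space V W \<Longrightarrow> flip_map V W t \<in> tensor_space W V"
  by (rule tensor_mem[OF flip_map_linear]) (auto simp: flip_map_apply vtensor_mem)

end

text \<open>For fixed \<open>z\<close> lift to a map \<open>k z\<close> on the first two factors.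
  Uniqueness of the lift makes \<open>z\<close> |-> \<open>k z\<close> linear, so that a second lift
  applies.\<close>

lemma tensor_lift3:
  fixes b :: "'k::field vec \<Rightarrow> 'k vec \<Rightarrow> 'k vec \<Rightarrow> ('l \<Rightarrow> 'k)"
  assumes fd: "fd_space U" "fd_space V" "fd_space W"
    and b: "\<And>z. z \<in> W \<Longrightarrow> bilinear_on U V (\<lambda>x y. b x y z)"
      "\<And>x y. x \<in> U \<Longrightarrow> y \<in> V \<Longrightarrow> linear_on W (b x y)"
  obtains h where "linear_on (tensor_space (tensor_space U V) W) h"
    "\<And>x y z. x \<in> U \<Longrightarrow> y \<in> V \<Longrightarrow> z \<in> W \<Longrightarrow> h ((x \<otimes>\<^sub>v y) \<otimes>\<^sub>v z) = b x y z"
proof -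
  have "\<exists>h. linear_on (tensor_space U V) h \<and> (\<forall>x\<in>U. \<forall>y\<in>V. h (x \<otimes>\<^sub>v y) = b x y z)" if "z \<in> W" for z
    using tensor_lift[OF fd(1) fd_subspace[OF fd(2)] b(1)[OF that]] by metis
  then obtain k where k: "\<And>z. z \<in> W \<Longrightarrow> linear_on (tensor_space U V) (k z)"
    "\<And>x y z. x \<in> U \<Longrightarrow> y \<in> V \<Longrightarrow> z \<in> W \<Longrightarrow> k z (x \<otimes>\<^sub>v y) = b x y z"
    by metis
  have "bilinear_on (tensor_space U V) W (\<lambda>t z. k z t)"
  proof (rule bilinear_onI)
    fix t assume t: "t \<in> tensor_space U V"
    show "linear_on W (\<lambda>z. k z t)"
    proof (rule linear_onI)
      fix z z' assume z: "z \<in> W" "z' \<in> W"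
      then have "z + z' \<in> W" using fd_subspace[OF fd(3)] by (simp add: vs.subspace_add)
      then show "k (z + z') t = k z t + k z' t"
        by (intro tensor_ext[OF k(1) linear_on_add_fun[OF k(1) k(1)] _ t])
          (simp_all add: k(2) z linear_on_add[OF b(2)])
    next
      fix c z assume z: "z \<in> W"
      then have "fscale c z \<in> W" using fd_subspace[OF fd(3)] by (simp add: vs.subspace_scale)
      then show "k (fscale c z) t = fscale c (k z t)"
        by (intro tensor_ext[OF k(1) linear_on_scale_fun[OF k(1)] _ t])
          (simp_all add: k(2) z linear_on_scale[OF b(2)])
    qed
  qed (use k in auto)
  then obtain h where "linear_on (tensor_space (tensor_space U V) W) h"
    "\<And>t z. t \<in> tensor_space U V \<Longrightarrow> z \<in> W \<Longrightarrow> h (t \<otimes>\<^sub>v z) = k z t"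
    using tensor_lift[OF fd_tensor[OF fd(1,2)] fd_subspace[OF fd(3)]] by blast
  then show thesis using that k(2) by (metis vtensor_mem)
qed

lemma tensor_ext3:
  fixes f g :: "'a::field vec \<Rightarrow> ('b \<Rightarrow> 'a)"
  assumes f: "linear_on (tensor_space (tensor_space U V) W) f"
    and g: "linear_on (tensor_space (tensor_space U V) W) g"
    and eq: "\<And>x y z. x \<in> U \<Longrightarrow> y \<in> V \<Longrightarrow> z \<in> W \<Longrightarrow> f ((x \<otimes>\<^sub>v y) \<otimes>\<^sub>v z) = g ((x \<otimes>\<^sub>v y) \<otimes>\<^sub>v z)"
    and t: "t \<in> tensor_space (tensor_space U V) W"
  shows "f t = g t"
proof (rule tensor_ext[OF f g _ t])
  fix s z assume s: "s \<in> tensor_space U V" and z: "z \<in> W"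
  have lin: "linear_on (tensor_space U V) (\<lambda>s. k (s \<otimes>\<^sub>v z))"
    if k: "linear_on (tensor_space (tensor_space U V) W) k" for k :: "'a vec \<Rightarrow> ('b \<Rightarrow> 'a)"
    by (rule linear_onI)
      (simp_all add: vtensor_add_left vtensor_scale_left linear_on_add[OF k] linear_on_scale[OF k]
        vtensor_mem z)
  show "f (s \<otimes>\<^sub>v z) = g (s \<otimes>\<^sub>v z)"
    by (rule tensor_ext[OF lin[OF f] lin[OF g] _ s]) (rule eq[OF _ _ z])
qed

lemma tensor_mem3:
  assumes f: "linear_on (tensor_space (tensor_space U V) W) f" and "vs.subspace X"
    and eq: "\<And>x y z. x \<in> U \<Longrightarrow> y \<in> V \<Longrightarrow> z \<in> W \<Longrightarrow> f ((x \<otimes>\<^sub>v y) \<otimes>\<^sub>v z) \<in> X"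
    and t: "t \<in> tensor_space (tensor_space U V) W"
  shows "f t \<in> X"
proof (rule tensor_mem[OF f assms(2) _ t])
  fix s z assume s: "s \<in> tensor_space U V" and z: "z \<in> W"
  have lin: "linear_on (tensor_space U V) (\<lambda>s. f (s \<otimes>\<^sub>v z))"
    by (rule linear_onI)
      (simp_all add: vtensor_add_left vtensor_scale_left linear_on_add[OF f] linear_on_scale[OF f]
        vtensor_mem z)
  show "f (s \<otimes>\<^sub>v z) \<in> X"
    by (rule tensor_mem[OF lin assms(2) _ s]) (rule eq[OF _ _ z])
qed

lemma
  fixes U V W :: "'k::field vec set"
  assumes fd: "fd_space U" "fd_space V" "fd_space W"
  shows assoc_map_ext: "assoc_map U V W \<in> extensional (tensor_space (tensor_space U V) W)"
    and assoc_map_linear: "linear_on (tensor_space (tensor_space U V) W) (assoc_map U V W)"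
    and assoc_map_apply: "\<And>x y z. x \<in> U \<Longrightarrow> y \<in> V \<Longrightarrow> z \<in> W \<Longrightarrow>
      assoc_map U V W ((x \<otimes>\<^sub>v y) \<otimes>\<^sub>v z) = x \<otimes>\<^sub>v (y \<otimes>\<^sub>v z)"
proof -
  let ?T = "tensor_space (tensor_space U V) W"
  obtain h where h: "linear_on ?T h"
    "\<And>x y z. x \<in> U \<Longrightarrow> y \<in> V \<Longrightarrow> z \<in> W \<Longrightarrow> h ((x \<otimes>\<^sub>v y) \<otimes>\<^sub>v z) = x \<otimes>\<^sub>v (y \<otimes>\<^sub>v z)"
    by (rule tensor_lift3[OF fd, of "\<lambda>x y z. x \<otimes>\<^sub>v (y \<otimes>\<^sub>v z)"])
      (auto simp: bilinear_on_def linear_on_def vtensor_add_left vtensor_add_right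
      vtensor_scale_left vtensor_scale_right)
  have eq: "assoc_map U V W = restrict h ?T"
    unfolding assoc_map_def
  proof (rule the_linear_works[OF _ h(1)])
    fix h' :: "'k vec \<Rightarrow> 'k vec" assume h': "linear_on ?T h'"
    show "(\<forall>x\<in>U. \<forall>y\<in>V. \<forall>z\<in>W. h' ((x \<otimes>\<^sub>v y) \<otimes>\<^sub>v z) = x \<otimes>\<^sub>v (y \<otimes>\<^sub>v z)) \<longleftrightarrow> (\<forall>x\<in>?T. h' x = h x)"
      using tensor_ext3[OF h' h(1)] h(2) by (metis vtensor_mem)
  qed simp
  show "assoc_map U V W \<in> extensional ?T" by (simp add: eq)
  show "linear_on ?T (assoc_map U V W)" by (simp add: eq linear_on_restrict h(1))
  show "\<And>x y z. x \<in> U \<Longrightarrow> y \<in> V \<Longrightarrow> z \<in> W \<Longrightarrow>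
      assoc_map U V W ((x \<otimes>\<^sub>v y) \<otimes>\<^sub>v z) = x \<otimes>\<^sub>v (y \<otimes>\<^sub>v z)"
    by (simp add: eq h(2) vtensor_mem)
qed

section \<open>The unit space and the unit constraints\<close>

lemma unit_space_iff: "x \<in> unit_space \<longleftrightarrow> (\<exists>c. x = fscale c one_vec)"
  by (auto simp: unit_space_def vs.span_singleton)

lemma fd_unit: "fd_space unit_space"
  by (auto simp: fd_space_def unit_space_def)

lemma one_vec_mem [simp]: "one_vec \<in> unit_space"
  by (auto simp: unit_space_def intro: vs.span_base)

text \<open>\<open>one_vec\<close> is supported at \<open>0\<close>, so evaluation at
  \<open>0\<close> is the coordinate on the unit space; the unit constraints are computed with
  it.\<close>

lemma unit_coeff: "x \<in> unit_space \<Longrightarrow> x = fscale (x 0) one_vec"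
  by (auto simp: unit_space_iff one_vec_def fscale_def fun_eq_iff)

lemma unit_ext:
  assumes "linear_on unit_space f" "linear_on unit_space g" "f one_vec = g one_vec" "x \<in> unit_space"
  shows "f x = g x"
proof -
  obtain c where "x = fscale c one_vec" using assms(4) by (auto simp: unit_space_iff)
  then show ?thesis using assms(3) by (simp add: linear_on_scale[OF assms(1)] linear_on_scale[OF assms(2)])
qed

lemma unit_lift: "linear_on unit_space (\<lambda>x. fscale (x 0) v)"
  by (auto simp: linear_on_def vs.scale_left_distrib fscale_eval fun_eval)

lemma one_vec_0 [simp]: "one_vec 0 = 1" and one_vec_neq_0 [simp]: "one_vec \<noteq> 0"
  by (auto simp: one_vec_def fun_eq_iff fun_eval)

lemma the_linear_unit:
  "the_linear unit_space (\<lambda>h. h one_vec = v) = restrict (\<lambda>x. fscale (x 0) v) unit_space"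
proof (rule the_linear_works[OF fd_subspace[OF fd_unit] unit_lift])
  fix h' :: "'a vec \<Rightarrow> 'a vec" assume h': "linear_on unit_space h'"
  show "(h' one_vec = v) = (\<forall>x\<in>unit_space. h' x = fscale (x 0) v)"
    using unit_ext[OF h' unit_lift, of v] one_vec_mem by (metis fscale_1 one_vec_0)
qed

lemma
  fixes V :: "'k::field vec set"
  assumes V: "fd_space V"
  shows lunit_map_ext: "lunit_map V \<in> extensional (tensor_space unit_space V)"
    and lunit_map_linear: "linear_on (tensor_space unit_space V) (lunit_map V)"
    and lunit_map_apply: "\<And>(c :: 'k vec) x. c \<in> unit_space \<Longrightarrow> x \<in> V \<Longrightarrow> lunit_map V (c \<otimes>\<^sub>v x) = fscale (c 0) x"
proof -
  have b: "bilinear_on unit_space V (\<lambda>c x. fscale (c 0) x)"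
    by (intro bilinear_onI unit_lift linear_on_scale_fun linear_on_id)
  have P: "(\<forall>x\<in>V. h (one_vec \<otimes>\<^sub>v x) = x) \<longleftrightarrow> (\<forall>c\<in>unit_space. \<forall>x\<in>V. h (c \<otimes>\<^sub>v x) = fscale (c 0) x)"
    if h: "linear_on (tensor_space unit_space V) h" for h :: "'k vec \<Rightarrow> 'k vec"
  proof (intro iffI ballI)
    fix c x :: "'k vec" assume "\<forall>x\<in>V. h (one_vec \<otimes>\<^sub>v x) = x" "c \<in> unit_space" "x \<in> V"
    then show "h (c \<otimes>\<^sub>v x) = fscale (c 0) x"
      by (subst unit_coeff) (auto simp: vtensor_scale_left linear_on_scale[OF h] vtensor_mem)
  qed fastforce
  show "lunit_map V \<in> extensional (tensor_space unit_space V)"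
    "linear_on (tensor_space unit_space V) (lunit_map V)"
    "\<And>(c :: 'k vec) x. c \<in> unit_space \<Longrightarrow> x \<in> V \<Longrightarrow> lunit_map V (c \<otimes>\<^sub>v x) = fscale (c 0) x"
    unfolding lunit_map_def by (rule the_linear_tensor[OF fd_unit V b P]; simp)+
qed

lemma
  fixes V :: "'k::field vec set"
  assumes V: "fd_space V"
  shows runit_map_ext: "runit_map V \<in> extensional (tensor_space V unit_space)"
    and runit_map_linear: "linear_on (tensor_space V unit_space) (runit_map V)"
    and runit_map_apply: "\<And>(c :: 'k vec) x. c \<in> unit_space \<Longrightarrow> x \<in> V \<Longrightarrow> runit_map V (x \<otimes>\<^sub>v c) = fscale (c 0) x"
proof -
  have b: "bilinear_on V unit_space (\<lambda>x c. fscale (c 0) x)"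
    by (intro bilinear_onI unit_lift linear_on_scale_fun linear_on_id)
  have P: "(\<forall>x\<in>V. h (x \<otimes>\<^sub>v one_vec) = x) \<longleftrightarrow> (\<forall>x\<in>V. \<forall>c\<in>unit_space. h (x \<otimes>\<^sub>v c) = fscale (c 0) x)"
    if h: "linear_on (tensor_space V unit_space) h" for h :: "'k vec \<Rightarrow> 'k vec"
  proof (intro iffI ballI)
    fix c x :: "'k vec" assume a: "\<forall>x\<in>V. h (x \<otimes>\<^sub>v one_vec) = x" "c \<in> unit_space" "x \<in> V"
    have "x \<otimes>\<^sub>v c = fscale (c 0) (x \<otimes>\<^sub>v one_vec)"
      using unit_coeff[OF a(2)] by (metis vtensor_scale_right)
    then show "h (x \<otimes>\<^sub>v c) = fscale (c 0) x"
      using a by (auto simp: linear_on_scale[OF h] vtensor_mem)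
  qed fastforce
  show "runit_map V \<in> extensional (tensor_space V unit_space)"
    "linear_on (tensor_space V unit_space) (runit_map V)"
    "\<And>(c :: 'k vec) x. c \<in> unit_space \<Longrightarrow> x \<in> V \<Longrightarrow> runit_map V (x \<otimes>\<^sub>v c) = fscale (c 0) x"
    unfolding runit_map_def by (rule the_linear_tensor[OF V fd_unit b P]; simp)+
qed

section \<open>The category of equivariant graded spaces\<close>

text \<open>The other bracketing of \<open>tensor_lift3\<close>, for the inverse of the
  associator.\<close>

lemma tensor_lift3':
  fixes b :: "'k::field vec \<Rightarrow> 'k vec \<Rightarrow> 'k vec \<Rightarrow> ('l \<Rightarrow> 'k)"
  assumes fd: "fd_space U" "fd_space V" "fd_space W"
    and b: "\<And>x. x \<in> U \<Longrightarrow> bilinear_on V W (b x)"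
      "\<And>y z. y \<in> V \<Longrightarrow> z \<in> W \<Longrightarrow> linear_on U (\<lambda>x. b x y z)"
  obtains h where "linear_on (tensor_space U (tensor_space V W)) h"
    "\<And>x y z. x \<in> U \<Longrightarrow> y \<in> V \<Longrightarrow> z \<in> W \<Longrightarrow> h (x \<otimes>\<^sub>v (y \<otimes>\<^sub>v z)) = b x y z"
proof -
  have "\<exists>h. linear_on (tensor_space V W) h \<and> (\<forall>y\<in>V. \<forall>z\<in>W. h (y \<otimes>\<^sub>v z) = b x y z)" if "x \<in> U" for x
    using tensor_lift[OF fd(2) fd_subspace[OF fd(3)] b(1)[OF that]] by metis
  then obtain k where k: "\<And>x. x \<in> U \<Longrightarrow> linear_on (tensor_space V W) (k x)"
    "\<And>x y z. x \<in> U \<Longrightarrow> y \<in> V \<Longrightarrow> z \<in> W \<Longrightarrow> k x (y \<otimes>\<^sub>v z) = b x y z"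
    by metis
  note U = fd_subspace[OF fd(1)]
  have "bilinear_on U (tensor_space V W) k"
  proof (rule bilinear_onI)
    fix t assume t: "t \<in> tensor_space V W"
    show "linear_on U (\<lambda>x. k x t)"
    proof (rule linear_onI)
      fix x x' assume x: "x \<in> U" "x' \<in> U"
      show "k (x + x') t = k x t + k x' t"
        by (intro tensor_ext[OF k(1) linear_on_add_fun[OF k(1) k(1)] _ t])
          (simp_all add: k(2) x vs.subspace_add[OF U] linear_on_add[OF b(2)])
    next
      fix c x assume x: "x \<in> U"
      show "k (fscale c x) t = fscale c (k x t)"
        by (intro tensor_ext[OF k(1) linear_on_scale_fun[OF k(1)] _ t])
          (simp_all add: k(2) x vs.subspace_scale[OF U] linear_on_scale[OF b(2)])
    qed
  qed (rule k(1))
  then obtain h where "linear_on (tensor_space U (tensor_space V W)) h"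
    "\<And>x t. x \<in> U \<Longrightarrow> t \<in> tensor_space V W \<Longrightarrow> h (x \<otimes>\<^sub>v t) = k x t"
    using tensor_lift[OF fd(1) subspace_tensor] by blast
  then show thesis using that k(2) by (metis vtensor_mem)
qed

lemma tensor_ext3':
  fixes f g :: "'a::field vec \<Rightarrow> ('b \<Rightarrow> 'a)"
  assumes f: "linear_on (tensor_space U (tensor_space V W)) f"
    and g: "linear_on (tensor_space U (tensor_space V W)) g"
    and eq: "\<And>x y z. x \<in> U \<Longrightarrow> y \<in> V \<Longrightarrow> z \<in> W \<Longrightarrow> f (x \<otimes>\<^sub>v (y \<otimes>\<^sub>v z)) = g (x \<otimes>\<^sub>v (y \<otimes>\<^sub>v z))"
    and t: "t \<in> tensor_space U (tensor_space V W)"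
  shows "f t = g t"
proof (rule tensor_ext[OF f g _ t])
  fix x s assume s: "s \<in> tensor_space V W" and x: "x \<in> U"
  have lin: "linear_on (tensor_space V W) (\<lambda>s. k (x \<otimes>\<^sub>v s))"
    if k: "linear_on (tensor_space U (tensor_space V W)) k" for k :: "'a vec \<Rightarrow> ('b \<Rightarrow> 'a)"
    by (rule linear_onI)
      (simp_all add: vtensor_add_right vtensor_scale_right linear_on_add[OF k] linear_on_scale[OF k]
        vtensor_mem x)
  show "f (x \<otimes>\<^sub>v s) = g (x \<otimes>\<^sub>v s)"
    by (rule tensor_ext[OF lin[OF f] lin[OF g] _ s]) (rule eq[OF x])
qed

text \<open>The component of degree \<open>g\<close>. The decomposition in \<open>is_zobj\<close> is
  a single tuple, so the component is read off from that unique tuple.\<close>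

definition zcomp :: "('g, 'm) monoid_scheme \<Rightarrow> ('g, 'k::field) zobj \<Rightarrow> 'g \<Rightarrow> 'k vec \<Rightarrow> 'k vec" where
  "zcomp G X g x =
     (THE c. c \<in> (\<Pi>\<^sub>E g\<in>carrier G. deg X g) \<and> x = (\<Sum>g\<in>carrier G. c g)) g"

text \<open>A morphism as a bare function: neither tagged with source and target nor extensional, so
  that composites need no restriction.\<close>

definition zmap ::
  "('g, 'm) monoid_scheme \<Rightarrow> ('g, 'k::field) zobj \<Rightarrow> ('g, 'k) zobj \<Rightarrow> ('k vec \<Rightarrow> 'k vec) \<Rightarrow> bool" where
  "zmap G X Y \<phi> \<longleftrightarrow> \<phi> \<in> space X \<rightarrow> space Y \<and> linear_on (space X) \<phi> \<and>
     (\<forall>g\<in>carrier G. \<forall>x\<in>deg X g. \<phi> x \<in> deg Y g) \<and>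
     (\<forall>g\<in>carrier G. \<forall>x\<in>space X. \<phi> (act X g x) = act Y g (\<phi> x))"

lemma zmapD:
  assumes "zmap G X Y \<phi>"
  shows "x \<in> space X \<Longrightarrow> \<phi> x \<in> space Y" "linear_on (space X) \<phi>"
    "g \<in> carrier G \<Longrightarrow> x \<in> deg X g \<Longrightarrow> \<phi> x \<in> deg Y g"
    "g \<in> carrier G \<Longrightarrow> x \<in> space X \<Longrightarrow> \<phi> (act X g x) = act Y g (\<phi> x)"
  using assms by (auto simp: zmap_def)

lemma zhom_iff: "f \<in> zhom G X Y \<longleftrightarrow>
    (\<exists>\<phi>. f = Arrow X Y \<phi> \<and> \<phi> \<in> extensional (space X) \<and> zmap G X Y \<phi>)"
  unfolding zhom_def zmap_def PiE_def by (auto simp: image_subset_iff)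

lemma zhomD:
  assumes "f \<in> zhom G X Y"
  shows "src f = X" "trg f = Y" "fn f \<in> extensional (space X)" "zmap G X Y (fn f)" "f = Arrow X Y (fn f)"
  using assms by (auto simp: zhom_iff)

lemma ztensor_simps [simp]:
  "space (ztensor G X Y) = tensor_space (space X) (space Y)"
  "act (ztensor G X Y) g = tensor_map (space X) (space Y) (act X g) (act Y g)"
  by (simp_all add: ztensor_def)

lemma zunit_simps [simp]:
  "space (zunit G) = unit_space" "act (zunit G) g = (\<lambda>x. x)"
  "deg (zunit G) g = (if g = \<one>\<^bsub>G\<^esub> then unit_space else {0})"
  by (simp_all add: zunit_def)

lemma ZG_simps [simp]:
  "obj (ZG G) = {X. is_zobj G X}" "Hom (ZG G) = zhom G"
  "tens (ZG G) = ztensor G" "unit_obj (ZG G) = zunit G"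
  by (simp_all add: ZG_def)

lemma ZG_arrows [simp]:
  "ident (ZG G) X = Arrow X X (\<lambda>x\<in>space X. x)"
  "comp (ZG G) b a = Arrow (src a) (trg b) (compose (space (src a)) (fn b) (fn a))"
  "tens_arr (ZG G) a b = Arrow (ztensor G (src a) (src b)) (ztensor G (trg a) (trg b))
        (tensor_map (space (src a)) (space (src b)) (fn a) (fn b))"
  "assoc (ZG G) X Y Z = Arrow (ztensor G (ztensor G X Y) Z) (ztensor G X (ztensor G Y Z))
        (assoc_map (space X) (space Y) (space Z))"
  "lunit (ZG G) X = Arrow (ztensor G (zunit G) X) X (lunit_map (space X))"
  "runit (ZG G) X = Arrow (ztensor G X (zunit G)) X (runit_map (space X))"
  "braid (ZG G) X Y = Arrow (ztensor G X Y) (ztensor G Y X) (zbraid_map G X Y)"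
  by (simp_all add: ZG_def)

lemma zmap_comp: "zmap G X Y f \<Longrightarrow> zmap G Y Z g \<Longrightarrow> zmap G X Z (\<lambda>x. g (f x))"
  unfolding zmap_def by (auto simp: Pi_iff intro: linear_on_comp)

section \<open>Objects of \<open>Z(G)\<close> and their homogeneous components\<close>

locale finite_grp = group G for G (structure) +
  assumes fin: "finite (carrier G)"
begin

lemma inv_cancel [simp]:
  assumes "f \<in> carrier G" "g \<in> carrier G"
  shows "inv f \<otimes> (f \<otimes> g) = g" "f \<otimes> (inv f \<otimes> g) = g"
  using assms by (simp_all add: m_assoc[symmetric])

lemma zobj_facts:
  assumes "is_zobj G X"
  shows zobj_fd: "fd_space (space X)"
    and zobj_subspace: "vs.subspace (space X)"
    and deg_subspace: "g \<in> carrier G \<Longrightarrow> vs.subspace (deg X g)"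
    and deg_in_space: "g \<in> carrier G \<Longrightarrow> x \<in> deg X g \<Longrightarrow> x \<in> space X"
    and act_mem: "g \<in> carrier G \<Longrightarrow> x \<in> space X \<Longrightarrow> act X g x \<in> space X"
    and act_linear: "g \<in> carrier G \<Longrightarrow> linear_on (space X) (act X g)"
    and act_one: "x \<in> space X \<Longrightarrow> act X \<one> x = x"
    and act_mult: "g \<in> carrier G \<Longrightarrow> h \<in> carrier G \<Longrightarrow> x \<in> space X \<Longrightarrow> act X (g \<otimes> h) x = act X g (act X h x)"
    and act_deg: "f \<in> carrier G \<Longrightarrow> g \<in> carrier G \<Longrightarrow> x \<in> deg X g \<Longrightarrow>
      act X f x \<in> deg X (f \<otimes> g \<otimes> inv f)"
proof -
  show "fd_space (space X)" using assms unfolding is_zobj_def by blast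
  then show "vs.subspace (space X)" by (rule fd_subspace)
  show "f \<in> carrier G \<Longrightarrow> g \<in> carrier G \<Longrightarrow> x \<in> deg X g \<Longrightarrow> act X f x \<in> deg X (f \<otimes> g \<otimes> inv f)"
    using assms unfolding is_zobj_def by blast
qed (use assms in \<open>auto simp: is_zobj_def Pi_iff\<close>)

lemma act_deg_one: "is_zobj G X \<Longrightarrow> f \<in> carrier G \<Longrightarrow> x \<in> deg X \<one> \<Longrightarrow> act X f x \<in> deg X \<one>"
  using act_deg[of X f \<one> x] by simp

lemma
  assumes X: "is_zobj G X" and x: "x \<in> space X"
  shows zcomp_deg: "g \<in> carrier G \<Longrightarrow> zcomp G X g x \<in> deg X g"
    and zcomp_sum: "(\<Sum>g\<in>carrier G. zcomp G X g x) = x"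
    and zcomp_unique: "\<lbrakk>\<And>g. g \<in> carrier G \<Longrightarrow> c g \<in> deg X g; x = (\<Sum>g\<in>carrier G. c g)\<rbrakk> \<Longrightarrow>
      g \<in> carrier G \<Longrightarrow> zcomp G X g x = c g"
proof -
  let ?P = "\<lambda>c. c \<in> (\<Pi>\<^sub>E g\<in>carrier G. deg X g) \<and> x = (\<Sum>g\<in>carrier G. c g)"
  have ex1: "\<exists>!c. ?P c" using assms by (auto simp: is_zobj_def)
  have P: "?P (THE c. ?P c)" by (rule theI'[OF ex1])
  show "g \<in> carrier G \<Longrightarrow> zcomp G X g x \<in> deg X g" "(\<Sum>g\<in>carrier G. zcomp G X g x) = x"
    using P unfolding zcomp_def by (auto simp del: sum.cong)
  assume c: "\<And>g. g \<in> carrier G \<Longrightarrow> c g \<in> deg X g" "x = (\<Sum>g\<in>carrier G. c g)" and g: "g \<in> carrier G"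
  then have "?P (restrict c (carrier G))" by auto
  then have "(THE c. ?P c) = restrict c (carrier G)" using ex1 by (intro the1_equality)
  then show "zcomp G X g x = c g" unfolding zcomp_def using g by simp
qed

lemma zcomp_homogeneous:
  assumes X: "is_zobj G X" and "h \<in> carrier G" "g \<in> carrier G" "x \<in> deg X h"
  shows "zcomp G X g x = (if g = h then x else 0)"
proof (rule zcomp_unique[OF X])
  show "x \<in> space X" using assms deg_in_space by blast
  show "x = (\<Sum>g\<in>carrier G. if g = h then x else 0)" using assms fin by simp
qed (use assms deg_subspace[OF X] in \<open>auto simp: vs.subspace_0\<close>)

lemma zcomp_mem: "is_zobj G X \<Longrightarrow> g \<in> carrier G \<Longrightarrow> x \<in> space X \<Longrightarrow> zcomp G X g x \<in> space X"
  using zcomp_deg deg_in_space by blast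

lemma zcomp_linear:
  assumes X: "is_zobj G X" and g: "g \<in> carrier G"
  shows "linear_on (space X) (zcomp G X g)"
proof (rule linear_onI)
  fix x y assume xy: "x \<in> space X" "y \<in> space X"
  then have "x + y = (\<Sum>g\<in>carrier G. zcomp G X g x + zcomp G X g y)"
    by (simp add: sum.distrib zcomp_sum[OF X])
  then show "zcomp G X g (x + y) = zcomp G X g x + zcomp G X g y"
    using xy g by (intro zcomp_unique[OF X vs.subspace_add[OF zobj_subspace[OF X]]])
      (simp_all add: vs.subspace_add[OF deg_subspace[OF X]] zcomp_deg[OF X])
next
  fix c x assume x: "x \<in> space X"
  then have "fscale c x = (\<Sum>g\<in>carrier G. fscale c (zcomp G X g x))"
    by (simp add: vs.scale_sum_right[symmetric] zcomp_sum[OF X])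
  then show "zcomp G X g (fscale c x) = fscale c (zcomp G X g x)"
    using x g by (intro zcomp_unique[OF X vs.subspace_scale[OF zobj_subspace[OF X]]])
      (simp_all add: vs.subspace_scale[OF deg_subspace[OF X]] zcomp_deg[OF X])
qed

lemma zspace_ext:
  assumes X: "is_zobj G X" and f: "linear_on (space X) f" and f': "linear_on (space X) f'"
    and "\<And>g x. g \<in> carrier G \<Longrightarrow> x \<in> deg X g \<Longrightarrow> f x = f' x" and x: "x \<in> space X"
  shows "f x = f' x"
proof -
  have "f (\<Sum>g\<in>carrier G. zcomp G X g x) = f' (\<Sum>g\<in>carrier G. zcomp G X g x)"
    using assms(4) x zcomp_deg[OF X x]
    by (simp add: linear_on_sum[OF f zobj_subspace[OF X]] linear_on_sum[OF f' zobj_subspace[OF X]]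
        zcomp_mem[OF X])
  then show ?thesis by (simp add: zcomp_sum[OF X x])
qed

lemma zspace_mem:
  assumes X: "is_zobj G X" and f: "linear_on (space X) f" and W: "vs.subspace W"
    and "\<And>g x. g \<in> carrier G \<Longrightarrow> x \<in> deg X g \<Longrightarrow> f x \<in> W" and x: "x \<in> space X"
  shows "f x \<in> W"
proof -
  have "f (\<Sum>g\<in>carrier G. zcomp G X g x) \<in> W"
    using assms(4) x zcomp_deg[OF X x]
    by (simp add: linear_on_sum[OF f zobj_subspace[OF X]] zcomp_mem[OF X] vs.subspace_sum[OF W])
  then show ?thesis by (simp add: zcomp_sum[OF X x])
qed

lemma zcomp_zmap:
  assumes X: "is_zobj G X" and Y: "is_zobj G Y" and f: "zmap G X Y f" and x: "x \<in> space X" and g: "g \<in> carrier G"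
  shows "zcomp G Y g (f x) = f (zcomp G X g x)"
proof (rule zspace_ext[OF X linear_on_comp[OF zmapD(2)[OF f] zcomp_linear[OF Y g]]
      linear_on_comp[OF zcomp_linear[OF X g] zmapD(2)[OF f]] _ x])
  fix h x assume h: "h \<in> carrier G" "x \<in> deg X h"
  then show "zcomp G Y g (f x) = f (zcomp G X g x)"
    using zmapD(3)[OF f h] g linear_on_zero[OF zmapD(2)[OF f] zobj_subspace[OF X]]
    by (simp add: zcomp_homogeneous[OF X] zcomp_homogeneous[OF Y])
qed (use zmapD(1)[OF f] zcomp_mem[OF X g] in auto)

text \<open>Projections \<open>p\<close> replace the unique decomposition: existence is their sum,
  uniqueness their vanishing on the other degrees. For the conjugation axiom one inclusion suffices,
  since acting by \<open>inv f\<close> gives the other.\<close>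

lemma is_zobjI:
  assumes fd: "fd_space (space X)"
    and sub: "\<And>g. g \<in> carrier G \<Longrightarrow> vs.subspace (deg X g)"
      "\<And>g x. g \<in> carrier G \<Longrightarrow> x \<in> deg X g \<Longrightarrow> x \<in> space X"
    and p: "\<And>g. g \<in> carrier G \<Longrightarrow> linear_on (space X) (p g)"
      "\<And>g x. g \<in> carrier G \<Longrightarrow> x \<in> space X \<Longrightarrow> p g x \<in> deg X g"
      "\<And>x. x \<in> space X \<Longrightarrow> (\<Sum>g\<in>carrier G. p g x) = x"
      "\<And>g h x. g \<in> carrier G \<Longrightarrow> h \<in> carrier G \<Longrightarrow> g \<noteq> h \<Longrightarrow> x \<in> deg X h \<Longrightarrow> p g x = 0"
    and act: "\<And>g x. g \<in> carrier G \<Longrightarrow> x \<in> space X \<Longrightarrow> act X g x \<in> space X"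
      "\<And>g. g \<in> carrier G \<Longrightarrow> linear_on (space X) (act X g)"
      "\<And>x. x \<in> space X \<Longrightarrow> act X \<one> x = x"
      "\<And>g h x. g \<in> carrier G \<Longrightarrow> h \<in> carrier G \<Longrightarrow> x \<in> space X \<Longrightarrow> act X (g \<otimes> h) x = act X g (act X h x)"
      "\<And>f g x. f \<in> carrier G \<Longrightarrow> g \<in> carrier G \<Longrightarrow> x \<in> deg X g \<Longrightarrow> act X f x \<in> deg X (f \<otimes> g \<otimes> inv f)"
  shows "is_zobj G X"
proof -
  note sp = fd_subspace[OF fd]
  \<comment> \<open>\<open>x\<close> is the sum of its projections, of which only the one of its own
    degree can be nonzero.\<close>
  have p_id: "p g x = x" if "g \<in> carrier G" "x \<in> deg X g" for g x
  proof -
    have "x = (\<Sum>h\<in>carrier G. p h x)" using p(3) sub(2) that by metis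
    also have "\<dots> = (\<Sum>h\<in>carrier G. if h = g then p g x else 0)"
      using that by (intro sum.cong) (auto intro: p(4))
    finally show ?thesis using fin that by simp
  qed
  have decomp: "\<exists>!c. c \<in> (\<Pi>\<^sub>E g\<in>carrier G. deg X g) \<and> x = (\<Sum>g\<in>carrier G. c g)" if x: "x \<in> space X" for x
  proof (rule ex1I[of _ "\<lambda>g\<in>carrier G. p g x"])
    fix c assume c: "c \<in> (\<Pi>\<^sub>E g\<in>carrier G. deg X g) \<and> x = (\<Sum>g\<in>carrier G. c g)"
    have "p g x = c g" if g: "g \<in> carrier G" for g
    proof -
      have "p g (\<Sum>h\<in>carrier G. c h) = (\<Sum>h\<in>carrier G. p g (c h))"
        using c sub(2) by (intro linear_on_sum[OF p(1)[OF g] sp]) auto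
      also have "\<dots> = (\<Sum>h\<in>carrier G. if h = g then c g else 0)"
      proof (rule sum.cong)
        fix h assume "h \<in> carrier G"
        then show "p g (c h) = (if h = g then c g else 0)"
          using c g p_id[of g "c g"] p(4)[of g h "c h"] by auto
      qed simp
      finally show ?thesis using c fin g by simp
    qed
    then show "c = (\<lambda>g\<in>carrier G. p g x)"
      using c by (intro extensionalityI[of _ "carrier G"]) (auto simp: PiE_def)
  qed (use x p(2,3) in auto)
  have conj: "act X f ` deg X g = deg X (f \<otimes> g \<otimes> inv f)" if fg: "f \<in> carrier G" "g \<in> carrier G" for f g
  proof
    show "deg X (f \<otimes> g \<otimes> inv f) \<subseteq> act X f ` deg X g"
    proof
      fix y assume y: "y \<in> deg X (f \<otimes> g \<otimes> inv f)"
      have "act X (inv f) y \<in> deg X (inv f \<otimes> (f \<otimes> g \<otimes> inv f) \<otimes> inv (inv f))"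
        using y fg by (intro act(5)) auto
      also have "inv f \<otimes> (f \<otimes> g \<otimes> inv f) \<otimes> inv (inv f) = g"
        using fg by (simp add: m_assoc)
      finally have "act X (inv f) y \<in> deg X g" .
      moreover have "y = act X f (act X (inv f) y)"
      proof -
        have "y \<in> space X" using sub(2) y fg by blast
        then show ?thesis using act(3)[of y] act(4)[of f "inv f" y] fg by simp
      qed
      ultimately show "y \<in> act X f ` deg X g" by blast
    qed
  qed (use act(5) fg in blast)
  have "deg X g \<subseteq> space X" "act X g \<in> space X \<rightarrow> space X" if "g \<in> carrier G" for g
    using sub(2) act(1) that by auto
  then show ?thesis
    unfolding is_zobj_def using fd sub(1) act(2-4) decomp conj by (intro conjI ballI) simp_all
qed

section \<open>Tensor products of objects and their constraints\<close>

lemma ztensor_deg: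
  "a \<in> carrier G \<Longrightarrow> b \<in> carrier G \<Longrightarrow> x \<in> deg X a \<Longrightarrow> y \<in> deg Y b \<Longrightarrow>
    x \<otimes>\<^sub>v y \<in> deg (ztensor G X Y) (a \<otimes> b)"
  by (auto simp: ztensor_def intro!: vs.span_base)

lemma ztensor_ext:
  fixes X Y :: "('a, 'k::field) zobj" and f g :: "'k vec \<Rightarrow> ('j \<Rightarrow> 'k)"
  assumes "is_zobj G X" "is_zobj G Y"
    and f: "linear_on (tensor_space (space X) (space Y)) f"
    and g: "linear_on (tensor_space (space X) (space Y)) g"
    and "\<And>a b x y. a \<in> carrier G \<Longrightarrow> b \<in> carrier G \<Longrightarrow> x \<in> deg X a \<Longrightarrow> y \<in> deg Y b \<Longrightarrow>
      f (x \<otimes>\<^sub>v y) = g (x \<otimes>\<^sub>v y)"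
    and t: "t \<in> tensor_space (space X) (space Y)"
  shows "f t = g t"
proof (rule tensor_ext[OF f g _ t])
  fix x y assume x: "x \<in> space X" and y: "y \<in> space Y"
  have lin: "linear_on (space X) (\<lambda>x. h (x \<otimes>\<^sub>v y))" "linear_on (space Y) (\<lambda>y. h (x \<otimes>\<^sub>v y))"
    if h: "linear_on (tensor_space (space X) (space Y)) h" "x \<in> space X" "y \<in> space Y"
    for h :: "'k vec \<Rightarrow> ('j \<Rightarrow> 'k)" and x y
    by (rule linear_onI; use that in \<open>simp add: vtensor_add_right vtensor_scale_right
        vtensor_add_left vtensor_scale_left linear_on_add[OF h(1)] linear_on_scale[OF h(1)] vtensor_mem\<close>)+
  show "f (x \<otimes>\<^sub>v y) = g (x \<otimes>\<^sub>v y)"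
  proof (rule zspace_ext[OF assms(1) lin(1)[OF f x y] lin(1)[OF g x y] _ x])
    fix a x assume a: "a \<in> carrier G" "x \<in> deg X a"
    then have x: "x \<in> space X" using assms(1) deg_in_space by blast
    show "f (x \<otimes>\<^sub>v y) = g (x \<otimes>\<^sub>v y)"
      using a assms(5) by (intro zspace_ext[OF assms(2) lin(2)[OF f x y] lin(2)[OF g x y] _ y]) blast
  qed
qed

lemma is_zobj_tensor:
  fixes X Y :: "('a, 'k::field) zobj"
  assumes X: "is_zobj G X" and Y: "is_zobj G Y"
  shows "is_zobj G (ztensor G X Y)"
proof -
  let ?T = "tensor_space (space X) (space Y)"
  let ?D = "deg (ztensor G X Y)"
  have fd: "fd_space ?T" using zobj_fd X Y by (blast intro: fd_tensor)
  have D: "vs.subspace (?D g)" for g by (simp add: ztensor_def)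
  have deg_sub: "t \<in> ?T" if "t \<in> ?D g" for g t
  proof -
    have "vs.span {x \<otimes>\<^sub>v y | x y a b. a \<in> carrier G \<and> b \<in> carrier G \<and>
        a \<otimes> b = g \<and> x \<in> deg X a \<and> y \<in> deg Y b} \<subseteq> ?T"
      using deg_in_space[OF X] deg_in_space[OF Y]
      by (intro vs.span_minimal) (auto intro!: vtensor_mem)
    then have "?D g \<subseteq> ?T" by (simp add: ztensor_def)
    then show ?thesis using that by blast
  qed
  \<comment> \<open>The components of a tensor product are defined as spans, so facts about them are
    reached by linearity from homogeneous tensors.\<close>
  have deg_ind: "h t \<in> W" if t: "t \<in> ?D g" and h: "linear_on ?T h" and W: "vs.subspace W"
      and hom: "\<And>a b x y. a \<in> carrier G \<Longrightarrow> b \<in> carrier G \<Longrightarrow> a \<otimes> b = g \<Longrightarrow> x \<in> deg X a \<Longrightarrow> y \<in> deg Y b \<Longrightarrow> h (x \<otimes>\<^sub>v y) \<in> W"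
    for t g h and W :: "'k vec set"
  proof -
    have "linear_on (?D g) h" using h deg_sub by (blast intro: linear_on_subset)
    then show ?thesis
      using t hom unfolding ztensor_def by (auto intro: linear_on_mem_span[OF _ W])
  qed
  \<comment> \<open>The part of degree \<open>g\<close> of \<open>x \<otimes>\<^sub>v y\<close>
    collects the pairs of degrees \<open>a\<close> and \<open>a^-1 g\<close>.\<close>
  define q where "q g = (\<lambda>x y. \<Sum>a\<in>carrier G. zcomp G X a x \<otimes>\<^sub>v zcomp G Y (inv a \<otimes> g) y)" for g
  have bil: "bilinear_on (space X) (space Y) (q g)" if "g \<in> carrier G" for g
    unfolding q_def using that
    by (intro bilinear_onI linear_onI)
      (simp_all add: linear_on_add[OF zcomp_linear[OF X]] linear_on_scale[OF zcomp_linear[OF X]]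
        linear_on_add[OF zcomp_linear[OF Y]] linear_on_scale[OF zcomp_linear[OF Y]]
        vtensor_add_left vtensor_add_right vtensor_scale_left vtensor_scale_right sum.distrib vs.scale_sum_right)
  have "\<exists>p. linear_on ?T p \<and> (\<forall>x\<in>space X. \<forall>y\<in>space Y. p (x \<otimes>\<^sub>v y) = q g x y)" if "g \<in> carrier G" for g
    using tensor_lift[OF zobj_fd[OF X] zobj_subspace[OF Y] bil[OF that]] by metis
  then obtain p where p: "\<And>g. g \<in> carrier G \<Longrightarrow> linear_on ?T (p g)"
    "\<And>g x y. g \<in> carrier G \<Longrightarrow> x \<in> space X \<Longrightarrow> y \<in> space Y \<Longrightarrow> p g (x \<otimes>\<^sub>v y) = q g x y"
    by metis
  have p_hom: "p g (x \<otimes>\<^sub>v y) = (if g = a \<otimes> b then x \<otimes>\<^sub>v y else 0)"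
    if "g \<in> carrier G" "a \<in> carrier G" "b \<in> carrier G" "x \<in> deg X a" "y \<in> deg Y b" for g a b x y
  proof -
    have "q g x y = (\<Sum>c\<in>carrier G. if c = a then x \<otimes>\<^sub>v zcomp G Y (inv a \<otimes> g) y else 0)"
      unfolding q_def using that by (intro sum.cong) (auto simp: zcomp_homogeneous[OF X])
    also have "\<dots> = (if g = a \<otimes> b then x \<otimes>\<^sub>v y else 0)"
      using that fin by (auto simp: zcomp_homogeneous[OF Y] inv_solve_left' m_assoc[symmetric])
    finally show ?thesis
      using that deg_in_space[OF X] deg_in_space[OF Y] p(2) by metis
  qed
  note actl = act_linear[OF X] act_linear[OF Y]
  note tm = tensor_map_linear[OF zobj_fd[OF X] zobj_fd[OF Y] actl] tensor_map_apply[OF zobj_fd[OF X] zobj_fd[OF Y] actl]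
  have act_T: "tensor_map (space X) (space Y) (act X g) (act Y g) t \<in> ?T" if "g \<in> carrier G" "t \<in> ?T" for g t
    using that act_mem[OF X] act_mem[OF Y] actl
    by (intro tensor_map_mem[OF zobj_fd[OF X] zobj_fd[OF Y]]) auto
  show ?thesis
  proof (rule is_zobjI[where p = p])
    fix g t assume g: "g \<in> carrier G" and t: "t \<in> space (ztensor G X Y)"
    show "p g t \<in> ?D g"
    proof (rule tensor_mem[OF p(1)[OF g] D])
      fix x y assume "x \<in> space X" "y \<in> space Y"
      then show "p g (x \<otimes>\<^sub>v y) \<in> ?D g"
        using g ztensor_deg[where b = "inv a \<otimes> g" and a = a and X = X and Y = Y for a]
        by (simp add: p(2) q_def zcomp_deg[OF X] zcomp_deg[OF Y] vs.subspace_sum[OF D])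
    qed (use t in simp)
  next
    fix t assume t: "t \<in> space (ztensor G X Y)"
    show "(\<Sum>g\<in>carrier G. p g t) = t"
    proof (rule ztensor_ext[OF X Y linear_on_sum_fun[OF p(1)] linear_on_id])
      fix a b x y assume "a \<in> carrier G" "b \<in> carrier G" "x \<in> deg X a" "y \<in> deg Y b"
      then show "(\<Sum>g\<in>carrier G. p g (x \<otimes>\<^sub>v y)) = x \<otimes>\<^sub>v y" using fin by (simp add: p_hom)
    qed (use t in auto)
  next
    fix g h t assume "g \<in> carrier G" "h \<in> carrier G" "g \<noteq> h" "t \<in> ?D h"
    then show "p g t = 0"
      using deg_ind[of t h "p g" "{0}"] p(1) p_hom by auto
  next
    fix t assume t: "t \<in> space (ztensor G X Y)"
    show "act (ztensor G X Y) \<one> t = t"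
      unfolding ztensor_simps
      by (rule tensor_ext[OF tm(1) linear_on_id]) (use t in \<open>auto simp: tm(2) act_one[OF X] act_one[OF Y]\<close>)
  next
    fix g h t assume gh: "g \<in> carrier G" "h \<in> carrier G" and t: "t \<in> space (ztensor G X Y)"
    show "act (ztensor G X Y) (g \<otimes> h) t = act (ztensor G X Y) g (act (ztensor G X Y) h t)"
      unfolding ztensor_simps
    proof (rule tensor_ext[OF tm(1) linear_on_comp[OF tm(1) tm(1)]])
      fix x y assume "x \<in> space X" "y \<in> space Y"
      then show "tensor_map (space X) (space Y) (act X (g \<otimes> h)) (act Y (g \<otimes> h)) (x \<otimes>\<^sub>v y) =
        tensor_map (space X) (space Y) (act X g) (act Y g)
         (tensor_map (space X) (space Y) (act X h) (act Y h) (x \<otimes>\<^sub>v y))"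
        using gh by (simp add: tm act_mem[OF X] act_mem[OF Y] act_mult[OF X] act_mult[OF Y])
    qed (use gh t act_T in auto)
  next
    fix f g t assume fg: "f \<in> carrier G" "g \<in> carrier G" and t: "t \<in> ?D g"
    show "act (ztensor G X Y) f t \<in> ?D (f \<otimes> g \<otimes> inv f)"
      unfolding ztensor_simps
    proof (rule deg_ind[OF t tm(1) D])
      fix a b x y assume ab: "a \<in> carrier G" "b \<in> carrier G" "a \<otimes> b = g" "x \<in> deg X a" "y \<in> deg Y b"
      have "act X f x \<otimes>\<^sub>v act Y f y \<in> ?D ((f \<otimes> a \<otimes> inv f) \<otimes> (f \<otimes> b \<otimes> inv f))"
        using ab fg by (intro ztensor_deg act_deg[OF X] act_deg[OF Y]) auto
      also have "(f \<otimes> a \<otimes> inv f) \<otimes> (f \<otimes> b \<otimes> inv f) = f \<otimes> g \<otimes> inv f"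
        using ab fg by (simp add: m_assoc inv_solve_left) (simp add: m_assoc[symmetric])
      finally show "tensor_map (space X) (space Y) (act X f) (act Y f) (x \<otimes>\<^sub>v y) \<in> ?D (f \<otimes> g \<otimes> inv f)"
        using ab fg by (simp add: tm deg_in_space[OF X] deg_in_space[OF Y])
    qed (use fg in auto)
  qed (use fd D deg_sub p(1) tm(1) act_T in auto)
qed

lemma is_zobj_unit: "is_zobj G (zunit G :: ('a, 'k::field) zobj)"
proof (rule is_zobjI[where p = "\<lambda>g x. if g = \<one> then x else 0"])
  fix f g x assume fg: "f \<in> carrier G" "g \<in> carrier G" and x: "x \<in> deg (zunit G :: ('a, 'k) zobj) g"
  have "f \<otimes> g \<otimes> inv f = \<one> \<longleftrightarrow> g = \<one>"
    using fg by (metis inv_closed inv_equality inv_inv l_one m_assoc m_closed r_inv r_one)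
  then show "act (zunit G) f x \<in> deg (zunit G) (f \<otimes> g \<otimes> inv f)" using x by simp
next
  fix g
  show "linear_on (space (zunit G :: ('a, 'k) zobj)) (\<lambda>x. if g = \<one> then x else 0)"
    by (cases "g = \<one>") (simp_all add: linear_on_id linear_on_const_zero)
qed (use fd_unit fd_subspace[OF fd_unit] vs.subspace_0[OF fd_subspace[OF fd_unit]] fin in
    \<open>auto simp: linear_on_id split: if_splits\<close>)

text \<open>Homogeneous tensors span, so degree and equivariance need only be tested there; that the
  values lie in \<open>Z\<close> at all follows from the degree condition.\<close>

lemma zmap_tensorI:
  assumes X: "is_zobj G X" and Y: "is_zobj G Y" and Z: "is_zobj G Z"
    and h: "linear_on (tensor_space (space X) (space Y)) h"
    and hom: "\<And>a b x y. a \<in> carrier G \<Longrightarrow> b \<in> carrier G \<Longrightarrow> x \<in> deg X a \<Longrightarrow> y \<in> deg Y b \<Longrightarrow>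
      h (x \<otimes>\<^sub>v y) \<in> deg Z (a \<otimes> b)"
    and eqv: "\<And>g a b x y. g \<in> carrier G \<Longrightarrow> a \<in> carrier G \<Longrightarrow> b \<in> carrier G \<Longrightarrow> x \<in> deg X a \<Longrightarrow> y \<in> deg Y b \<Longrightarrow>
      h (act X g x \<otimes>\<^sub>v act Y g y) = act Z g (h (x \<otimes>\<^sub>v y))"
  shows "zmap G (ztensor G X Y) Z h"
proof -
  let ?T = "tensor_space (space X) (space Y)"
  note T = is_zobj_tensor[OF X Y]
  have deg: "h t \<in> deg Z g" if g: "g \<in> carrier G" and t: "t \<in> deg (ztensor G X Y) g" for g t
  proof -
    have "deg (ztensor G X Y) g \<subseteq> ?T" using deg_in_space[OF T g] by auto
    then have "linear_on (deg (ztensor G X Y) g) h" using h by (blast intro: linear_on_subset)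
    then show ?thesis
      using t hom unfolding ztensor_def by (auto intro: linear_on_mem_span[OF _ deg_subspace[OF Z g]])
  qed
  have mem: "h t \<in> space Z" if "t \<in> ?T" for t
    using zspace_mem[OF T _ zobj_subspace[OF Z], of h t] h deg deg_in_space[OF Z] that by auto
  note tm = tensor_map_linear[OF zobj_fd[OF X] zobj_fd[OF Y] act_linear[OF X] act_linear[OF Y]]
    tensor_map_apply[OF zobj_fd[OF X] zobj_fd[OF Y] act_linear[OF X] act_linear[OF Y]]
  have "h (act (ztensor G X Y) g t) = act Z g (h t)" if g: "g \<in> carrier G" and t: "t \<in> ?T" for g t
  proof (rule ztensor_ext[OF X Y linear_on_comp[OF _ h] linear_on_comp[OF h act_linear[OF Z g]] _ t])
    fix a b x y assume "a \<in> carrier G" "b \<in> carrier G" "x \<in> deg X a" "y \<in> deg Y b"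
    then show "h (act (ztensor G X Y) g (x \<otimes>\<^sub>v y)) = act Z g (h (x \<otimes>\<^sub>v y))"
      using g by (simp add: tm eqv deg_in_space[OF X] deg_in_space[OF Y])
  qed (use g mem act_linear[OF T] act_mem[OF T] in auto)
  then show ?thesis unfolding zmap_def using h deg mem by auto
qed

lemma zmap_tensorD:
  assumes "is_zobj G X" "is_zobj G Y" "zmap G (ztensor G X Y) Z h"
  shows "a \<in> carrier G \<Longrightarrow> b \<in> carrier G \<Longrightarrow> x \<in> deg X a \<Longrightarrow> y \<in> deg Y b \<Longrightarrow>
      h (x \<otimes>\<^sub>v y) \<in> deg Z (a \<otimes> b)"
    and "g \<in> carrier G \<Longrightarrow> x \<in> space X \<Longrightarrow> y \<in> space Y \<Longrightarrow>
      h (act X g x \<otimes>\<^sub>v act Y g y) = act Z g (h (x \<otimes>\<^sub>v y))"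
    and "linear_on (tensor_space (space X) (space Y)) h"
    and "x \<in> space X \<Longrightarrow> y \<in> space Y \<Longrightarrow> h (x \<otimes>\<^sub>v y) \<in> space Z"
    and "bilinear_on (space X) (space Y) (\<lambda>x y. h (x \<otimes>\<^sub>v y))"
proof -
  show lin: "linear_on (tensor_space (space X) (space Y)) h" using zmapD(2)[OF assms(3)] by simp
  show "a \<in> carrier G \<Longrightarrow> b \<in> carrier G \<Longrightarrow> x \<in> deg X a \<Longrightarrow> y \<in> deg Y b \<Longrightarrow>
      h (x \<otimes>\<^sub>v y) \<in> deg Z (a \<otimes> b)"
    by (rule zmapD(3)[OF assms(3)]) (auto intro: ztensor_deg)
  show "x \<in> space X \<Longrightarrow> y \<in> space Y \<Longrightarrow> h (x \<otimes>\<^sub>v y) \<in> space Z"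
    by (rule zmapD(1)[OF assms(3)]) (simp add: vtensor_mem)
  show "g \<in> carrier G \<Longrightarrow> x \<in> space X \<Longrightarrow> y \<in> space Y \<Longrightarrow>
      h (act X g x \<otimes>\<^sub>v act Y g y) = act Z g (h (x \<otimes>\<^sub>v y))"
    using zmapD(4)[OF assms(3), of g "x \<otimes>\<^sub>v y"]
    by (simp add: vtensor_mem tensor_map_apply zobj_fd act_linear assms(1,2))
  show "bilinear_on (space X) (space Y) (\<lambda>x y. h (x \<otimes>\<^sub>v y))"
    using bilinear_on_tensor[OF lin] .
qed

lemma zmap_tensor_map:
  assumes X: "is_zobj G X" and Y: "is_zobj G Y" and X': "is_zobj G X'" and Y': "is_zobj G Y'"
    and f: "zmap G X X' f" and g: "zmap G Y Y' g"
  shows "zmap G (ztensor G X Y) (ztensor G X' Y') (tensor_map (space X) (space Y) f g)"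
proof -
  note fg = zmapD[OF f] zmapD[OF g]
  note tm = tensor_map_linear[OF zobj_fd[OF X] zobj_fd[OF Y] fg(2,6)]
    tensor_map_apply[OF zobj_fd[OF X] zobj_fd[OF Y] fg(2,6)]
  show ?thesis
    by (rule zmap_tensorI[OF X Y is_zobj_tensor[OF X' Y']])
      (auto simp: tm deg_in_space[OF X] deg_in_space[OF Y] fg act_mem[OF X] act_mem[OF Y]
        tensor_map_apply zobj_fd act_linear X' Y' intro: ztensor_deg)
qed

lemma zmap_assoc:
  assumes X: "is_zobj G X" and Y: "is_zobj G Y" and Z: "is_zobj G Z"
  shows "zmap G (ztensor G (ztensor G X Y) Z) (ztensor G X (ztensor G Y Z))
    (assoc_map (space X) (space Y) (space Z))"
proof -
  note XY = is_zobj_tensor[OF X Y] and YZ = is_zobj_tensor[OF Y Z]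
  note XYZ = is_zobj_tensor[OF X YZ]
  note fds = zobj_fd[OF X] zobj_fd[OF Y] zobj_fd[OF Z]
  note am = assoc_map_linear[OF fds] assoc_map_apply[OF fds]
  let ?a = "assoc_map (space X) (space Y) (space Z)"
  let ?D = "deg (ztensor G X (ztensor G Y Z))"
  have lin: "linear_on (tensor_space (space X) (space Y)) (\<lambda>s. ?a (s \<otimes>\<^sub>v z))" if "z \<in> space Z" for z
    using that by (intro linear_onI)
      (simp_all add: vtensor_add_left vtensor_scale_left linear_on_add[OF am(1)] linear_on_scale[OF am(1)] vtensor_mem)
  \<comment> \<open>Degrees agree by \<open>a (b c) = (a b) c\<close>. The elements of degree
    \<open>d\<close> of the inner product are again reached by linearity from homogeneous
    tensors.\<close>
  have deg: "?a (s \<otimes>\<^sub>v z) \<in> ?D (d \<otimes> c)"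
    if "d \<in> carrier G" "c \<in> carrier G" "s \<in> deg (ztensor G X Y) d" and z: "z \<in> deg Z c" for s z d c
  proof -
    have "deg (ztensor G X Y) d \<subseteq> tensor_space (space X) (space Y)"
      using deg_in_space[OF XY] that by auto
    then have "linear_on (deg (ztensor G X Y) d) (\<lambda>s. ?a (s \<otimes>\<^sub>v z))"
      using lin deg_in_space[OF Z] that by (blast intro: linear_on_subset)
    moreover have "?a ((x \<otimes>\<^sub>v y) \<otimes>\<^sub>v z) \<in> ?D (d \<otimes> c)"
      if "a \<in> carrier G" "b \<in> carrier G" "a \<otimes> b = d" "x \<in> deg X a" "y \<in> deg Y b" for a b x y
    proof -
      have "x \<otimes>\<^sub>v (y \<otimes>\<^sub>v z) \<in> ?D (a \<otimes> (b \<otimes> c))"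
        using that \<open>c \<in> carrier G\<close> z by (intro ztensor_deg) auto
      then show ?thesis
        using that \<open>c \<in> carrier G\<close> z deg_in_space[OF X] deg_in_space[OF Y] deg_in_space[OF Z]
        by (auto simp: am m_assoc)
    qed
    moreover have "deg (ztensor G X Y) d = vs.span {x \<otimes>\<^sub>v y | x y a b. a \<in> carrier G \<and> b \<in> carrier G \<and>
        a \<otimes> b = d \<and> x \<in> deg X a \<and> y \<in> deg Y b}"
      by (simp add: ztensor_def)
    ultimately show ?thesis
      using that deg_subspace[OF XYZ, of "d \<otimes> c"]
      by (intro linear_on_mem_span[of _ "\<lambda>s. ?a (s \<otimes>\<^sub>v z)" "?D (d \<otimes> c)" s]) auto
  qed
  have eqv: "?a (act (ztensor G X Y) g s \<otimes>\<^sub>v act Z g z) = act (ztensor G X (ztensor G Y Z)) g (?a (s \<otimes>\<^sub>v z))"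
    if g: "g \<in> carrier G" and s: "s \<in> tensor_space (space X) (space Y)" and z: "z \<in> space Z" for g s z
  proof -
    have act_XY: "linear_on (tensor_space (space X) (space Y)) (act (ztensor G X Y) g)"
      using act_linear[OF XY g] by (simp only: ztensor_simps(1))
    have mem: "act (ztensor G X Y) g t \<in> tensor_space (space X) (space Y)"
      if "t \<in> tensor_space (space X) (space Y)" for t
      using act_mem[OF XY g, of t] that by (simp only: ztensor_simps(1))
    have mem': "?a (t \<otimes>\<^sub>v z) \<in> space (ztensor G X (ztensor G Y Z))"
      if "t \<in> tensor_space (space X) (space Y)" for t
      unfolding ztensor_simps(1)
      by (rule tensor_mem3[OF am(1)]) (use that z in \<open>auto simp: am vtensor_mem\<close>)
    show ?thesis
    proof (rule tensor_ext[OF linear_on_comp[OF act_XY lin mem] linear_on_comp[OF lin act_linear[OF XYZ g] mem'] _ s])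
    fix x y assume "x \<in> space X" "y \<in> space Y"
    then show "?a (act (ztensor G X Y) g (x \<otimes>\<^sub>v y) \<otimes>\<^sub>v act Z g z) =
      act (ztensor G X (ztensor G Y Z)) g (?a ((x \<otimes>\<^sub>v y) \<otimes>\<^sub>v z))"
      using g z act_mem[OF X] act_mem[OF Y] act_mem[OF Z] act_linear[OF YZ g]
      by (simp add: am tensor_map_apply fds fd_tensor act_linear[OF X] act_linear[OF Y] act_linear[OF Z] vtensor_mem)
    qed (use g z act_mem[OF Z] in auto)
  qed
  show ?thesis
    by (rule zmap_tensorI[OF XY Z XYZ]) (use am(1) deg eqv deg_in_space[OF XY] deg_in_space[OF Z] in auto)
qed

lemma zmap_lunit:
  assumes X: "is_zobj G X"
  shows "zmap G (ztensor G (zunit G) X) X (lunit_map (space X))"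
  by (rule zmap_tensorI[OF is_zobj_unit X X])
    (use deg_subspace[OF X] deg_in_space[OF X] act_mem[OF X] act_linear[OF X] linear_on_zero[OF lunit_map_linear[OF zobj_fd[OF X]]]
     in \<open>auto simp: lunit_map_linear lunit_map_apply zobj_fd[OF X] vs.subspace_scale vs.subspace_0
       linear_on_scale[OF act_linear[OF X]] linear_on_zero[OF _ zobj_subspace[OF X]] split: if_splits\<close>)

lemma zmap_runit:
  assumes X: "is_zobj G X"
  shows "zmap G (ztensor G X (zunit G)) X (runit_map (space X))"
  by (rule zmap_tensorI[OF X is_zobj_unit X])
    (use deg_subspace[OF X] deg_in_space[OF X] act_mem[OF X] act_linear[OF X] linear_on_zero[OF runit_map_linear[OF zobj_fd[OF X]]]
     in \<open>auto simp: runit_map_linear runit_map_apply zobj_fd[OF X] vs.subspace_scale vs.subspace_0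
       linear_on_scale[OF act_linear[OF X]] linear_on_zero[OF _ zobj_subspace[OF X]] split: if_splits\<close>)

section \<open>The braiding\<close>

context
  fixes X Y :: "('a, 'k::field) zobj"
  assumes X: "is_zobj G X" and Y: "is_zobj G Y"
begin

text \<open>The defining description fixes the values for homogeneous \<open>x\<close> only; summing
  over the components of \<open>x\<close> yields a bilinear formula that agrees with it
  there.\<close>

lemma zbraid_facts:
  shows "zbraid_map G X Y \<in> extensional (tensor_space (space X) (space Y)) \<and>
    linear_on (tensor_space (space X) (space Y)) (zbraid_map G X Y) \<and>
    (\<forall>x\<in>space X. \<forall>y\<in>space Y. zbraid_map G X Y (x \<otimes>\<^sub>v y) =
      (\<Sum>f\<in>carrier G. act Y f y \<otimes>\<^sub>v zcomp G X f x))"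
proof -
  let ?b = "\<lambda>x y. \<Sum>f\<in>carrier G. act Y f y \<otimes>\<^sub>v zcomp G X f x"
  let ?P = "\<lambda>h. \<forall>f\<in>carrier G. \<forall>x\<in>deg X f. \<forall>y\<in>space Y. h (x \<otimes>\<^sub>v y) = act Y f y \<otimes>\<^sub>v x"
  have b: "bilinear_on (space X) (space Y) ?b"
    by (intro bilinear_onI linear_onI)
      (simp_all add: linear_on_add[OF zcomp_linear[OF X]] linear_on_scale[OF zcomp_linear[OF X]]
        linear_on_add[OF act_linear[OF Y]] linear_on_scale[OF act_linear[OF Y]]
        vtensor_add_left vtensor_add_right vtensor_scale_left vtensor_scale_right sum.distrib vs.scale_sum_right)
  have b_hom: "?b x y = act Y f y \<otimes>\<^sub>v x" if "f \<in> carrier G" "x \<in> deg X f" for f x y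
  proof -
    have "?b x y = (\<Sum>g\<in>carrier G. if g = f then act Y f y \<otimes>\<^sub>v x else 0)"
      using that by (intro sum.cong) (auto simp: zcomp_homogeneous[OF X])
    then show ?thesis using that fin by simp
  qed
  have P: "?P h \<longleftrightarrow> (\<forall>x\<in>space X. \<forall>y\<in>space Y. h (x \<otimes>\<^sub>v y) = ?b x y)"
    if h: "linear_on (tensor_space (space X) (space Y)) h" for h :: "'k vec \<Rightarrow> 'k vec"
  proof
    assume hP: "?P h"
    show "\<forall>x\<in>space X. \<forall>y\<in>space Y. h (x \<otimes>\<^sub>v y) = ?b x y"
    proof (intro ballI)
      fix x y assume x: "x \<in> space X" and y: "y \<in> space Y"
      have lin: "linear_on (space X) (\<lambda>x. h (x \<otimes>\<^sub>v y))"
        using y by (intro linear_onI)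
          (simp_all add: vtensor_add_left vtensor_scale_left linear_on_add[OF h] linear_on_scale[OF h] vtensor_mem)
      show "h (x \<otimes>\<^sub>v y) = ?b x y"
        by (rule zspace_ext[OF X lin bilinear_onD(2)[OF b y] _ x]) (use hP y b_hom in auto)
    qed
  next
    assume "\<forall>x\<in>space X. \<forall>y\<in>space Y. h (x \<otimes>\<^sub>v y) = ?b x y"
    then show "?P h" using b_hom deg_in_space[OF X] by auto
  qed
  show ?thesis
    using the_linear_tensor[OF zobj_fd[OF X] zobj_fd[OF Y] b P] unfolding zbraid_map_def by simp
qed

lemma zbraid_ext: "zbraid_map G X Y \<in> extensional (tensor_space (space X) (space Y))"
  and zbraid_linear: "linear_on (tensor_space (space X) (space Y)) (zbraid_map G X Y)"
  and zbraid_apply: "f \<in> carrier G \<Longrightarrow> x \<in> deg X f \<Longrightarrow> y \<in> space Y \<Longrightarrow>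
    zbraid_map G X Y (x \<otimes>\<^sub>v y) = act Y f y \<otimes>\<^sub>v x"
proof -
  assume f: "f \<in> carrier G" "x \<in> deg X f" "y \<in> space Y"
  then have "zbraid_map G X Y (x \<otimes>\<^sub>v y) = (\<Sum>g\<in>carrier G. act Y g y \<otimes>\<^sub>v zcomp G X g x)"
    using zbraid_facts deg_in_space[OF X] by blast
  also have "\<dots> = (\<Sum>g\<in>carrier G. if g = f then act Y f y \<otimes>\<^sub>v x else 0)"
    using f by (intro sum.cong) (auto simp: zcomp_homogeneous[OF X])
  finally show "zbraid_map G X Y (x \<otimes>\<^sub>v y) = act Y f y \<otimes>\<^sub>v x" using f fin by simp
qed (use zbraid_facts in auto)

text \<open>Degrees match because \<open>(a b a^-1) a = a b\<close>; equivariance comes down to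
  \<open>(g a g^-1) g = g a\<close>.\<close>

lemma zmap_braid: "zmap G (ztensor G X Y) (ztensor G Y X) (zbraid_map G X Y)"
proof (rule zmap_tensorI[OF X Y is_zobj_tensor[OF Y X] zbraid_linear])
  fix a b x y assume ab: "a \<in> carrier G" "b \<in> carrier G" "x \<in> deg X a" "y \<in> deg Y b"
  have "act Y a y \<otimes>\<^sub>v x \<in> deg (ztensor G Y X) ((a \<otimes> b \<otimes> inv a) \<otimes> a)"
    using ab by (intro ztensor_deg act_deg[OF Y]) auto
  then show "zbraid_map G X Y (x \<otimes>\<^sub>v y) \<in> deg (ztensor G Y X) (a \<otimes> b)"
    using ab by (simp add: zbraid_apply deg_in_space[OF Y] m_assoc)
  fix g assume g: "g \<in> carrier G"
  have "g \<otimes> a \<otimes> inv g \<otimes> g = g \<otimes> a" using ab g by (simp add: m_assoc)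
  then have "act Y (g \<otimes> a \<otimes> inv g) (act Y g y) = act Y g (act Y a y)"
    using ab g deg_in_space[OF Y] by (simp add: act_mult[OF Y, symmetric])
  then show "zbraid_map G X Y (act X g x \<otimes>\<^sub>v act Y g y) = act (ztensor G Y X) g (zbraid_map G X Y (x \<otimes>\<^sub>v y))"
    using ab g act_deg[OF X g ab(1,3)] act_mem[OF Y] deg_in_space[OF X] deg_in_space[OF Y]
    by (simp add: zbraid_apply[of "g \<otimes> a \<otimes> inv g"] zbraid_apply[of a] tensor_map_apply
        zobj_fd[OF X] zobj_fd[OF Y] act_linear[OF X] act_linear[OF Y])
qed

end

section \<open>Restrictions, zero maps and quotient objects\<close>

lemma zmap_restrict:
  assumes X: "is_zobj G X" and f: "zmap G X Y f"
  shows "zmap G X Y (restrict f (space X))"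
  using f act_mem[OF X] deg_in_space[OF X]
  by (auto simp: zmap_def linear_on_restrict[OF zobj_subspace[OF X]])

lemma zmap_cong:
  assumes X: "is_zobj G X" and "zmap G X Y f" "\<And>x. x \<in> space X \<Longrightarrow> f x = g x"
  shows "zmap G X Y g"
proof -
  have "restrict f (space X) = restrict g (space X)" using assms by (auto intro: restrict_ext)
  then have "zmap G X Y (restrict g (space X))" using zmap_restrict[OF assms(1,2)] by simp
  then show ?thesis
    using act_mem[OF X] deg_in_space[OF X]
    by (auto simp: zmap_def linear_on_restrict[OF zobj_subspace[OF X]] Pi_iff)
qed

lemma zmap_id: "zmap G X X (\<lambda>x. x)"
  by (auto simp: zmap_def linear_on_id)

lemma zmap_zero: "is_zobj G X \<Longrightarrow> is_zobj G Y \<Longrightarrow> zmap G X Y (\<lambda>x. 0)"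
  by (auto simp: zmap_def linear_on_const_zero vs.subspace_0 zobj_subspace deg_subspace
      linear_on_zero[OF act_linear zobj_subspace])

lemma restrict_zhom: "is_zobj G X \<Longrightarrow> zmap G X Y f \<Longrightarrow> Arrow X Y (restrict f (space X)) \<in> zhom G X Y"
  by (simp add: zhom_iff zmap_restrict)

lemma arrow_zhom: "f \<in> extensional (space X) \<Longrightarrow> zmap G X Y f \<Longrightarrow> Arrow X Y f \<in> zhom G X Y"
  by (simp add: zhom_iff)

text \<open>Everything in \<open>Q\<close> is the image of something, so the structure of \<open>Y\<close> descends to \<open>Q\<close>.\<close>

lemma zquotient_exists:
  fixes Y :: "('a, 'k::field) zobj"
  assumes Y: "is_zobj G Y" and K: "vs.subspace K" "K \<subseteq> space Y"
    and Kdeg: "\<And>x g. x \<in> K \<Longrightarrow> g \<in> carrier G \<Longrightarrow> zcomp G Y g x \<in> K"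
    and Kact: "\<And>x g. x \<in> K \<Longrightarrow> g \<in> carrier G \<Longrightarrow> act Y g x \<in> K"
  obtains Q p where "is_zobj G Q" "zmap G Y Q p" "p ` space Y = space Q"
    "\<And>x. x \<in> space Y \<Longrightarrow> p x = 0 \<longleftrightarrow> x \<in> K"
proof -
  obtain S where S: "space Y = vs.span S" "finite S" using zobj_fd[OF Y] by (auto simp: fd_space_def)
  obtain p :: "'k vec \<Rightarrow> 'k vec" where p: "linear_on UNIV p" "\<And>x. x \<in> space Y \<Longrightarrow> p x = 0 \<longleftrightarrow> x \<in> K"
    using exists_linear_with_kernel[OF S K] by blast
  note sub = zobj_subspace[OF Y]
  have pY: "linear_on (space Y) p" using p(1) linear_on_subset by blast
  have "\<exists>h. linear_on (p ` space Y) h \<and> (\<forall>x\<in>space Y. h (p x) = p (act Y g x))" if "g \<in> carrier G" for g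
    using linear_factor[OF pY linear_on_comp[OF act_linear[OF Y that] pY] sub]
      Kact[OF _ that] p(2) act_mem[OF Y that] by metis
  then obtain ac where ac: "\<And>g. g \<in> carrier G \<Longrightarrow> linear_on (p ` space Y) (ac g)"
    "\<And>g x. g \<in> carrier G \<Longrightarrow> x \<in> space Y \<Longrightarrow> ac g (p x) = p (act Y g x)" by metis
  have "\<exists>h. linear_on (p ` space Y) h \<and> (\<forall>x\<in>space Y. h (p x) = p (zcomp G Y g x))" if "g \<in> carrier G" for g
    using linear_factor[OF pY linear_on_comp[OF zcomp_linear[OF Y that] pY] sub]
      Kdeg[OF _ that] p(2) zcomp_mem[OF Y that] by metis
  then obtain pr where pr: "\<And>g. g \<in> carrier G \<Longrightarrow> linear_on (p ` space Y) (pr g)"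
    "\<And>g x. g \<in> carrier G \<Longrightarrow> x \<in> space Y \<Longrightarrow> pr g (p x) = p (zcomp G Y g x)" by metis
  define Q where "Q = \<lparr>space = p ` space Y, deg = (\<lambda>g. p ` deg Y g), act = ac\<rparr>"
  have p0: "p 0 = 0" using linear_on_zero[OF p(1)] by simp
  have Q: "is_zobj G Q"
  proof (rule is_zobjI[where p = pr])
    show "fd_space (space Q)" using fd_image[OF zobj_fd[OF Y] pY] by (simp add: Q_def)
  next
    fix g assume g: "g \<in> carrier G"
    have "linear_on (deg Y g) p" using p(1) linear_on_subset by blast
    then show "vs.subspace (deg Q g)" using subspace_image[OF _ deg_subspace[OF Y g]] by (simp add: Q_def)
  next
    fix x assume "x \<in> space Q"
    then obtain y where y: "y \<in> space Y" "x = p y" by (auto simp: Q_def)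
    then have "(\<Sum>g\<in>carrier G. pr g x) = p (\<Sum>g\<in>carrier G. zcomp G Y g y)"
      by (simp add: pr linear_on_sum[OF pY sub] zcomp_mem[OF Y])
    then show "(\<Sum>g\<in>carrier G. pr g x) = x" using y by (simp add: zcomp_sum[OF Y])
  next
    fix g h x assume "g \<in> carrier G" "h \<in> carrier G" "g \<noteq> h" "x \<in> deg Q h"
    then show "pr g x = 0" using deg_in_space[OF Y]
      by (auto simp: Q_def pr zcomp_homogeneous[OF Y] p0)
  qed (use deg_in_space[OF Y] act_mem[OF Y] zcomp_deg[OF Y] in
      \<open>auto simp: Q_def pr ac act_one[OF Y] act_mult[OF Y] intro!: imageI act_deg[OF Y]\<close>)
  moreover have "zmap G Y Q p" using ac pY by (auto simp: zmap_def Q_def)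
  moreover have "p ` space Y = space Q" by (simp add: Q_def)
  ultimately show thesis using that p(2) by blast
qed

lemma zmap_factor:
  assumes Y: "is_zobj G Y" and Q: "is_zobj G Q" and Z: "is_zobj G Z"
    and q: "zmap G Y Q q" "q ` space Y = space Q" and f: "zmap G Y Z f"
    and ker: "\<And>x. x \<in> space Y \<Longrightarrow> q x = 0 \<Longrightarrow> f x = 0"
  obtains h where "zmap G Q Z h" "\<And>x. x \<in> space Y \<Longrightarrow> h (q x) = f x"
proof -
  obtain h where h: "linear_on (space Q) h" "\<And>x. x \<in> space Y \<Longrightarrow> h (q x) = f x"
    using linear_factor[OF zmapD(2)[OF q(1)] zmapD(2)[OF f] zobj_subspace[OF Y] ker] q(2) by metis
  have "zmap G Q Z h"
    unfolding zmap_def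
  proof (intro conjI ballI)
    fix g x assume g: "g \<in> carrier G" and x: "x \<in> deg Q g"
    then obtain y where y: "y \<in> space Y" "x = q y" using q(2) deg_in_space[OF Q] by blast
    \<comment> \<open>Taking components of degree \<open>g\<close> on both sides replaces the
      arbitrary preimage by a homogeneous one.\<close>
    then have "x = q (zcomp G Y g y)"
      using zcomp_zmap[OF Y Q q(1) y(1) g] zcomp_homogeneous[OF Q g g x] by simp
    then show "h x \<in> deg Z g"
      using h(2) zcomp_mem[OF Y g y(1)] zcomp_deg[OF Y y(1) g] zmapD(3)[OF f g] by simp
  next
    fix g x assume g: "g \<in> carrier G" and x: "x \<in> space Q"
    then obtain y where y: "y \<in> space Y" "x = q y" using q(2) by blast
    then show "h (act Q g x) = act Z g (h x)"
      using zmapD(4)[OF q(1) g, symmetric] h(2) act_mem[OF Y g] zmapD(4)[OF f g] by simp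
  qed (use h zmapD(1)[OF f] in \<open>auto simp: q(2)[symmetric]\<close>)
  then show thesis using that h(2) by blast
qed

end

section \<open>Algebras and modules in terms of elements\<close>

lemma compose_eq_iff: "compose T f g = compose T f' g' \<longleftrightarrow> (\<forall>x\<in>T. f (g x) = f' (g' x))"
  by (auto simp: compose_def restrict_def fun_eq_iff)

lemma compose_eq_ext_iff:
  "f' \<in> extensional T \<Longrightarrow> compose T f g = f' \<longleftrightarrow> (\<forall>x\<in>T. f (g x) = f' x)"
  by (auto simp: compose_def restrict_def fun_eq_iff extensional_def)

context finite_grp
begin

lemma ztensor_ext_iff:
  assumes "zmap G (ztensor G X Y) W f" "zmap G (ztensor G X Y) W g"
  shows "(\<forall>t\<in>tensor_space (space X) (space Y). f t = g t) \<longleftrightarrow>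
    (\<forall>x\<in>space X. \<forall>y\<in>space Y. f (x \<otimes>\<^sub>v y) = g (x \<otimes>\<^sub>v y))"
proof -
  have "linear_on (tensor_space (space X) (space Y)) f" "linear_on (tensor_space (space X) (space Y)) g"
    using zmapD(2)[OF assms(1)] zmapD(2)[OF assms(2)] by simp_all
  then show ?thesis using tensor_ext[of "space X" "space Y" f g] vtensor_mem by metis
qed

lemma ztensor3_ext_iff:
  assumes "zmap G (ztensor G (ztensor G X Y) Z) W f" "zmap G (ztensor G (ztensor G X Y) Z) W g"
  shows "(\<forall>t\<in>tensor_space (tensor_space (space X) (space Y)) (space Z). f t = g t) \<longleftrightarrow>
    (\<forall>x\<in>space X. \<forall>y\<in>space Y. \<forall>z\<in>space Z. f ((x \<otimes>\<^sub>v y) \<otimes>\<^sub>v z) = g ((x \<otimes>\<^sub>v y) \<otimes>\<^sub>v z))"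
proof -
  have "linear_on (tensor_space (tensor_space (space X) (space Y)) (space Z)) f"
    "linear_on (tensor_space (tensor_space (space X) (space Y)) (space Z)) g"
    using zmapD(2)[OF assms(1)] zmapD(2)[OF assms(2)] by simp_all
  then show ?thesis
    using tensor_ext3[of "space X" "space Y" "space Z" f g] vtensor_mem by metis
qed

lemma ztm_apply:
  assumes "is_zobj G X" "is_zobj G Y" "zmap G X X' f" "zmap G Y Y' g" "x \<in> space X" "y \<in> space Y"
  shows "tensor_map (space X) (space Y) f g (x \<otimes>\<^sub>v y) = f x \<otimes>\<^sub>v g y"
  using assms by (simp add: tensor_map_apply zobj_fd zmapD(2))

lemma zmap_rid: "zmap G X X (\<lambda>x\<in>space X. x)" if "is_zobj G X"
  using zmap_restrict[OF that zmap_id] .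

lemma zassoc_apply:
  assumes "is_zobj G X" "is_zobj G Y" "is_zobj G Z" "x \<in> space X" "y \<in> space Y" "z \<in> space Z"
  shows "assoc_map (space X) (space Y) (space Z) ((x \<otimes>\<^sub>v y) \<otimes>\<^sub>v z) = x \<otimes>\<^sub>v (y \<otimes>\<^sub>v z)"
  using assms by (simp add: assoc_map_apply zobj_fd)

text \<open>Arrows are extensional, so the equation of composites can be tested on pure tensors.
  Keeping \<open>M\<close> apart from \<open>A\<close> lets one statement serve the associativity of
  the algebra and of its modules.\<close>

lemma action_assoc_iff:
  assumes M: "is_zobj G M" and A: "is_zobj G A"
    and \<nu>: "\<nu> \<in> zhom G (ztensor G M A) M" and \<mu>: "\<mu> \<in> zhom G (ztensor G A A) A"
  shows "comp (ZG G) \<nu> (tens_arr (ZG G) \<nu> (ident (ZG G) A)) =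
      comp (ZG G) \<nu> (comp (ZG G) (tens_arr (ZG G) (ident (ZG G) M) \<mu>) (assoc (ZG G) M A A)) \<longleftrightarrow>
    (\<forall>m\<in>space M. \<forall>a\<in>space A. \<forall>b\<in>space A. fn \<nu> (fn \<nu> (m \<otimes>\<^sub>v a) \<otimes>\<^sub>v b) = fn \<nu> (m \<otimes>\<^sub>v fn \<mu> (a \<otimes>\<^sub>v b)))"
proof -
  note MA = is_zobj_tensor[OF M A] and AA = is_zobj_tensor[OF A A]
  note \<nu>' = zhomD[OF \<nu>] and \<mu>' = zhomD[OF \<mu>]
  let ?l = "\<lambda>t. fn \<nu> (tensor_map (tensor_space (space M) (space A)) (space A) (fn \<nu>) (\<lambda>x\<in>space A. x) t)"
  let ?r = "\<lambda>t. fn \<nu> (tensor_map (space M) (tensor_space (space A) (space A)) (\<lambda>x\<in>space M. x) (fn \<mu>)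
    (assoc_map (space M) (space A) (space A) t))"
  note tl = zmap_tensor_map[OF MA A M A \<nu>'(4) zmap_rid[OF A]]
  note tr = zmap_tensor_map[OF M AA M A zmap_rid[OF M] \<mu>'(4)]
  have l: "zmap G (ztensor G (ztensor G M A) A) M ?l"
    using zmap_comp[OF tl \<nu>'(4)] by simp
  have r: "zmap G (ztensor G (ztensor G M A) A) M ?r"
    using zmap_comp[OF zmap_comp[OF zmap_assoc[OF M A A] tr] \<nu>'(4)] by simp
  have "(\<forall>t\<in>tensor_space (tensor_space (space M) (space A)) (space A). ?l t = ?r t) \<longleftrightarrow>
    (\<forall>m\<in>space M. \<forall>a\<in>space A. \<forall>b\<in>space A. fn \<nu> (fn \<nu> (m \<otimes>\<^sub>v a) \<otimes>\<^sub>v b) = fn \<nu> (m \<otimes>\<^sub>v fn \<mu> (a \<otimes>\<^sub>v b)))"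
    unfolding ztensor3_ext_iff[OF l r]
    using ztm_apply[OF MA A \<nu>'(4) zmap_rid[OF A]] ztm_apply[OF M AA zmap_rid[OF M] \<mu>'(4)]
    by (simp add: vtensor_mem zassoc_apply M A)
  then show ?thesis
    using \<nu>'(1,2) \<mu>'(1,2) by (simp add: compose_eq_iff) (simp add: compose_def)
qed

lemma action_runit_iff:
  assumes M: "is_zobj G M" and A: "is_zobj G A"
    and \<nu>: "\<nu> \<in> zhom G (ztensor G M A) M" and \<iota>: "\<iota> \<in> zhom G (zunit G) A"
  shows "comp (ZG G) \<nu> (tens_arr (ZG G) (ident (ZG G) M) \<iota>) = runit (ZG G) M \<longleftrightarrow>
    (\<forall>m\<in>space M. fn \<nu> (m \<otimes>\<^sub>v fn \<iota> one_vec) = m)"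
proof -
  note \<nu>' = zhomD[OF \<nu>] and \<iota>' = zhomD[OF \<iota>]
  let ?l = "\<lambda>t. fn \<nu> (tensor_map (space M) unit_space (\<lambda>x\<in>space M. x) (fn \<iota>) t)"
  note tl = zmap_tensor_map[OF M is_zobj_unit M A zmap_rid[OF M] \<iota>'(4)]
  have l: "zmap G (ztensor G M (zunit G)) M ?l"
    using zmap_comp[OF tl \<nu>'(4)] by simp
  \<comment> \<open>A map out of the unit object is determined by the image of
    \<open>one_vec\<close>; the scalar \<open>c 0\<close> then pulls out of the whole
    expression.\<close>
  have ap: "?l (m \<otimes>\<^sub>v c) = fscale (c 0) (fn \<nu> (m \<otimes>\<^sub>v fn \<iota> one_vec))" if "m \<in> space M" "c \<in> unit_space" for m c
  proof -
    have "fn \<iota> c = fscale (c 0) (fn \<iota> one_vec)"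
      using unit_coeff[OF that(2)] linear_on_scale[OF zmapD(2)[OF \<iota>'(4)], of one_vec "c 0"] by simp
    then show ?thesis
      using ztm_apply[OF M is_zobj_unit zmap_rid[OF M] \<iota>'(4)] that zmapD(2)[OF \<nu>'(4)] zmapD(1)[OF \<iota>'(4), of one_vec]
      by (simp add: vtensor_scale_right linear_on_scale vtensor_mem)
  qed
  have "(\<forall>t\<in>tensor_space (space M) unit_space. ?l t = runit_map (space M) t) \<longleftrightarrow>
    (\<forall>m\<in>space M. fn \<nu> (m \<otimes>\<^sub>v fn \<iota> one_vec) = m)"
  proof -
    have "(\<forall>m\<in>space M. \<forall>c\<in>unit_space. fscale (c 0) (fn \<nu> (m \<otimes>\<^sub>v fn \<iota> one_vec)) = fscale (c 0) m) \<longleftrightarrow>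
      (\<forall>m\<in>space M. fn \<nu> (m \<otimes>\<^sub>v fn \<iota> one_vec) = m)"
    proof (intro iffI ballI)
      fix m assume "m \<in> space M" and "\<forall>m\<in>space M. \<forall>c\<in>unit_space. fscale (c 0) (fn \<nu> (m \<otimes>\<^sub>v fn \<iota> one_vec)) = fscale (c 0) m"
      then show "fn \<nu> (m \<otimes>\<^sub>v fn \<iota> one_vec) = m" by (auto dest: bspec[of _ _ one_vec])
    qed simp
    then show ?thesis
      using ztensor_ext_iff[OF l zmap_runit[OF M]] ap runit_map_apply[OF zobj_fd[OF M]] by simp
  qed
  then show ?thesis
    using \<nu>'(1,2) \<iota>'(1,2) by (simp add: compose_eq_ext_iff[OF runit_map_ext[OF zobj_fd[OF M]]])
qed

lemma action_lunit_iff: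
  assumes M: "is_zobj G M" and A: "is_zobj G A"
    and \<nu>: "\<nu> \<in> zhom G (ztensor G A M) M" and \<iota>: "\<iota> \<in> zhom G (zunit G) A"
  shows "comp (ZG G) \<nu> (tens_arr (ZG G) \<iota> (ident (ZG G) M)) = lunit (ZG G) M \<longleftrightarrow>
    (\<forall>m\<in>space M. fn \<nu> (fn \<iota> one_vec \<otimes>\<^sub>v m) = m)"
proof -
  note \<nu>' = zhomD[OF \<nu>] and \<iota>' = zhomD[OF \<iota>]
  let ?l = "\<lambda>t. fn \<nu> (tensor_map unit_space (space M) (fn \<iota>) (\<lambda>x\<in>space M. x) t)"
  note tl = zmap_tensor_map[OF is_zobj_unit M A M \<iota>'(4) zmap_rid[OF M]]
  have l: "zmap G (ztensor G (zunit G) M) M ?l"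
    using zmap_comp[OF tl \<nu>'(4)] by simp
  have ap: "?l (c \<otimes>\<^sub>v m) = fscale (c 0) (fn \<nu> (fn \<iota> one_vec \<otimes>\<^sub>v m))" if "m \<in> space M" "c \<in> unit_space" for m c
  proof -
    have "fn \<iota> c = fscale (c 0) (fn \<iota> one_vec)"
      using unit_coeff[OF that(2)] linear_on_scale[OF zmapD(2)[OF \<iota>'(4)], of one_vec "c 0"] by simp
    then show ?thesis
      using ztm_apply[OF is_zobj_unit M \<iota>'(4) zmap_rid[OF M]] that zmapD(2)[OF \<nu>'(4)] zmapD(1)[OF \<iota>'(4), of one_vec]
      by (simp add: vtensor_scale_left linear_on_scale vtensor_mem)
  qed
  have "(\<forall>t\<in>tensor_space unit_space (space M). ?l t = lunit_map (space M) t) \<longleftrightarrow>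
    (\<forall>m\<in>space M. fn \<nu> (fn \<iota> one_vec \<otimes>\<^sub>v m) = m)"
  proof -
    have "(\<forall>c\<in>unit_space. \<forall>m\<in>space M. fscale (c 0) (fn \<nu> (fn \<iota> one_vec \<otimes>\<^sub>v m)) = fscale (c 0) m) \<longleftrightarrow>
      (\<forall>m\<in>space M. fn \<nu> (fn \<iota> one_vec \<otimes>\<^sub>v m) = m)"
    proof (intro iffI ballI)
      fix m assume "m \<in> space M" and "\<forall>c\<in>unit_space. \<forall>m\<in>space M. fscale (c 0) (fn \<nu> (fn \<iota> one_vec \<otimes>\<^sub>v m)) = fscale (c 0) m"
      then show "fn \<nu> (fn \<iota> one_vec \<otimes>\<^sub>v m) = m" by (auto dest: bspec[of _ _ one_vec])
    qed simp
    then show ?thesis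
      using ztensor_ext_iff[OF l zmap_lunit[OF M]] ap lunit_map_apply[OF zobj_fd[OF M]] by simp
  qed
  then show ?thesis
    using \<nu>'(1,2) \<iota>'(1,2) by (simp add: compose_eq_ext_iff[OF lunit_map_ext[OF zobj_fd[OF M]]])
qed

lemma algebra_in_iff:
  "algebra_in (ZG G) \<A> \<longleftrightarrow> is_zobj G (alg_obj \<A>) \<and>
    alg_mult \<A> \<in> zhom G (ztensor G (alg_obj \<A>) (alg_obj \<A>)) (alg_obj \<A>) \<and>
    alg_unit \<A> \<in> zhom G (zunit G) (alg_obj \<A>) \<and>
    (\<forall>a\<in>space (alg_obj \<A>). \<forall>b\<in>space (alg_obj \<A>). \<forall>c\<in>space (alg_obj \<A>).
      fn (alg_mult \<A>) (fn (alg_mult \<A>) (a \<otimes>\<^sub>v b) \<otimes>\<^sub>v c) = fn (alg_mult \<A>) (a \<otimes>\<^sub>v fn (alg_mult \<A>) (b \<otimes>\<^sub>v c))) \<and>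
    (\<forall>a\<in>space (alg_obj \<A>). fn (alg_mult \<A>) (fn (alg_unit \<A>) one_vec \<otimes>\<^sub>v a) = a) \<and>
    (\<forall>a\<in>space (alg_obj \<A>). fn (alg_mult \<A>) (a \<otimes>\<^sub>v fn (alg_unit \<A>) one_vec) = a)"
  unfolding algebra_in_def Let_def ZG_simps mem_Collect_eq
  using action_assoc_iff[of "alg_obj \<A>" "alg_obj \<A>" "alg_mult \<A>" "alg_mult \<A>"]
    action_runit_iff[of "alg_obj \<A>" "alg_obj \<A>" "alg_mult \<A>" "alg_unit \<A>"]
    action_lunit_iff[of "alg_obj \<A>" "alg_obj \<A>" "alg_mult \<A>" "alg_unit \<A>"]
  by (auto simp del: ZG_arrows)

text \<open>The braiding is explicit only for a homogeneous left factor, hence the quantifier over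
  \<open>x\<close>; homogeneous tensors suffice for the converse.\<close>

lemma commutative_alg_iff:
  assumes A: "is_zobj G (alg_obj \<A>)" and \<mu>: "alg_mult \<A> \<in> zhom G (ztensor G (alg_obj \<A>) (alg_obj \<A>)) (alg_obj \<A>)"
  shows "commutative_alg (ZG G) \<A> \<longleftrightarrow>
    (\<forall>x\<in>carrier G. \<forall>a\<in>deg (alg_obj \<A>) x. \<forall>b\<in>space (alg_obj \<A>).
      fn (alg_mult \<A>) (act (alg_obj \<A>) x b \<otimes>\<^sub>v a) = fn (alg_mult \<A>) (a \<otimes>\<^sub>v b))"
    (is "_ \<longleftrightarrow> ?R")
proof -
  let ?A = "alg_obj \<A>"
  let ?T = "tensor_space (space ?A) (space ?A)"
  let ?l = "\<lambda>t. fn (alg_mult \<A>) (zbraid_map G ?A ?A t)"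
  note \<mu>' = zhomD[OF \<mu>]
  have l: "zmap G (ztensor G ?A ?A) ?A ?l"
    by (rule zmap_comp[OF zmap_braid[OF A A] \<mu>'(4)])
  have lin: "linear_on ?T ?l" "linear_on ?T (fn (alg_mult \<A>))"
    using zmapD(2)[OF l] zmapD(2)[OF \<mu>'(4)] by simp_all
  have "commutative_alg (ZG G) \<A> \<longleftrightarrow> (\<forall>t\<in>?T. ?l t = fn (alg_mult \<A>) t)"
    unfolding commutative_alg_def
    using \<mu>' compose_eq_ext_iff[of "fn (alg_mult \<A>)" ?T "fn (alg_mult \<A>)" "zbraid_map G ?A ?A"]
    by (cases "alg_mult \<A>") simp
  also have "\<dots> \<longleftrightarrow> ?R"
  proof
    assume "\<forall>t\<in>?T. ?l t = fn (alg_mult \<A>) t"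
    then have "?l (a \<otimes>\<^sub>v b) = fn (alg_mult \<A>) (a \<otimes>\<^sub>v b)" if "a \<in> space ?A" "b \<in> space ?A" for a b
      using that by (simp add: vtensor_mem)
    then show ?R using deg_in_space[OF A] by (simp add: zbraid_apply[OF A A, symmetric])
  next
    assume ?R
    then have "?l (a \<otimes>\<^sub>v b) = fn (alg_mult \<A>) (a \<otimes>\<^sub>v b)"
      if "x \<in> carrier G" "y \<in> carrier G" "a \<in> deg ?A x" "b \<in> deg ?A y" for x y a b
      using that deg_in_space[OF A] by (simp add: zbraid_apply[OF A A that(1,3)])
    then show "\<forall>t\<in>?T. ?l t = fn (alg_mult \<A>) t"
      using ztensor_ext[OF A A lin] by blast
  qed
  finally show ?thesis .
qed

end

definition mact :: "('g, 'k::field) zobj \<times> (('g, 'k) zobj, 'k vec \<Rightarrow> 'k vec) arrow \<Rightarrow> 'k vec \<Rightarrow> 'k vec \<Rightarrow> 'k vec" where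
  "mact M m a = fn (snd M) (m \<otimes>\<^sub>v a)"

section \<open>Local modules over a commutative algebra, in terms of elements\<close>

locale zalgebra = finite_grp G for G (structure) +
  fixes \<A> :: "(('a, 'k::field) zobj, (('a, 'k) zobj, 'k vec \<Rightarrow> 'k vec) arrow) algebra_data"
  assumes alg: "algebra_in (ZG G) \<A>" and comm: "commutative_alg (ZG G) \<A>"
begin

abbreviation "A \<equiv> alg_obj \<A>"
abbreviation "mul a b \<equiv> fn (alg_mult \<A>) (a \<otimes>\<^sub>v b)"
abbreviation "u \<equiv> fn (alg_unit \<A>) one_vec"

lemma A: "is_zobj G A"
  and mult_zhom: "alg_mult \<A> \<in> zhom G (ztensor G A A) A"
  and unit_zhom: "alg_unit \<A> \<in> zhom G (zunit G) A"
  and mul_assoc: "\<And>a b c. a \<in> space A \<Longrightarrow> b \<in> space A \<Longrightarrow> c \<in> space A \<Longrightarrow> mul (mul a b) c = mul a (mul b c)"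
  and mul_unit: "\<And>a. a \<in> space A \<Longrightarrow> mul u a = a" "\<And>a. a \<in> space A \<Longrightarrow> mul a u = a"
  using alg unfolding algebra_in_iff by auto

lemma mul_comm: "x \<in> carrier G \<Longrightarrow> a \<in> deg A x \<Longrightarrow> b \<in> space A \<Longrightarrow> mul (act A x b) a = mul a b"
  using comm unfolding commutative_alg_iff[OF A mult_zhom] by blast

lemmas mult_zmap = zhomD(4)[OF mult_zhom] and unit_zmap = zhomD(4)[OF unit_zhom]
lemmas mul_facts = zmap_tensorD[OF A A mult_zmap]

lemma u_mem: "u \<in> space A" and u_deg: "u \<in> deg A \<one>" and u_act: "g \<in> carrier G \<Longrightarrow> act A g u = u"
  using zmapD(1)[OF unit_zmap, of one_vec] zmapD(3)[OF unit_zmap, of \<one> one_vec]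
    zmapD(4)[OF unit_zmap, of g one_vec] by auto

text \<open>The typing of an action without the module axioms. Iterated tensor products over the
  algebra are handled at this level.\<close>

definition "pre_module M \<longleftrightarrow> is_zobj G (fst M) \<and> snd M \<in> zhom G (ztensor G (fst M) A) (fst M)"

lemma pre_moduleD:
  assumes "pre_module M"
  shows pm_zobj: "is_zobj G (fst M)"
    and pm_zhom: "snd M \<in> zhom G (ztensor G (fst M) A) (fst M)"
    and pm_zmap: "zmap G (ztensor G (fst M) A) (fst M) (fn (snd M))"
  using assms zhomD(4) unfolding pre_module_def by blast+

lemma mact_facts:
  assumes M: "pre_module M"
  shows mact_deg: "a \<in> carrier G \<Longrightarrow> b \<in> carrier G \<Longrightarrow> x \<in> deg (fst M) a \<Longrightarrow> y \<in> deg A b \<Longrightarrow>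
      mact M x y \<in> deg (fst M) (a \<otimes> b)"
    and mact_act: "g \<in> carrier G \<Longrightarrow> x \<in> space (fst M) \<Longrightarrow> y \<in> space A \<Longrightarrow>
      mact M (act (fst M) g x) (act A g y) = act (fst M) g (mact M x y)"
    and mact_mem: "x \<in> space (fst M) \<Longrightarrow> y \<in> space A \<Longrightarrow> mact M x y \<in> space (fst M)"
    and mact_bilinear: "bilinear_on (space (fst M)) (space A) (mact M)"
    and mact_linear: "x \<in> space (fst M) \<Longrightarrow> linear_on (space A) (mact M x)"
      "y \<in> space A \<Longrightarrow> linear_on (space (fst M)) (\<lambda>x. mact M x y)"
  using zmap_tensorD[OF pm_zobj[OF M] A pm_zmap[OF M]] unfolding mact_def[abs_def]
  by (simp_all add: bilinear_on_def)

lemma right_module_iff: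
  "right_module (ZG G) \<A> M \<longleftrightarrow> pre_module M \<and>
    (\<forall>m\<in>space (fst M). \<forall>a\<in>space A. \<forall>b\<in>space A. mact M (mact M m a) b = mact M m (mul a b)) \<and>
    (\<forall>m\<in>space (fst M). mact M m u = m)"
proof (cases M)
  case (Pair M0 \<nu>)
  show ?thesis
    unfolding Pair right_module_def pre_module_def mact_def Let_def prod.case fst_conv snd_conv ZG_simps mem_Collect_eq
    using action_assoc_iff[of M0 A \<nu> "alg_mult \<A>"] action_runit_iff[of M0 A \<nu> "alg_unit \<A>"] A mult_zhom unit_zhom
    by (auto simp del: ZG_arrows)
qed

text \<open>The braiding of \<open>M\<close> and \<open>A\<close> sends \<open>m \<otimes> a\<close>
  to \<open>x a \<otimes> m\<close>. The element \<open>x a\<close> has degree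
  \<open>x y x^-1\<close>, and this is what the second braiding lets act on
  \<open>m\<close>.\<close>

lemma local_module_iff:
  "local_module (ZG G) \<A> M \<longleftrightarrow> right_module (ZG G) \<A> M \<and>
    (\<forall>x\<in>carrier G. \<forall>y\<in>carrier G. \<forall>m\<in>deg (fst M) x. \<forall>a\<in>deg A y.
      mact M (act (fst M) (x \<otimes> y \<otimes> inv x) m) (act A x a) = mact M m a)"
proof (cases M)
  case (Pair M0 \<nu>)
  show ?thesis
  proof (cases "right_module (ZG G) \<A> M")
    case True
    then have M: "is_zobj G M0" and \<nu>: "\<nu> \<in> zhom G (ztensor G M0 A) M0"
      unfolding right_module_iff pre_module_def Pair by auto
    note \<nu>' = zhomD[OF \<nu>]
    let ?T = "tensor_space (space M0) (space A)"
    let ?l = "\<lambda>t. fn \<nu> (zbraid_map G A M0 (zbraid_map G M0 A t))"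
    have l: "zmap G (ztensor G M0 A) M0 ?l"
      by (rule zmap_comp[OF zmap_comp[OF zmap_braid[OF M A] zmap_braid[OF A M]] \<nu>'(4)])
    have lin: "linear_on ?T ?l" "linear_on ?T (fn \<nu>)"
      using zmapD(2)[OF l] zmapD(2)[OF \<nu>'(4)] by simp_all
    have ap: "?l (m \<otimes>\<^sub>v a) = fn \<nu> (act M0 (x \<otimes> y \<otimes> inv x) m \<otimes>\<^sub>v act A x a)"
      if "x \<in> carrier G" "y \<in> carrier G" "m \<in> deg M0 x" "a \<in> deg A y" for x y m a
      using that act_deg[OF A that(1,2,4)] deg_in_space[OF M that(1,3)] deg_in_space[OF A that(2,4)]
      by (simp add: zbraid_apply[OF M A that(1,3)] zbraid_apply[OF A M, of "x \<otimes> y \<otimes> inv x"])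
    have "local_module (ZG G) \<A> M \<longleftrightarrow> (\<forall>t\<in>?T. ?l t = fn \<nu> t)"
      unfolding Pair local_module_def prod.case
      using True Pair \<nu>' compose_eq_ext_iff[of "fn \<nu>" ?T "fn \<nu>" "compose ?T (zbraid_map G A M0) (zbraid_map G M0 A)"]
      by (cases \<nu>) (simp add: compose_eq)
    also have "\<dots> \<longleftrightarrow> (\<forall>x\<in>carrier G. \<forall>y\<in>carrier G. \<forall>m\<in>deg M0 x. \<forall>a\<in>deg A y.
      mact M (act M0 (x \<otimes> y \<otimes> inv x) m) (act A x a) = mact M m a)" (is "_ \<longleftrightarrow> ?R")
    proof
      assume "\<forall>t\<in>?T. ?l t = fn \<nu> t"
      then have "?l (m \<otimes>\<^sub>v a) = fn \<nu> (m \<otimes>\<^sub>v a)" if "m \<in> space M0" "a \<in> space A" for m a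
        using that by (simp add: vtensor_mem)
      then show ?R unfolding mact_def Pair snd_conv fst_conv
        using deg_in_space[OF M] deg_in_space[OF A] by (simp add: ap[symmetric])
    next
      assume ?R
      then have "?l (m \<otimes>\<^sub>v a) = fn \<nu> (m \<otimes>\<^sub>v a)"
        if "x \<in> carrier G" "y \<in> carrier G" "m \<in> deg M0 x" "a \<in> deg A y" for x y m a
        using that by (simp add: ap[OF that] mact_def Pair)
      then show "\<forall>t\<in>?T. ?l t = fn \<nu> t"
        using ztensor_ext[OF M A lin] by blast
    qed
    finally show ?thesis using True Pair by simp
  next
    case False
    then show ?thesis by (simp add: local_module_def Pair)
  qed
qed

lemma local_moduleD:
  assumes "local_module (ZG G) \<A> M"
  shows lm_pre: "pre_module M"
    and mact_assoc: "m \<in> space (fst M) \<Longrightarrow> a \<in> space A \<Longrightarrow> b \<in> space A \<Longrightarrow> mact M (mact M m a) b = mact M m (mul a b)"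
    and mact_unit: "m \<in> space (fst M) \<Longrightarrow> mact M m u = m"
    and mact_local: "x \<in> carrier G \<Longrightarrow> y \<in> carrier G \<Longrightarrow> m \<in> deg (fst M) x \<Longrightarrow> a \<in> deg A y \<Longrightarrow>
      mact M (act (fst M) (x \<otimes> y \<otimes> inv x) m) (act A x a) = mact M m a"
  using assms unfolding local_module_iff right_module_iff by auto

lemma mact_regular: "mact (regular_module \<A>) a b = mul a b"
  by (simp add: mact_def regular_module_def)

text \<open>Commutativity used twice: once to interchange \<open>x b\<close>, of degree
  \<open>x y x^-1\<close>, with \<open>a\<close>, and once to undo the action of \<open>x\<close> on
  \<open>b\<close>.\<close>

lemma regular_local: "local_module (ZG G) \<A> (regular_module \<A>)"
proof -
  have "mul (act A (x \<otimes> y \<otimes> inv x) a) (act A x b) = mul a b"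
    if "x \<in> carrier G" "y \<in> carrier G" "a \<in> deg A x" "b \<in> deg A y" for x y a b
    using mul_comm[of "x \<otimes> y \<otimes> inv x" "act A x b" a] mul_comm[of x a b] that
      act_deg[OF A that(1,2,4)] deg_in_space[OF A] by simp
  then show ?thesis
    unfolding local_module_iff right_module_iff pre_module_def mact_regular
    using A mult_zhom mul_assoc mul_unit by (simp add: regular_module_def)
qed

lemma module_hom_iff:
  assumes M: "pre_module M" and N: "pre_module N"
  shows "f \<in> module_hom_arrows (ZG G) \<A> M N \<longleftrightarrow>
    (\<exists>\<phi>. f = Arrow M N (Arrow (fst M) (fst N) \<phi>) \<and> \<phi> \<in> extensional (space (fst M)) \<and>
      zmap G (fst M) (fst N) \<phi> \<and>
      (\<forall>m\<in>space (fst M). \<forall>a\<in>space A. \<phi> (mact M m a) = mact N (\<phi> m) a))"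
proof -
  obtain M0 \<nu> N0 \<rho> where MN: "M = (M0, \<nu>)" "N = (N0, \<rho>)" by (cases M, cases N)
  have M0: "is_zobj G M0" and N0: "is_zobj G N0"
    and \<nu>: "\<nu> \<in> zhom G (ztensor G M0 A) M0" and \<rho>: "\<rho> \<in> zhom G (ztensor G N0 A) N0"
    using M N unfolding pre_module_def MN by auto
  note \<nu>' = zhomD[OF \<nu>] and \<rho>' = zhomD[OF \<rho>]
  have "comp (ZG G) (Arrow M0 N0 \<phi>) \<nu> = comp (ZG G) \<rho> (tens_arr (ZG G) (Arrow M0 N0 \<phi>) (ident (ZG G) A)) \<longleftrightarrow>
     (\<forall>m\<in>space M0. \<forall>a\<in>space A. \<phi> (mact M m a) = mact N (\<phi> m) a)"
    if \<phi>: "zmap G M0 N0 \<phi>" for \<phi>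
  proof -
    let ?r = "\<lambda>t. fn \<rho> (tensor_map (space M0) (space A) \<phi> (\<lambda>x\<in>space A. x) t)"
    note tr = zmap_tensor_map[OF M0 A N0 A \<phi> zmap_rid[OF A]]
    have "(\<forall>t\<in>tensor_space (space M0) (space A). \<phi> (fn \<nu> t) = ?r t) \<longleftrightarrow>
      (\<forall>m\<in>space M0. \<forall>a\<in>space A. \<phi> (mact M m a) = mact N (\<phi> m) a)"
      using ztensor_ext_iff[OF zmap_comp[OF \<nu>'(4) \<phi>] zmap_comp[OF tr \<rho>'(4)]]
        ztm_apply[OF M0 A \<phi> zmap_rid[OF A]]
      by (simp add: mact_def MN)
    then show ?thesis using \<nu>'(1,2) \<rho>'(1,2) by (simp add: compose_eq_iff)
  qed
  then show ?thesis
    unfolding module_hom_arrows_def MN by (auto simp: zhom_iff simp del: ZG_arrows)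
qed

definition lact :: "('a, 'k) zobj \<times> (('a, 'k) zobj, 'k vec \<Rightarrow> 'k vec) arrow \<Rightarrow> 'k vec \<Rightarrow> 'k vec \<Rightarrow> 'k vec" where
  "lact N a n = fn (snd N) (zbraid_map G A (fst N) (a \<otimes>\<^sub>v n))"

lemma lact_hom:
  assumes "pre_module N" "y \<in> carrier G" "a \<in> deg A y" "n \<in> space (fst N)"
  shows "lact N a n = mact N (act (fst N) y n) a"
  using zbraid_apply[OF A pm_zobj[OF assms(1)] assms(2-4)] by (simp add: lact_def mact_def)

lemma left_action_eq:
  assumes N: "pre_module N"
  shows "left_action (ZG G) \<A> N = Arrow (ztensor G A (fst N)) (fst N)
      (restrict (\<lambda>t. fn (snd N) (zbraid_map G A (fst N) t)) (tensor_space (space A) (space (fst N))))"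
    and left_action_zmap: "zmap G (ztensor G A (fst N)) (fst N) (\<lambda>t. fn (snd N) (zbraid_map G A (fst N) t))"
    and left_action_zhom: "left_action (ZG G) \<A> N \<in> zhom G (ztensor G A (fst N)) (fst N)"
proof -
  obtain N0 \<rho> where NN: "N = (N0, \<rho>)" by (cases N)
  note N0 = pm_zobj[OF N] and \<rho>' = zhomD[OF pm_zhom[OF N]]
  show eq: "left_action (ZG G) \<A> N = Arrow (ztensor G A (fst N)) (fst N)
      (restrict (\<lambda>t. fn (snd N) (zbraid_map G A (fst N) t)) (tensor_space (space A) (space (fst N))))"
    unfolding left_action_def NN using \<rho>' by (simp add: NN compose_def)
  show z: "zmap G (ztensor G A (fst N)) (fst N) (\<lambda>t. fn (snd N) (zbraid_map G A (fst N) t))"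
    by (rule zmap_comp[OF zmap_braid[OF A N0] \<rho>'(4)])
  show "left_action (ZG G) \<A> N \<in> zhom G (ztensor G A (fst N)) (fst N)"
    unfolding eq using restrict_zhom[OF is_zobj_tensor[OF A N0] z] by simp
qed

lemmas lact_facts = zmap_tensorD[OF A pm_zobj left_action_zmap, folded lact_def]

lemma lact_bilinear:
  assumes "pre_module N" shows "bilinear_on (space A) (space (fst N)) (lact N)"
  using lact_facts(5)[OF assms assms] by (simp add: bilinear_on_def)

end

section \<open>The tensor product over an algebra\<close>

text \<open>Tensoring a quotient projection with an identity stays onto, so maps on
  \<open>(M \<otimes>_A N) \<otimes> A\<close> are determined by their pullback to
  \<open>(M \<otimes> N) \<otimes> A\<close>.\<close>

lemma tensor_map_surj:
  fixes V W :: "'k::field vec set"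
  assumes V: "fd_space V" and W: "fd_space W" and f: "linear_on V f" and g: "linear_on W g"
  shows "tensor_map V W f g ` tensor_space V W = tensor_space (f ` V) (g ` W)"
proof
  show "tensor_map V W f g ` tensor_space V W \<subseteq> tensor_space (f ` V) (g ` W)"
    using tensor_map_mem[OF V W f g, of "f ` V" "g ` W"] by auto
  have "vs.subspace (tensor_map V W f g ` tensor_space V W)"
    by (rule subspace_image[OF tensor_map_linear[OF V W f g]]) simp
  moreover have "f x \<otimes>\<^sub>v g y \<in> tensor_map V W f g ` tensor_space V W" if "x \<in> V" "y \<in> W" for x y
    using tensor_map_apply[OF V W f g that] vtensor_mem[OF that] by (metis imageI)
  ultimately show "tensor_space (f ` V) (g ` W) \<subseteq> tensor_map V W f g ` tensor_space V W"
    unfolding tensor_space_def[of "f ` V"] by (intro vs.span_minimal) auto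
qed

section \<open>Arrows by their values, and coequalisers in \<open>Z(G)\<close>\<close>

context finite_grp
begin

lemma comp_zhom:
  assumes X: "is_zobj G X" and f: "f \<in> zhom G X Y" and g: "g \<in> zhom G Y Z"
  shows "comp (ZG G) g f \<in> zhom G X Z"
    and comp_apply: "x \<in> space X \<Longrightarrow> fn (comp (ZG G) g f) x = fn g (fn f x)"
  using zmap_restrict[OF X zmap_comp[OF zhomD(4)[OF f] zhomD(4)[OF g]]] zhomD(1,2)[OF f] zhomD(1,2)[OF g]
  by (auto simp: zhom_iff compose_def)

lemma tens_zhom:
  assumes X: "is_zobj G X" and Y: "is_zobj G Y" and X': "is_zobj G X'" and Y': "is_zobj G Y'"
    and f: "f \<in> zhom G X X'" and g: "g \<in> zhom G Y Y'"
  shows "tens_arr (ZG G) f g \<in> zhom G (ztensor G X Y) (ztensor G X' Y')"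
    and tens_apply: "x \<in> space X \<Longrightarrow> y \<in> space Y \<Longrightarrow> fn (tens_arr (ZG G) f g) (x \<otimes>\<^sub>v y) = fn f x \<otimes>\<^sub>v fn g y"
  using zhomD(1,2)[OF f] zhomD(1,2)[OF g] zmap_tensor_map[OF X Y X' Y' zhomD(4)[OF f] zhomD(4)[OF g]]
    ztm_apply[OF X Y zhomD(4)[OF f] zhomD(4)[OF g]]
    tensor_map_ext[OF zobj_fd[OF X] zobj_fd[OF Y] zmapD(2)[OF zhomD(4)[OF f]] zmapD(2)[OF zhomD(4)[OF g]]]
  by (simp_all add: zhom_iff)

lemma id_zhom:
  assumes "is_zobj G X" shows "ident (ZG G) X \<in> zhom G X X"
    and id_apply: "x \<in> space X \<Longrightarrow> fn (ident (ZG G) X) x = x"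
  using zmap_rid[OF assms] by (simp_all add: zhom_iff)

lemma assoc_zhom:
  assumes "is_zobj G X" "is_zobj G Y" "is_zobj G Z"
  shows "assoc (ZG G) X Y Z \<in> zhom G (ztensor G (ztensor G X Y) Z) (ztensor G X (ztensor G Y Z))"
    and assoc_apply: "x \<in> space X \<Longrightarrow> y \<in> space Y \<Longrightarrow> z \<in> space Z \<Longrightarrow>
      fn (assoc (ZG G) X Y Z) ((x \<otimes>\<^sub>v y) \<otimes>\<^sub>v z) = x \<otimes>\<^sub>v (y \<otimes>\<^sub>v z)"
  using zmap_assoc[OF assms] zassoc_apply[OF assms] assms
  by (simp_all add: zhom_iff zobj_fd assoc_map_ext)

lemma braid_zhom:
  assumes "is_zobj G X" "is_zobj G Y"
  shows "braid (ZG G) X Y \<in> zhom G (ztensor G X Y) (ztensor G Y X)"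
    and braid_apply: "f \<in> carrier G \<Longrightarrow> x \<in> deg X f \<Longrightarrow> y \<in> space Y \<Longrightarrow>
      fn (braid (ZG G) X Y) (x \<otimes>\<^sub>v y) = act Y f y \<otimes>\<^sub>v x"
  using zmap_braid[OF assms] zbraid_ext[OF assms] zbraid_apply[OF assms]
  by (simp_all add: zhom_iff)

lemma zhom_eqI:
  assumes "f \<in> zhom G X Y" "g \<in> zhom G X Y" "\<And>x. x \<in> space X \<Longrightarrow> fn f x = fn g x"
  shows "f = g"
proof -
  have "fn f = fn g"
    by (rule extensionalityI[OF zhomD(3)[OF assms(1)] zhomD(3)[OF assms(2)] assms(3)])
  then show ?thesis using zhomD(5)[OF assms(1)] zhomD(5)[OF assms(2)] by simp
qed

text \<open>Morphisms out of a quotient can be built as linear maps first; compatibility with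
  grading and action is inherited from \<open>f\<close> through the surjection
  \<open>q\<close>.\<close>

lemma zmap_of_factor:
  assumes Y: "is_zobj G Y" and Q: "is_zobj G Q" and Z: "is_zobj G Z"
    and q: "zmap G Y Q q" "q ` space Y = space Q" and f: "zmap G Y Z f"
    and h: "linear_on (space Q) h" and eq: "\<And>x. x \<in> space Y \<Longrightarrow> h (q x) = f x"
  shows "zmap G Q Z h"
proof -
  have "f x = 0" if "x \<in> space Y" "q x = 0" for x
    using eq[OF that(1)] that(2) linear_on_zero[OF h zobj_subspace[OF Q]] by simp
  then obtain h' where h': "zmap G Q Z h'" "\<And>x. x \<in> space Y \<Longrightarrow> h' (q x) = f x"
    using zmap_factor[OF Y Q Z q f] by blast
  show ?thesis
    by (rule zmap_cong[OF Q h'(1)]) (use h'(2) eq in \<open>auto simp: q(2)[symmetric]\<close>)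
qed

text \<open>Evaluates definite descriptions of arrows out of a quotient; surjectivity of
  \<open>q\<close> gives uniqueness.\<close>

lemma the_zhom:
  assumes Y: "is_zobj G Y" and Q: "is_zobj G Q" and q: "q \<in> zhom G Y Q" "fn q ` space Y = space Q"
    and f: "f \<in> zhom G Y Z" and h: "zmap G Q Z h" "\<And>y. y \<in> space Y \<Longrightarrow> h (fn q y) = fn f y"
  shows "(THE h'. h' \<in> zhom G Q Z \<and> comp (ZG G) h' q = f) = Arrow Q Z (restrict h (space Q))"
proof (rule the_equality)
  let ?h = "Arrow Q Z (restrict h (space Q))"
  have zh: "?h \<in> zhom G Q Z" using restrict_zhom[OF Q h(1)] .
  have "comp (ZG G) ?h q = f"
    by (rule zhom_eqI[OF comp_zhom(1)[OF Y q(1) zh] f]) (use q(2) h(2) in \<open>auto simp: comp_zhom(2)[OF Y q(1) zh] simp del: ZG_arrows\<close>)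
  then show "?h \<in> zhom G Q Z \<and> comp (ZG G) ?h q = f" using zh by simp
  fix h' assume h': "h' \<in> zhom G Q Z \<and> comp (ZG G) h' q = f"
  show "h' = ?h"
  proof (rule zhom_eqI[OF _ zh])
    fix x assume "x \<in> space Q"
    then obtain y where "y \<in> space Y" "x = fn q y" using q(2) by blast
    then show "fn h' x = fn ?h x" using h(2) q(2) h' comp_zhom(2)[OF Y q(1), of h' Z y] by auto
  qed (use h' in simp)
qed

text \<open>The coequalisers in the definitions are chosen ones, known only by their universal
  property. The quotient of \<open>Y\<close> by the image of \<open>f - g\<close> is one
  coequaliser, and the comparison maps carry its surjectivity and its kernel over to any
  other.\<close>

lemma zcoequaliser:
  assumes X: "is_zobj G X" and Y: "is_zobj G Y" and f: "f \<in> zhom G X Y" and g: "g \<in> zhom G X Y"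
  shows zcoequaliser_exists: "\<exists>P. coequaliser (ZG G) X Y f g P"
    and zcoequaliser_facts: "coequaliser (ZG G) X Y f g (Q, \<pi>) \<Longrightarrow>
      is_zobj G Q \<and> \<pi> \<in> zhom G Y Q \<and> fn \<pi> ` space Y = space Q \<and>
      (\<forall>x\<in>space X. fn \<pi> (fn f x) = fn \<pi> (fn g x)) \<and>
      (\<forall>y\<in>space Y. fn \<pi> y = 0 \<longrightarrow> (\<exists>x\<in>space X. y = fn f x - fn g x))"
proof -
  note f' = zmapD[OF zhomD(4)[OF f]] and g' = zmapD[OF zhomD(4)[OF g]]
  note subY = zobj_subspace[OF Y]
  define d where "d x = fn f x - fn g x" for x
  have d: "linear_on (space X) d"
    by (rule linear_onI) (simp_all add: d_def linear_on_add[OF f'(2)] linear_on_add[OF g'(2)]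
      linear_on_scale[OF f'(2)] linear_on_scale[OF g'(2)] vs.scale_right_diff_distrib)
  have d_act: "d (act X h x) = act Y h (d x)" if "h \<in> carrier G" "x \<in> space X" for h x
    using that by (simp add: d_def f' g' linear_on_diff[OF act_linear[OF Y] subY])
  have d_comp: "d (zcomp G X h x) = zcomp G Y h (d x)" if "h \<in> carrier G" "x \<in> space X" for h x
    using that zcomp_zmap[OF X Y zhomD(4)[OF f]] zcomp_zmap[OF X Y zhomD(4)[OF g]]
    by (simp add: d_def f' g' linear_on_diff[OF zcomp_linear[OF Y] subY])
  have d_mem: "d x \<in> space Y" if "x \<in> space X" for x
    using that f'(1) g'(1) subY by (simp add: d_def vs.subspace_diff)
  obtain Q0 p0 where Q0: "is_zobj G Q0" "zmap G Y Q0 p0" "p0 ` space Y = space Q0"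
    "\<And>x. x \<in> space Y \<Longrightarrow> p0 x = 0 \<longleftrightarrow> x \<in> d ` space X"
  proof (rule zquotient_exists[OF Y, of "d ` space X"])
    show "vs.subspace (d ` space X)" by (rule subspace_image[OF d zobj_subspace[OF X]])
  next
    fix x g assume "x \<in> d ` space X" "g \<in> carrier G"
    then show "zcomp G Y g x \<in> d ` space X" "act Y g x \<in> d ` space X"
      by (auto simp: d_comp[symmetric] d_act[symmetric] intro!: imageI zcomp_mem[OF X] act_mem[OF X])
  qed (use d_mem in auto)
  define p where "p = Arrow Y Q0 (restrict p0 (space Y))"
  have p: "p \<in> zhom G Y Q0" unfolding p_def by (rule restrict_zhom[OF Y Q0(2)])
  have p_fn: "fn p y = p0 y" if "y \<in> space Y" for y using that by (simp add: p_def)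
  have surj: "fn p ` space Y = space Q0" using Q0(3) by (simp add: p_def)
  have pd: "p0 (fn f x) = p0 (fn g x)" if "x \<in> space X" for x
  proof -
    have "p0 (d x) = 0" using Q0(4) d_mem that by blast
    then show ?thesis using linear_on_diff[OF zmapD(2)[OF Q0(2)] subY] that f'(1) g'(1) by (simp add: d_def)
  qed
  have coeq_iff: "comp (ZG G) h f = comp (ZG G) h g \<longleftrightarrow> (\<forall>x\<in>space X. fn h (fn f x) = fn h (fn g x))"
    if h: "h \<in> zhom G Y Z" for h Z
  proof
    assume "comp (ZG G) h f = comp (ZG G) h g"
    then show "\<forall>x\<in>space X. fn h (fn f x) = fn h (fn g x)"
      using comp_zhom(2)[OF X f h] comp_zhom(2)[OF X g h] by metis
  next
    assume "\<forall>x\<in>space X. fn h (fn f x) = fn h (fn g x)"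
    then show "comp (ZG G) h f = comp (ZG G) h g"
      by (intro zhom_eqI[OF comp_zhom(1)[OF X f h] comp_zhom(1)[OF X g h]])
        (simp add: comp_zhom(2)[OF X f h] comp_zhom(2)[OF X g h] del: ZG_arrows)
  qed
  have ex1: "\<exists>!u. u \<in> zhom G Q0 Z \<and> comp (ZG G) u p = h"
    if Z: "is_zobj G Z" and h: "h \<in> zhom G Y Z" and hf: "comp (ZG G) h f = comp (ZG G) h g" for Z h
  proof -
    have "fn h y = 0" if y: "y \<in> space Y" "p0 y = 0" for y
    proof -
      obtain x where x: "x \<in> space X" "y = d x" using Q0(4) y by blast
      then show ?thesis
        using coeq_iff[OF h] hf linear_on_diff[OF zmapD(2)[OF zhomD(4)[OF h]] subY] f'(1) g'(1)
        by (simp add: d_def)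
    qed
    then obtain v where v: "zmap G Q0 Z v" "\<And>x. x \<in> space Y \<Longrightarrow> v (p0 x) = fn h x"
      using zmap_factor[OF Y Q0(1) Z Q0(2,3) zhomD(4)[OF h]] by blast
    let ?v = "Arrow Q0 Z (restrict v (space Q0))"
    have zv: "?v \<in> zhom G Q0 Z" by (rule restrict_zhom[OF Q0(1) v(1)])
    show ?thesis
    proof (rule ex1I[of _ ?v])
      have "comp (ZG G) ?v p = h"
        by (rule zhom_eqI[OF comp_zhom(1)[OF Y p zv] h])
          (use Q0(3) in \<open>auto simp: comp_zhom(2)[OF Y p zv] p_fn v(2) simp del: ZG_arrows\<close>)
      then show "?v \<in> zhom G Q0 Z \<and> comp (ZG G) ?v p = h" using zv by simp
      fix w assume w: "w \<in> zhom G Q0 Z \<and> comp (ZG G) w p = h"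
      show "w = ?v"
      proof (rule zhom_eqI[OF _ zv])
        fix x assume "x \<in> space Q0"
        then obtain y where "y \<in> space Y" "x = p0 y" using Q0(3) by blast
        then show "fn w x = fn ?v x"
          using w comp_zhom(2)[OF Y p, of w Z y] v(2) Q0(3) by (auto simp: p_fn)
      qed (use w in simp)
    qed
  qed
  have co: "coequaliser (ZG G) X Y f g (Q0, p)"
    unfolding coequaliser_def prod.case ZG_simps mem_Collect_eq
    using Q0(1) p ex1 pd f'(1) g'(1) by (simp add: coeq_iff[OF p] p_fn del: ZG_arrows)
  then show "\<exists>P. coequaliser (ZG G) X Y f g P" by blast
  assume "coequaliser (ZG G) X Y f g (Q, \<pi>)"
  then have Q: "is_zobj G Q" and \<pi>: "\<pi> \<in> zhom G Y Q" and \<pi>c: "comp (ZG G) \<pi> f = comp (ZG G) \<pi> g"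
    and \<pi>u: "\<And>Z h. is_zobj G Z \<Longrightarrow> h \<in> zhom G Y Z \<Longrightarrow> comp (ZG G) h f = comp (ZG G) h g \<Longrightarrow>
      (\<exists>!u. u \<in> zhom G Q Z \<and> comp (ZG G) u \<pi> = h)"
    unfolding coequaliser_def by (auto simp del: ZG_arrows)
  obtain u where u: "u \<in> zhom G Q Q0" "comp (ZG G) u \<pi> = p"
    using \<pi>u[OF Q0(1) p] pd f'(1) g'(1) by (auto simp: coeq_iff[OF p] p_fn simp del: ZG_arrows)
  obtain v where v: "v \<in> zhom G Q0 Q" "comp (ZG G) v p = \<pi>"
    using ex1[OF Q \<pi> \<pi>c] by blast
  have u_ap: "fn u (fn \<pi> y) = p0 y" and v_ap: "fn v (p0 y) = fn \<pi> y" if "y \<in> space Y" for y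
    using comp_zhom(2)[OF Y \<pi> u(1) that] comp_zhom(2)[OF Y p v(1) that] u(2) v(2) that by (simp_all add: p_fn del: ZG_arrows)
  \<comment> \<open>Both \<open>v u\<close> and the identity factor \<open>\<pi>\<close> through
    itself, so the universal property makes them equal; surjectivity of \<open>\<pi>\<close>
    follows.\<close>
  have vu: "comp (ZG G) v u = ident (ZG G) Q"
  proof -
    have "comp (ZG G) (comp (ZG G) v u) \<pi> = \<pi>"
      by (rule zhom_eqI[OF comp_zhom(1)[OF Y \<pi> comp_zhom(1)[OF Q u(1) v(1)]] \<pi>])
        (simp add: comp_zhom(2)[OF Y \<pi> comp_zhom(1)[OF Q u(1) v(1)]] comp_zhom(2)[OF Q u(1) v(1)]
          zmapD(1)[OF zhomD(4)[OF \<pi>]] u_ap v_ap del: ZG_arrows)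
    moreover have "comp (ZG G) (ident (ZG G) Q) \<pi> = \<pi>"
      by (rule zhom_eqI[OF comp_zhom(1)[OF Y \<pi> id_zhom(1)[OF Q]] \<pi>])
        (simp add: comp_zhom(2)[OF Y \<pi> id_zhom(1)[OF Q]] zmapD(1)[OF zhomD(4)[OF \<pi>]] id_zhom(2)[OF Q] del: ZG_arrows)
    ultimately show ?thesis
      using \<pi>u[OF Q \<pi> \<pi>c] comp_zhom(1)[OF Q u(1) v(1)] id_zhom(1)[OF Q] by blast
  qed
  have "fn \<pi> ` space Y = space Q"
  proof
    show "space Q \<subseteq> fn \<pi> ` space Y"
    proof
      fix q assume q: "q \<in> space Q"
      have "fn u q \<in> space Q0" by (rule zmapD(1)[OF zhomD(4)[OF u(1)] q])
      then obtain y where y: "y \<in> space Y" "fn u q = p0 y" using Q0(3) by blast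
      have "q = fn (comp (ZG G) v u) q" by (simp only: vu id_zhom(2)[OF Q q])
      also have "\<dots> = fn \<pi> y" using comp_zhom(2)[OF Q u(1) v(1) q] y v_ap by simp
      finally show "q \<in> fn \<pi> ` space Y" using y by blast
    qed
  qed (use zmapD(1)[OF zhomD(4)[OF \<pi>]] in auto)
  moreover have "\<exists>x\<in>space X. y = fn f x - fn g x" if "y \<in> space Y" "fn \<pi> y = 0" for y
  proof -
    have "p0 y = 0" using u_ap[OF that(1)] that(2)
        linear_on_zero[OF zmapD(2)[OF zhomD(4)[OF u(1)]] zobj_subspace[OF Q]] by simp
    then show ?thesis using Q0(4)[OF that(1)] by (auto simp: d_def)
  qed
  ultimately show "is_zobj G Q \<and> \<pi> \<in> zhom G Y Q \<and> fn \<pi> ` space Y = space Q \<and>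
      (\<forall>x\<in>space X. fn \<pi> (fn f x) = fn \<pi> (fn g x)) \<and>
      (\<forall>y\<in>space Y. fn \<pi> y = 0 \<longrightarrow> (\<exists>x\<in>space X. y = fn f x - fn g x))"
    using Q \<pi> \<pi>c coeq_iff[OF \<pi>] by blast
qed

end

section \<open>The tensor product of modules over the algebra\<close>

context zalgebra
begin

abbreviation "relQ M N \<equiv> rel_obj (ZG G) \<A> M N"
abbreviation "relP M N \<equiv> rel_proj (ZG G) \<A> M N"

definition "rt M N m n = fn (relP M N) (m \<otimes>\<^sub>v n)"

context
  fixes M N
  assumes M: "pre_module M" and N: "pre_module N"
begin

private lemmas zM = pm_zobj[OF M] and zN = pm_zobj[OF N]

text \<open>The kernel clause is the universal property in linear form: an element of the kernel is
  a difference of values of the two parallel maps, and a balanced \<open>h\<close> identifies these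
  on pure tensors.\<close>

lemma
  shows rel_zobj: "is_zobj G (relQ M N)"
    and rel_proj_zhom: "relP M N \<in> zhom G (ztensor G (fst M) (fst N)) (relQ M N)"
    and rel_surj: "fn (relP M N) ` tensor_space (space (fst M)) (space (fst N)) = space (relQ M N)"
    and rt_balanced: "\<And>m a n. m \<in> space (fst M) \<Longrightarrow> a \<in> space A \<Longrightarrow> n \<in> space (fst N) \<Longrightarrow>
      rt M N (mact M m a) n = rt M N m (lact N a n)"
    and rel_kernel: "\<And>h :: 'k vec \<Rightarrow> 'k vec. linear_on (tensor_space (space (fst M)) (space (fst N))) h \<Longrightarrow>
      (\<And>m a n. m \<in> space (fst M) \<Longrightarrow> a \<in> space A \<Longrightarrow> n \<in> space (fst N) \<Longrightarrow>
        h (mact M m a \<otimes>\<^sub>v n) = h (m \<otimes>\<^sub>v lact N a n)) \<Longrightarrow>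
      y \<in> tensor_space (space (fst M)) (space (fst N)) \<Longrightarrow> fn (relP M N) y = 0 \<Longrightarrow> h y = 0"
proof -
  let ?M = "fst M" and ?N = "fst N"
  let ?X = "ztensor G (ztensor G ?M A) ?N"
  let ?Y = "ztensor G ?M ?N"
  let ?f = "tens_arr (ZG G) (snd M) (ident (ZG G) ?N)"
  let ?g = "comp (ZG G) (tens_arr (ZG G) (ident (ZG G) ?M) (left_action (ZG G) \<A> N)) (assoc (ZG G) ?M A ?N)"
  note MA = is_zobj_tensor[OF zM A] and AN = is_zobj_tensor[OF A zN]
  note X = is_zobj_tensor[OF MA zN] and Y = is_zobj_tensor[OF zM zN]
  note f = tens_zhom[OF MA zN zM zN pm_zhom[OF M] id_zhom(1)[OF zN]]
  note idl = tens_zhom[OF zM AN zM zN id_zhom(1)[OF zM] left_action_zhom[OF N]]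
  note as = assoc_zhom[OF zM A zN]
  note g = comp_zhom[OF X as(1) idl(1)]
  have fap: "fn ?f ((m \<otimes>\<^sub>v a) \<otimes>\<^sub>v n) = mact M m a \<otimes>\<^sub>v n"
    and gap: "fn ?g ((m \<otimes>\<^sub>v a) \<otimes>\<^sub>v n) = m \<otimes>\<^sub>v lact N a n"
    if "m \<in> space ?M" "a \<in> space A" "n \<in> space ?N" for m a n
  proof -
    show "fn ?f ((m \<otimes>\<^sub>v a) \<otimes>\<^sub>v n) = mact M m a \<otimes>\<^sub>v n"
      using f(2)[of "m \<otimes>\<^sub>v a" n] that id_zhom(2)[OF zN] by (simp add: vtensor_mem mact_def del: ZG_arrows)
    have "fn ?g ((m \<otimes>\<^sub>v a) \<otimes>\<^sub>v n) = fn (ident (ZG G) ?M) m \<otimes>\<^sub>v fn (left_action (ZG G) \<A> N) (a \<otimes>\<^sub>v n)"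
      using g(2)[of "(m \<otimes>\<^sub>v a) \<otimes>\<^sub>v n"] as(2)[OF that] idl(2)[of m "a \<otimes>\<^sub>v n"] that
      by (simp add: vtensor_mem del: ZG_arrows)
    also have "fn (left_action (ZG G) \<A> N) (a \<otimes>\<^sub>v n) = lact N a n"
      using that by (simp add: left_action_eq[OF N] lact_def vtensor_mem)
    also have "fn (ident (ZG G) ?M) m = m" by (rule id_zhom(2)[OF zM that(1)])
    finally show "fn ?g ((m \<otimes>\<^sub>v a) \<otimes>\<^sub>v n) = m \<otimes>\<^sub>v lact N a n" .
  qed
  have eq: "rel_tensor_coeq (ZG G) \<A> M N = (SOME Q. coequaliser (ZG G) ?X ?Y ?f ?g Q)"
    unfolding rel_tensor_coeq_def Let_def ZG_simps ..
  have "coequaliser (ZG G) ?X ?Y ?f ?g (relQ M N, relP M N)"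
    unfolding eq prod.collapse by (rule someI_ex[OF zcoequaliser_exists[OF X Y f(1) g(1)]])
  note facts = zcoequaliser_facts[OF X Y f(1) g(1) this]
  then show "is_zobj G (relQ M N)" "relP M N \<in> zhom G ?Y (relQ M N)"
    "fn (relP M N) ` tensor_space (space ?M) (space ?N) = space (relQ M N)" by simp_all
  show "rt M N (mact M m a) n = rt M N m (lact N a n)"
    if "m \<in> space ?M" "a \<in> space A" "n \<in> space ?N" for m a n
  proof -
    have "fn (relP M N) (fn ?f ((m \<otimes>\<^sub>v a) \<otimes>\<^sub>v n)) = fn (relP M N) (fn ?g ((m \<otimes>\<^sub>v a) \<otimes>\<^sub>v n))"
      using facts that by (simp add: vtensor_mem del: ZG_arrows)
    then show ?thesis unfolding fap[OF that] gap[OF that] rt_def .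
  qed
  show "h y = 0"
    if h: "linear_on (tensor_space (space ?M) (space ?N)) h"
      and bal: "\<And>m a n. m \<in> space ?M \<Longrightarrow> a \<in> space A \<Longrightarrow> n \<in> space ?N \<Longrightarrow>
        h (mact M m a \<otimes>\<^sub>v n) = h (m \<otimes>\<^sub>v lact N a n)"
      and y: "y \<in> tensor_space (space ?M) (space ?N)" "fn (relP M N) y = 0"
    for h :: "'k vec \<Rightarrow> 'k vec"
  proof -
    obtain x where x: "x \<in> space ?X" "y = fn ?f x - fn ?g x" using facts y by auto
    have lin: "linear_on (space ?X) (\<lambda>x. h (fn ?f x))" "linear_on (space ?X) (\<lambda>x. h (fn ?g x))"
      using linear_on_comp[OF zmapD(2)[OF zhomD(4)[OF f(1)]], of "space ?Y" h] h zmapD(1)[OF zhomD(4)[OF f(1)]]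
        linear_on_comp[OF zmapD(2)[OF zhomD(4)[OF g(1)]], of "space ?Y" h] zmapD(1)[OF zhomD(4)[OF g(1)]]
      by (simp_all del: ZG_arrows)
    have "h (fn ?f x) = h (fn ?g x)"
    proof (rule tensor_ext3[of "space ?M" "space A" "space ?N" "\<lambda>x. h (fn ?f x)" "\<lambda>x. h (fn ?g x)"])
      fix m a n assume "m \<in> space ?M" "a \<in> space A" "n \<in> space ?N"
      then show "h (fn ?f ((m \<otimes>\<^sub>v a) \<otimes>\<^sub>v n)) = h (fn ?g ((m \<otimes>\<^sub>v a) \<otimes>\<^sub>v n))"
        by (simp only: fap gap bal)
    qed (use lin x in simp_all)
    moreover have "fn ?f x \<in> space ?Y" "fn ?g x \<in> space ?Y"
      using zmapD(1)[OF zhomD(4)[OF f(1)]] zmapD(1)[OF zhomD(4)[OF g(1)]] x by blast+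
    ultimately show ?thesis using x(2) linear_on_diff[OF h subspace_tensor] by simp
  qed
qed

lemmas rel_proj_zmap = zhomD(4)[OF rel_proj_zhom]

lemma rt_deg: "a \<in> carrier G \<Longrightarrow> b \<in> carrier G \<Longrightarrow> m \<in> deg (fst M) a \<Longrightarrow> n \<in> deg (fst N) b \<Longrightarrow>
      rt M N m n \<in> deg (relQ M N) (a \<otimes> b)"
  and rt_act: "g \<in> carrier G \<Longrightarrow> m \<in> space (fst M) \<Longrightarrow> n \<in> space (fst N) \<Longrightarrow>
      rt M N (act (fst M) g m) (act (fst N) g n) = act (relQ M N) g (rt M N m n)"
  and rt_mem: "m \<in> space (fst M) \<Longrightarrow> n \<in> space (fst N) \<Longrightarrow> rt M N m n \<in> space (relQ M N)"
  and rt_bilinear: "bilinear_on (space (fst M)) (space (fst N)) (rt M N)"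
  using zmap_tensorD[OF zM zN rel_proj_zmap] unfolding rt_def[abs_def] by simp_all

lemma rel_ext:
  fixes f g :: "'k vec \<Rightarrow> ('j \<Rightarrow> 'k)"
  assumes "linear_on (space (relQ M N)) f" "linear_on (space (relQ M N)) g"
    and "\<And>m n. m \<in> space (fst M) \<Longrightarrow> n \<in> space (fst N) \<Longrightarrow> f (rt M N m n) = g (rt M N m n)"
    and q: "q \<in> space (relQ M N)"
  shows "f q = g q"
proof -
  let ?T = "tensor_space (space (fst M)) (space (fst N))"
  have lin: "linear_on ?T (fn (relP M N))" using zmapD(2)[OF rel_proj_zmap] by simp
  obtain t where t: "t \<in> ?T" "q = fn (relP M N) t" using q rel_surj by blast
  have "f (fn (relP M N) t) = g (fn (relP M N) t)"
    by (rule tensor_ext[OF linear_on_comp[OF lin assms(1)] linear_on_comp[OF lin assms(2)] _ t(1)])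
      (use rel_surj assms(3) in \<open>auto simp: rt_def\<close>)
  then show ?thesis by (simp add: t)
qed

lemma rel_mem:
  fixes f :: "'k vec \<Rightarrow> ('j \<Rightarrow> 'k)"
  assumes "linear_on (space (relQ M N)) f" "vs.subspace W"
    and "\<And>m n. m \<in> space (fst M) \<Longrightarrow> n \<in> space (fst N) \<Longrightarrow> f (rt M N m n) \<in> W"
    and q: "q \<in> space (relQ M N)"
  shows "f q \<in> W"
proof -
  let ?T = "tensor_space (space (fst M)) (space (fst N))"
  have lin: "linear_on ?T (fn (relP M N))" using zmapD(2)[OF rel_proj_zmap] by simp
  obtain t where t: "t \<in> ?T" "q = fn (relP M N) t" using q rel_surj by blast
  have "f (fn (relP M N) t) \<in> W"
    by (rule tensor_mem[OF linear_on_comp[OF lin assms(1)] assms(2) _ t(1)])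
      (use rel_surj assms(3) in \<open>auto simp: rt_def\<close>)
  then show ?thesis by (simp add: t)
qed

lemma rel_lift_linear:
  fixes b :: "'k vec \<Rightarrow> 'k vec \<Rightarrow> 'k vec"
  assumes b: "bilinear_on (space (fst M)) (space (fst N)) b"
    and bal: "\<And>m a n. m \<in> space (fst M) \<Longrightarrow> a \<in> space A \<Longrightarrow> n \<in> space (fst N) \<Longrightarrow>
      b (mact M m a) n = b m (lact N a n)"
  obtains h where "linear_on (space (relQ M N)) h"
    "\<And>m n. m \<in> space (fst M) \<Longrightarrow> n \<in> space (fst N) \<Longrightarrow> h (rt M N m n) = b m n"
proof -
  let ?T = "tensor_space (space (fst M)) (space (fst N))"
  obtain h0 where h0: "linear_on ?T h0"
    "\<And>x y. x \<in> space (fst M) \<Longrightarrow> y \<in> space (fst N) \<Longrightarrow> h0 (x \<otimes>\<^sub>v y) = b x y"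
    using tensor_lift[OF zobj_fd[OF zM] zobj_subspace[OF zN] b] by blast
  have ker: "h0 y = 0" if "y \<in> ?T" "fn (relP M N) y = 0" for y
    by (rule rel_kernel[OF h0(1) _ that])
      (simp add: h0(2) bal mact_mem[OF M] lact_facts(4)[OF N N])
  have lin: "linear_on ?T (fn (relP M N))" using zmapD(2)[OF rel_proj_zmap] by simp
  obtain h where "linear_on (space (relQ M N)) h" "\<And>x. x \<in> ?T \<Longrightarrow> h (fn (relP M N) x) = h0 x"
    using linear_factor[OF lin h0(1) subspace_tensor ker] rel_surj by metis
  then show thesis using that h0(2) by (simp add: rt_def vtensor_mem)
qed

end

lemma lact_linear:
  "pre_module N \<Longrightarrow> n \<in> space (fst N) \<Longrightarrow> linear_on (space A) (\<lambda>a. lact N a n)"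
  "pre_module N \<Longrightarrow> a \<in> space A \<Longrightarrow> linear_on (space (fst N)) (lact N a)"
  using bilinear_onD[OF lact_bilinear] by blast+

lemma lact_mem: "pre_module N \<Longrightarrow> a \<in> space A \<Longrightarrow> n \<in> space (fst N) \<Longrightarrow> lact N a n \<in> space (fst N)"
  using lact_facts(4) by blast

text \<open>For \<open>b\<close> of degree \<open>y\<close>:
  \<open>b (n a) = ((y n) (y a)) b = (y n) (b a) = (b n) a\<close>, the middle step by commutativity
  of the algebra.\<close>

lemma lact_mact:
  assumes N: "local_module (ZG G) \<A> N" and n: "n \<in> space (fst N)" and a: "a \<in> space A" "b \<in> space A"
  shows "lact N b (mact N n a) = mact N (lact N b n) a"
proof -
  note pN = lm_pre[OF N]
  have "lact N b (mact N n a) = mact N (lact N b n) a" if "y \<in> carrier G" "b \<in> deg A y" for y b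
  proof -
    have b: "b \<in> space A" using deg_in_space[OF A] that by blast
    note m = act_mem[OF pm_zobj[OF pN] that(1)] act_mem[OF A that(1) a(1)]
    have "lact N b (mact N n a) = mact N (mact N (act (fst N) y n) (act A y a)) b"
      using that n a by (simp add: lact_hom[OF pN that] mact_mem[OF pN] mact_act[OF pN])
    also have "\<dots> = mact N (act (fst N) y n) (mul b a)"
      using m n a b that by (simp add: mact_assoc[OF N] mul_comm)
    also have "\<dots> = mact N (lact N b n) a"
      using m n a b by (simp add: mact_assoc[OF N, symmetric] lact_hom[OF pN that])
    finally show ?thesis .
  qed
  then show ?thesis
    using n a mact_mem[OF pN] lact_mem[OF pN]
    by (intro zspace_ext[OF A lact_linear(1)[OF pN] linear_on_comp[OF lact_linear(1)[OF pN] mact_linear(2)[OF pN]] _ a(2)]) auto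
qed

text \<open>The algebra acts on \<open>M \<otimes>_A N\<close> through \<open>N\<close>; this
  respects balancing because the left and right actions on \<open>N\<close> commute
  (\<open>lact_mact\<close>).\<close>

lemma rel_tensor_eq:
  assumes M: "pre_module M" and N: "local_module (ZG G) \<A> N"
  shows fst_rel_tensor: "fst (rel_tensor (ZG G) \<A> M N) = relQ M N"
    and pre_rel_tensor: "pre_module (rel_tensor (ZG G) \<A> M N)"
    and mact_rel_tensor: "\<And>m n a. m \<in> space (fst M) \<Longrightarrow> n \<in> space (fst N) \<Longrightarrow> a \<in> space A \<Longrightarrow>
      mact (rel_tensor (ZG G) \<A> M N) (rt M N m n) a = rt M N m (mact N n a)"
proof -
  let ?M = "fst M" and ?N = "fst N" and ?Q = "relQ M N" and ?P = "relP M N"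
  note pN = lm_pre[OF N]
  note zM = pm_zobj[OF M] and zN = pm_zobj[OF pN]
  note Q = rel_zobj[OF M pN] and P = rel_proj_zhom[OF M pN]
  note MN = is_zobj_tensor[OF zM zN] and NA = is_zobj_tensor[OF zN A]
  note rtl = bilinear_onD[OF rt_bilinear[OF M pN]]
  note MNA = is_zobj_tensor[OF MN A] and QA = is_zobj_tensor[OF Q A]
  note Pid = tens_zhom[OF MN A Q A P id_zhom(1)[OF A]]
  note idr = tens_zhom[OF zM NA zM zN id_zhom(1)[OF zM] pm_zhom[OF pN]]
  note as = assoc_zhom[OF zM zN A]
  note c1 = comp_zhom[OF MNA as(1) idr(1)]
  note c2 = comp_zhom[OF MNA c1(1) P]
  let ?F = "comp (ZG G) ?P (comp (ZG G) (tens_arr (ZG G) (ident (ZG G) ?M) (snd N)) (assoc (ZG G) ?M ?N A))"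
  have F: "fn ?F ((m \<otimes>\<^sub>v n) \<otimes>\<^sub>v a) = rt M N m (mact N n a)"
    if "m \<in> space ?M" "n \<in> space ?N" "a \<in> space A" for m n a
    using c2(2)[of "(m \<otimes>\<^sub>v n) \<otimes>\<^sub>v a"] c1(2)[of "(m \<otimes>\<^sub>v n) \<otimes>\<^sub>v a"] as(2)[OF that] idr(2)[of m "n \<otimes>\<^sub>v a"]
      id_zhom(2)[OF zM that(1)] that
    by (simp add: vtensor_mem rt_def mact_def del: ZG_arrows)
  have "\<exists>k. linear_on (space ?Q) k \<and> (\<forall>m\<in>space ?M. \<forall>n\<in>space ?N. k (rt M N m n) = rt M N m (mact N n a))"
    if a: "a \<in> space A" for a
  proof -
    have b: "bilinear_on (space ?M) (space ?N) (\<lambda>m n. rt M N m (mact N n a))"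
      using a mact_mem[OF pN] by (intro bilinear_onI linear_on_comp[OF mact_linear(2)[OF pN a] rtl(1)] rtl(2)) auto
    have bal: "rt M N (mact M m c) (mact N n a) = rt M N m (mact N (lact N c n) a)"
      if "m \<in> space ?M" "c \<in> space A" "n \<in> space ?N" for m c n
      using that a by (simp add: rt_balanced[OF M pN] mact_mem[OF pN] lact_mact[OF N])
    show ?thesis by (rule rel_lift_linear[OF M pN b bal]) auto
  qed
  then obtain k where k: "\<And>a. a \<in> space A \<Longrightarrow> linear_on (space ?Q) (k a)"
    "\<And>a m n. a \<in> space A \<Longrightarrow> m \<in> space ?M \<Longrightarrow> n \<in> space ?N \<Longrightarrow> k a (rt M N m n) = rt M N m (mact N n a)"
    by metis
  have lin_a: "linear_on (space A) (\<lambda>a. rt M N m (mact N n a))" if "m \<in> space ?M" "n \<in> space ?N" for m n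
    using that mact_mem[OF pN] by (intro linear_on_comp[OF mact_linear(1)[OF pN] rtl(1)]) auto
  \<comment> \<open>Each \<open>k a\<close> was chosen separately; its linear dependence on
    \<open>a\<close> is recovered from the values on the classes \<open>rt M N m n\<close>.\<close>
  have "bilinear_on (space ?Q) (space A) (\<lambda>q a. k a q)"
  proof (rule bilinear_onI)
    fix q assume q: "q \<in> space ?Q"
    show "linear_on (space A) (\<lambda>a. k a q)"
    proof (rule linear_onI)
      fix a b assume ab: "a \<in> space A" "b \<in> space A"
      then have "a + b \<in> space A" using zobj_subspace[OF A] by (simp add: vs.subspace_add)
      then show "k (a + b) q = k a q + k b q"
        using ab by (intro rel_ext[OF M pN k(1) linear_on_add_fun[OF k(1) k(1)] _ q])
          (simp_all add: k(2) linear_on_add[OF lin_a])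
    next
      fix c a assume a: "a \<in> space A"
      then have "fscale c a \<in> space A" using zobj_subspace[OF A] by (simp add: vs.subspace_scale)
      then show "k (fscale c a) q = fscale c (k a q)"
        using a by (intro rel_ext[OF M pN k(1) linear_on_scale_fun[OF k(1)] _ q])
          (simp_all add: k(2) linear_on_scale[OF lin_a])
    qed
  qed (rule k(1))
  then obtain h where h: "linear_on (tensor_space (space ?Q) (space A)) h"
    "\<And>q a. q \<in> space ?Q \<Longrightarrow> a \<in> space A \<Longrightarrow> h (q \<otimes>\<^sub>v a) = k a q"
    using tensor_lift[OF zobj_fd[OF Q] zobj_subspace[OF A]] by blast
  have surj: "fn (tens_arr (ZG G) ?P (ident (ZG G) A)) ` space (ztensor G (ztensor G ?M ?N) A) = space (ztensor G ?Q A)"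
    using tensor_map_surj[OF zobj_fd[OF MN] zobj_fd[OF A] zmapD(2)[OF zhomD(4)[OF P]] linear_on_id]
      tensor_map_surj[OF zobj_fd[OF MN] zobj_fd[OF A] zmapD(2)[OF zhomD(4)[OF P]] zmapD(2)[OF zmap_rid[OF A]]]
      rel_surj[OF M pN] zhomD(1)[OF P] by simp
  have hlin: "linear_on (space (ztensor G (ztensor G ?M ?N) A)) (\<lambda>t. h (fn (tens_arr (ZG G) ?P (ident (ZG G) A)) t))"
    using zmapD(1)[OF zhomD(4)[OF Pid(1)]] h(1)
    by (intro linear_on_comp[OF zmapD(2)[OF zhomD(4)[OF Pid(1)]], of "tensor_space (space ?Q) (space A)"]) (simp_all del: ZG_arrows)
  have hF: "h (fn (tens_arr (ZG G) ?P (ident (ZG G) A)) t) = fn ?F t"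
    if t: "t \<in> space (ztensor G (ztensor G ?M ?N) A)" for t
  proof (rule tensor_ext3[of "space ?M" "space ?N" "space A" "\<lambda>t. h (fn (tens_arr (ZG G) ?P (ident (ZG G) A)) t)"])
    fix m n a assume mna: "m \<in> space ?M" "n \<in> space ?N" "a \<in> space A"
    have "fn (tens_arr (ZG G) ?P (ident (ZG G) A)) ((m \<otimes>\<^sub>v n) \<otimes>\<^sub>v a) = rt M N m n \<otimes>\<^sub>v a"
      using Pid(2)[of "m \<otimes>\<^sub>v n" a] mna id_zhom(2)[OF A] by (simp add: vtensor_mem rt_def del: ZG_arrows)
    then show "h (fn (tens_arr (ZG G) ?P (ident (ZG G) A)) ((m \<otimes>\<^sub>v n) \<otimes>\<^sub>v a)) = fn ?F ((m \<otimes>\<^sub>v n) \<otimes>\<^sub>v a)"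
      using mna by (simp only: F h(2) k(2) rt_mem[OF M pN])
  qed (use hlin zmapD(2)[OF zhomD(4)[OF c2(1)]] t in \<open>simp_all del: ZG_arrows\<close>)
  have hz: "zmap G (ztensor G ?Q A) ?Q h"
    by (rule zmap_of_factor[OF MNA QA Q zhomD(4)[OF Pid(1)] surj zhomD(4)[OF c2(1)] _ hF]) (use h(1) in simp)
  have eq: "rel_tensor (ZG G) \<A> M N = (?Q, Arrow (ztensor G ?Q A) ?Q (restrict h (space (ztensor G ?Q A))))"
    unfolding rel_tensor_def Let_def ZG_simps
    using the_zhom[OF MNA QA Pid(1) surj c2(1) hz hF] by (simp del: ZG_arrows)
  show "fst (rel_tensor (ZG G) \<A> M N) = ?Q" by (simp add: eq)
  show "pre_module (rel_tensor (ZG G) \<A> M N)"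
    unfolding pre_module_def eq fst_conv snd_conv using Q restrict_zhom[OF QA hz] by blast
  show "mact (rel_tensor (ZG G) \<A> M N) (rt M N m n) a = rt M N m (mact N n a)"
    if "m \<in> space ?M" "n \<in> space ?N" "a \<in> space A" for m n a
    using that by (simp add: mact_def[of "(?Q, x)" for x] eq vtensor_mem rt_mem[OF M pN] h(2) k(2))
qed

text \<open>An \<open>a\<close> of degree \<open>y\<close> first moves both factors by
  \<open>y\<close> and then acts on the right of the second; balancing hands it to the first factor,
  where the result is the left action.\<close>

lemma lact_rel_tensor:
  assumes N: "pre_module N" and P: "local_module (ZG G) \<A> P"
    and n: "n \<in> space (fst N)" and p: "p \<in> space (fst P)" and a: "a \<in> space A"
  shows "lact (rel_tensor (ZG G) \<A> N P) a (rt N P n p) = rt N P (lact N a n) p"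
proof -
  let ?NP = "rel_tensor (ZG G) \<A> N P"
  note pP = lm_pre[OF P]
  note NP = pre_rel_tensor[OF N P] fst_rel_tensor[OF N P]
  have "lact ?NP a (rt N P n p) = rt N P (lact N a n) p" if "y \<in> carrier G" "a \<in> deg A y" for y a
  proof -
    have a: "a \<in> space A" using deg_in_space[OF A] that by blast
    note m = act_mem[OF pm_zobj[OF N] that(1) n] act_mem[OF pm_zobj[OF pP] that(1) p]
    have "lact ?NP a (rt N P n p) = mact ?NP (rt N P (act (fst N) y n) (act (fst P) y p)) a"
      using n p by (simp add: lact_hom[OF NP(1) that] NP(2) rt_mem[OF N pP] rt_act[OF N pP that(1)])
    also have "\<dots> = rt N P (act (fst N) y n) (lact P a p)"
      using m a p by (simp add: mact_rel_tensor[OF N P] lact_hom[OF pP that])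
    also have "\<dots> = rt N P (lact N a n) p"
      using m a n p by (simp add: rt_balanced[OF N pP, symmetric] lact_hom[OF N that])
    finally show ?thesis .
  qed
  then show ?thesis
    using n p lact_mem[OF N] rt_mem[OF N pP]
    by (intro zspace_ext[OF A lact_linear(1)[OF NP(1)] linear_on_comp[OF lact_linear(1)[OF N n] bilinear_onD(2)[OF rt_bilinear[OF N pP] p]] _ a])
      (auto simp: NP(2))
qed

end

section \<open>The structure arrows on tensor products over the algebra\<close>

context zalgebra
begin

text \<open>With \<open>a\<close>, \<open>b\<close> of degrees \<open>x\<close>, \<open>y\<close>:
  \<open>a (b m) = ((x y m) (x b)) a = (x y m) ((x b) a) = (x y m) (a b)\<close>, and
  \<open>a b\<close> has degree \<open>x y\<close>.\<close>

lemma lact_assoc: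
  assumes M: "local_module (ZG G) \<A> M" and a: "a \<in> space A" "b \<in> space A" and m: "m \<in> space (fst M)"
  shows "lact M (mul a b) m = lact M a (lact M b m)"
proof -
  note pM = lm_pre[OF M] and mul_mem = mul_facts(4)
  have hom: "lact M (mul a b) m = lact M a (lact M b m)"
    if x: "x \<in> carrier G" "a \<in> deg A x" and y: "y \<in> carrier G" "b \<in> deg A y" for x a y b
  proof -
    have ab: "a \<in> space A" "b \<in> space A" using deg_in_space[OF A] x y by blast+
    note ym = act_mem[OF pm_zobj[OF pM] y(1) m] and xb = act_mem[OF A x(1) ab(2)]
    have xym: "act (fst M) x (act (fst M) y m) = act (fst M) (x \<otimes> y) m"
      using x y m by (simp add: act_mult[OF pm_zobj[OF pM]])
    have xym_mem: "act (fst M) (x \<otimes> y) m \<in> space (fst M)"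
      using act_mem[OF pm_zobj[OF pM] _ m] x y by simp
    have "lact M a (lact M b m) = mact M (act (fst M) x (mact M (act (fst M) y m) b)) a"
      using ym ab m by (simp add: lact_hom[OF pM x] lact_hom[OF pM y] mact_mem[OF pM])
    also have "\<dots> = mact M (mact M (act (fst M) (x \<otimes> y) m) (act A x b)) a"
      using ym ab x y m by (simp add: mact_act[OF pM, symmetric] xym)
    also have "\<dots> = mact M (act (fst M) (x \<otimes> y) m) (mul (act A x b) a)"
      using xym_mem xb ab(1) by (rule mact_assoc[OF M])
    also have "\<dots> = mact M (act (fst M) (x \<otimes> y) m) (mul a b)"
      using x ab by (simp add: mul_comm)
    also have "\<dots> = lact M (mul a b) m"
      using lact_hom[OF pM _ mul_facts(1)[OF x(1) y(1) x(2) y(2)] m] x y by simp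
    finally show ?thesis by simp
  qed
  have lin: "linear_on (space A) (\<lambda>b. lact M (mul a b) m)" "linear_on (space A) (\<lambda>b. lact M a (lact M b m))"
    if a: "a \<in> space A" for a
    using a m mul_mem lact_mem[OF pM]
    by (auto intro: linear_on_comp[OF bilinear_onD(1)[OF mul_facts(5) a] lact_linear(1)[OF pM m]]
        linear_on_comp[OF lact_linear(1)[OF pM m] lact_linear(2)[OF pM a]])
  have lin': "linear_on (space A) (\<lambda>a. lact M (mul a b) m)" "linear_on (space A) (\<lambda>a. lact M a (lact M b m))"
    if b: "b \<in> space A" for b
    using b m mul_mem lact_mem[OF pM]
    by (auto intro: linear_on_comp[OF bilinear_onD(2)[OF mul_facts(5) b] lact_linear(1)[OF pM m]]
        lact_linear(1)[OF pM])
  have "lact M (mul a b) m = lact M a (lact M b m)" if "x \<in> carrier G" "a \<in> deg A x" for x a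
    by (rule zspace_ext[OF A lin(1,2) _ assms(3)]) (use that deg_in_space[OF A] hom in auto)
  then show ?thesis
    by (intro zspace_ext[OF A lin'(1,2)[OF assms(3)] _ assms(2)]) auto
qed

text \<open>Common evaluation of the descriptions behind the structure arrows: a balanced
  \<open>F\<close> descends to the quotient, and the descended map is known on pure tensors.\<close>

lemma rel_the:
  assumes M: "pre_module M" and N: "pre_module N" and Z: "is_zobj G Z"
    and F: "F \<in> zhom G (ztensor G (fst M) (fst N)) Z"
    and bal: "\<And>m a n. m \<in> space (fst M) \<Longrightarrow> a \<in> space A \<Longrightarrow> n \<in> space (fst N) \<Longrightarrow>
      fn F (mact M m a \<otimes>\<^sub>v n) = fn F (m \<otimes>\<^sub>v lact N a n)"
    and h: "h = (THE h. h \<in> Hom (ZG G) (relQ M N) Z \<and> comp (ZG G) h (relP M N) = F)"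
  shows "h \<in> zhom G (relQ M N) Z \<and> (\<forall>m\<in>space (fst M). \<forall>n\<in>space (fst N). fn h (rt M N m n) = fn F (m \<otimes>\<^sub>v n))"
proof -
  note T = is_zobj_tensor[OF pm_zobj[OF M] pm_zobj[OF N]] and Q = rel_zobj[OF M N]
  note P = rel_proj_zhom[OF M N] rel_proj_zmap[OF M N]
  have surj: "fn (relP M N) ` space (ztensor G (fst M) (fst N)) = space (relQ M N)"
    using rel_surj[OF M N] by simp
  have "fn F y = 0" if "y \<in> space (ztensor G (fst M) (fst N))" "fn (relP M N) y = 0" for y
    using that zmapD(2)[OF zhomD(4)[OF F]] by (intro rel_kernel[OF M N _ bal]) auto
  then obtain k where k: "zmap G (relQ M N) Z k" "\<And>y. y \<in> space (ztensor G (fst M) (fst N)) \<Longrightarrow> k (fn (relP M N) y) = fn F y"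
    using zmap_factor[OF T Q Z P(2) surj zhomD(4)[OF F]] by blast
  have "h = Arrow (relQ M N) Z (restrict k (space (relQ M N)))"
    unfolding h ZG_simps by (rule the_zhom[OF T Q P(1) surj F k])
  then show ?thesis
    using restrict_zhom[OF Q k(1)] rt_mem[OF M N] k(2) by (simp add: rt_def vtensor_mem)
qed

text \<open>The last clause holds because the left action is the right action after moving the
  element by a degree, and arrows are equivariant.\<close>

lemma module_homD:
  assumes M: "pre_module M" and N: "pre_module N" and f: "f \<in> module_hom_arrows (ZG G) \<A> M N"
  shows "src f = M" "trg f = N" "fn f \<in> zhom G (fst M) (fst N)"
    "m \<in> space (fst M) \<Longrightarrow> a \<in> space A \<Longrightarrow> fn (fn f) (mact M m a) = mact N (fn (fn f) m) a"
    "m \<in> space (fst M) \<Longrightarrow> a \<in> space A \<Longrightarrow> fn (fn f) (lact M a m) = lact N a (fn (fn f) m)"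
proof -
  show *: "src f = M" "trg f = N" "fn f \<in> zhom G (fst M) (fst N)"
    "\<And>m a. m \<in> space (fst M) \<Longrightarrow> a \<in> space A \<Longrightarrow> fn (fn f) (mact M m a) = mact N (fn (fn f) m) a"
    using f unfolding module_hom_iff[OF M N] by (auto simp: zhom_iff)
  assume m: "m \<in> space (fst M)" and a: "a \<in> space A"
  note z = zmapD[OF zhomD(4)[OF *(3)]]
  show "fn (fn f) (lact M a m) = lact N a (fn (fn f) m)"
  proof (rule zspace_ext[OF A linear_on_comp[OF lact_linear(1)[OF M m] z(2)] lact_linear(1)[OF N z(1)[OF m]] _ a])
    fix g b assume "g \<in> carrier G" "b \<in> deg A g"
    then show "fn (fn f) (lact M b m) = lact N b (fn (fn f) m)"
      using m by (simp add: lact_hom[OF M] lact_hom[OF N] *(4) z act_mem[OF pm_zobj[OF M]] deg_in_space[OF A])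
  qed (use lact_mem[OF M] m in auto)
qed

lemma rel_tensor_arr_apply:
  assumes M: "pre_module M" and M': "pre_module M'" and N: "pre_module N" and N': "pre_module N'"
    and f: "f \<in> module_hom_arrows (ZG G) \<A> M M'" and g: "g \<in> module_hom_arrows (ZG G) \<A> N N'"
  shows "fn (rel_tensor_arr (ZG G) \<A> f g) \<in> zhom G (relQ M N) (relQ M' N') \<and>
    (\<forall>m\<in>space (fst M). \<forall>n\<in>space (fst N).
      fn (fn (rel_tensor_arr (ZG G) \<A> f g)) (rt M N m n) = rt M' N' (fn (fn f) m) (fn (fn g) n))"
proof -
  note f' = module_homD[OF M M' f] and g' = module_homD[OF N N' g]
  note zf = zmapD(1)[OF zhomD(4)[OF f'(3)]] and zg = zmapD(1)[OF zhomD(4)[OF g'(3)]]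
  note t = tens_zhom[OF pm_zobj[OF M] pm_zobj[OF N] pm_zobj[OF M'] pm_zobj[OF N'] f'(3) g'(3)]
  note c = comp_zhom[OF is_zobj_tensor[OF pm_zobj[OF M] pm_zobj[OF N]] t(1) rel_proj_zhom[OF M' N']]
  let ?F = "comp (ZG G) (relP M' N') (tens_arr (ZG G) (fn f) (fn g))"
  have F: "fn ?F (m \<otimes>\<^sub>v n) = rt M' N' (fn (fn f) m) (fn (fn g) n)"
    if "m \<in> space (fst M)" "n \<in> space (fst N)" for m n
    using c(2)[of "m \<otimes>\<^sub>v n"] t(2)[OF that] that by (simp add: vtensor_mem rt_def del: ZG_arrows)
  have h: "fn (rel_tensor_arr (ZG G) \<A> f g) = (THE h. h \<in> Hom (ZG G) (relQ M N) (relQ M' N') \<and> comp (ZG G) h (relP M N) = ?F)"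
    unfolding rel_tensor_arr_def f'(1,2) g'(1,2) by simp
  show ?thesis
    using rel_the[OF M N rel_zobj[OF M' N'] c(1) _ h] F mact_mem[OF M] lact_mem[OF N] f'(4) g'(5) zf zg rt_balanced[OF M' N']
    by (simp del: ZG_arrows)
qed

text \<open>Locality makes the braiding descend: \<open>m \<otimes> a n\<close> is sent to the class
  of \<open>(x y n) \<otimes> (x a) m\<close>, and \<open>m a \<otimes> n\<close> to that of
  \<open>(x y n) \<otimes> m a\<close>; locality of \<open>M\<close> says
  \<open>(x a) m = m a\<close>.\<close>

lemma rel_braid_apply:
  assumes M: "local_module (ZG G) \<A> M" and N: "local_module (ZG G) \<A> N"
  shows "fn (rel_braid (ZG G) \<A> M N) \<in> zhom G (relQ M N) (relQ N M) \<and>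
    (\<forall>x\<in>carrier G. \<forall>m\<in>deg (fst M) x. \<forall>n\<in>space (fst N).
      fn (fn (rel_braid (ZG G) \<A> M N)) (rt M N m n) = rt N M (act (fst N) x n) m)"
proof -
  note pM = lm_pre[OF M] and pN = lm_pre[OF N]
  note zM = pm_zobj[OF pM] and zN = pm_zobj[OF pN]
  note b = braid_zhom[OF zM zN]
  note c = comp_zhom[OF is_zobj_tensor[OF zM zN] b(1) rel_proj_zhom[OF pN pM]]
  let ?F = "comp (ZG G) (relP N M) (braid (ZG G) (fst M) (fst N))"
  have F: "fn ?F (m \<otimes>\<^sub>v n) = rt N M (act (fst N) x n) m"
    if "x \<in> carrier G" "m \<in> deg (fst M) x" "n \<in> space (fst N)" for x m n
    using c(2)[of "m \<otimes>\<^sub>v n"] b(2)[OF that] that deg_in_space[OF zM that(1,2)]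
    by (simp add: vtensor_mem rt_def del: ZG_arrows)
  have Flin: "linear_on (tensor_space (space (fst M)) (space (fst N))) (fn ?F)"
    using zmapD(2)[OF zhomD(4)[OF c(1)]] by (simp del: ZG_arrows)
  have bal_hom: "fn ?F (mact M m a \<otimes>\<^sub>v n) = fn ?F (m \<otimes>\<^sub>v lact N a n)"
    if x: "x \<in> carrier G" "m \<in> deg (fst M) x" and y: "y \<in> carrier G" "a \<in> deg A y" and n: "n \<in> space (fst N)"
    for x m y a n
  proof -
    have m: "m \<in> space (fst M)" and a: "a \<in> space A" using deg_in_space[OF zM x] deg_in_space[OF A y] .
    note yn = act_mem[OF zN y(1) n] and xa = act_mem[OF A x(1) a] and xyn = act_mem[OF zN x(1) act_mem[OF zN y(1) n]]
    have "fn ?F (m \<otimes>\<^sub>v lact N a n) = rt N M (act (fst N) x (mact N (act (fst N) y n) a)) m"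
      using F[OF x lact_mem[OF pN a n]] by (simp only: lact_hom[OF pN y n])
    also have "\<dots> = rt N M (mact N (act (fst N) x (act (fst N) y n)) (act A x a)) m"
      using x yn a by (simp add: mact_act[OF pN])
    also have "\<dots> = rt N M (act (fst N) x (act (fst N) y n)) (lact M (act A x a) m)"
      by (rule rt_balanced[OF pN pM xyn xa m])
    also have "lact M (act A x a) m = mact M m a"
      using x y m mact_local[OF M x(1) y(1) x(2) y(2)] lact_hom[OF pM _ act_deg[OF A x(1) y] m] by simp
    also have "rt N M (act (fst N) x (act (fst N) y n)) (mact M m a) = fn ?F (mact M m a \<otimes>\<^sub>v n)"
      using F[OF _ mact_deg[OF pM x(1) y(1) x(2) y(2)] n] x y n by (simp add: act_mult[OF zN])
    finally show ?thesis by simp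
  qed
  have lm: "linear_on (space (fst M)) (\<lambda>m. fn ?F (mact M m a \<otimes>\<^sub>v n))" "linear_on (space (fst M)) (\<lambda>m. fn ?F (m \<otimes>\<^sub>v lact N a n))"
    if "a \<in> space A" "n \<in> space (fst N)" for a n
    using that mact_mem[OF pM] lact_mem[OF pN]
    by (auto simp: linear_on_add[OF mact_linear(2)[OF pM]] linear_on_scale[OF mact_linear(2)[OF pM]]
        vtensor_add_left vtensor_scale_left linear_on_add[OF Flin] linear_on_scale[OF Flin] vtensor_mem
        intro!: linear_onI simp del: ZG_arrows)
  have la: "linear_on (space A) (\<lambda>a. fn ?F (mact M m a \<otimes>\<^sub>v n))" "linear_on (space A) (\<lambda>a. fn ?F (m \<otimes>\<^sub>v lact N a n))"
    if "m \<in> space (fst M)" "n \<in> space (fst N)" for m n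
    using that mact_mem[OF pM] lact_mem[OF pN]
    by (auto simp: linear_on_add[OF mact_linear(1)[OF pM]] linear_on_scale[OF mact_linear(1)[OF pM]]
        linear_on_add[OF lact_linear(1)[OF pN]] linear_on_scale[OF lact_linear(1)[OF pN]]
        vtensor_add_left vtensor_scale_left vtensor_add_right vtensor_scale_right
        linear_on_add[OF Flin] linear_on_scale[OF Flin] vtensor_mem
        intro!: linear_onI simp del: ZG_arrows)
  have bal: "fn ?F (mact M m a \<otimes>\<^sub>v n) = fn ?F (m \<otimes>\<^sub>v lact N a n)"
    if m: "m \<in> space (fst M)" and a: "a \<in> space A" and n: "n \<in> space (fst N)" for m a n
  proof (rule zspace_ext[OF zM lm[OF a n] _ m])
    fix x m assume x: "x \<in> carrier G" "m \<in> deg (fst M) x"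
    show "fn ?F (mact M m a \<otimes>\<^sub>v n) = fn ?F (m \<otimes>\<^sub>v lact N a n)"
      by (rule zspace_ext[OF A la[OF deg_in_space[OF zM x] n] _ a]) (rule bal_hom[OF x _ _ n])
  qed
  have h: "fn (rel_braid (ZG G) \<A> M N) = (THE h. h \<in> Hom (ZG G) (relQ M N) (relQ N M) \<and> comp (ZG G) h (relP M N) = ?F)"
    unfolding rel_braid_def by simp
  show ?thesis
    using rel_the[OF pM pN rel_zobj[OF pN pM] c(1) bal h] F deg_in_space[OF zM] by (simp del: ZG_arrows)
qed

lemma rel_lunit_apply:
  assumes M: "local_module (ZG G) \<A> M"
  shows "fn (rel_lunit (ZG G) \<A> M) \<in> zhom G (relQ (regular_module \<A>) M) (fst M) \<and>
    (\<forall>a\<in>space A. \<forall>m\<in>space (fst M). fn (fn (rel_lunit (ZG G) \<A> M)) (rt (regular_module \<A>) M a m) = lact M a m)"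
proof -
  let ?R = "regular_module \<A>"
  note pM = lm_pre[OF M] and pR = lm_pre[OF regular_local]
  have R: "fst ?R = A" by (simp add: regular_module_def)
  have F: "fn (left_action (ZG G) \<A> M) (a \<otimes>\<^sub>v m) = lact M a m" if "a \<in> space A" "m \<in> space (fst M)" for a m
    using that by (simp add: left_action_eq[OF pM] lact_def vtensor_mem)
  have h: "fn (rel_lunit (ZG G) \<A> M) = (THE h. h \<in> Hom (ZG G) (relQ ?R M) (fst M) \<and> comp (ZG G) h (relP ?R M) = left_action (ZG G) \<A> M)"
    unfolding rel_lunit_def by simp
  show ?thesis
    using rel_the[OF pR pM pm_zobj[OF pM] _ _ h] left_action_zhom[OF pM] mul_facts(4) lact_mem[OF pM] lact_assoc[OF M]
    by (simp add: R F mact_regular del: ZG_arrows)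
qed

lemma lact_regular:
  assumes a: "a \<in> space A" and b: "b \<in> space A"
  shows "lact (regular_module \<A>) a b = mul a b"
proof (rule zspace_ext[OF A _ bilinear_onD(2)[OF mul_facts(5) b] _ a])
  note pR = lm_pre[OF regular_local]
  have R: "fst (regular_module \<A>) = A" by (simp add: regular_module_def)
  show "linear_on (space A) (\<lambda>a. lact (regular_module \<A>) a b)" using lact_linear(1)[OF pR] b by (simp add: R)
  fix g x assume "g \<in> carrier G" "x \<in> deg A g"
  then show "lact (regular_module \<A>) x b = mul x b"
    using lact_hom[OF pR] b by (simp add: R mact_regular mul_comm)
qed

lemma rel_runit_apply:
  assumes M: "local_module (ZG G) \<A> M"
  shows "fn (rel_runit (ZG G) \<A> M) \<in> zhom G (relQ M (regular_module \<A>)) (fst M) \<and>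
    (\<forall>m\<in>space (fst M). \<forall>a\<in>space A. fn (fn (rel_runit (ZG G) \<A> M)) (rt M (regular_module \<A>) m a) = mact M m a)"
proof -
  let ?R = "regular_module \<A>"
  note pM = lm_pre[OF M] and pR = lm_pre[OF regular_local]
  have R: "fst ?R = A" by (simp add: regular_module_def)
  have F: "fn (snd M) (m \<otimes>\<^sub>v a) = mact M m a" for m a by (simp add: mact_def)
  have h: "fn (rel_runit (ZG G) \<A> M) = (THE h. h \<in> Hom (ZG G) (relQ M ?R) (fst M) \<and> comp (ZG G) h (relP M ?R) = snd M)"
    unfolding rel_runit_def by simp
  show ?thesis
    using rel_the[OF pM pR pm_zobj[OF pM] _ _ h] pm_zhom[OF pM] mul_facts(4) mact_mem[OF pM] mact_assoc[OF M]
    by (simp add: R F lact_regular del: ZG_arrows)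
qed

text \<open>Built in two stages: for fixed \<open>p\<close> the assignment descends to
  \<open>M \<otimes>_A N\<close>, and then to the product with \<open>P\<close>. Balancing rests on
  \<open>lact_rel_tensor\<close> in the first stage and on \<open>mact_rel_tensor\<close> in the
  second.\<close>

lemma rel_assoc_apply:
  assumes M: "pre_module M" and N: "local_module (ZG G) \<A> N" and P: "local_module (ZG G) \<A> P"
  defines "MN \<equiv> rel_tensor (ZG G) \<A> M N" and "NP \<equiv> rel_tensor (ZG G) \<A> N P"
  shows "fn (rel_assoc (ZG G) \<A> M N P) \<in> zhom G (relQ MN P) (relQ M NP) \<and>
    (\<forall>m\<in>space (fst M). \<forall>n\<in>space (fst N). \<forall>p\<in>space (fst P).
      fn (fn (rel_assoc (ZG G) \<A> M N P)) (rt MN P (rt M N m n) p) = rt M NP m (rt N P n p))"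
proof -
  note pN = lm_pre[OF N] and pP = lm_pre[OF P]
  note pMN = pre_rel_tensor[OF M N, folded MN_def] and pNP = pre_rel_tensor[OF pN P, folded NP_def]
  note MNo = fst_rel_tensor[OF M N, folded MN_def] and NPo = fst_rel_tensor[OF pN P, folded NP_def]
  note zM = pm_zobj[OF M] and zN = pm_zobj[OF pN] and zP = pm_zobj[OF pP]
  note zMN = rel_zobj[OF M pN] and zNP = rel_zobj[OF pN pP]
  note tMN = is_zobj_tensor[OF zM zN] and tNP = is_zobj_tensor[OF zN zP]
  note Y = is_zobj_tensor[OF tMN zP]
  note l1 = tens_zhom[OF tMN zP zMN zP rel_proj_zhom[OF M pN] id_zhom(1)[OF zP]]
  note zMNP = rel_proj_zhom[OF pMN pP, unfolded MNo]
  note q = comp_zhom[OF Y l1(1) zMNP]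
  note as = assoc_zhom[OF zM zN zP]
  note r1 = tens_zhom[OF zM tNP zM zNP id_zhom(1)[OF zM] rel_proj_zhom[OF pN pP]]
  note zM_NP = rel_proj_zhom[OF M pNP, unfolded NPo]
  note r2 = comp_zhom[OF Y as(1) r1(1)]
  note F = comp_zhom[OF Y r2(1) zM_NP]
  note Q1 = rel_zobj[OF pMN pP] and Q2 = rel_zobj[OF M pNP]
  let ?q = "comp (ZG G) (relP MN P) (tens_arr (ZG G) (relP M N) (ident (ZG G) (fst P)))"
  let ?F = "comp (ZG G) (relP M NP) (comp (ZG G) (tens_arr (ZG G) (ident (ZG G) (fst M)) (relP N P)) (assoc (ZG G) (fst M) (fst N) (fst P)))"
  have qa: "fn ?q ((m \<otimes>\<^sub>v n) \<otimes>\<^sub>v p) = rt MN P (rt M N m n) p"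
    and Fa: "fn ?F ((m \<otimes>\<^sub>v n) \<otimes>\<^sub>v p) = rt M NP m (rt N P n p)"
    if "m \<in> space (fst M)" "n \<in> space (fst N)" "p \<in> space (fst P)" for m n p
    using q(2)[of "(m \<otimes>\<^sub>v n) \<otimes>\<^sub>v p"] l1(2)[of "m \<otimes>\<^sub>v n" p] id_zhom(2)[OF zP that(3)]
      F(2)[of "(m \<otimes>\<^sub>v n) \<otimes>\<^sub>v p"] r2(2)[of "(m \<otimes>\<^sub>v n) \<otimes>\<^sub>v p"] as(2)[OF that]
      r1(2)[of m "n \<otimes>\<^sub>v p"] id_zhom(2)[OF zM that(1)] that
    by (simp_all add: vtensor_mem rt_def del: ZG_arrows)
  note rt1 = bilinear_onD[OF rt_bilinear[OF pN pP]]
  note rt2 = bilinear_onD[OF rt_bilinear[OF M pNP], unfolded NPo]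
  have lin_p: "linear_on (space (fst P)) (\<lambda>p. rt M NP m (rt N P n p))"
    if "m \<in> space (fst M)" "n \<in> space (fst N)" for m n
    using that rt_mem[OF pN pP] by (intro linear_on_comp[OF rt1(1) rt2(1)]) auto
  have "\<exists>k. linear_on (space (relQ M N)) k \<and>
      (\<forall>m\<in>space (fst M). \<forall>n\<in>space (fst N). k (rt M N m n) = rt M NP m (rt N P n p))"
    if p: "p \<in> space (fst P)" for p
  proof -
    have b: "bilinear_on (space (fst M)) (space (fst N)) (\<lambda>m n. rt M NP m (rt N P n p))"
      using p rt_mem[OF pN pP] by (intro bilinear_onI linear_on_comp[OF rt1(2) rt2(1)] rt2(2)) auto
    have bal: "rt M NP (mact M m a) (rt N P n p) = rt M NP m (rt N P (lact N a n) p)"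
      if "m \<in> space (fst M)" "a \<in> space A" "n \<in> space (fst N)" for m a n
      using that p rt_mem[OF pN pP] by (simp add: rt_balanced[OF M pNP] NPo lact_rel_tensor[OF pN P, folded NP_def])
    show ?thesis by (rule rel_lift_linear[OF M pN b bal]) auto
  qed
  then obtain k where k: "\<And>p. p \<in> space (fst P) \<Longrightarrow> linear_on (space (relQ M N)) (k p)"
    "\<And>p m n. p \<in> space (fst P) \<Longrightarrow> m \<in> space (fst M) \<Longrightarrow> n \<in> space (fst N) \<Longrightarrow> k p (rt M N m n) = rt M NP m (rt N P n p)"
    by metis
  have bk: "bilinear_on (space (fst MN)) (space (fst P)) (\<lambda>x p. k p x)"
    unfolding MNo
  proof (rule bilinear_onI)
    fix x assume x: "x \<in> space (relQ M N)"
    show "linear_on (space (fst P)) (\<lambda>p. k p x)"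
    proof (rule linear_onI)
      fix p p' assume p: "p \<in> space (fst P)" "p' \<in> space (fst P)"
      then have "p + p' \<in> space (fst P)" using zobj_subspace[OF zP] by (simp add: vs.subspace_add)
      then show "k (p + p') x = k p x + k p' x"
        using p by (intro rel_ext[OF M pN k(1) linear_on_add_fun[OF k(1) k(1)] _ x])
          (simp_all add: k(2) linear_on_add[OF lin_p])
    next
      fix c p assume p: "p \<in> space (fst P)"
      then have "fscale c p \<in> space (fst P)" using zobj_subspace[OF zP] by (simp add: vs.subspace_scale)
      then show "k (fscale c p) x = fscale c (k p x)"
        using p by (intro rel_ext[OF M pN k(1) linear_on_scale_fun[OF k(1)] _ x])
          (simp_all add: k(2) linear_on_scale[OF lin_p])
    qed
  qed (rule k(1))
  have bal: "k p (mact MN x a) = k (lact P a p) x"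
    if "x \<in> space (fst MN)" "a \<in> space A" "p \<in> space (fst P)" for x a p
  proof (rule rel_ext[OF M pN, where f = "\<lambda>x. k p (mact MN x a)"])
    show "linear_on (space (relQ M N)) (\<lambda>x. k p (mact MN x a))"
      using mact_linear(2)[OF pMN that(2)] k(1)[OF that(3)] mact_mem[OF pMN _ that(2)]
      unfolding MNo by (rule linear_on_comp)
  qed (use that lact_mem[OF pP] mact_mem[OF pN] in
      \<open>auto simp: MNo k mact_rel_tensor[OF M N, folded MN_def] rt_balanced[OF pN pP]\<close>)
  obtain h where h: "linear_on (space (relQ MN P)) h"
    "\<And>x p. x \<in> space (fst MN) \<Longrightarrow> p \<in> space (fst P) \<Longrightarrow> h (rt MN P x p) = k p x"
    using rel_lift_linear[OF pMN pP bk bal] by blast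
  have surj1: "fn (tens_arr (ZG G) (relP M N) (ident (ZG G) (fst P))) ` space (ztensor G (ztensor G (fst M) (fst N)) (fst P)) =
      space (ztensor G (relQ M N) (fst P))"
    using tensor_map_surj[OF zobj_fd[OF tMN] zobj_fd[OF zP] zmapD(2)[OF rel_proj_zmap[OF M pN]] zmapD(2)[OF zmap_rid[OF zP]]]
      rel_surj[OF M pN] zhomD(1)[OF rel_proj_zhom[OF M pN]] by simp
  have surj: "fn ?q ` space (ztensor G (ztensor G (fst M) (fst N)) (fst P)) = space (relQ MN P)"
  proof -
    have "fn ?q ` space (ztensor G (ztensor G (fst M) (fst N)) (fst P)) =
      fn (relP MN P) ` (fn (tens_arr (ZG G) (relP M N) (ident (ZG G) (fst P))) ` space (ztensor G (ztensor G (fst M) (fst N)) (fst P)))"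
      unfolding image_image by (rule image_cong) (simp_all add: q(2) del: ZG_arrows)
    then show ?thesis unfolding surj1 using rel_surj[OF pMN pP] by (simp add: MNo del: ZG_arrows)
  qed
  have hlin: "linear_on (space (ztensor G (ztensor G (fst M) (fst N)) (fst P))) (\<lambda>t. h (fn ?q t))"
    using zmapD(2)[OF zhomD(4)[OF q(1)]] h(1) zmapD(1)[OF zhomD(4)[OF q(1)]] by (rule linear_on_comp)
  have hF: "h (fn ?q t) = fn ?F t" if t: "t \<in> space (ztensor G (ztensor G (fst M) (fst N)) (fst P))" for t
  proof (rule tensor_ext3[of "space (fst M)" "space (fst N)" "space (fst P)" "\<lambda>t. h (fn ?q t)"])
    fix m n p assume mnp: "m \<in> space (fst M)" "n \<in> space (fst N)" "p \<in> space (fst P)"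
    then show "h (fn ?q ((m \<otimes>\<^sub>v n) \<otimes>\<^sub>v p)) = fn ?F ((m \<otimes>\<^sub>v n) \<otimes>\<^sub>v p)"
      by (simp only: qa Fa h(2) k(2) rt_mem[OF M pN] MNo)
  qed (use hlin zmapD(2)[OF zhomD(4)[OF F(1)]] t in \<open>simp_all del: ZG_arrows\<close>)
  have hz: "zmap G (relQ MN P) (relQ M NP) h"
    by (rule zmap_of_factor[OF Y Q1 Q2 zhomD(4)[OF q(1)] surj zhomD(4)[OF F(1)] h(1) hF])
  have "fn (rel_assoc (ZG G) \<A> M N P) = Arrow (relQ MN P) (relQ M NP) (restrict h (space (relQ MN P)))"
    unfolding rel_assoc_def Let_def MN_def[symmetric] NP_def[symmetric] ZG_simps arrow.sel
    by (rule the_zhom[OF Y Q1 q(1) surj F(1) hz hF])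
  then show ?thesis
    using restrict_zhom[OF Q1 hz] rt_mem[OF pMN pP] rt_mem[OF M pN] h(2) k(2) by (simp add: MNo)
qed

end

section \<open>Fully faithful and essentially surjective functors\<close>

locale cat =
  fixes C :: "('o, 'a, 'z) braided_monoidal_scheme"
  assumes ident_hom: "X \<in> obj C \<Longrightarrow> ident C X \<in> Hom C X X"
    and comp_hom: "X \<in> obj C \<Longrightarrow> Y \<in> obj C \<Longrightarrow> Z \<in> obj C \<Longrightarrow> f \<in> Hom C X Y \<Longrightarrow> g \<in> Hom C Y Z \<Longrightarrow> comp C g f \<in> Hom C X Z"
    and comp_assoc: "X \<in> obj C \<Longrightarrow> Y \<in> obj C \<Longrightarrow> Z \<in> obj C \<Longrightarrow> W \<in> obj C \<Longrightarrow>
      f \<in> Hom C X Y \<Longrightarrow> g \<in> Hom C Y Z \<Longrightarrow> h \<in> Hom C Z W \<Longrightarrow> comp C (comp C h g) f = comp C h (comp C g f)"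
    and comp_ident: "X \<in> obj C \<Longrightarrow> Y \<in> obj C \<Longrightarrow> f \<in> Hom C X Y \<Longrightarrow> comp C f (ident C X) = f"
      "X \<in> obj C \<Longrightarrow> Y \<in> obj C \<Longrightarrow> f \<in> Hom C X Y \<Longrightarrow> comp C (ident C Y) f = f"

text \<open>The usual construction of a quasi-inverse by choice. \<open>disj\<close> enters because
  \<open>Ga\<close> depends on the arrow alone: an arrow must determine its ends, and with them the
  objects between which its lift runs.\<close>

lemma equivalenceI:
  assumes "cat C" "cat D" and F: "functorial C D Fo Fa"
    and disj: "\<And>X Y X' Y' f. f \<in> Hom D X Y \<Longrightarrow> f \<in> Hom D X' Y' \<Longrightarrow> X = X' \<and> Y = Y'"
    and faithful: "\<And>X Y f g. X \<in> obj C \<Longrightarrow> Y \<in> obj C \<Longrightarrow> f \<in> Hom C X Y \<Longrightarrow> g \<in> Hom C X Y \<Longrightarrow> Fa f = Fa g \<Longrightarrow> f = g"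
    and full: "\<And>X Y h. X \<in> obj C \<Longrightarrow> Y \<in> obj C \<Longrightarrow> h \<in> Hom D (Fo X) (Fo Y) \<Longrightarrow> \<exists>f\<in>Hom C X Y. Fa f = h"
    and ess: "\<And>Y. Y \<in> obj D \<Longrightarrow> \<exists>X\<in>obj C. \<exists>e. iso_arrow D (Fo X) Y e"
  shows "equivalence_of_categories C D Fo Fa"
proof -
  interpret C: cat C by fact
  interpret D: cat D by fact
  have Fo: "Fo X \<in> obj D" if "X \<in> obj C" for X using F that by (auto simp: functorial_def)
  have Fa: "Fa f \<in> Hom D (Fo X) (Fo Y)" if "X \<in> obj C" "Y \<in> obj C" "f \<in> Hom C X Y" for X Y f
    using F that by (auto simp: functorial_def)
  have Fid: "Fa (ident C X) = ident D (Fo X)" if "X \<in> obj C" for X using F that by (auto simp: functorial_def)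
  have Fcomp: "Fa (comp C g f) = comp D (Fa g) (Fa f)"
    if "X \<in> obj C" "Y \<in> obj C" "Z \<in> obj C" "f \<in> Hom C X Y" "g \<in> Hom C Y Z" for X Y Z f g
    using F that by (auto simp: functorial_def)
  obtain Go where Go: "\<And>Y. Y \<in> obj D \<Longrightarrow> Go Y \<in> obj C \<and> (\<exists>e. iso_arrow D (Fo (Go Y)) Y e)"
    using ess by metis
  then obtain e where "\<And>Y. Y \<in> obj D \<Longrightarrow> iso_arrow D (Fo (Go Y)) Y (e Y)" by metis
  then obtain e' where e: "\<And>Y. Y \<in> obj D \<Longrightarrow> inverse_arrows D (Fo (Go Y)) Y (e Y) (e' Y)"
    unfolding iso_arrow_def by metis
  have eh: "e Y \<in> Hom D (Fo (Go Y)) Y" "e' Y \<in> Hom D Y (Fo (Go Y))"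
    "comp D (e' Y) (e Y) = ident D (Fo (Go Y))" "comp D (e Y) (e' Y) = ident D Y" if "Y \<in> obj D" for Y
    using e[OF that] by (auto simp: inverse_arrows_def)
  have GoC: "Go Y \<in> obj C" if "Y \<in> obj D" for Y using Go that by blast
  have e_can: "comp D (e Z) (comp D (e' Z) f) = f" if "Y \<in> obj D" "Z \<in> obj D" "f \<in> Hom D Y Z" for Y Z f
    using D.comp_assoc[OF that(1,2) Fo[OF GoC[OF that(2)]] that(2,3) eh(2,1)[OF that(2)]]
      D.comp_ident(2)[OF that] eh(4)[OF that(2)] by simp
  have e'_can: "comp D (e' Z) (comp D (e Z) f) = f" if "Y \<in> obj D" "Z \<in> obj D" "f \<in> Hom D Y (Fo (Go Z))" for Y Z f
    using D.comp_assoc[OF that(1) Fo[OF GoC[OF that(2)]] that(2) Fo[OF GoC[OF that(2)]] that(3) eh(1,2)[OF that(2)]]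
      D.comp_ident(2)[OF that(1) Fo[OF GoC[OF that(2)]] that(3)] eh(3)[OF that(2)] by simp
  \<comment> \<open>The inverse functor transports \<open>g\<close> along the isomorphisms
    \<open>e\<close> and lifts the result by fullness.\<close>
  define lift where "lift g Y Z = comp D (e' Z) (comp D g (e Y))" for g Y Z
  have lift: "lift g Y Z \<in> Hom D (Fo (Go Y)) (Fo (Go Z))" if "Y \<in> obj D" "Z \<in> obj D" "g \<in> Hom D Y Z" for g Y Z
    unfolding lift_def using that Fo GoC eh by (blast intro: D.comp_hom)
  have "\<exists>f. \<forall>Y\<in>obj D. \<forall>Z\<in>obj D. g \<in> Hom D Y Z \<longrightarrow> f \<in> Hom C (Go Y) (Go Z) \<and> Fa f = lift g Y Z" for g
  proof (cases "\<exists>Y\<in>obj D. \<exists>Z\<in>obj D. g \<in> Hom D Y Z")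
    case True
    then obtain Y Z where YZ: "Y \<in> obj D" "Z \<in> obj D" "g \<in> Hom D Y Z" by blast
    obtain f where "f \<in> Hom C (Go Y) (Go Z)" "Fa f = lift g Y Z"
      using full[OF GoC GoC lift, OF YZ(1,2) YZ] by blast
    then show ?thesis using disj[OF YZ(3)] by blast
  qed blast
  then obtain Ga where Ga: "\<And>g Y Z. Y \<in> obj D \<Longrightarrow> Z \<in> obj D \<Longrightarrow> g \<in> Hom D Y Z \<Longrightarrow>
      Ga g \<in> Hom C (Go Y) (Go Z) \<and> Fa (Ga g) = lift g Y Z"
    by metis
  have G: "functorial D C Go Ga"
    unfolding functorial_def
  proof (intro conjI ballI)
    fix Y assume Y: "Y \<in> obj D"
    note i = D.ident_hom[OF Y]
    have "Fa (Ga (ident D Y)) = Fa (ident C (Go Y))"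
      using Ga[OF Y Y i] Fid[OF GoC[OF Y]] D.comp_ident(2)[OF Fo[OF GoC[OF Y]] Y eh(1)[OF Y]] eh(3)[OF Y]
      by (simp add: lift_def)
    then show "Ga (ident D Y) = ident C (Go Y)"
      using faithful[OF GoC[OF Y] GoC[OF Y]] Ga[OF Y Y i] C.ident_hom[OF GoC[OF Y]] by blast
  next
    fix X Y Z f g assume XYZ: "X \<in> obj D" "Y \<in> obj D" "Z \<in> obj D" and f: "f \<in> Hom D X Y" and g: "g \<in> Hom D Y Z"
    note gf = D.comp_hom[OF XYZ f g]
    note o = Fo[OF GoC[OF XYZ(1)]] Fo[OF GoC[OF XYZ(2)]] Fo[OF GoC[OF XYZ(3)]]
    note Gf = Ga[OF XYZ(1,2) f] and Gg = Ga[OF XYZ(2,3) g]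
    note fe = D.comp_hom[OF o(1) XYZ(1,2) eh(1)[OF XYZ(1)] f]
    have "Fa (comp C (Ga g) (Ga f)) = comp D (lift g Y Z) (lift f X Y)"
      using Fcomp[of "Go X" "Go Y" "Go Z" "Ga f" "Ga g"] Gf Gg GoC XYZ by simp
    also have "\<dots> = comp D (e' Z) (comp D (comp D g (e Y)) (lift f X Y))"
      unfolding lift_def[of g]
      using D.comp_assoc[OF o(1,2) XYZ(3) o(3) lift[OF XYZ(1,2) f] D.comp_hom[OF o(2) XYZ(2,3) eh(1)[OF XYZ(2)] g] eh(2)[OF XYZ(3)]] .
    also have "comp D (comp D g (e Y)) (lift f X Y) = comp D g (comp D (e Y) (lift f X Y))"
      using D.comp_assoc[OF o(1,2) XYZ(2,3) lift[OF XYZ(1,2) f] eh(1)[OF XYZ(2)] g] .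
    also have "comp D (e Y) (lift f X Y) = comp D f (e X)"
      unfolding lift_def using e_can[OF o(1) XYZ(2) fe] .
    also have "comp D g (comp D f (e X)) = comp D (comp D g f) (e X)"
      using D.comp_assoc[OF o(1) XYZ eh(1)[OF XYZ(1)] f g] by simp
    finally have "Fa (comp C (Ga g) (Ga f)) = Fa (Ga (comp D g f))"
      using Ga[OF XYZ(1,3) gf] by (simp add: lift_def)
    moreover have "comp C (Ga g) (Ga f) \<in> Hom C (Go X) (Go Z)"
      using C.comp_hom[of "Go X" "Go Y" "Go Z" "Ga f" "Ga g"] Gf Gg GoC XYZ by simp
    ultimately show "Ga (comp D g f) = comp C (Ga g) (Ga f)"
      using faithful[OF GoC[OF XYZ(1)] GoC[OF XYZ(3)]] Ga[OF XYZ(1,3) gf] by metis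
  qed (use GoC Ga in blast)+
  \<comment> \<open>The unit is the lift of \<open>e'\<close>; as the lift of an isomorphism along a
    fully faithful functor it is invertible.\<close>
  have "\<exists>h. h \<in> Hom C X (Go (Fo X)) \<and> Fa h = e' (Fo X)" if "X \<in> obj C" for X
    using full[OF that GoC[OF Fo[OF that]] eh(2)[OF Fo[OF that]]] by blast
  then obtain \<eta> where \<eta>: "\<And>X. X \<in> obj C \<Longrightarrow> \<eta> X \<in> Hom C X (Go (Fo X))" "\<And>X. X \<in> obj C \<Longrightarrow> Fa (\<eta> X) = e' (Fo X)"
    by metis
  have "natural_iso C C (\<lambda>X. X) (\<lambda>f. f) (Go \<circ> Fo) (Ga \<circ> Fa) \<eta>"
    unfolding natural_iso_def o_def
  proof (intro conjI ballI)
    fix X assume X: "X \<in> obj C"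
    note FX = Fo[OF X] and GX = GoC[OF Fo[OF X]]
    obtain \<zeta> where \<zeta>: "\<zeta> \<in> Hom C (Go (Fo X)) X" "Fa \<zeta> = e (Fo X)"
      using full[OF GX X eh(1)[OF FX]] by blast
    have "comp C \<zeta> (\<eta> X) = ident C X"
      by (rule faithful[OF X X C.comp_hom[OF X GX X \<eta>(1)[OF X] \<zeta>(1)] C.ident_hom[OF X]])
        (simp add: Fcomp[OF X GX X \<eta>(1)[OF X] \<zeta>(1)] \<zeta>(2) \<eta>(2)[OF X] eh(4)[OF FX] Fid[OF X])
    moreover have "comp C (\<eta> X) \<zeta> = ident C (Go (Fo X))"
      by (rule faithful[OF GX GX C.comp_hom[OF GX X GX \<zeta>(1) \<eta>(1)[OF X]] C.ident_hom[OF GX]])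
        (simp add: Fcomp[OF GX X GX \<zeta>(1) \<eta>(1)[OF X]] \<zeta>(2) \<eta>(2)[OF X] eh(3)[OF FX] Fid[OF GX])
    ultimately show "iso_arrow C X (Go (Fo X)) (\<eta> X)"
      using \<eta>(1)[OF X] \<zeta>(1) by (auto simp: iso_arrow_def inverse_arrows_def)
  next
    fix X Y f assume XY: "X \<in> obj C" "Y \<in> obj C" and f: "f \<in> Hom C X Y"
    note FX = Fo[OF XY(1)] and FY = Fo[OF XY(2)] and GX = GoC[OF Fo[OF XY(1)]] and GY = GoC[OF Fo[OF XY(2)]]
    note Ff = Fa[OF XY f]
    note GFf = Ga[OF FX FY Ff]
    have "Fa (comp C (Ga (Fa f)) (\<eta> X)) = comp D (lift (Fa f) (Fo X) (Fo Y)) (e' (Fo X))"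
      using Fcomp[of X "Go (Fo X)" "Go (Fo Y)" "\<eta> X" "Ga (Fa f)"] GFf \<eta>[OF XY(1)] XY GX GY by simp
    also have "\<dots> = comp D (e' (Fo Y)) (comp D (Fa f) (comp D (e (Fo X)) (e' (Fo X))))"
      unfolding lift_def
      using D.comp_assoc[OF FX Fo[OF GX] FY Fo[OF GY] eh(2)[OF FX] D.comp_hom[OF Fo[OF GX] FX FY eh(1)[OF FX] Ff] eh(2)[OF FY]]
        D.comp_assoc[OF FX Fo[OF GX] FX FY eh(2,1)[OF FX] Ff] by simp
    also have "\<dots> = Fa (comp C (\<eta> Y) f)"
      using D.comp_ident(1)[OF FX FY Ff] eh(4)[OF FX] Fcomp[OF XY GY f \<eta>(1)[OF XY(2)]] \<eta>(2)[OF XY(2)] by simp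
    finally show "comp C (\<eta> Y) f = comp C (Ga (Fa f)) (\<eta> X)"
      using faithful[OF XY(1) GY] C.comp_hom[OF XY GY f \<eta>(1)[OF XY(2)]]
        C.comp_hom[OF XY(1) GX GY \<eta>(1)[OF XY(1)]] GFf by metis
  qed
  moreover have "natural_iso D D (Fo \<circ> Go) (Fa \<circ> Ga) (\<lambda>X. X) (\<lambda>f. f) e"
    unfolding natural_iso_def o_def
  proof (intro conjI ballI)
    fix Y assume "Y \<in> obj D"
    then show "iso_arrow D (Fo (Go Y)) Y (e Y)" using e by (auto simp: iso_arrow_def)
  next
    fix Y Z f assume YZ: "Y \<in> obj D" "Z \<in> obj D" and f: "f \<in> Hom D Y Z"
    have "comp D f (e Y) \<in> Hom D (Fo (Go Y)) Z" using YZ f eh(1) Fo GoC by (blast intro: D.comp_hom)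
    then show "comp D (e Z) (Fa (Ga f)) = comp D f (e Y)"
      using Ga[OF YZ f] e_can[OF Fo[OF GoC[OF YZ(1)]] YZ(2)] by (simp add: lift_def)
  qed
  ultimately show ?thesis
    unfolding equivalence_of_categories_def using F G by blast
qed


section \<open>Vector spaces\<close>

lemma Vect_simps [simp]:
  "obj Vect = {V. fd_space V}" "tens Vect = tensor_space" "unit_obj Vect = unit_space"
  by (simp_all add: Vect_def)

lemma vhom_iff: "f \<in> Hom Vect V W \<longleftrightarrow>
    (\<exists>\<phi>. f = Arrow V W \<phi> \<and> \<phi> \<in> extensional V \<and> \<phi> \<in> V \<rightarrow> W \<and> linear_on V \<phi>)"
  by (auto simp: Vect_def PiE_def)

lemma vhomD:
  assumes "f \<in> Hom Vect V W"
  shows "src f = V" "trg f = W" "fn f \<in> extensional V" "x \<in> V \<Longrightarrow> fn f x \<in> W" "linear_on V (fn f)"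
    "f = Arrow V W (fn f)"
  using assms by (auto simp: vhom_iff)

lemma vhom_eqI:
  assumes "f \<in> Hom Vect V W" "g \<in> Hom Vect V W" "\<And>x. x \<in> V \<Longrightarrow> fn f x = fn g x"
  shows "f = g"
proof -
  have "fn f = fn g"
    by (rule extensionalityI[OF vhomD(3)[OF assms(1)] vhomD(3)[OF assms(2)] assms(3)])
  then show ?thesis using vhomD(6)[OF assms(1)] vhomD(6)[OF assms(2)] by simp
qed

lemma vhom_tensor_eqI:
  assumes "f \<in> Hom Vect (tensor_space V W) U" "g \<in> Hom Vect (tensor_space V W) U"
    and "\<And>x y. x \<in> V \<Longrightarrow> y \<in> W \<Longrightarrow> fn f (x \<otimes>\<^sub>v y) = fn g (x \<otimes>\<^sub>v y)"
  shows "f = g"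
  by (rule vhom_eqI[OF assms(1,2)]) (rule tensor_ext[OF vhomD(5)[OF assms(1)] vhomD(5)[OF assms(2)] assms(3)])

lemma vhom_tensor3_eqI:
  assumes "f \<in> Hom Vect (tensor_space (tensor_space X V) W) U" "g \<in> Hom Vect (tensor_space (tensor_space X V) W) U"
    and "\<And>x y z. x \<in> X \<Longrightarrow> y \<in> V \<Longrightarrow> z \<in> W \<Longrightarrow> fn f ((x \<otimes>\<^sub>v y) \<otimes>\<^sub>v z) = fn g ((x \<otimes>\<^sub>v y) \<otimes>\<^sub>v z)"
  shows "f = g"
  by (rule vhom_eqI[OF assms(1,2)]) (rule tensor_ext3[OF vhomD(5)[OF assms(1)] vhomD(5)[OF assms(2)] assms(3)])

lemma vcomp:
  assumes f: "f \<in> Hom Vect U V" and g: "g \<in> Hom Vect V W" and U: "fd_space U"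
  shows vcomp_hom: "comp Vect g f \<in> Hom Vect U W"
    and vcomp_apply: "x \<in> U \<Longrightarrow> fn (comp Vect g f) x = fn g (fn f x)"
proof -
  note f' = vhomD[OF f] and g' = vhomD[OF g]
  have "linear_on U (\<lambda>x. fn g (fn f x))" by (rule linear_on_comp[OF f'(5) g'(5) f'(4)])
  then have "linear_on U (compose U (fn g) (fn f))"
    by (simp add: compose_def linear_on_restrict[OF fd_subspace[OF U]])
  then show "comp Vect g f \<in> Hom Vect U W"
    using f' g' unfolding vhom_iff by (auto simp: Vect_def compose_def)
  show "x \<in> U \<Longrightarrow> fn (comp Vect g f) x = fn g (fn f x)"
    using f'(1) by (simp add: Vect_def compose_def)
qed

lemma vtens:
  assumes f: "f \<in> Hom Vect V V'" and g: "g \<in> Hom Vect W W'" and fd: "fd_space V" "fd_space W"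
  shows vtens_hom: "tens_arr Vect f g \<in> Hom Vect (tensor_space V W) (tensor_space V' W')"
    and vtens_apply: "x \<in> V \<Longrightarrow> y \<in> W \<Longrightarrow> fn (tens_arr Vect f g) (x \<otimes>\<^sub>v y) = fn f x \<otimes>\<^sub>v fn g y"
  unfolding vhom_iff
  using vhomD[OF f] vhomD[OF g] tensor_map_ext[OF fd, of "fn f" "fn g"] tensor_map_linear[OF fd, of "fn f" "fn g"]
    tensor_map_apply[OF fd, of "fn f" "fn g"] tensor_map_mem[OF fd, of "fn f" "fn g" V' W']
  by (simp_all add: Vect_def Pi_iff)

lemma vident:
  assumes V: "fd_space V"
  shows vident_hom: "ident Vect V \<in> Hom Vect V V" and vident_apply: "x \<in> V \<Longrightarrow> fn (ident Vect V) x = x"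
  unfolding vhom_iff using linear_on_restrict[OF fd_subspace[OF V]] linear_on_id by (auto simp: Vect_def)

lemma vassoc:
  fixes U V W :: "'k::field vec set"
  assumes fd: "fd_space U" "fd_space V" "fd_space W"
  shows vassoc_hom: "assoc Vect U V W \<in> Hom Vect (tensor_space (tensor_space U V) W) (tensor_space U (tensor_space V W))"
    and vassoc_apply: "x \<in> U \<Longrightarrow> y \<in> V \<Longrightarrow> z \<in> W \<Longrightarrow> fn (assoc Vect U V W) ((x \<otimes>\<^sub>v y) \<otimes>\<^sub>v z) = x \<otimes>\<^sub>v (y \<otimes>\<^sub>v z)"
proof -
  have "assoc_map U V W t \<in> tensor_space U (tensor_space V W)" if "t \<in> tensor_space (tensor_space U V) W" for t
    by (rule tensor_mem3[OF assoc_map_linear[OF fd] _ _ that]) (auto simp: assoc_map_apply[OF fd] vtensor_mem)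
  then show "assoc Vect U V W \<in> Hom Vect (tensor_space (tensor_space U V) W) (tensor_space U (tensor_space V W))"
    unfolding vhom_iff using assoc_map_linear[OF fd] assoc_map_ext[OF fd] by (simp add: Vect_def Pi_iff)
  show "x \<in> U \<Longrightarrow> y \<in> V \<Longrightarrow> z \<in> W \<Longrightarrow> fn (assoc Vect U V W) ((x \<otimes>\<^sub>v y) \<otimes>\<^sub>v z) = x \<otimes>\<^sub>v (y \<otimes>\<^sub>v z)"
    by (simp add: Vect_def assoc_map_apply[OF fd])
qed

lemma vunit:
  fixes V :: "'k::field vec set"
  assumes V: "fd_space V"
  shows vlunit_hom: "lunit Vect V \<in> Hom Vect (tensor_space unit_space V) V"
    and vlunit_apply: "c \<in> unit_space \<Longrightarrow> x \<in> V \<Longrightarrow> fn (lunit Vect V) (c \<otimes>\<^sub>v x) = fscale (c 0) x"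
    and vrunit_hom: "runit Vect V \<in> Hom Vect (tensor_space V unit_space) V"
    and vrunit_apply: "c \<in> unit_space \<Longrightarrow> x \<in> V \<Longrightarrow> fn (runit Vect V) (x \<otimes>\<^sub>v c) = fscale (c 0) x"
proof -
  have "lunit_map V t \<in> V" if "t \<in> tensor_space unit_space V" for t
    by (rule tensor_mem[OF lunit_map_linear[OF V] fd_subspace[OF V] _ that])
      (simp add: lunit_map_apply[OF V] vs.subspace_scale[OF fd_subspace[OF V]])
  then show "lunit Vect V \<in> Hom Vect (tensor_space unit_space V) V"
    unfolding vhom_iff using lunit_map_linear[OF V] lunit_map_ext[OF V] by (simp add: Vect_def Pi_iff)
  have "runit_map V t \<in> V" if "t \<in> tensor_space V unit_space" for t
    by (rule tensor_mem[OF runit_map_linear[OF V] fd_subspace[OF V] _ that])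
      (simp add: runit_map_apply[OF V] vs.subspace_scale[OF fd_subspace[OF V]])
  then show "runit Vect V \<in> Hom Vect (tensor_space V unit_space) V"
    unfolding vhom_iff using runit_map_linear[OF V] runit_map_ext[OF V] by (simp add: Vect_def Pi_iff)
qed (simp_all add: Vect_def lunit_map_apply[OF V] runit_map_apply[OF V])

lemma vbraid:
  fixes V W :: "'k::field vec set"
  assumes fd: "fd_space V" "fd_space W"
  shows vbraid_hom: "braid Vect V W \<in> Hom Vect (tensor_space V W) (tensor_space W V)"
    and vbraid_apply: "x \<in> V \<Longrightarrow> y \<in> W \<Longrightarrow> fn (braid Vect V W) (x \<otimes>\<^sub>v y) = y \<otimes>\<^sub>v x"
  unfolding vhom_iff using flip_map_linear[OF fd] flip_map_ext[OF fd] flip_map_mem[OF fd]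
  by (auto simp: Vect_def flip_map_apply[OF fd])

lemma cat_Vect: "cat (Vect :: ('k::field vec set, ('k vec set, 'k vec \<Rightarrow> 'k vec) arrow) braided_monoidal)"
proof (unfold_locales, unfold Vect_simps mem_Collect_eq)
  fix X Y Z W :: "'k vec set" and f g h
  assume fd: "fd_space X" "fd_space Y" "fd_space Z" "fd_space W"
    and f: "f \<in> Hom Vect X Y" and g: "g \<in> Hom Vect Y Z" and h: "h \<in> Hom Vect Z W"
  show "comp Vect (comp Vect h g) f = comp Vect h (comp Vect g f)"
    by (rule vhom_eqI[OF vcomp(1)[OF f vcomp(1)[OF g h fd(2)] fd(1)] vcomp(1)[OF vcomp(1)[OF f g fd(1)] h fd(1)]])
      (simp add: vcomp(2)[OF f vcomp(1)[OF g h fd(2)] fd(1)] vcomp(2)[OF vcomp(1)[OF f g fd(1)] h fd(1)]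
        vcomp(2)[OF g h fd(2)] vcomp(2)[OF f g fd(1)] vhomD(4)[OF f])
next
  fix X Y :: "'k vec set" and f
  assume fd: "fd_space X" "fd_space Y" and f: "f \<in> Hom Vect X Y"
  show "comp Vect f (ident Vect X) = f"
    by (rule vhom_eqI[OF vcomp(1)[OF vident(1)[OF fd(1)] f fd(1)] f])
      (simp add: vcomp(2)[OF vident(1)[OF fd(1)] f fd(1)] vident(2)[OF fd(1)])
  show "comp Vect (ident Vect Y) f = f"
    by (rule vhom_eqI[OF vcomp(1)[OF f vident(1)[OF fd(2)] fd(1)] f])
      (simp add: vcomp(2)[OF f vident(1)[OF fd(2)] fd(1)] vident(2)[OF fd(2)] vhomD(4)[OF f])
qed (auto intro: vident vcomp)

lemma vect_isoI:
  assumes V: "fd_space V" and f: "f \<in> Hom Vect V W" and inj: "\<And>x. x \<in> V \<Longrightarrow> fn f x = 0 \<Longrightarrow> x = 0"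
    and surj: "W \<subseteq> fn f ` V"
  shows "iso_arrow Vect V W f"
proof -
  note f' = vhomD[OF f] and sV = fd_subspace[OF V]
  have W: "W = fn f ` V" using surj f'(4) by blast
  have fdW: "fd_space W" unfolding W by (rule fd_image[OF V f'(5)])
  have i: "inj_on (fn f) V" by (rule inj_on_linearI[OF f'(5) sV inj])
  define g where "g = Arrow W V (restrict (inv_into V (fn f)) W)"
  have lin: "linear_on W (inv_into V (fn f))"
    unfolding W by (rule linear_on_inv_into[OF f'(5) sV i])
  have g: "g \<in> Hom Vect W V"
    unfolding vhom_iff g_def using lin linear_on_restrict[OF fd_subspace[OF fdW]] W
    by (auto intro: inv_into_into)
  have f_inv: "fn f (inv_into V (fn f) y) = y" if "y \<in> W" for y
    using that W by (simp add: f_inv_into_f)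
  have g_ap: "fn g y = inv_into V (fn f) y" if "y \<in> W" for y using that by (simp add: g_def)
  have "comp Vect g f = ident Vect V"
    by (rule vhom_eqI[OF vcomp(1)[OF f g V] vident(1)[OF V]])
      (use i f'(4) in \<open>auto simp: vcomp(2)[OF f g V] vident(2)[OF V] g_ap\<close>)
  moreover have "comp Vect f g = ident Vect W"
    by (rule vhom_eqI[OF vcomp(1)[OF g f fdW] vident(1)[OF fdW]])
      (simp add: vcomp(2)[OF g f fdW] vident(2)[OF fdW] g_ap f_inv)
  ultimately show ?thesis using f g by (auto simp: iso_arrow_def inverse_arrows_def)
qed


section \<open>Invariants\<close>

definition invs :: "('g, 'm) monoid_scheme \<Rightarrow> ('g, 'k::field) zobj \<Rightarrow> 'k vec set" where
  "invs G X = {x \<in> deg X \<one>\<^bsub>G\<^esub>. \<forall>g\<in>carrier G. act X g x = x}"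

text \<open>The Reynolds operator preceded by the projection to degree \<open>e\<close>; this is the
  \<open>R\<close> of the overview.\<close>

definition reyn :: "('g, 'm) monoid_scheme \<Rightarrow> ('g, 'k::field) zobj \<Rightarrow> 'k vec \<Rightarrow> 'k vec" where
  "reyn G X x = fscale (inverse (of_nat (card (carrier G)))) (\<Sum>g\<in>carrier G. act X g (zcomp G X \<one>\<^bsub>G\<^esub> x))"

context finite_grp
begin

lemma invsD: "x \<in> invs G X \<Longrightarrow> x \<in> deg X \<one>" "x \<in> invs G X \<Longrightarrow> g \<in> carrier G \<Longrightarrow> act X g x = x"
  by (auto simp: invs_def)

lemma zmap_invs: "is_zobj G X \<Longrightarrow> zmap G X Y f \<Longrightarrow> x \<in> invs G X \<Longrightarrow> f x \<in> invs G Y"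
  using zmapD(3,4)[of G X Y f] deg_in_space[of X \<one> x] unfolding invs_def by (auto simp flip: zmapD(4))

context
  fixes X :: "('a, 'k::field) zobj"
  assumes X: "is_zobj G X"
begin

lemma invs_mem: "x \<in> invs G X \<Longrightarrow> x \<in> space X"
  using deg_in_space[OF X] invsD(1) by blast

lemma invs_subspace: "vs.subspace (invs G X)"
proof -
  note D = deg_subspace[OF X one_closed] and l = act_linear[OF X] and m = deg_in_space[OF X one_closed]
  show ?thesis
    by (rule vs.subspaceI)
      (auto simp: invs_def vs.subspace_0[OF D] vs.subspace_add[OF D] vs.subspace_scale[OF D]
        linear_on_zero[OF l zobj_subspace[OF X]] linear_on_add[OF l m m] linear_on_scale[OF l m])
qed

lemma invs_fd: "fd_space (invs G X)"
  using fd_subset[OF zobj_fd[OF X] invs_subspace] invs_mem by blast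

lemma reyn_linear: "linear_on (space X) (reyn G X)"
  unfolding reyn_def[abs_def] using zcomp_mem[OF X]
  by (intro linear_on_scale_fun linear_on_sum_fun linear_on_comp[OF zcomp_linear[OF X] act_linear[OF X]]) auto

lemma reyn_invs:
  assumes x: "x \<in> space X"
  shows "reyn G X x \<in> invs G X"
proof -
  let ?y = "zcomp G X \<one> x"
  have y: "?y \<in> deg X \<one>" "?y \<in> space X" using zcomp_deg[OF X x] zcomp_mem[OF X _ x] by auto
  have "act X h (\<Sum>g\<in>carrier G. act X g ?y) = (\<Sum>g\<in>carrier G. act X g ?y)" if h: "h \<in> carrier G" for h
  proof -
    have "act X h (\<Sum>g\<in>carrier G. act X g ?y) = (\<Sum>g\<in>carrier G. act X (h \<otimes> g) ?y)"
      using h y by (simp add: linear_on_sum[OF act_linear[OF X h] zobj_subspace[OF X]] act_mem[OF X] act_mult[OF X])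
    also have "\<dots> = (\<Sum>g\<in>carrier G. act X g ?y)"
      by (rule sum.reindex_bij_betw[of "\<lambda>g. h \<otimes> g" "carrier G" "carrier G" "\<lambda>g. act X g ?y"])
        (use h in \<open>simp add: bij_betw_def inj_on_cmult surj_const_mult\<close>)
    finally show ?thesis .
  qed
  moreover have s: "(\<Sum>g\<in>carrier G. act X g ?y) \<in> deg X \<one>"
    using y by (intro vs.subspace_sum deg_subspace[OF X]) (auto simp: act_deg_one[OF X])
  moreover have "(\<Sum>g\<in>carrier G. act X g ?y) \<in> space X"
    using deg_in_space[OF X one_closed s] .
  ultimately show ?thesis
    unfolding reyn_def invs_def using deg_in_space[OF X] deg_subspace[OF X]
    by (auto simp: linear_on_scale[OF act_linear[OF X]] vs.subspace_scale)
qed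

end

text \<open>All summands coincide, and the order of the group is invertible in characteristic
  zero.\<close>

lemma reyn_id:
  fixes X :: "('a, 'k::field_char_0) zobj"
  assumes X: "is_zobj G X" and x: "x \<in> invs G X"
  shows "reyn G X x = x"
proof -
  have "zcomp G X \<one> x = x" using zcomp_homogeneous[OF X, of \<one> \<one> x] invsD(1)[OF x] by simp
  then have "reyn G X x = fscale (inverse (of_nat (card (carrier G)))) (\<Sum>g\<in>carrier G. x)"
    by (simp add: reyn_def invsD(2)[OF x])
  also have "\<dots> = x"
  proof -
    have "card (carrier G) \<noteq> 0" using fin one_closed card_0_eq by blast
    then show ?thesis by (simp add: vs.sum_constant_scale del: sum_constant)
  qed
  finally show ?thesis .
qed

lemma zmap_reyn:
  assumes X: "is_zobj G X" and Y: "is_zobj G Y" and f: "zmap G X Y f" and x: "x \<in> space X"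
  shows "f (reyn G X x) = reyn G Y (f x)"
proof -
  have m: "zcomp G X \<one> x \<in> space X" using zcomp_mem[OF X _ x] by simp
  then have "f (\<Sum>g\<in>carrier G. act X g (zcomp G X \<one> x)) = (\<Sum>g\<in>carrier G. act Y g (f (zcomp G X \<one> x)))"
    by (simp add: linear_on_sum[OF zmapD(2)[OF f] zobj_subspace[OF X]] act_mem[OF X] zmapD(4)[OF f])
  then show ?thesis
    unfolding reyn_def using m x
    by (simp add: linear_on_scale[OF zmapD(2)[OF f]] vs.subspace_sum[OF zobj_subspace[OF X]] act_mem[OF X]
        zcomp_zmap[OF X Y f])
qed

end

section \<open>Local modules over an algebra with a dual family\<close>

context zalgebra
begin

abbreviation "LM \<equiv> local_modules (ZG G) \<A>"

lemma LM_simps [simp]: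
  "obj LM = {M. local_module (ZG G) \<A> M}" "Hom LM = module_hom_arrows (ZG G) \<A>"
  "ident LM M = Arrow M M (ident (ZG G) (fst M))"
  "comp LM g f = Arrow (src f) (trg g) (comp (ZG G) (fn g) (fn f))"
  "tens LM = rel_tensor (ZG G) \<A>" "tens_arr LM = rel_tensor_arr (ZG G) \<A>"
  "unit_obj LM = regular_module \<A>" "assoc LM = rel_assoc (ZG G) \<A>"
  "lunit LM = rel_lunit (ZG G) \<A>" "runit LM = rel_runit (ZG G) \<A>" "braid LM = rel_braid (ZG G) \<A>"
  by (simp_all add: local_modules_def)

lemma module_homI:
  assumes M: "pre_module M" and N: "pre_module N" and "f \<in> zhom G (fst M) (fst N)"
    and "\<And>m a. m \<in> space (fst M) \<Longrightarrow> a \<in> space A \<Longrightarrow> fn f (mact M m a) = mact N (fn f m) a"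
  shows "Arrow M N f \<in> module_hom_arrows (ZG G) \<A> M N"
  using assms(4) zhomD[OF assms(3)] unfolding module_hom_iff[OF M N] by (cases f) auto

lemma module_hom_eqI:
  assumes M: "pre_module M" and N: "pre_module N"
    and f: "f \<in> module_hom_arrows (ZG G) \<A> M N" and g: "g \<in> module_hom_arrows (ZG G) \<A> M N"
    and "\<And>m. m \<in> space (fst M) \<Longrightarrow> fn (fn f) m = fn (fn g) m"
  shows "f = g"
proof -
  note f' = module_homD[OF M N f] and g' = module_homD[OF M N g]
  have "fn f = fn g" by (rule zhom_eqI[OF f'(3) g'(3) assms(5)])
  then show ?thesis using f'(1,2) g'(1,2) by (cases f; cases g) simp
qed

lemma LM_comp:
  assumes M: "pre_module M" and N: "pre_module N" and P: "pre_module P"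
    and f: "f \<in> module_hom_arrows (ZG G) \<A> M N" and g: "g \<in> module_hom_arrows (ZG G) \<A> N P"
  shows LM_comp_hom: "comp LM g f \<in> module_hom_arrows (ZG G) \<A> M P"
    and LM_comp_apply: "\<And>m. m \<in> space (fst M) \<Longrightarrow> fn (fn (comp LM g f)) m = fn (fn g) (fn (fn f) m)"
proof -
  note f' = module_homD[OF M N f] and g' = module_homD[OF N P g]
  note c = comp_zhom[OF pm_zobj[OF M] f'(3) g'(3)]
  show "fn (fn (comp LM g f)) m = fn (fn g) (fn (fn f) m)" if "m \<in> space (fst M)" for m
    using c(2)[OF that] by (simp del: ZG_arrows)
  show "comp LM g f \<in> module_hom_arrows (ZG G) \<A> M P"
    unfolding LM_simps f'(1) g'(2)
    by (rule module_homI[OF M P c(1)])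
      (simp add: c(2) mact_mem[OF M] f'(4) g'(4) zmapD(1)[OF zhomD(4)[OF f'(3)]] del: ZG_arrows)
qed

lemma LM_ident:
  assumes M: "pre_module M"
  shows LM_ident_hom: "ident LM M \<in> module_hom_arrows (ZG G) \<A> M M"
    and LM_ident_apply: "\<And>m. m \<in> space (fst M) \<Longrightarrow> fn (fn (ident LM M)) m = m"
proof -
  note i = id_zhom[OF pm_zobj[OF M]]
  show "fn (fn (ident LM M)) m = m" if "m \<in> space (fst M)" for m
    using i(2)[OF that] by (simp del: ZG_arrows)
  show "ident LM M \<in> module_hom_arrows (ZG G) \<A> M M"
    unfolding LM_simps by (rule module_homI[OF M M i(1)]) (simp add: i(2) mact_mem[OF M] del: ZG_arrows)
qed

lemma module_hom_mem:
  assumes "pre_module M" "pre_module N" "f \<in> module_hom_arrows (ZG G) \<A> M N" "m \<in> space (fst M)"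
  shows "fn (fn f) m \<in> space (fst N)"
  using zmapD(1)[OF zhomD(4)[OF module_homD(3)[OF assms(1-3)]] assms(4)] .

lemma cat_LM: "cat LM"
proof (unfold_locales, unfold LM_simps(1,2) mem_Collect_eq)
  fix X Y Z W f g h
  assume "local_module (ZG G) \<A> X" "local_module (ZG G) \<A> Y" "local_module (ZG G) \<A> Z" "local_module (ZG G) \<A> W"
  then have m: "pre_module X" "pre_module Y" "pre_module Z" "pre_module W" using lm_pre by blast+
  assume f: "f \<in> module_hom_arrows (ZG G) \<A> X Y" and g: "g \<in> module_hom_arrows (ZG G) \<A> Y Z"
    and h: "h \<in> module_hom_arrows (ZG G) \<A> Z W"
  note gf = LM_comp[OF m(1-3) f g] and hg = LM_comp[OF m(2-4) g h]
  show "comp LM (comp LM h g) f = comp LM h (comp LM g f)"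
    by (rule module_hom_eqI[OF m(1,4) LM_comp(1)[OF m(1,2,4) f hg(1)] LM_comp(1)[OF m(1,3,4) gf(1) h]])
      (simp only: LM_comp(2)[OF m(1,2,4) f hg(1)] LM_comp(2)[OF m(1,3,4) gf(1) h] gf(2) hg(2) module_hom_mem[OF m(1,2) f])
next
  fix X Y f
  assume "local_module (ZG G) \<A> X" "local_module (ZG G) \<A> Y"
  then have m: "pre_module X" "pre_module Y" using lm_pre by blast+
  assume f: "f \<in> module_hom_arrows (ZG G) \<A> X Y"
  show "comp LM f (ident LM X) = f"
    by (rule module_hom_eqI[OF m LM_comp(1)[OF m(1,1,2) LM_ident(1)[OF m(1)] f] f])
      (simp only: LM_comp(2)[OF m(1,1,2) LM_ident(1)[OF m(1)] f] LM_ident(2)[OF m(1)])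
  show "comp LM (ident LM Y) f = f"
    by (rule module_hom_eqI[OF m LM_comp(1)[OF m(1,2,2) f LM_ident(1)[OF m(2)]] f])
      (simp only: LM_comp(2)[OF m(1,2,2) f LM_ident(1)[OF m(2)]] LM_ident(2)[OF m(2)] module_hom_mem[OF m f])
qed (use lm_pre LM_ident(1) LM_comp(1) in blast)+

text \<open>An invariant \<open>n\<close> amounts to a map \<open>a\<close> |-> \<open>n a\<close>
  from the algebra to \<open>M\<close>: lying in degree \<open>e\<close> it keeps the grading, being
  fixed by the group it keeps the action.\<close>

lemma mact_inv_zmap:
  assumes M: "pre_module M" and n: "n \<in> invs G (fst M)"
  shows "zmap G A (fst M) (mact M n)"
proof -
  have n': "n \<in> space (fst M)" "n \<in> deg (fst M) \<one>" using invs_mem[OF pm_zobj[OF M] n] invsD(1)[OF n] .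
  have "mact M n (act A g a) = act (fst M) g (mact M n a)" if "g \<in> carrier G" "a \<in> space A" for g a
    using mact_act[OF M that(1) n'(1) that(2)] invsD(2)[OF n that(1)] by simp
  then show ?thesis
    unfolding zmap_def using mact_mem[OF M n'(1)] mact_linear(1)[OF M n'(1)] mact_deg[OF M one_closed _ n'(2)] by auto
qed

lemma lact_inv:
  assumes M: "pre_module M" and n: "n \<in> invs G (fst M)" and a: "a \<in> space A"
  shows "lact M a n = mact M n a"
proof (rule zspace_ext[OF A _ _ _ a])
  have n': "n \<in> space (fst M)" using invs_mem[OF pm_zobj[OF M] n] .
  show "linear_on (space A) (\<lambda>a. lact M a n)" "linear_on (space A) (mact M n)"
    using lact_linear(1)[OF M n'] mact_linear(1)[OF M n'] .
  show "lact M x n = mact M n x" if "g \<in> carrier G" "x \<in> deg A g" for g x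
    using lact_hom[OF M that n'] invsD(2)[OF n that(1)] by simp
qed

lemma rt_invs:
  assumes "pre_module M" "pre_module N" "m \<in> invs G (fst M)" "n \<in> invs G (fst N)"
  shows "rt M N m n \<in> invs G (relQ M N)"
  using rt_deg[OF assms(1,2) one_closed one_closed] rt_act[OF assms(1,2), symmetric]
    invsD[OF assms(3)] invsD[OF assms(4)] invs_mem[OF pm_zobj] assms
  unfolding invs_def[of G "relQ M N"] by auto

lemma module_hom_invs:
  assumes "pre_module M" "pre_module N" "f \<in> module_hom_arrows (ZG G) \<A> M N" "m \<in> invs G (fst M)"
  shows "fn (fn f) m \<in> invs G (fst N)"
  using zmap_invs[OF pm_zobj[OF assms(1)] zhomD(4)[OF module_homD(3)[OF assms(1-3)]] assms(4)] .

end

text \<open>Separates the freeness argument from the symbols. The \<open>up i\<close> and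
  \<open>dn i\<close> are the two legs of a Casimir element, \<open>dual\<close> rebuilds each
  element of a local module from invariants, and the last two assumptions make the invariants of the
  algebra a line.\<close>

locale triv_algebra = zalgebra G \<A> for G (structure)
    and \<A> :: "(('a, 'k::field_char_0) zobj, (('a, 'k) zobj, 'k vec \<Rightarrow> 'k vec) arrow) algebra_data" +
  fixes I :: "'i set" and up dn :: "'i \<Rightarrow> 'k vec"
  assumes up: "i \<in> I \<Longrightarrow> up i \<in> space A" and dn: "i \<in> I \<Longrightarrow> dn i \<in> space A"
    and casimir: "a \<in> space A \<Longrightarrow> (\<Sum>i\<in>I. mul a (up i) \<otimes>\<^sub>v dn i) = (\<Sum>i\<in>I. up i \<otimes>\<^sub>v mul (dn i) a)"
    and dual: "local_module (ZG G) \<A> M \<Longrightarrow> m \<in> space (fst M) \<Longrightarrow>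
      (\<Sum>i\<in>I. mact M (reyn G (fst M) (mact M m (up i))) (dn i)) = m"
    and invs_A: "a \<in> invs G A \<Longrightarrow> \<exists>c. a = fscale c u" and u_neq_0: "u \<noteq> 0"
begin

text \<open>The functional through which \<open>R\<close> acts on the algebra; it is determined
  because \<open>u\<close> is nonzero.\<close>

definition "\<tau> a = (SOME c. reyn G A a = fscale c u)"

lemma reyn_A: "a \<in> space A \<Longrightarrow> reyn G A a = fscale (\<tau> a) u"
  unfolding \<tau>_def by (rule someI_ex) (rule invs_A[OF reyn_invs[OF A]])

lemma u_invs: "u \<in> invs G A"
  using u_deg u_act by (simp add: invs_def)

lemma mact_scale_u:
  "local_module (ZG G) \<A> M \<Longrightarrow> n \<in> space (fst M) \<Longrightarrow> mact M n (fscale c u) = fscale c n"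
  by (simp add: linear_on_scale[OF mact_linear(1)] lm_pre u_mem mact_unit)

text \<open>\<open>R\<close> commutes with the morphism \<open>a\<close> |-> \<open>n a\<close>,
  which takes \<open>u\<close> to \<open>n\<close>.\<close>

lemma reyn_mact:
  assumes M: "local_module (ZG G) \<A> M" and n: "n \<in> invs G (fst M)" and a: "a \<in> space A"
  shows "reyn G (fst M) (mact M n a) = fscale (\<tau> a) n"
  using zmap_reyn[OF A pm_zobj[OF lm_pre[OF M]] mact_inv_zmap[OF lm_pre[OF M] n] a]
    mact_scale_u[OF M invs_mem[OF pm_zobj[OF lm_pre[OF M]] n]] reyn_A[OF a] by simp

text \<open>This is \<open>dual\<close> for the unit element of the regular module.\<close>

lemma dual_u: "(\<Sum>i\<in>I. fscale (\<tau> (up i)) (dn i)) = u"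
proof -
  have R: "fst (regular_module \<A>) = A" by (simp add: regular_module_def)
  have "u = (\<Sum>i\<in>I. mul (reyn G A (mul u (up i))) (dn i))"
    using dual[OF regular_local, of u] u_mem by (simp add: R mact_regular)
  also have "\<dots> = (\<Sum>i\<in>I. fscale (\<tau> (up i)) (dn i))"
    by (rule sum.cong)
      (simp_all add: up dn mul_unit reyn_A vtensor_scale_left linear_on_scale[OF mul_facts(3)] vtensor_mem u_mem)
  finally show ?thesis ..
qed

text \<open>Carries the identity of tensors along a bilinear map, so that the two legs can be fed
  into different places.\<close>

lemma casimir_bilinear:
  fixes b :: "'k vec \<Rightarrow> 'k vec \<Rightarrow> 'k vec"
  assumes b: "bilinear_on (space A) (space A) b" and a: "a \<in> space A"
  shows "(\<Sum>i\<in>I. b (mul a (up i)) (dn i)) = (\<Sum>i\<in>I. b (up i) (mul (dn i) a))"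
proof -
  obtain h where h: "linear_on (tensor_space (space A) (space A)) h"
    "\<And>x y. x \<in> space A \<Longrightarrow> y \<in> space A \<Longrightarrow> h (x \<otimes>\<^sub>v y) = b x y"
    using tensor_lift[OF zobj_fd[OF A] zobj_subspace[OF A] b] by blast
  have m: "mul a (up i) \<in> space A" "mul (dn i) a \<in> space A" if "i \<in> I" for i
    using mul_facts(4) up dn a that by simp_all
  have "h (\<Sum>i\<in>I. mul a (up i) \<otimes>\<^sub>v dn i) = h (\<Sum>i\<in>I. up i \<otimes>\<^sub>v mul (dn i) a)" using casimir[OF a] by simp
  then show ?thesis
    using m up dn by (simp add: linear_on_sum[OF h(1) subspace_tensor] vtensor_mem h(2))
qed

context
  fixes M
  assumes M: "local_module (ZG G) \<A> M"
begin

private lemmas pM = lm_pre[OF M] and zM = pm_zobj[OF lm_pre[OF M]]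

text \<open>By \<open>dual\<close> the products of invariants with algebra elements span the
  module.\<close>

lemma free_ext:
  fixes f g :: "'k vec \<Rightarrow> ('j \<Rightarrow> 'k)"
  assumes f: "linear_on (space (fst M)) f" and g: "linear_on (space (fst M)) g"
    and eq: "\<And>n a. n \<in> invs G (fst M) \<Longrightarrow> a \<in> space A \<Longrightarrow> f (mact M n a) = g (mact M n a)"
    and m: "m \<in> space (fst M)"
  shows "f m = g m"
proof -
  let ?n = "\<lambda>i. reyn G (fst M) (mact M m (up i))"
  have n: "?n i \<in> invs G (fst M)" "?n i \<in> space (fst M)" if "i \<in> I" for i
    using reyn_invs[OF zM] invs_mem[OF zM] mact_mem[OF pM m] up that by blast+
  have "f (\<Sum>i\<in>I. mact M (?n i) (dn i)) = g (\<Sum>i\<in>I. mact M (?n i) (dn i))"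
    using n dn eq mact_mem[OF pM]
    by (simp add: linear_on_sum[OF f zobj_subspace[OF zM]] linear_on_sum[OF g zobj_subspace[OF zM]])
  then show ?thesis by (simp only: dual[OF M m])
qed

lemma free_mem:
  fixes f :: "'k vec \<Rightarrow> ('j \<Rightarrow> 'k)"
  assumes f: "linear_on (space (fst M)) f" and W: "vs.subspace W"
    and mem: "\<And>n a. n \<in> invs G (fst M) \<Longrightarrow> a \<in> space A \<Longrightarrow> f (mact M n a) \<in> W"
    and m: "m \<in> space (fst M)"
  shows "f m \<in> W"
proof -
  let ?n = "\<lambda>i. reyn G (fst M) (mact M m (up i))"
  have n: "?n i \<in> invs G (fst M)" "?n i \<in> space (fst M)" if "i \<in> I" for i
    using reyn_invs[OF zM] invs_mem[OF zM] mact_mem[OF pM m] up that by blast+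
  have "f (\<Sum>i\<in>I. mact M (?n i) (dn i)) \<in> W"
    using n dn mem mact_mem[OF pM]
    by (simp add: linear_on_sum[OF f zobj_subspace[OF zM]] vs.subspace_sum[OF W])
  then show ?thesis by (simp only: dual[OF M m])
qed

end

section \<open>The functor of invariants and its tensor structure\<close>

definition "FO M = invs G (fst M)"
definition "FA f = Arrow (FO (src f)) (FO (trg f)) (restrict (fn (fn f)) (FO (src f)))"
definition "FJ M N = Arrow (tensor_space (FO M) (FO N)) (FO (rel_tensor (ZG G) \<A> M N))
  (restrict (fn (relP M N)) (tensor_space (FO M) (FO N)))"
definition "FJ0 = Arrow unit_space (FO (regular_module \<A>)) (restrict (fn (alg_unit \<A>)) unit_space)"

lemma FO_fd: "pre_module M \<Longrightarrow> fd_space (FO M)"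
  unfolding FO_def by (rule invs_fd[OF pm_zobj])

lemma FO_mem: "pre_module M \<Longrightarrow> m \<in> FO M \<Longrightarrow> m \<in> space (fst M)"
  unfolding FO_def by (rule invs_mem[OF pm_zobj])

text \<open>Stated for morphisms of the underlying objects, the form in which the structure arrows
  are evaluated.\<close>

lemma FA_arrow:
  assumes M: "is_zobj G (fst M)" and f: "f \<in> zhom G (fst M) (fst N)"
  shows "FA (Arrow M N f) \<in> Hom Vect (FO M) (FO N)" "m \<in> FO M \<Longrightarrow> fn (FA (Arrow M N f)) m = fn f m"
proof -
  have "linear_on (FO M) (fn f)"
    using linear_on_subset[OF zmapD(2)[OF zhomD(4)[OF f]]] invs_mem[OF M] by (auto simp: FO_def)
  moreover have "vs.subspace (FO M)" unfolding FO_def by (rule invs_subspace[OF M])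
  ultimately show "FA (Arrow M N f) \<in> Hom Vect (FO M) (FO N)"
    unfolding vhom_iff FA_def using zmap_invs[OF M zhomD(4)[OF f]] by (auto simp: linear_on_restrict FO_def)
  show "m \<in> FO M \<Longrightarrow> fn (FA (Arrow M N f)) m = fn f m" by (simp add: FA_def)
qed

lemma FA_hom:
  assumes M: "pre_module M" and N: "pre_module N" and f: "f \<in> module_hom_arrows (ZG G) \<A> M N"
  shows "FA f \<in> Hom Vect (FO M) (FO N)" "m \<in> FO M \<Longrightarrow> fn (FA f) m = fn (fn f) m"
  using FA_arrow(1)[OF pm_zobj[OF M] module_homD(3)[OF M N f]]
    FA_arrow(2)[OF pm_zobj[OF M] module_homD(3)[OF M N f], of m] module_homD(1,2)[OF M N f]
  by (cases f; simp)+

lemma FO_rel_tensor: "FO (rel_tensor (ZG G) \<A> M N) = invs G (relQ M N)"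
  by (simp add: FO_def rel_tensor_def Let_def)

lemma FJ_hom:
  assumes pM: "pre_module M" and pN: "pre_module N"
  shows "FJ M N \<in> Hom Vect (tensor_space (FO M) (FO N)) (FO (rel_tensor (ZG G) \<A> M N))"
    and FJ_apply: "m \<in> FO M \<Longrightarrow> n \<in> FO N \<Longrightarrow> fn (FJ M N) (m \<otimes>\<^sub>v n) = rt M N m n"
proof -
  let ?T = "tensor_space (FO M) (FO N)"
  have sub: "?T \<subseteq> tensor_space (space (fst M)) (space (fst N))"
    using FO_mem[OF pM] FO_mem[OF pN] by (intro tensor_mono) auto
  have lin: "linear_on ?T (fn (relP M N))"
    using linear_on_subset[OF zmapD(2)[OF rel_proj_zmap[OF pM pN]]] sub by simp
  have "fn (relP M N) t \<in> invs G (relQ M N)" if "t \<in> ?T" for t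
    by (rule tensor_mem[OF lin invs_subspace[OF rel_zobj[OF pM pN]] _ that])
      (use rt_invs[OF pM pN] in \<open>auto simp: FO_def rt_def\<close>)
  then show "FJ M N \<in> Hom Vect ?T (FO (rel_tensor (ZG G) \<A> M N))"
    unfolding vhom_iff FJ_def using lin by (auto simp: linear_on_restrict FO_rel_tensor)
  show "m \<in> FO M \<Longrightarrow> n \<in> FO N \<Longrightarrow> fn (FJ M N) (m \<otimes>\<^sub>v n) = rt M N m n"
    by (simp add: FJ_def vtensor_mem rt_def)
qed

text \<open>The candidate inverse sends \<open>m \<otimes> n\<close> to the sum of the
  \<open>R (m (up i)) \<otimes> R ((dn i) n)\<close>. It is balanced by the Casimir identity, hence
  defined on the tensor product over the algebra. Surjectivity comes from applying \<open>R\<close>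
  to a spanning set.\<close>

lemma FJ_iso:
  assumes M: "local_module (ZG G) \<A> M" and N: "local_module (ZG G) \<A> N"
  shows "iso_arrow Vect (tensor_space (FO M) (FO N)) (FO (rel_tensor (ZG G) \<A> M N)) (FJ M N)"
proof (rule vect_isoI)
  note pM = lm_pre[OF M] and pN = lm_pre[OF N]
  note zM = pm_zobj[OF pM] and zN = pm_zobj[OF pN] and zQ = rel_zobj[OF pM pN]
  let ?T = "tensor_space (FO M) (FO N)"
  show "fd_space ?T" using FO_fd[OF pM] FO_fd[OF pN] by (rule fd_tensor)
  show J: "FJ M N \<in> Hom Vect ?T (FO (rel_tensor (ZG G) \<A> M N))" by (rule FJ_hom[OF pM pN])
  note J' = vhomD[OF J]
  let ?b = "\<lambda>m n. \<Sum>i\<in>I. reyn G (fst M) (mact M m (up i)) \<otimes>\<^sub>v reyn G (fst N) (lact N (dn i) n)"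
  have lM: "linear_on (space (fst M)) (\<lambda>m. reyn G (fst M) (mact M m a))" if "a \<in> space A" for a
    using mact_mem[OF pM] that by (intro linear_on_comp[OF mact_linear(2)[OF pM] reyn_linear[OF zM]]) auto
  have lN: "linear_on (space (fst N)) (\<lambda>n. reyn G (fst N) (lact N a n))" if "a \<in> space A" for a
    using lact_mem[OF pN] that by (intro linear_on_comp[OF lact_linear(2)[OF pN] reyn_linear[OF zN]]) auto
  have lA: "linear_on (space A) (\<lambda>a. reyn G (fst M) (mact M m a))" if "m \<in> space (fst M)" for m
    using mact_mem[OF pM] that by (intro linear_on_comp[OF mact_linear(1)[OF pM] reyn_linear[OF zM]]) auto
  have lA': "linear_on (space A) (\<lambda>a. reyn G (fst N) (lact N a n))" if "n \<in> space (fst N)" for n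
    using lact_mem[OF pN] that by (intro linear_on_comp[OF lact_linear(1)[OF pN] reyn_linear[OF zN]]) auto
  have b: "bilinear_on (space (fst M)) (space (fst N)) ?b"
    by (intro bilinear_onI linear_on_sum_fun linear_onI)
      (simp_all add: up dn linear_on_add[OF lM] linear_on_scale[OF lM] linear_on_add[OF lN] linear_on_scale[OF lN]
        vtensor_add_left vtensor_add_right vtensor_scale_left vtensor_scale_right)
  have bal: "?b (mact M m a) n = ?b m (lact N a n)"
    if m: "m \<in> space (fst M)" and a: "a \<in> space A" and n: "n \<in> space (fst N)" for m a n
    using casimir_bilinear[OF bilinear_tensor_map[OF lA[OF m] lA'[OF n]] a]
    by (simp add: mact_assoc[OF M] lact_assoc[OF N] m a n up dn)
  obtain h where h: "linear_on (space (relQ M N)) h"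
    "\<And>m n. m \<in> space (fst M) \<Longrightarrow> n \<in> space (fst N) \<Longrightarrow> h (rt M N m n) = ?b m n"
    using rel_lift_linear[OF pM pN b bal] by blast
  have h_inv: "h (rt M N m n) = m \<otimes>\<^sub>v n" if m: "m \<in> FO M" and n: "n \<in> FO N" for m n
  proof -
    have mn: "m \<in> invs G (fst M)" "n \<in> invs G (fst N)" "m \<in> space (fst M)" "n \<in> space (fst N)"
      using m n FO_mem[OF pM] FO_mem[OF pN] by (auto simp: FO_def)
    have "h (rt M N m n) = (\<Sum>i\<in>I. fscale (\<tau> (up i) * \<tau> (dn i)) (m \<otimes>\<^sub>v n))"
      unfolding h(2)[OF mn(3,4)]
      by (rule sum.cong)
        (simp_all add: up dn reyn_mact[OF M mn(1)] lact_inv[OF pN mn(2)] reyn_mact[OF N mn(2)]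
          vtensor_scale_left vtensor_scale_right)
    also have "\<dots> = fscale (\<Sum>i\<in>I. \<tau> (up i) * \<tau> (dn i)) (m \<otimes>\<^sub>v n)"
      by (simp add: vs.scale_sum_left)
    \<comment> \<open>\<open>R\<close> applied to \<open>dual_u\<close> shows that the sum of the
      \<open>\<tau> (up i) * \<tau> (dn i)\<close> is \<open>1\<close>.\<close>
    also have "fscale (\<Sum>i\<in>I. \<tau> (up i) * \<tau> (dn i)) u = reyn G A (\<Sum>i\<in>I. fscale (\<tau> (up i)) (dn i))"
    proof -
      have "reyn G A (\<Sum>i\<in>I. fscale (\<tau> (up i)) (dn i)) = (\<Sum>i\<in>I. fscale (\<tau> (up i)) (reyn G A (dn i)))"
        using dn by (simp add: linear_on_sum[OF reyn_linear[OF A] zobj_subspace[OF A]]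
            vs.subspace_scale[OF zobj_subspace[OF A]] linear_on_scale[OF reyn_linear[OF A]])
      then show ?thesis using dn by (simp add: reyn_A vs.scale_sum_left)
    qed
    then have "fscale (\<Sum>i\<in>I. \<tau> (up i) * \<tau> (dn i)) u = fscale 1 u"
      by (simp add: dual_u reyn_id[OF A u_invs])
    then have "(\<Sum>i\<in>I. \<tau> (up i) * \<tau> (dn i)) = 1"
      using u_neq_0 by (simp only: vs.scale_cancel_right) simp
    finally show ?thesis by simp
  qed
  have ht: "h (fn (FJ M N) t) = t" if "t \<in> ?T" for t
  proof (rule tensor_ext[OF linear_on_comp[OF J'(5) h(1)] linear_on_id _ that])
    fix t assume "t \<in> ?T"
    then show "fn (FJ M N) t \<in> space (relQ M N)"
      using J'(4) invs_mem[OF zQ] by (auto simp: FO_def fst_rel_tensor[OF pM N])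
  qed (simp add: FJ_apply[OF pM pN] h_inv)
  show "t = 0" if "t \<in> ?T" "fn (FJ M N) t = 0" for t
    using ht[OF that(1)] that(2) linear_on_zero[OF h(1) zobj_subspace[OF zQ]] by simp
  let ?W = "fn (FJ M N) ` ?T"
  have W: "vs.subspace ?W" by (rule subspace_image[OF J'(5) subspace_tensor])
  show "FO (rel_tensor (ZG G) \<A> M N) \<subseteq> ?W"
  proof
    fix q assume "q \<in> FO (rel_tensor (ZG G) \<A> M N)"
    then have q: "q \<in> invs G (relQ M N)" by (simp add: FO_def fst_rel_tensor[OF pM N])
    let ?Q = "rel_tensor (ZG G) \<A> M N"
    note pQ = pre_rel_tensor[OF pM N] and fQ = fst_rel_tensor[OF pM N]
    \<comment> \<open>For invariants \<open>m\<close>, \<open>n\<close> the class of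
      \<open>m a \<otimes> n c\<close> is the class of \<open>m \<otimes> n\<close> times
      \<open>mul a c\<close>, and \<open>R\<close> turns the latter factor into the scalar
      \<open>\<tau> (mul a c)\<close>.\<close>
    have base: "reyn G (relQ M N) (rt M N (mact M m a) (mact N n c)) \<in> ?W"
      if m: "m \<in> invs G (fst M)" and n: "n \<in> invs G (fst N)" and a: "a \<in> space A" and c: "c \<in> space A" for m n a c
    proof -
      note mn = invs_mem[OF zM m] invs_mem[OF zN n]
      have ac: "mul a c \<in> space A" by (rule mul_facts(4)[OF a c])
      have "rt M N (mact M m a) (mact N n c) = mact ?Q (rt M N m n) (mul a c)"
        using mn a c ac by (simp add: rt_balanced[OF pM pN] mact_mem[OF pN] lact_mact[OF N] lact_inv[OF pN n]
            mact_assoc[OF N] mact_rel_tensor[OF pM N])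
      moreover have "reyn G (relQ M N) (mact ?Q (rt M N m n) (mul a c)) = mact ?Q (rt M N m n) (fscale (\<tau> (mul a c)) u)"
        using zmap_reyn[OF A zQ mact_inv_zmap[OF pQ, unfolded fQ, OF rt_invs[OF pM pN m n]] ac] reyn_A[OF ac] by simp
      moreover have "\<dots> = rt M N m (fscale (\<tau> (mul a c)) n)"
        using mn u_mem by (simp add: mact_rel_tensor[OF pM N] vs.subspace_scale[OF zobj_subspace[OF A]] mact_scale_u[OF N])
      moreover have "\<dots> = fn (FJ M N) (m \<otimes>\<^sub>v fscale (\<tau> (mul a c)) n)"
        using m n vs.subspace_scale[OF invs_subspace[OF zN] n] by (simp add: FJ_apply[OF pM pN] FO_def)
      ultimately show ?thesis
        using m vs.subspace_scale[OF invs_subspace[OF zN] n] by (simp add: FO_def vtensor_mem)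
    qed
    have lin1: "linear_on (space (fst N)) (\<lambda>n. reyn G (relQ M N) (rt M N m n))" if "m \<in> space (fst M)" for m
      using that rt_mem[OF pM pN] bilinear_onD(1)[OF rt_bilinear[OF pM pN]]
      by (intro linear_on_comp[OF _ reyn_linear[OF zQ]]) auto
    have lin2: "linear_on (space (fst M)) (\<lambda>m. reyn G (relQ M N) (rt M N m n))" if "n \<in> space (fst N)" for n
      using that rt_mem[OF pM pN] bilinear_onD(2)[OF rt_bilinear[OF pM pN]]
      by (intro linear_on_comp[OF _ reyn_linear[OF zQ]]) auto
    have "reyn G (relQ M N) (rt M N (mact M m a) n) \<in> ?W"
      if m: "m \<in> invs G (fst M)" and a: "a \<in> space A" and n: "n \<in> space (fst N)" for m a n
      by (rule free_mem[OF N lin1[OF mact_mem[OF pM invs_mem[OF zM m] a]] W _ n]) (rule base[OF m _ a])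
    then have "reyn G (relQ M N) (rt M N m n) \<in> ?W"
      if m: "m \<in> space (fst M)" and n: "n \<in> space (fst N)" for m n
      using n by (intro free_mem[OF M lin2[OF n] W _ m])
    then have "reyn G (relQ M N) q \<in> ?W"
      by (intro rel_mem[OF pM pN reyn_linear[OF zQ] W _ invs_mem[OF zQ q]])
    then show "q \<in> ?W" by (simp only: reyn_id[OF zQ q])
  qed
qed

section \<open>Full faithfulness\<close>

lemma FA_faithful:
  assumes M: "local_module (ZG G) \<A> M" and N: "local_module (ZG G) \<A> N"
    and f: "f \<in> module_hom_arrows (ZG G) \<A> M N" and g: "g \<in> module_hom_arrows (ZG G) \<A> M N"
    and eq: "FA f = FA g"
  shows "f = g"
proof (rule module_hom_eqI[OF lm_pre[OF M] lm_pre[OF N] f g])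
  note pM = lm_pre[OF M] and pN = lm_pre[OF N]
  note f' = module_homD[OF pM pN f] and g' = module_homD[OF pM pN g]
  fix m assume m: "m \<in> space (fst M)"
  show "fn (fn f) m = fn (fn g) m"
  proof (rule free_ext[OF M zmapD(2)[OF zhomD(4)[OF f'(3)]] zmapD(2)[OF zhomD(4)[OF g'(3)]] _ m])
    fix n a assume n: "n \<in> invs G (fst M)" and a: "a \<in> space A"
    have "fn (fn f) n = fn (fn g) n"
      using FA_hom(2)[OF pM pN f] FA_hom(2)[OF pM pN g] n eq by (simp add: FO_def)
    then show "fn (fn f) (mact M n a) = fn (fn g) (mact M n a)"
      using f'(4) g'(4) invs_mem[OF pm_zobj[OF pM] n] a by simp
  qed
qed

text \<open>The extension of \<open>\<phi>\<close> sends \<open>m\<close> to the sum of the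
  \<open>\<phi> (R (m (up i)))\<close> times \<open>dn i\<close>. The Casimir identity makes it
  linear over the algebra and \<open>dual_u\<close> makes it extend \<open>\<phi>\<close>;
  compatibility with grading and action is then tested on products \<open>n a\<close> with
  \<open>n\<close> invariant.\<close>

lemma FA_full:
  assumes M: "local_module (ZG G) \<A> M" and N: "local_module (ZG G) \<A> N"
    and \<phi>: "\<phi> \<in> Hom Vect (FO M) (FO N)"
  shows "\<exists>f\<in>module_hom_arrows (ZG G) \<A> M N. FA f = \<phi>"
proof -
  note pM = lm_pre[OF M] and pN = lm_pre[OF N]
  note zM = pm_zobj[OF pM] and zN = pm_zobj[OF pN]
  note \<phi>' = vhomD[OF \<phi>, unfolded FO_def]
  let ?p = "\<lambda>m a. fn \<phi> (reyn G (fst M) (mact M m a))"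
  define P where "P m = (\<Sum>i\<in>I. mact N (?p m (up i)) (dn i))" for m
  have p_inv: "?p m a \<in> invs G (fst N)" "?p m a \<in> space (fst N)" if "m \<in> space (fst M)" "a \<in> space A" for m a
    using \<phi>'(4)[OF reyn_invs[OF zM mact_mem[OF pM that]]] invs_mem[OF zN] by blast+
  have p_lin: "linear_on (space A) (?p m)" if "m \<in> space (fst M)" for m
    using that mact_mem[OF pM] reyn_invs[OF zM]
    by (intro linear_on_comp[OF linear_on_comp[OF mact_linear(1)[OF pM] reyn_linear[OF zM]] \<phi>'(5)]) auto
  have p_lin': "linear_on (space (fst M)) (\<lambda>m. ?p m a)" if "a \<in> space A" for a
    using that mact_mem[OF pM] reyn_invs[OF zM]
    by (intro linear_on_comp[OF linear_on_comp[OF mact_linear(2)[OF pM] reyn_linear[OF zM]] \<phi>'(5)]) auto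
  have P_lin: "linear_on (space (fst M)) P"
    unfolding P_def[abs_def] using p_inv(2) up dn
    by (intro linear_on_sum_fun linear_on_comp[OF p_lin' mact_linear(2)[OF pN]]) auto
  have P_mem: "P m \<in> space (fst N)" if "m \<in> space (fst M)" for m
    unfolding P_def using p_inv(2) up dn that by (intro vs.subspace_sum[OF zobj_subspace[OF zN]] mact_mem[OF pN]) auto
  have P_inv: "P n = fn \<phi> n" if n: "n \<in> invs G (fst M)" for n
  proof -
    note nm = invs_mem[OF zM n]
    have \<phi>n: "fn \<phi> n \<in> space (fst N)" using \<phi>'(4)[OF n] invs_mem[OF zN] by blast
    have "P n = (\<Sum>i\<in>I. mact N (fn \<phi> n) (fscale (\<tau> (up i)) (dn i)))"
      unfolding P_def
      by (rule sum.cong) (simp_all add: up dn reyn_mact[OF M n] linear_on_scale[OF \<phi>'(5) n]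
          linear_on_scale[OF mact_linear(2)[OF pN] \<phi>n] linear_on_scale[OF mact_linear(1)[OF pN \<phi>n]])
    also have "\<dots> = mact N (fn \<phi> n) (\<Sum>i\<in>I. fscale (\<tau> (up i)) (dn i))"
      using dn by (simp add: linear_on_sum[OF mact_linear(1)[OF pN \<phi>n] zobj_subspace[OF A]]
          vs.subspace_scale[OF zobj_subspace[OF A]])
    finally show ?thesis by (simp add: dual_u mact_unit[OF N \<phi>n])
  qed
  have P_act: "P (mact M m b) = mact N (P m) b" if m: "m \<in> space (fst M)" and b: "b \<in> space A" for m b
  proof -
    have bil: "bilinear_on (space A) (space A) (\<lambda>x y. mact N (?p m x) y)"
      using m p_inv(2) by (intro bilinear_onI linear_on_comp[OF p_lin mact_linear(2)[OF pN]] mact_linear(1)[OF pN]) auto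
    have "P (mact M m b) = (\<Sum>i\<in>I. mact N (?p m (mul b (up i))) (dn i))"
      unfolding P_def by (rule sum.cong) (simp_all add: mact_assoc[OF M] m b up)
    also have "\<dots> = (\<Sum>i\<in>I. mact N (?p m (up i)) (mul (dn i) b))"
      by (rule casimir_bilinear[OF bil b])
    also have "\<dots> = (\<Sum>i\<in>I. mact N (mact N (?p m (up i)) (dn i)) b)"
      by (rule sum.cong) (simp_all add: mact_assoc[OF N] p_inv m b up dn)
    also have "\<dots> = mact N (P m) b"
      unfolding P_def using p_inv(2)[OF m up] dn
      by (simp add: linear_on_sum[OF mact_linear(2)[OF pN b] zobj_subspace[OF zN]] mact_mem[OF pN])
    finally show ?thesis .
  qed
  have P_free: "P (mact M n a) = mact N (fn \<phi> n) a" if "n \<in> invs G (fst M)" "a \<in> space A" for n a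
    using P_act[OF invs_mem[OF zM that(1)] that(2)] P_inv[OF that(1)] by simp
  have P_comp: "zcomp G (fst N) x (P m) = P (zcomp G (fst M) x m)"
    if x: "x \<in> carrier G" and m: "m \<in> space (fst M)" for x m
  proof (rule free_ext[OF M linear_on_comp[OF P_lin zcomp_linear[OF zN x] P_mem]
        linear_on_comp[OF zcomp_linear[OF zM x] P_lin zcomp_mem[OF zM x]] _ m])
    fix n a assume n: "n \<in> invs G (fst M)" and a: "a \<in> space A"
    show "zcomp G (fst N) x (P (mact M n a)) = P (zcomp G (fst M) x (mact M n a))"
      using zcomp_zmap[OF A zM mact_inv_zmap[OF pM n] a x]
        zcomp_zmap[OF A zN mact_inv_zmap[OF pN \<phi>'(4)[OF n]] a x]
      by (simp add: P_free n a zcomp_mem[OF A x])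
  qed
  have P_eqv: "P (act (fst M) g m) = act (fst N) g (P m)" if g: "g \<in> carrier G" and m: "m \<in> space (fst M)" for g m
  proof (rule free_ext[OF M linear_on_comp[OF act_linear[OF zM g] P_lin act_mem[OF zM g]]
        linear_on_comp[OF P_lin act_linear[OF zN g] P_mem] _ m])
    fix n a assume n: "n \<in> invs G (fst M)" and a: "a \<in> space A"
    show "P (act (fst M) g (mact M n a)) = act (fst N) g (P (mact M n a))"
      using zmapD(4)[OF mact_inv_zmap[OF pM n] g a, symmetric]
        zmapD(4)[OF mact_inv_zmap[OF pN \<phi>'(4)[OF n]] g a, symmetric]
      by (simp add: P_free n a act_mem[OF A g])
  qed
  have P_deg: "P m \<in> deg (fst N) x" if x: "x \<in> carrier G" and m: "m \<in> deg (fst M) x" for x m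
    using P_comp[OF x deg_in_space[OF zM x m]] zcomp_homogeneous[OF zM x x m]
      zcomp_deg[OF zN P_mem[OF deg_in_space[OF zM x m]] x] by simp
  have zP: "zmap G (fst M) (fst N) P"
    unfolding zmap_def using P_lin P_mem P_deg P_eqv by auto
  let ?f = "Arrow M N (Arrow (fst M) (fst N) (restrict P (space (fst M))))"
  have f: "?f \<in> module_hom_arrows (ZG G) \<A> M N"
    by (rule module_homI[OF pM pN restrict_zhom[OF zM zP]]) (simp add: mact_mem[OF pM] P_act)
  have "FA ?f = \<phi>"
    by (rule vhom_eqI[OF FA_hom(1)[OF pM pN f] \<phi>])
      (simp add: FA_hom(2)[OF pM pN f] FO_mem[OF pM] P_inv[unfolded FO_def[symmetric]] FO_def P_inv invs_mem[OF zM])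
  then show ?thesis using f by blast
qed

section \<open>Essential surjectivity\<close>

definition ztriv :: "'k vec set \<Rightarrow> ('a, 'k) zobj" where
  "ztriv V = \<lparr>space = V, deg = (\<lambda>g. if g = \<one> then V else {0}), act = (\<lambda>g x. x)\<rparr>"

lemma ztriv_zobj:
  assumes V: "fd_space V"
  shows "is_zobj G (ztriv V)"
proof (rule is_zobjI[where p = "\<lambda>g x. if g = \<one> then x else 0"])
  fix f g x assume fg: "f \<in> carrier G" "g \<in> carrier G" and x: "x \<in> deg (ztriv V) g"
  have "f \<otimes> g \<otimes> inv f = \<one> \<longleftrightarrow> g = \<one>"
    using fg by (metis inv_closed inv_equality inv_inv l_one m_assoc m_closed r_inv r_one)
  then show "act (ztriv V) f x \<in> deg (ztriv V) (f \<otimes> g \<otimes> inv f)" using x by (simp add: ztriv_def)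
next
  fix g
  show "linear_on (space (ztriv V)) (\<lambda>x. if g = \<one> then x else 0)"
    by (cases "g = \<one>") (simp_all add: linear_on_id linear_on_const_zero)
qed (use V fd_subspace[OF V] vs.subspace_0[OF fd_subspace[OF V]] fin in
    \<open>auto simp: ztriv_def linear_on_id split: if_splits\<close>)

text \<open>The free module on \<open>V\<close>, placed in degree \<open>e\<close> with trivial
  action, has a copy of \<open>V\<close> as invariants: \<open>R\<close> sends
  \<open>v \<otimes> a\<close> to \<open>v \<otimes> u\<close> scaled by
  \<open>\<tau> a\<close>.\<close>

lemma FA_ess_surj:
  assumes V: "fd_space V"
  shows "\<exists>M\<in>{M. local_module (ZG G) \<A> M}. \<exists>e. iso_arrow Vect (FO M) V e"
proof -
  let ?V = "ztriv V"
  note zV = ztriv_zobj[OF V] and AA = is_zobj_tensor[OF A A]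
  note VA = is_zobj_tensor[OF zV A]
  note VAA = is_zobj_tensor[OF VA A]
  note i = tens_zhom[OF zV AA zV A id_zhom(1)[OF zV] mult_zhom] and as = assoc_zhom[OF zV A A]
  note c = comp_zhom[OF VAA as(1) i(1)]
  have sV: "space ?V = V" by (simp add: ztriv_def)
  let ?\<nu> = "comp (ZG G) (tens_arr (ZG G) (ident (ZG G) ?V) (alg_mult \<A>)) (assoc (ZG G) ?V A A)"
  define M where "M = (ztensor G ?V A, ?\<nu>)"
  have fM: "fst M = ztensor G ?V A" by (simp add: M_def)
  have pM: "pre_module M" unfolding pre_module_def M_def fst_conv snd_conv using VA c(1) by blast
  have ma: "mact M (v \<otimes>\<^sub>v a) b = v \<otimes>\<^sub>v mul a b" if "v \<in> V" "a \<in> space A" "b \<in> space A" for v a b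
    using that c(2)[of "(v \<otimes>\<^sub>v a) \<otimes>\<^sub>v b"] as(2)[of v a b] i(2)[of v "a \<otimes>\<^sub>v b"] id_zhom(2)[OF zV, of v]
    by (simp add: mact_def M_def sV vtensor_mem del: ZG_arrows)
  have lm: "linear_on (tensor_space V (space A)) (\<lambda>t. mact M t b)" if "b \<in> space A" for b
    using mact_linear(2)[OF pM that] by (simp add: fM sV)
  have mm: "mact M t b \<in> tensor_space V (space A)" if "t \<in> tensor_space V (space A)" "b \<in> space A" for t b
    using mact_mem[OF pM _ that(2), of t] that(1) by (simp add: fM sV)
  have assoc: "mact M (mact M t a) b = mact M t (mul a b)"
    if t: "t \<in> tensor_space V (space A)" and a: "a \<in> space A" and b: "b \<in> space A" for t a b
  proof (rule tensor_ext[OF linear_on_comp[OF lm[OF a] lm[OF b] mm[OF _ a]] lm[OF mul_facts(4)[OF a b]] _ t])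
    fix v c assume v: "v \<in> V" and c: "c \<in> space A"
    show "mact M (mact M (v \<otimes>\<^sub>v c) a) b = mact M (v \<otimes>\<^sub>v c) (mul a b)"
      unfolding ma[OF v c a] ma[OF v mul_facts(4)[OF c a] b] ma[OF v c mul_facts(4)[OF a b]] mul_assoc[OF c a b] ..
  qed
  have unit: "mact M t u = t" if t: "t \<in> tensor_space V (space A)" for t
    by (rule tensor_ext[OF lm[OF u_mem] linear_on_id _ t]) (simp add: ma u_mem mul_unit)
  have local: "mact M (act (fst M) (x \<otimes> y \<otimes> inv x) m) (act A x a) = mact M m a"
    if x: "x \<in> carrier G" and y: "y \<in> carrier G" and m: "m \<in> deg (fst M) x" and a: "a \<in> deg A y" for x y m a
  proof -
    have xy: "x \<otimes> y \<otimes> inv x \<in> carrier G" using x y by simp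
    have aA: "a \<in> space A" "act A x a \<in> space A" using deg_in_space[OF A y a] act_mem[OF A x] by auto
    let ?S = "{v \<otimes>\<^sub>v b | v b p q. p \<in> carrier G \<and> q \<in> carrier G \<and> p \<otimes> q = x \<and> v \<in> deg ?V p \<and> b \<in> deg A q}"
    have deg: "deg (fst M) x = vs.span ?S" by (simp add: fM ztensor_def)
    have sub: "deg (fst M) x \<subseteq> space (fst M)" using deg_in_space[OF pm_zobj[OF pM] x] by blast
    have l1: "linear_on (space (fst M)) (\<lambda>m. mact M (act (fst M) (x \<otimes> y \<otimes> inv x) m) (act A x a))"
      using act_mem[OF pm_zobj[OF pM] xy]
      by (intro linear_on_comp[OF act_linear[OF pm_zobj[OF pM] xy] mact_linear(2)[OF pM aA(2)]])
    show ?thesis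
    proof (rule linear_on_eq_span[OF linear_on_subset[OF l1 sub, unfolded deg]
          linear_on_subset[OF mact_linear(2)[OF pM aA(1)] sub, unfolded deg] _ m[unfolded deg]])
      fix s assume "s \<in> ?S"
      then obtain v b p q where s: "s = v \<otimes>\<^sub>v b" "p \<in> carrier G" "q \<in> carrier G" "p \<otimes> q = x" "v \<in> deg ?V p" "b \<in> deg A q"
        by blast
      have v: "v \<in> V" using s(2,5) deg_in_space[OF zV] sV by blast
      have b: "b \<in> space A" using s deg_in_space[OF A] by blast
      have act_s: "act (fst M) g s = v \<otimes>\<^sub>v act A g b" if "g \<in> carrier G" for g
        using tensor_map_apply[OF zobj_fd[OF zV] zobj_fd[OF A] act_linear[OF zV that] act_linear[OF A that], of v b]
          v b s(1) by (simp add: fM sV) (simp add: ztriv_def)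
      show "mact M (act (fst M) (x \<otimes> y \<otimes> inv x) s) (act A x a) = mact M s a"
      \<comment> \<open>Only \<open>p = \<one>\<close> carries nonzero vectors of \<open>V\<close>;
        then \<open>b\<close> has the full degree \<open>x\<close> and locality is that of the
        regular module.\<close>
      proof (cases "p = \<one>")
        case True
        then have "b \<in> deg A x" using s by simp
        then have "mul (act A (x \<otimes> y \<otimes> inv x) b) (act A x a) = mul b a"
          using mact_local[OF regular_local x y, of b a] a unfolding mact_regular by (simp add: regular_module_def)
        then show ?thesis
          unfolding act_s[OF xy] unfolding s(1) using v b aA act_mem[OF A xy] by (simp add: ma)
      next
        case False
        then have "v = 0" using s(5) by (simp add: ztriv_def)
        then show ?thesis unfolding act_s[OF xy] unfolding s(1)
          by (simp add: linear_on_zero[OF mact_linear(2)[OF pM] zobj_subspace[OF pm_zobj[OF pM]]] aA)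
      qed
    qed
  qed
  have M: "local_module (ZG G) \<A> M"
    unfolding local_module_iff right_module_iff using pM assoc unit local by (simp add: fM sV)
  let ?e = "Arrow V (FO M) (restrict (\<lambda>v. v \<otimes>\<^sub>v u) V)"
  have lin_e: "linear_on V (\<lambda>v. v \<otimes>\<^sub>v u)"
    by (rule linear_onI) (simp_all add: vtensor_add_left vtensor_scale_left)
  have za: "zmap G A (ztensor G ?V A) (\<lambda>a. v \<otimes>\<^sub>v a)" if v: "v \<in> V" for v
  proof -
    have "v \<in> deg ?V \<one>" using v by (simp add: ztriv_def)
    then have "v \<otimes>\<^sub>v a \<in> deg (ztensor G ?V A) g" if "g \<in> carrier G" "a \<in> deg A g" for g a
      using ztensor_deg[OF one_closed that(1) _ that(2), of v ?V] that by simp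
    moreover have "v \<otimes>\<^sub>v act A g a = act (ztensor G ?V A) g (v \<otimes>\<^sub>v a)" if "g \<in> carrier G" "a \<in> space A" for g a
      using tensor_map_apply[OF zobj_fd[OF zV] zobj_fd[OF A] act_linear[OF zV that(1)] act_linear[OF A that(1)], of v a]
        v that by (simp add: sV) (simp add: ztriv_def)
    ultimately show ?thesis
      unfolding zmap_def using v by (auto simp: sV vtensor_mem vtensor_add_right vtensor_scale_right intro!: linear_onI)
  qed
  have e: "?e \<in> Hom Vect V (FO M)"
    unfolding vhom_iff using lin_e linear_on_restrict[OF fd_subspace[OF V]] zmap_invs[OF A za u_invs]
    by (auto simp: FO_def fM)
  have "iso_arrow Vect V (FO M) ?e"
  proof (rule vect_isoI[OF V e])
    fix v assume "v \<in> V" "fn ?e v = 0"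
    then show "v = 0" using vtensor_eq_0[of v u] u_neq_0 by simp
  next
    have W: "vs.subspace ((\<lambda>v. v \<otimes>\<^sub>v u) ` V)" by (rule subspace_image[OF lin_e fd_subspace[OF V]])
    show "FO M \<subseteq> fn ?e ` V"
    proof
      fix q assume "q \<in> FO M"
      then have q: "q \<in> invs G (ztensor G ?V A)" by (simp add: FO_def fM)
      then have qT: "q \<in> tensor_space V (space A)" using invs_mem[OF VA] by (simp add: sV)
      have "reyn G (ztensor G ?V A) q \<in> (\<lambda>v. v \<otimes>\<^sub>v u) ` V"
      proof (rule tensor_mem[OF _ W _ qT])
        show "linear_on (tensor_space V (space A)) (reyn G (ztensor G ?V A))"
          using reyn_linear[OF VA] by (simp add: sV)
        fix v a assume v: "v \<in> V" and a: "a \<in> space A"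
        have "reyn G (ztensor G ?V A) (v \<otimes>\<^sub>v a) = v \<otimes>\<^sub>v fscale (\<tau> a) u"
          using zmap_reyn[OF A VA za[OF v] a] reyn_A[OF a] by simp
        also have "\<dots> = fscale (\<tau> a) v \<otimes>\<^sub>v u" by (simp add: vtensor_scale_left vtensor_scale_right)
        finally show "reyn G (ztensor G ?V A) (v \<otimes>\<^sub>v a) \<in> (\<lambda>v. v \<otimes>\<^sub>v u) ` V"
          using vs.subspace_scale[OF fd_subspace[OF V] v] by blast
      qed
      then show "q \<in> fn ?e ` V" using reyn_id[OF VA q] by auto
    qed
  qed
  then show ?thesis using M unfolding iso_arrow_def inverse_arrows_def by blast
qed

end

section \<open>Coherence of the functor of invariants\<close>

context triv_algebra
begin

lemma FA_functorial: "functorial LM Vect FO FA"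
  unfolding functorial_def
proof (intro conjI ballI)
  fix X assume "X \<in> obj LM"
  then have X: "pre_module X" using lm_pre by simp
  show "FO X \<in> obj Vect" using FO_fd[OF X] by simp
  show "FA (ident LM X) = ident Vect (FO X)"
    by (rule vhom_eqI[OF FA_hom(1)[OF X X LM_ident(1)[OF X]] vident(1)[OF FO_fd[OF X]]])
      (simp only: FA_hom(2)[OF X X LM_ident(1)[OF X]] vident(2)[OF FO_fd[OF X]] LM_ident(2)[OF X] FO_mem[OF X])
next
  fix X Y f assume "X \<in> obj LM" "Y \<in> obj LM" "f \<in> Hom LM X Y"
  then show "FA f \<in> Hom Vect (FO X) (FO Y)" using FA_hom(1) lm_pre by simp
next
  fix X Y Z f g assume "X \<in> obj LM" "Y \<in> obj LM" "Z \<in> obj LM" "f \<in> Hom LM X Y" "g \<in> Hom LM Y Z"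
  then have X: "pre_module X" and Y: "pre_module Y" and Z: "pre_module Z"
    and f: "f \<in> module_hom_arrows (ZG G) \<A> X Y" and g: "g \<in> module_hom_arrows (ZG G) \<A> Y Z"
    using lm_pre by simp_all
  note c = LM_comp[OF X Y Z f g]
  note Ff = FA_hom[OF X Y f] and Fg = FA_hom[OF Y Z g] and Fc = FA_hom[OF X Z c(1)]
  note vc = vcomp[OF Ff(1) Fg(1) FO_fd[OF X]]
  show "FA (comp LM g f) = comp Vect (FA g) (FA f)"
  proof (rule vhom_eqI[OF Fc(1) vc(1)])
    fix m assume m: "m \<in> FO X"
    show "fn (FA (comp LM g f)) m = fn (comp Vect (FA g) (FA f)) m"
      unfolding Fc(2)[OF m] vc(2)[OF m] c(2)[OF FO_mem[OF X m]]
      using Ff(2)[OF m] Fg(2)[of "fn (FA f) m"] vhomD(4)[OF Ff(1) m] by simp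
  qed
qed

lemma FJ0_iso: "iso_arrow Vect unit_space (FO (regular_module \<A>)) FJ0"
  and FJ0_hom: "FJ0 \<in> Hom Vect unit_space (FO (regular_module \<A>))"
  and FJ0_apply: "c \<in> unit_space \<Longrightarrow> fn FJ0 c = fscale (c 0) u"
proof -
  have R: "FO (regular_module \<A>) = invs G A" by (simp add: FO_def regular_module_def)
  have ap: "fn (alg_unit \<A>) c = fscale (c 0) u" if "c \<in> unit_space" for c
    using unit_coeff[OF that] linear_on_scale[OF zmapD(2)[OF unit_zmap], of one_vec "c 0"] by simp
  show ap': "fn FJ0 c = fscale (c 0) u" if "c \<in> unit_space" for c
    using ap[OF that] that by (simp add: FJ0_def)
  have mem: "fn (alg_unit \<A>) c \<in> invs G A" if "c \<in> unit_space" for c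
    unfolding ap[OF that] by (rule vs.subspace_scale[OF invs_subspace[OF A] u_invs])
  have lin: "linear_on unit_space (fn (alg_unit \<A>))"
    using zmapD(2)[OF unit_zmap] by simp
  show J0: "FJ0 \<in> Hom Vect unit_space (FO (regular_module \<A>))"
    unfolding vhom_iff FJ0_def R
    using lin mem linear_on_restrict[OF fd_subspace[OF fd_unit]] by auto
  show "iso_arrow Vect unit_space (FO (regular_module \<A>)) FJ0"
  proof (rule vect_isoI[OF fd_unit J0])
    fix c :: "'k vec" assume c: "c \<in> unit_space" "fn FJ0 c = 0"
    then have "c 0 = 0" using ap' u_neq_0 by simp
    then show "c = 0" using unit_coeff[OF c(1)] by simp
  next
    show "FO (regular_module \<A>) \<subseteq> fn FJ0 ` unit_space"
    proof
      fix a assume "a \<in> FO (regular_module \<A>)"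
      then obtain c where c: "a = fscale c u" using invs_A R by blast
      have "fscale c one_vec \<in> unit_space" by (auto simp: unit_space_iff)
      then show "a \<in> fn FJ0 ` unit_space"
        using ap'[of "fscale c one_vec"] c by (auto simp: fscale_eval intro!: image_eqI)
    qed
  qed
qed

lemma FA_FJ_natural:
  assumes X: "local_module (ZG G) \<A> X" and X': "local_module (ZG G) \<A> X'"
    and Y: "local_module (ZG G) \<A> Y" and Y': "local_module (ZG G) \<A> Y'"
    and f: "f \<in> module_hom_arrows (ZG G) \<A> X X'" and g: "g \<in> module_hom_arrows (ZG G) \<A> Y Y'"
  shows "comp Vect (FA (rel_tensor_arr (ZG G) \<A> f g)) (FJ X Y) = comp Vect (FJ X' Y') (tens_arr Vect (FA f) (FA g))"
proof -
  note pX = lm_pre[OF X] and pX' = lm_pre[OF X'] and pY = lm_pre[OF Y] and pY' = lm_pre[OF Y']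
  note r = rel_tensor_arr_apply[OF pX pX' pY pY' f g]
  note o = fst_rel_tensor[OF pX Y] fst_rel_tensor[OF pX' Y']
  have arr: "rel_tensor_arr (ZG G) \<A> f g = Arrow (rel_tensor (ZG G) \<A> X Y) (rel_tensor (ZG G) \<A> X' Y') (fn (rel_tensor_arr (ZG G) \<A> f g))"
    unfolding rel_tensor_arr_def using module_homD(1,2)[OF pX pX' f] module_homD(1,2)[OF pY pY' g] by simp
  note Fr = FA_arrow[of "rel_tensor (ZG G) \<A> X Y" _ "rel_tensor (ZG G) \<A> X' Y'", unfolded o, OF rel_zobj[OF pX pY] conjunct1[OF r], folded arr]
  note J = FJ_hom[OF pX pY] and J' = FJ_hom[OF pX' pY'] and Ff = FA_hom[OF pX pX' f] and Fg = FA_hom[OF pY pY' g]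
  note fd = FO_fd[OF pX] FO_fd[OF pY]
  note t = vtens[OF Ff(1) Fg(1) fd] and fdT = fd_tensor[OF fd]
  note c1 = vcomp[OF J(1) Fr(1) fdT] and c2 = vcomp[OF t(1) J'(1) fdT]
  show ?thesis
  proof (rule vhom_tensor_eqI[OF c1(1) c2(1)])
    fix m n assume m: "m \<in> FO X" and n: "n \<in> FO Y"
    note mn = vtensor_mem[OF m n]
    have "rt X Y m n \<in> FO (rel_tensor (ZG G) \<A> X Y)"
      using rt_invs[OF pX pY] m n by (simp add: FO_def o)
    then have "fn (FA (rel_tensor_arr (ZG G) \<A> f g)) (rt X Y m n) = rt X' Y' (fn (fn f) m) (fn (fn g) n)"
      using Fr(2) r FO_mem[OF pX m] FO_mem[OF pY n] by simp
    then show "fn (comp Vect (FA (rel_tensor_arr (ZG G) \<A> f g)) (FJ X Y)) (m \<otimes>\<^sub>v n) =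
      fn (comp Vect (FJ X' Y') (tens_arr Vect (FA f) (FA g))) (m \<otimes>\<^sub>v n)"
      unfolding c1(2)[OF mn] c2(2)[OF mn] J(2)[OF m n] t(2)[OF m n]
      using J'(2)[OF vhomD(4)[OF Ff(1) m] vhomD(4)[OF Fg(1) n]] Ff(2)[OF m] Fg(2)[OF n] by simp
  qed
qed

text \<open>Evaluated on invariants, both sides send \<open>(x \<otimes> y) \<otimes> z\<close> to
  the class of \<open>x \<otimes> (y \<otimes> z)\<close>.\<close>

lemma FA_FJ_assoc:
  assumes X: "local_module (ZG G) \<A> X" and Y: "local_module (ZG G) \<A> Y" and Z: "local_module (ZG G) \<A> Z"
  defines "XY \<equiv> rel_tensor (ZG G) \<A> X Y" and "YZ \<equiv> rel_tensor (ZG G) \<A> Y Z"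
  shows "comp Vect (FA (rel_assoc (ZG G) \<A> X Y Z)) (comp Vect (FJ XY Z) (tens_arr Vect (FJ X Y) (ident Vect (FO Z)))) =
    comp Vect (FJ X YZ) (comp Vect (tens_arr Vect (ident Vect (FO X)) (FJ Y Z)) (assoc Vect (FO X) (FO Y) (FO Z)))"
proof -
  note pX = lm_pre[OF X] and pY = lm_pre[OF Y] and pZ = lm_pre[OF Z]
  note pXY = pre_rel_tensor[OF pX Y, folded XY_def] and pYZ = pre_rel_tensor[OF pY Z, folded YZ_def]
  note r = rel_assoc_apply[OF pX Y Z, folded XY_def YZ_def]
  let ?S = "rel_tensor (ZG G) \<A> XY Z" and ?T = "rel_tensor (ZG G) \<A> X YZ"
  have oS: "fst ?S = relQ XY Z" and oT: "fst ?T = relQ X YZ" by (simp_all add: rel_tensor_def Let_def)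
  have arr: "rel_assoc (ZG G) \<A> X Y Z = Arrow ?S ?T (fn (rel_assoc (ZG G) \<A> X Y Z))"
    by (simp add: rel_assoc_def Let_def XY_def YZ_def)
  note Fr = FA_arrow[of ?S "fn (rel_assoc (ZG G) \<A> X Y Z)" ?T, unfolded oS oT, OF rel_zobj[OF pXY pZ] conjunct1[OF r], folded arr]
  note fd = FO_fd[OF pX] FO_fd[OF pY] FO_fd[OF pZ]
  note fdXY = fd_tensor[OF fd(1,2)] and fdYZ = fd_tensor[OF fd(2,3)]
  note fdL = fd_tensor[OF fdXY fd(3)]
  note J1 = FJ_hom[OF pX pY, folded XY_def] and J2 = FJ_hom[OF pXY pZ] and J3 = FJ_hom[OF pY pZ, folded YZ_def] and J4 = FJ_hom[OF pX pYZ]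
  note l1 = vtens[OF J1(1) vident(1)[OF fd(3)] fdXY fd(3)]
  note l2 = vcomp[OF l1(1) J2(1) fdL]
  note l3 = vcomp[OF l2(1) Fr(1) fdL]
  note as = vassoc[OF fd]
  note r1 = vtens[OF vident(1)[OF fd(1)] J3(1) fd(1) fdYZ]
  note r2 = vcomp[OF as(1) r1(1) fdL]
  note r3 = vcomp[OF r2(1) J4(1) fdL]
  show ?thesis
  proof (rule vhom_tensor3_eqI[OF l3(1) r3(1)])
    fix x y z assume x: "x \<in> FO X" and y: "y \<in> FO Y" and z: "z \<in> FO Z"
    note xy = vtensor_mem[OF x y] and yz = vtensor_mem[OF y z]
    note t = vtensor_mem[OF xy z]
    have rxy: "rt X Y x y \<in> FO XY" using rt_invs[OF pX pY] x y by (simp add: XY_def FO_rel_tensor) (simp add: FO_def)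
    have ryz: "rt Y Z y z \<in> FO YZ" using rt_invs[OF pY pZ] y z by (simp add: YZ_def FO_rel_tensor) (simp add: FO_def)
    have rxyz: "rt XY Z (rt X Y x y) z \<in> FO ?S"
      using rt_invs[OF pXY pZ] rxy z by (simp add: FO_rel_tensor) (simp add: FO_def)
    show "fn (comp Vect (FA (rel_assoc (ZG G) \<A> X Y Z)) (comp Vect (FJ XY Z) (tens_arr Vect (FJ X Y) (ident Vect (FO Z))))) ((x \<otimes>\<^sub>v y) \<otimes>\<^sub>v z) =
      fn (comp Vect (FJ X YZ) (comp Vect (tens_arr Vect (ident Vect (FO X)) (FJ Y Z)) (assoc Vect (FO X) (FO Y) (FO Z)))) ((x \<otimes>\<^sub>v y) \<otimes>\<^sub>v z)"
      unfolding l3(2)[OF t] l2(2)[OF t] l1(2)[OF xy z] r3(2)[OF t] r2(2)[OF t] as(2)[OF x y z] r1(2)[OF x yz]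
        J1(2)[OF x y] J3(2)[OF y z] vident(2)[OF fd(1) x] vident(2)[OF fd(3) z] J2(2)[OF rxy z] J4(2)[OF x ryz] Fr(2)[OF rxyz]
      using r FO_mem[OF pX x] FO_mem[OF pY y] FO_mem[OF pZ z] by blast
  qed
qed

text \<open>On invariants the left and the right action agree, so both unit constraints come down to
  multiplication by the scalar \<open>c 0\<close>.\<close>

lemma FA_FJ_unit:
  assumes X: "local_module (ZG G) \<A> X"
  defines "R \<equiv> regular_module \<A>"
  shows "comp Vect (FA (rel_lunit (ZG G) \<A> X)) (comp Vect (FJ R X) (tens_arr Vect FJ0 (ident Vect (FO X)))) = lunit Vect (FO X)"
    and "comp Vect (FA (rel_runit (ZG G) \<A> X)) (comp Vect (FJ X R) (tens_arr Vect (ident Vect (FO X)) FJ0)) = runit Vect (FO X)"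
proof -
  note pX = lm_pre[OF X]
  note lR = regular_local[folded R_def]
  note pR = lm_pre[OF lR]
  have oR: "fst R = A" by (simp add: R_def regular_module_def)
  note l = rel_lunit_apply[OF X, folded R_def] and r = rel_runit_apply[OF X, folded R_def]
  let ?S = "rel_tensor (ZG G) \<A> R X" and ?T = "rel_tensor (ZG G) \<A> X R"
  have oS: "fst ?S = relQ R X" and oT: "fst ?T = relQ X R" by (simp_all add: rel_tensor_def Let_def)
  have arl: "rel_lunit (ZG G) \<A> X = Arrow ?S X (fn (rel_lunit (ZG G) \<A> X))"
    and arr: "rel_runit (ZG G) \<A> X = Arrow ?T X (fn (rel_runit (ZG G) \<A> X))"
    by (simp_all add: rel_lunit_def rel_runit_def R_def)
  note Fl = FA_arrow[of ?S "fn (rel_lunit (ZG G) \<A> X)" X, unfolded oS, OF rel_zobj[OF pR pX] conjunct1[OF l], folded arl]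
  note Fr = FA_arrow[of ?T "fn (rel_runit (ZG G) \<A> X)" X, unfolded oT, OF rel_zobj[OF pX pR] conjunct1[OF r], folded arr]
  note fX = FO_fd[OF pX]
  note J1 = FJ_hom[OF pR pX] and J2 = FJ_hom[OF pX pR] and J0 = FJ0_hom[folded R_def]
  note fl = fd_tensor[OF fd_unit fX] and fr = fd_tensor[OF fX fd_unit]
  note l1 = vtens[OF J0 vident(1)[OF fX] fd_unit fX]
  note l2 = vcomp[OF l1(1) J1(1) fl]
  note l3 = vcomp[OF l2(1) Fl(1) fl]
  note r1 = vtens[OF vident(1)[OF fX] J0 fX fd_unit]
  note r2 = vcomp[OF r1(1) J2(1) fr]
  note r3 = vcomp[OF r2(1) Fr(1) fr]
  have cu: "fscale c u \<in> FO R" "fscale c u \<in> space A" for c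
    using u_invs u_mem by (simp_all add: FO_def oR vs.subspace_scale[OF invs_subspace[OF A]] vs.subspace_scale[OF zobj_subspace[OF A]])
  have uact: "mact X x (fscale c u) = fscale c x" if "x \<in> FO X" for c x
    using mact_scale_u[OF X FO_mem[OF pX that]] .
  show "comp Vect (FA (rel_lunit (ZG G) \<A> X)) (comp Vect (FJ R X) (tens_arr Vect FJ0 (ident Vect (FO X)))) = lunit Vect (FO X)"
  proof (rule vhom_tensor_eqI[OF l3(1) vunit(1)[OF fX]])
    fix c :: "'k vec" and x assume c: "c \<in> unit_space" and x: "x \<in> FO X"
    note t = vtensor_mem[OF c x]
    have "rt R X (fscale (c 0) u) x \<in> FO ?S"
      using rt_invs[OF pR pX] cu x by (simp add: FO_rel_tensor) (simp add: FO_def)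
    then show "fn (comp Vect (FA (rel_lunit (ZG G) \<A> X)) (comp Vect (FJ R X) (tens_arr Vect FJ0 (ident Vect (FO X))))) (c \<otimes>\<^sub>v x) =
      fn (lunit Vect (FO X)) (c \<otimes>\<^sub>v x)"
      unfolding l3(2)[OF t] l2(2)[OF t] l1(2)[OF c x] FJ0_apply[OF c] vident(2)[OF fX x] J1(2)[OF cu(1) x] vunit(2)[OF fX c x]
      using l FO_mem[OF pX x] cu lact_inv[OF pX _ cu(2)] x uact by (simp add: Fl(2)) (simp add: FO_def)
  qed
  show "comp Vect (FA (rel_runit (ZG G) \<A> X)) (comp Vect (FJ X R) (tens_arr Vect (ident Vect (FO X)) FJ0)) = runit Vect (FO X)"
  proof (rule vhom_tensor_eqI[OF r3(1) vunit(3)[OF fX]])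
    fix x and c :: "'k vec" assume x: "x \<in> FO X" and c: "c \<in> unit_space"
    note t = vtensor_mem[OF x c]
    have "rt X R x (fscale (c 0) u) \<in> FO ?T"
      using rt_invs[OF pX pR] cu x by (simp add: FO_rel_tensor) (simp add: FO_def)
    then show "fn (comp Vect (FA (rel_runit (ZG G) \<A> X)) (comp Vect (FJ X R) (tens_arr Vect (ident Vect (FO X)) FJ0))) (x \<otimes>\<^sub>v c) =
      fn (runit Vect (FO X)) (x \<otimes>\<^sub>v c)"
      unfolding r3(2)[OF t] r2(2)[OF t] r1(2)[OF x c] FJ0_apply[OF c] vident(2)[OF fX x] J2(2)[OF x cu(1)] vunit(4)[OF fX c x]
      using r FO_mem[OF pX x] cu x uact by (simp add: Fr(2))
  qed
qed

text \<open>Invariants have degree \<open>e\<close>, so the braiding acts on the second factor by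
  the identity and becomes the flip.\<close>

lemma FA_FJ_braid:
  assumes X: "local_module (ZG G) \<A> X" and Y: "local_module (ZG G) \<A> Y"
  shows "comp Vect (FA (rel_braid (ZG G) \<A> X Y)) (FJ X Y) = comp Vect (FJ Y X) (braid Vect (FO X) (FO Y))"
proof -
  note pX = lm_pre[OF X] and pY = lm_pre[OF Y]
  note b = rel_braid_apply[OF X Y]
  let ?S = "rel_tensor (ZG G) \<A> X Y" and ?T = "rel_tensor (ZG G) \<A> Y X"
  have oS: "fst ?S = relQ X Y" and oT: "fst ?T = relQ Y X" by (simp_all add: rel_tensor_def Let_def)
  have arr: "rel_braid (ZG G) \<A> X Y = Arrow ?S ?T (fn (rel_braid (ZG G) \<A> X Y))"
    by (simp add: rel_braid_def)
  note Fb = FA_arrow[of ?S "fn (rel_braid (ZG G) \<A> X Y)" ?T, unfolded oS oT, OF rel_zobj[OF pX pY] conjunct1[OF b], folded arr]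
  note fd = FO_fd[OF pX] FO_fd[OF pY] and J1 = FJ_hom[OF pX pY] and J2 = FJ_hom[OF pY pX]
  note fT = fd_tensor[OF fd]
  note l = vcomp[OF J1(1) Fb(1) fT] and vb = vbraid[OF fd]
  note r = vcomp[OF vb(1) J2(1) fT]
  show ?thesis
  proof (rule vhom_tensor_eqI[OF l(1) r(1)])
    fix x y assume x: "x \<in> FO X" and y: "y \<in> FO Y"
    note t = vtensor_mem[OF x y]
    have xy: "rt X Y x y \<in> FO ?S" using rt_invs[OF pX pY] x y by (simp add: FO_rel_tensor) (simp add: FO_def)
    have "x \<in> deg (fst X) \<one>" using invsD(1) x by (simp add: FO_def)
    then have "fn (fn (rel_braid (ZG G) \<A> X Y)) (rt X Y x y) = rt Y X (act (fst Y) \<one> y) x"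
      using b FO_mem[OF pY y] by blast
    then show "fn (comp Vect (FA (rel_braid (ZG G) \<A> X Y)) (FJ X Y)) (x \<otimes>\<^sub>v y) =
      fn (comp Vect (FJ Y X) (braid Vect (FO X) (FO Y))) (x \<otimes>\<^sub>v y)"
      unfolding l(2)[OF t] r(2)[OF t] J1(2)[OF x y] vb(2)[OF x y] J2(2)[OF y x] Fb(2)[OF xy]
      by (simp add: act_one[OF pm_zobj[OF pY] FO_mem[OF pY y]])
  qed
qed

theorem local_modules_equivalent_Vect:
  "braided_monoidal_equivalent LM (Vect :: ('k vec set, ('k vec set, 'k vec \<Rightarrow> 'k vec) arrow) braided_monoidal)"
proof -
  have "braided_monoidal_functor LM Vect FO FA FJ FJ0"
    unfolding braided_monoidal_functor_def
    using FA_functorial FJ0_iso FJ_iso FA_FJ_natural FA_FJ_assoc FA_FJ_unit FA_FJ_braid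
    by (simp del: LM_simps(3,4))
  moreover have "equivalence_of_categories LM Vect FO FA"
  proof (rule equivalenceI[OF cat_LM cat_Vect FA_functorial])
    fix f :: "('k vec set, 'k vec \<Rightarrow> 'k vec) arrow" and X Y X' Y'
    assume "f \<in> Hom Vect X Y" "f \<in> Hom Vect X' Y'"
    then show "X = X' \<and> Y = Y'" using vhomD(1,2) by metis
  next
    fix V :: "'k vec set" assume "V \<in> obj Vect"
    then show "\<exists>M\<in>obj LM. \<exists>e. iso_arrow Vect (FO M) V e" using FA_ess_surj by simp
  qed (use FA_faithful FA_full in auto)
  ultimately show ?thesis unfolding braided_monoidal_equivalent_def by blast
qed

text \<open>In a product decomposition the unit of the first factor paired with zero would be an
  invariant element of the algebra. Invariants are multiples \<open>c u\<close>; the first factor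
  forces \<open>c = 1\<close> and the second \<open>c = 0\<close>.\<close>

lemma indecomposable: "indecomposable_alg (ZG G) \<A>"
proof -
  have zero_iff: "space X = {0}" if z: "zero_obj (ZG G) X" and "is_zobj G X" for X :: "('a, 'k) zobj"
  proof -
    have "\<exists>!f. f \<in> zhom G X X" using z by (auto simp: zero_obj_def)
    moreover have "Arrow X X (restrict (\<lambda>x. x) (space X)) \<in> zhom G X X" "Arrow X X (restrict (\<lambda>x. 0) (space X)) \<in> zhom G X X"
      using restrict_zhom[OF that(2) zmap_id] restrict_zhom[OF that(2) zmap_zero[OF that(2) that(2)]] .
    ultimately have "restrict (\<lambda>x. x) (space X) = restrict (\<lambda>x. 0) (space X)" by auto
    then have "x = 0" if "x \<in> space X" for x using that by (metis restrict_apply')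
    then show ?thesis using vs.subspace_0[OF zobj_subspace[OF that(2)]] by auto
  qed
  have zeroI: "zero_obj (ZG G) X" if X: "is_zobj G X" and 0: "\<And>x. x \<in> space X \<Longrightarrow> x = 0"
    for X :: "('a, 'k) zobj"
    unfolding zero_obj_def ZG_simps mem_Collect_eq
  proof (intro conjI ballI)
    fix Y :: "('a, 'k) zobj" assume Y: "Y \<in> {X. is_zobj G X}"
    then have Y: "is_zobj G Y" by simp
    note z = restrict_zhom[OF Y zmap_zero[OF Y X]] restrict_zhom[OF X zmap_zero[OF X Y]]
    show "\<exists>!f. f \<in> zhom G Y X"
    proof (rule ex1I)
      show "Arrow Y X (\<lambda>x\<in>space Y. 0) \<in> zhom G Y X" by (rule z(1))
      fix f assume f: "f \<in> zhom G Y X"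
      show "f = Arrow Y X (\<lambda>x\<in>space Y. 0)"
        by (rule zhom_eqI[OF f z(1)]) (use 0 zmapD(1)[OF zhomD(4)[OF f]] in simp)
    qed
    show "\<exists>!f. f \<in> zhom G X Y"
    proof (rule ex1I)
      show "Arrow X Y (\<lambda>x\<in>space X. 0) \<in> zhom G X Y" by (rule z(2))
      fix f assume f: "f \<in> zhom G X Y"
      show "f = Arrow X Y (\<lambda>x\<in>space X. 0)"
      proof (rule zhom_eqI[OF f z(2)])
        fix x assume "x \<in> space X"
        then show "fn f x = fn (Arrow X Y (\<lambda>x\<in>space X. 0)) x"
          using 0[of x] linear_on_zero[OF zmapD(2)[OF zhomD(4)[OF f]] zobj_subspace[OF X]] by simp
      qed
    qed
  qed (rule X)
  have nz: "\<not> zero_obj (ZG G) A" using zero_iff[OF _ A] u_mem u_neq_0 by blast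
  have False
    if B1: "algebra_in (ZG G) \<B>1" and B2: "algebra_in (ZG G) \<B>2"
      and n1: "\<not> zero_obj (ZG G) (alg_obj \<B>1)" and n2: "\<not> zero_obj (ZG G) (alg_obj \<B>2)"
      and p1: "algebra_hom (ZG G) \<A> \<B>1 p1" and p2: "algebra_hom (ZG G) \<A> \<B>2 p2"
      and pc: "product_cone (ZG G) A (alg_obj \<B>1) (alg_obj \<B>2) p1 p2" for \<B>1 \<B>2 p1 p2
  proof -
    let ?B1 = "alg_obj \<B>1" and ?B2 = "alg_obj \<B>2"
    let ?u1 = "fn (alg_unit \<B>1) one_vec" and ?u2 = "fn (alg_unit \<B>2) one_vec"
    have z: "is_zobj G ?B1" "is_zobj G ?B2" and un: "alg_unit \<B>1 \<in> zhom G (zunit G) ?B1"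
      using B1 B2 unfolding algebra_in_iff by auto
    have u_nz: "fn (alg_unit \<B>) one_vec \<noteq> 0" if B: "algebra_in (ZG G) \<B>" and n: "\<not> zero_obj (ZG G) (alg_obj \<B>)"
      for \<B> :: "(('a, 'k) zobj, (('a, 'k) zobj, 'k vec \<Rightarrow> 'k vec) arrow) algebra_data"
    proof
      assume 0: "fn (alg_unit \<B>) one_vec = 0"
      have zB: "is_zobj G (alg_obj \<B>)" and m: "alg_mult \<B> \<in> zhom G (ztensor G (alg_obj \<B>) (alg_obj \<B>)) (alg_obj \<B>)"
        and un: "\<And>a. a \<in> space (alg_obj \<B>) \<Longrightarrow> fn (alg_mult \<B>) (fn (alg_unit \<B>) one_vec \<otimes>\<^sub>v a) = a"
        using B unfolding algebra_in_iff by auto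
      have "a = 0" if "a \<in> space (alg_obj \<B>)" for a
        using un[OF that] linear_on_zero[OF zmapD(2)[OF zhomD(4)[OF m]]] by (simp add: 0)
      then show False using zeroI[OF zB] n by blast
    qed
    have ph: "p1 \<in> zhom G A ?B1" "p2 \<in> zhom G A ?B2"
      and pu: "comp (ZG G) p1 (alg_unit \<A>) = alg_unit \<B>1" "comp (ZG G) p2 (alg_unit \<A>) = alg_unit \<B>2"
      using p1 p2 unfolding algebra_hom_def by auto
    have pu': "fn p1 u = ?u1" "fn p2 u = ?u2"
      using comp_zhom(2)[OF is_zobj_unit unit_zhom ph(1), of one_vec] comp_zhom(2)[OF is_zobj_unit unit_zhom ph(2), of one_vec]
      by (simp_all add: pu del: ZG_arrows)
    let ?z = "Arrow (zunit G) ?B2 (\<lambda>x\<in>space (zunit G). 0)"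
    have zz: "?z \<in> zhom G (zunit G) ?B2" by (rule restrict_zhom[OF is_zobj_unit zmap_zero[OF is_zobj_unit z(2)]])
    obtain h where h: "h \<in> zhom G (zunit G) A" "comp (ZG G) p1 h = alg_unit \<B>1" "comp (ZG G) p2 h = ?z"
      using pc un zz is_zobj_unit unfolding product_cone_def ZG_simps by blast
    have "one_vec \<in> invs G (zunit G :: ('a, 'k) zobj)" by (simp add: invs_def)
    then have "fn h one_vec \<in> invs G A" by (rule zmap_invs[OF is_zobj_unit zhomD(4)[OF h(1)]])
    then obtain c where c: "fn h one_vec = fscale c u" using invs_A by blast
    have "fn p1 (fscale c u) = ?u1" "fn p2 (fscale c u) = 0"
      using comp_zhom(2)[OF is_zobj_unit h(1) ph(1), of one_vec] comp_zhom(2)[OF is_zobj_unit h(1) ph(2), of one_vec]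
      by (simp_all add: h(2,3) c del: ZG_arrows)
    then have "fscale c ?u1 = ?u1" "fscale c ?u2 = 0"
      using linear_on_scale[OF zmapD(2)[OF zhomD(4)[OF ph(1)]] u_mem, of c]
        linear_on_scale[OF zmapD(2)[OF zhomD(4)[OF ph(2)]] u_mem, of c] by (simp_all add: pu')
    then show False using u_nz[OF B1 n1] u_nz[OF B2 n2] by (simp add: vs.scale_eq_0_iff)
  qed
  then show ?thesis unfolding indecomposable_alg_def using nz by blast
qed

end

section \<open>An obstruction\<close>

context zalgebra
begin

text \<open>
  In \<open>Vect\<close> an object is at most one-dimensional as soon as any two maps into it from the unit are
  multiples of each other, and then its identity factors through the unit. Stated in this form the
  implication transfers along equivalences that are not known to be linear.
\<close>

lemma factors_through_unit:
  assumes eq: "braided_monoidal_equivalent LM (Vect :: ('k vec set, ('k vec set, 'k vec \<Rightarrow> 'k vec) arrow) braided_monoidal)"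
    and N: "local_module (ZG G) \<A> N"
    and w: "\<And>f g. f \<in> module_hom_arrows (ZG G) \<A> (regular_module \<A>) N \<Longrightarrow> g \<in> module_hom_arrows (ZG G) \<A> (regular_module \<A>) N \<Longrightarrow>
      \<exists>s\<in>module_hom_arrows (ZG G) \<A> (regular_module \<A>) (regular_module \<A>). f = comp LM g s \<or> g = comp LM f s"
  obtains f g where "f \<in> module_hom_arrows (ZG G) \<A> (regular_module \<A>) N" "g \<in> module_hom_arrows (ZG G) \<A> N (regular_module \<A>)"
    "comp LM f g = ident LM N"
proof -
  let ?R = "regular_module \<A>" and ?V = "Vect :: ('k vec set, ('k vec set, 'k vec \<Rightarrow> 'k vec) arrow) braided_monoidal"
  interpret C: cat LM by (rule cat_LM)
  interpret V: cat ?V by (rule cat_Vect)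
  obtain Fo Fa J J0 where bm: "braided_monoidal_functor LM ?V Fo Fa J J0" and ec: "equivalence_of_categories LM ?V Fo Fa"
    using eq unfolding braided_monoidal_equivalent_def by blast
  obtain Go Ga \<eta> \<theta> where F: "functorial LM ?V Fo Fa" and G: "functorial ?V LM Go Ga"
    and \<eta>: "natural_iso LM LM (\<lambda>X. X) (\<lambda>f. f) (Go \<circ> Fo) (Ga \<circ> Fa) \<eta>"
    and \<theta>: "natural_iso ?V ?V (Fo \<circ> Go) (Fa \<circ> Ga) (\<lambda>X. X) (\<lambda>f. f) \<theta>"
    using ec unfolding equivalence_of_categories_def by blast
  have R: "?R \<in> obj LM" and No: "N \<in> obj LM" using regular_local N by simp_all
  have Fo: "Fo X \<in> obj ?V" if "X \<in> obj LM" for X using F that unfolding functorial_def by blast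
  have Go: "Go X \<in> obj LM" if "X \<in> obj ?V" for X using G that unfolding functorial_def by blast
  have Fa: "Fa f \<in> Hom ?V (Fo X) (Fo Y)" if "X \<in> obj LM" "Y \<in> obj LM" "f \<in> Hom LM X Y" for X Y f
    using F that unfolding functorial_def by blast
  have Ga: "Ga f \<in> Hom LM (Go X) (Go Y)" if "X \<in> obj ?V" "Y \<in> obj ?V" "f \<in> Hom ?V X Y" for X Y f
    using G that unfolding functorial_def by blast
  have Fcomp: "Fa (comp LM g f) = comp ?V (Fa g) (Fa f)"
    if "X \<in> obj LM" "Y \<in> obj LM" "Z \<in> obj LM" "f \<in> Hom LM X Y" "g \<in> Hom LM Y Z" for X Y Z f g
    using F that unfolding functorial_def by blast
  have Fid: "Fa (ident LM X) = ident ?V (Fo X)" if "X \<in> obj LM" for X using F that unfolding functorial_def by blast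
  have \<eta>i: "\<exists>e'. inverse_arrows LM X (Go (Fo X)) (\<eta> X) e'" if "X \<in> obj LM" for X
    using \<eta> that unfolding natural_iso_def iso_arrow_def o_def by blast
  have \<eta>n: "comp LM (\<eta> Y) f = comp LM (Ga (Fa f)) (\<eta> X)" if "X \<in> obj LM" "Y \<in> obj LM" "f \<in> Hom LM X Y" for X Y f
    using \<eta> that unfolding natural_iso_def o_def by blast
  have \<theta>i: "\<exists>e'. inverse_arrows ?V (Fo (Go X)) X (\<theta> X) e'" if "X \<in> obj ?V" for X
    using \<theta> that unfolding natural_iso_def iso_arrow_def o_def by blast
  have \<theta>n: "comp ?V (\<theta> Y) (Fa (Ga f)) = comp ?V f (\<theta> X)" if "X \<in> obj ?V" "Y \<in> obj ?V" "f \<in> Hom ?V X Y" for X Y f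
    using \<theta> that unfolding natural_iso_def o_def by blast
  \<comment> \<open>Unit and counit make both functors faithful. For fullness, \<open>Ga h\<close>
    is conjugated with the unit, and faithfulness of the inverse functor identifies the image of the
    result with \<open>h\<close>.\<close>
  have G_faithful: "f = g" if XY: "X \<in> obj ?V" "Y \<in> obj ?V" and f: "f \<in> Hom ?V X Y" and g: "g \<in> Hom ?V X Y" and "Ga f = Ga g" for X Y f g
  proof -
    obtain e' where e: "inverse_arrows ?V (Fo (Go X)) X (\<theta> X) e'" using \<theta>i[OF XY(1)] by blast
    then have e: "\<theta> X \<in> Hom ?V (Fo (Go X)) X" "e' \<in> Hom ?V X (Fo (Go X))" "comp ?V (\<theta> X) e' = ident ?V X"
      by (auto simp: inverse_arrows_def)
    have "comp ?V (comp ?V h (\<theta> X)) e' = h" if h: "h \<in> Hom ?V X Y" for h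
      using V.comp_assoc[OF XY(1) Fo[OF Go[OF XY(1)]] XY e(2,1) h] e(3) V.comp_ident(1)[OF XY h] by simp
    then show ?thesis using \<theta>n[OF XY f] \<theta>n[OF XY g] f g that(5) by metis
  qed
  have F_faithful: "f = g" if XY: "X \<in> obj LM" "Y \<in> obj LM" and f: "f \<in> Hom LM X Y" and g: "g \<in> Hom LM X Y" and "Fa f = Fa g" for X Y f g
  proof -
    obtain e' where e: "inverse_arrows LM Y (Go (Fo Y)) (\<eta> Y) e'" using \<eta>i[OF XY(2)] by blast
    then have e: "\<eta> Y \<in> Hom LM Y (Go (Fo Y))" "e' \<in> Hom LM (Go (Fo Y)) Y" "comp LM e' (\<eta> Y) = ident LM Y"
      unfolding inverse_arrows_def by blast+
    have "comp LM e' (comp LM (\<eta> Y) h) = h" if h: "h \<in> Hom LM X Y" for h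
      using C.comp_assoc[OF XY Go[OF Fo[OF XY(2)]] XY(2) h e(1,2)] e(3) C.comp_ident(2)[OF XY h] by (simp del: LM_simps ZG_arrows)
    then show ?thesis using \<eta>n[OF XY f] \<eta>n[OF XY g] f g that(5) by metis
  qed
  have F_full: "\<exists>f\<in>Hom LM X Y. Fa f = h" if XY: "X \<in> obj LM" "Y \<in> obj LM" and h: "h \<in> Hom ?V (Fo X) (Fo Y)" for X Y h
  proof -
    note FX = Fo[OF XY(1)] and FY = Fo[OF XY(2)]
    note GX = Go[OF FX] and GY = Go[OF FY] and Gh = Ga[OF FX FY h]
    obtain e' where "inverse_arrows LM Y (Go (Fo Y)) (\<eta> Y) e'" using \<eta>i[OF XY(2)] by blast
    then have e: "\<eta> Y \<in> Hom LM Y (Go (Fo Y))" "e' \<in> Hom LM (Go (Fo Y)) Y" "comp LM (\<eta> Y) e' = ident LM (Go (Fo Y))"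
      unfolding inverse_arrows_def by blast+
    obtain d' where "inverse_arrows LM X (Go (Fo X)) (\<eta> X) d'" using \<eta>i[OF XY(1)] by blast
    then have d: "\<eta> X \<in> Hom LM X (Go (Fo X))" "d' \<in> Hom LM (Go (Fo X)) X" "comp LM (\<eta> X) d' = ident LM (Go (Fo X))"
      unfolding inverse_arrows_def by blast+
    note k = C.comp_hom[OF XY(1) GX GY d(1) Gh]
    let ?f = "comp LM e' (comp LM (Ga h) (\<eta> X))"
    have f: "?f \<in> Hom LM X Y" by (rule C.comp_hom[OF XY(1) GY XY(2) k e(2)])
    have "comp LM (\<eta> Y) ?f = comp LM (Ga h) (\<eta> X)"
      using C.comp_assoc[OF XY(1) GY XY(2) GY k e(2,1)] e(3) C.comp_ident(2)[OF XY(1) GY k] by (simp del: LM_simps ZG_arrows)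
    then have *: "comp LM (Ga (Fa ?f)) (\<eta> X) = comp LM (Ga h) (\<eta> X)" using \<eta>n[OF XY f] by (simp del: LM_simps ZG_arrows)
    have "comp LM (comp LM q (\<eta> X)) d' = q" if q: "q \<in> Hom LM (Go (Fo X)) (Go (Fo Y))" for q
      using C.comp_assoc[OF GX XY(1) GX GY d(2,1) q] d(3) C.comp_ident(1)[OF GX GY q] by (simp del: LM_simps ZG_arrows)
    then have "Ga (Fa ?f) = Ga h" using * Ga[OF FX FY Fa[OF XY f]] Gh by metis
    then have "Fa ?f = h" by (rule G_faithful[OF FX FY Fa[OF XY f] h])
    then show ?thesis using f by blast
  qed
  \<comment> \<open>The monoidal structure enters through \<open>J0\<close>: it identifies the image
    of the regular module with the unit space, so that this image is a line with generator
    \<open>e\<close> and coordinate \<open>co\<close>.\<close>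
  have "iso_arrow ?V unit_space (Fo ?R) J0" using bm unfolding braided_monoidal_functor_def by simp
  then obtain j where "inverse_arrows ?V unit_space (Fo ?R) J0 j" unfolding iso_arrow_def by blast
  then have J0: "J0 \<in> Hom ?V unit_space (Fo ?R)" and j: "j \<in> Hom ?V (Fo ?R) unit_space"
    and J0j: "comp ?V J0 j = ident ?V (Fo ?R)" and jJ0: "comp ?V j J0 = ident ?V unit_space"
    unfolding inverse_arrows_def by blast+
  let ?X = "Fo N" and ?O = "Fo ?R"
  have fdX: "fd_space ?X" and fdO: "fd_space ?O" using Fo[OF No] Fo[OF R] by simp_all
  define e where "e = fn J0 one_vec"
  have e: "e \<in> ?O" using vhomD(4)[OF J0 one_vec_mem] by (simp add: e_def)
  define co where "co y = fn j y 0" for y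
  have O: "y = fscale (co y) e" if y: "y \<in> ?O" for y
  proof -
    have jy: "fn j y \<in> unit_space" using vhomD(4)[OF j y] .
    have "y = fn (comp ?V J0 j) y" by (simp only: J0j vident(2)[OF fdO y])
    also have "\<dots> = fn J0 (fn j y)" by (rule vcomp(2)[OF j J0 fdO y])
    also have "fn j y = fscale (co y) one_vec" using unit_coeff[OF jy] by (simp add: co_def)
    also have "fn J0 \<dots> = fscale (co y) e" using linear_on_scale[OF vhomD(5)[OF J0] one_vec_mem] by (simp add: e_def)
    finally show ?thesis .
  qed
  have co_e: "co e = 1"
  proof -
    have "fn j e = one_vec" using vcomp(2)[OF J0 j fd_unit one_vec_mem] by (simp add: e_def jJ0 vident(2)[OF fd_unit one_vec_mem])
    then show ?thesis by (simp add: co_def)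
  qed
  have co_lin: "co (x + y) = co x + co y" "co (fscale c x) = c * co x" if "x \<in> ?O" "y \<in> ?O" for x y c
    using that by (simp_all add: co_def linear_on_add[OF vhomD(5)[OF j]] linear_on_scale[OF vhomD(5)[OF j]] fun_eval fscale_eval)
  \<comment> \<open>Vectors of \<open>?X\<close> as maps from that line: \<open>pt x\<close> sends
    \<open>e\<close> to \<open>x\<close>.\<close>
  define pt where "pt x = Arrow ?O ?X (restrict (\<lambda>y. fscale (co y) x) ?O)" for x :: "'k vec"
  have pt: "pt x \<in> Hom ?V ?O ?X" if "x \<in> ?X" for x
  proof -
    have "linear_on ?O (\<lambda>y. fscale (co y) x)"
      by (rule linear_onI) (simp_all add: co_lin vs.scale_left_distrib)
    then show ?thesis unfolding vhom_iff pt_def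
      using that fd_subspace[OF fdX] linear_on_restrict[OF fd_subspace[OF fdO]] by (auto simp: vs.subspace_scale)
  qed
  have pt_e: "fn (pt x) e = x" if "x \<in> ?X" for x using e co_e by (simp add: pt_def)
  \<comment> \<open>Lift both vectors to maps into \<open>N\<close>. One factors through the other
    by an endomorphism \<open>s\<close> of the regular module, and \<open>Fa s\<close> acts on the
    line by a scalar, read off at \<open>e\<close>.\<close>
  have dep: "\<exists>c. x = fscale c y \<or> y = fscale c x" if x: "x \<in> ?X" and y: "y \<in> ?X" for x y
  proof -
    obtain f where f: "f \<in> Hom LM ?R N" "Fa f = pt x" using F_full[OF R No pt[OF x]] by blast
    obtain g where g: "g \<in> Hom LM ?R N" "Fa g = pt y" using F_full[OF R No pt[OF y]] by blast
    obtain s where s: "s \<in> Hom LM ?R ?R" "f = comp LM g s \<or> g = comp LM f s"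
      using w[of f g] f(1) g(1) unfolding LM_simps(2) by blast
    note Fs = Fa[OF R R s(1)]
    have se: "fn (Fa s) e = fscale (co (fn (Fa s) e)) e" by (rule O[OF vhomD(4)[OF Fs e]])
    have *: "q2 = fscale (co (fn (Fa s) e)) q1"
      if "pt q2 = comp ?V (pt q1) (Fa s)" "q1 \<in> ?X" "q2 \<in> ?X" for q1 q2
    proof -
      have "q2 = fn (pt q1) (fn (Fa s) e)" using vcomp(2)[OF Fs pt[OF that(2)] fdO e] pt_e[OF that(3)] that(1) by simp
      also have "\<dots> = fn (pt q1) (fscale (co (fn (Fa s) e)) e)" by (subst se) simp
      also have "\<dots> = fscale (co (fn (Fa s) e)) q1"
        using linear_on_scale[OF vhomD(5)[OF pt[OF that(2)]] e] pt_e[OF that(2)] by simp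
      finally show ?thesis .
    qed
    from s(2) show ?thesis
    proof
      assume "f = comp LM g s"
      then have "pt x = comp ?V (pt y) (Fa s)" using Fcomp[OF R R No s(1) g(1)] f(2) g(2) by simp
      then show ?thesis using *[OF _ y x] by blast
    next
      assume "g = comp LM f s"
      then have "pt y = comp ?V (pt x) (Fa s)" using Fcomp[OF R R No s(1) f(1)] f(2) g(2) by simp
      then show ?thesis using *[OF _ x y] by blast
    qed
  qed
  obtain x where x: "x \<in> ?X" "\<And>y. y \<in> ?X \<Longrightarrow> \<exists>c. y = fscale c x"
  proof (cases "?X = {0}")
    case True
    then show thesis using that[of 0] by auto
  next
    case False
    then obtain x where x: "x \<in> ?X" "x \<noteq> 0" using vs.subspace_0[OF fd_subspace[OF fdX]] by blast
    show thesis
    proof (rule that[OF x(1)])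
      fix y assume "y \<in> ?X"
      then consider c where "x = fscale c y" | c where "y = fscale c x" using dep[OF x(1)] by blast
      then show "\<exists>c. y = fscale c x"
      proof cases
        case (1 c)
        then have "c \<noteq> 0" using x(2) by auto
        then have "y = fscale (inverse c) x" using 1 by simp
        then show ?thesis ..
      qed blast
    qed
  qed
  obtain B where B: "finite B" "\<not> vs.dependent B" "?X = vs.span B" using fd_basis[OF fdX] by blast
  \<comment> \<open>A right inverse of \<open>pt x\<close>; for \<open>x = 0\<close> the whole space
    is zero and the zero map will do.\<close>
  have "\<exists>k. k \<in> Hom ?V ?X ?O \<and> (\<forall>y\<in>?X. fn (pt x) (fn k y) = y)"
  proof (cases "x = 0")
    case True
    have "Arrow ?X ?O (restrict (\<lambda>y. 0) ?X) \<in> Hom ?V ?X ?O"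
      unfolding vhom_iff using linear_on_restrict[OF fd_subspace[OF fdX]] linear_on_const_zero vs.subspace_0[OF fd_subspace[OF fdO]] by auto
    moreover have "y = 0" if "y \<in> ?X" for y using x(2)[OF that] True by auto
    moreover have "fn (pt x) 0 = 0" using linear_on_zero[OF vhomD(5)[OF pt[OF x(1)]] fd_subspace[OF fdO]] .
    ultimately show ?thesis by (intro exI conjI) (assumption, auto)
  next
    case False
    define d where "d y = (THE c. y = fscale c x)" for y
    have d: "d (fscale c x) = c" for c unfolding d_def using False by (auto simp: vs.scale_cancel_right)
    have d_lin: "linear_on ?X (\<lambda>y. fscale (d y) e)"
    proof (rule linear_onI)
      fix y z assume "y \<in> ?X" "z \<in> ?X"
      then obtain a b where "y = fscale a x" "z = fscale b x" using x(2) by blast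
      moreover from this have "y + z = fscale (a + b) x" by (simp add: vs.scale_left_distrib)
      ultimately show "fscale (d (y + z)) e = fscale (d y) e + fscale (d z) e" by (simp add: d flip: vs.scale_left_distrib)
    next
      fix c y assume "y \<in> ?X"
      then obtain a where "y = fscale a x" using x(2) by blast
      then show "fscale (d (fscale c y)) e = fscale c (fscale (d y) e)" by (simp add: d)
    qed
    let ?k = "Arrow ?X ?O (restrict (\<lambda>y. fscale (d y) e) ?X)"
    have k: "?k \<in> Hom ?V ?X ?O"
      unfolding vhom_iff using d_lin linear_on_restrict[OF fd_subspace[OF fdX]] vs.subspace_scale[OF fd_subspace[OF fdO] e] by auto
    have "fn (pt x) (fn ?k y) = y" if y: "y \<in> ?X" for y
    proof -
      obtain c where "y = fscale c x" using x(2)[OF y] by blast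
      then show ?thesis using y linear_on_scale[OF vhomD(5)[OF pt[OF x(1)]] e] pt_e[OF x(1)] by (simp add: d)
    qed
    then show ?thesis using k by blast
  qed
  then obtain k where k: "k \<in> Hom ?V ?X ?O" "\<And>y. y \<in> ?X \<Longrightarrow> fn (pt x) (fn k y) = y" by blast
  obtain f where f: "f \<in> Hom LM ?R N" "Fa f = pt x" using F_full[OF R No pt[OF x(1)]] by blast
  obtain g where g: "g \<in> Hom LM N ?R" "Fa g = k" using F_full[OF No R k(1)] by blast
  have "comp ?V (pt x) k = ident ?V ?X"
    by (rule vhom_eqI[OF vcomp(1)[OF k(1) pt[OF x(1)] fdX] vident(1)[OF fdX]])
      (simp add: vcomp(2)[OF k(1) pt[OF x(1)] fdX] vident(2)[OF fdX] k(2))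
  then have "Fa (comp LM f g) = Fa (ident LM N)" using Fcomp[OF No R No g(1) f(1)] f(2) g(2) Fid[OF No] by simp
  then have "comp LM f g = ident LM N"
    by (rule F_faithful[OF No No C.comp_hom[OF No R No g(1) f(1)] C.ident_hom[OF No]])
  then show thesis using that f(1) g(1) by simp
qed

end

section \<open>The space spanned by the symbols\<close>

lemma (in group) conj_mult:
  "g \<in> carrier G \<Longrightarrow> h \<in> carrier G \<Longrightarrow> f \<in> carrier G \<Longrightarrow>
    (g \<otimes> h) \<otimes> f \<otimes> inv (g \<otimes> h) = g \<otimes> (h \<otimes> f \<otimes> inv h) \<otimes> inv g"
  by (simp add: inv_mult_group m_assoc)

text \<open>The subgroup \<open>K\<close> over which the relations run is a parameter, so that one
  construction gives both the algebra and modules over it.\<close>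

locale symbol_system = finite_grp G for G (structure) +
  fixes K F :: "'a set" and \<epsilon> :: "'a \<Rightarrow> 'a \<Rightarrow> 'k::field"
  assumes K: "subgroup K G" and F: "F \<subseteq> carrier G"
    and conj_F: "h \<in> K \<Longrightarrow> f \<in> F \<Longrightarrow> h \<otimes> f \<otimes> inv h \<in> F"
begin

lemma K_mem: "h \<in> K \<Longrightarrow> h \<in> carrier G" and F_mem: "f \<in> F \<Longrightarrow> f \<in> carrier G"
  using subgroup.subset[OF K] F by auto

abbreviation "a g f \<equiv> gen G K F \<epsilon> g f"
abbreviation "AS \<equiv> A_space G K F \<epsilon>"
abbreviation "AZ \<equiv> A_zobj G K F \<epsilon>"

lemma finite_F: "finite F" using fin F finite_subset by blast

lemma free_symbols_span: "free_symbols G F = vs.span ((\<lambda>(g, f). symbol g f) ` (carrier G \<times> F) :: ('a \<times> 'a \<Rightarrow> 'k) set)"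
proof
  have S: "vs.subspace (free_symbols G F :: ('a \<times> 'a \<Rightarrow> 'k) set)"
    by (rule vs.subspaceI) (auto simp: free_symbols_def fun_eval fscale_eval)
  show "vs.span ((\<lambda>(g, f). symbol g f) ` (carrier G \<times> F)) \<subseteq> (free_symbols G F :: ('a \<times> 'a \<Rightarrow> 'k) set)"
    by (rule vs.span_minimal[OF _ S]) (auto simp: free_symbols_def symbol_def)
  show "free_symbols G F \<subseteq> vs.span ((\<lambda>(g, f). symbol g f) ` (carrier G \<times> F) :: ('a \<times> 'a \<Rightarrow> 'k) set)"
  proof
    fix p :: "'a \<times> 'a \<Rightarrow> 'k" assume p: "p \<in> free_symbols G F"
    have "p = (\<Sum>s\<in>carrier G \<times> F. fscale (p s) (symbol (fst s) (snd s)))"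
    proof
      fix t
      have "(\<Sum>s\<in>carrier G \<times> F. fscale (p s) (symbol (fst s) (snd s))) t =
        (\<Sum>s\<in>carrier G \<times> F. if s = t then p t else 0)"
        unfolding sum_fun_eval by (rule sum.cong) (auto simp: fscale_eval symbol_def)
      also have "\<dots> = p t" using p fin finite_F by (cases t) (auto simp: free_symbols_def)
      finally show "p t = (\<Sum>s\<in>carrier G \<times> F. fscale (p s) (symbol (fst s) (snd s))) t" by simp
    qed
    also have "\<dots> \<in> vs.span ((\<lambda>(g, f). symbol g f) ` (carrier G \<times> F))"
      by (intro vs.span_sum vs.span_scale vs.span_base) auto
    finally show "p \<in> vs.span ((\<lambda>(g, f). symbol g f) ` (carrier G \<times> F))" .
  qed
qed

lemma free_symbols_subspace: "vs.subspace (free_symbols G F :: ('a \<times> 'a \<Rightarrow> 'k) set)"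
  by (simp add: free_symbols_span)

lemma symbol_mem: "g \<in> carrier G \<Longrightarrow> f \<in> F \<Longrightarrow> (symbol g f :: 'a \<times> 'a \<Rightarrow> 'k) \<in> free_symbols G F"
  by (auto simp: free_symbols_def symbol_def)

lemma relation_mem:
  assumes "g \<in> carrier G" "h \<in> K" "f \<in> F"
  shows "symbol (g \<otimes> h) f - fscale (\<epsilon> h f) (symbol g (h \<otimes> f \<otimes> inv h)) \<in> free_symbols G F"
  using assms K_mem conj_F
  by (intro symbol_mem vs.subspace_diff[OF free_symbols_subspace] vs.subspace_scale[OF free_symbols_subspace]) auto

text \<open>The choice in \<open>quotient_map\<close> is met by
  \<open>exists_linear_with_kernel\<close>, the free space being spanned by finitely many
  symbols.\<close>

lemma quotient_map_facts:
  "linear_on (free_symbols G F) (quotient_map G K F \<epsilon>) \<and>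
     (\<forall>p\<in>free_symbols G F. quotient_map G K F \<epsilon> p = 0 \<longleftrightarrow> p \<in> symbol_relations G K F \<epsilon>)"
proof -
  have sub: "symbol_relations G K F \<epsilon> \<subseteq> free_symbols G F"
    unfolding symbol_relations_def
    by (rule vs.span_minimal[OF _ free_symbols_subspace]) (use relation_mem in auto)
  have f: "finite ((\<lambda>(g, f). symbol g f :: 'a \<times> 'a \<Rightarrow> 'k) ` (carrier G \<times> F))" using fin finite_F by simp
  have r: "vs.subspace (symbol_relations G K F \<epsilon>)" by (simp add: symbol_relations_def)
  obtain q :: "('a \<times> 'a \<Rightarrow> 'k) \<Rightarrow> 'k vec" where q: "linear_on UNIV q"
    "\<And>p. p \<in> free_symbols G F \<Longrightarrow> q p = 0 \<longleftrightarrow> p \<in> symbol_relations G K F \<epsilon>"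
    using exists_linear_with_kernel[OF free_symbols_span f r sub] by blast
  have "linear_on (free_symbols G F) q" using q(1) by (rule linear_on_subset) simp
  then have "\<exists>q :: ('a \<times> 'a \<Rightarrow> 'k) \<Rightarrow> 'k vec. linear_on (free_symbols G F) q \<and>
     (\<forall>p\<in>free_symbols G F. q p = 0 \<longleftrightarrow> p \<in> symbol_relations G K F \<epsilon>)"
    using q(2) by blast
  from someI_ex[OF this] show ?thesis unfolding quotient_map_def .
qed

lemmas quotient_map_linear = conjunct1[OF quotient_map_facts]

lemma gen_mem: "g \<in> carrier G \<Longrightarrow> f \<in> F \<Longrightarrow> a g f \<in> AS"
  unfolding gen_def A_space_def using symbol_mem by blast

lemma A_span: "AS = vs.span {a g f | g f. g \<in> carrier G \<and> f \<in> F}"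
proof -
  have "AS = quotient_map G K F \<epsilon> ` vs.span ((\<lambda>(g, f). symbol g f) ` (carrier G \<times> F))"
    by (simp add: A_space_def free_symbols_span)
  also have "\<dots> = vs.span (quotient_map G K F \<epsilon> ` (\<lambda>(g, f). symbol g f) ` (carrier G \<times> F))"
    by (rule linear_on_image_span) (use quotient_map_linear in \<open>simp add: free_symbols_span\<close>)
  also have "quotient_map G K F \<epsilon> ` (\<lambda>(g, f). symbol g f) ` (carrier G \<times> F) = {a g f | g f. g \<in> carrier G \<and> f \<in> F}"
    by (force simp: gen_def image_image)
  finally show ?thesis .
qed

lemma AS_fd: "fd_space AS"
proof -
  have "{a g f | g f. g \<in> carrier G \<and> f \<in> F} = (\<lambda>(g, f). a g f) ` (carrier G \<times> F)" by auto
  then have "finite {a g f | g f. g \<in> carrier G \<and> f \<in> F}" using fin finite_F by simp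
  then show ?thesis unfolding fd_space_def using A_span by (intro exI conjI)
qed

lemmas AS_subspace = fd_subspace[OF AS_fd]

lemma gen_rel:
  assumes "g \<in> carrier G" "h \<in> K" "f \<in> F"
  shows "a (g \<otimes> h) f = fscale (\<epsilon> h f) (a g (h \<otimes> f \<otimes> inv h))"
proof -
  note q = quotient_map_linear
  have m: "(symbol (g \<otimes> h) f :: 'a \<times> 'a \<Rightarrow> 'k) \<in> free_symbols G F"
    "(symbol g (h \<otimes> f \<otimes> inv h) :: 'a \<times> 'a \<Rightarrow> 'k) \<in> free_symbols G F"
    using assms K_mem conj_F by (auto intro: symbol_mem)
  have "quotient_map G K F \<epsilon> (symbol (g \<otimes> h) f - fscale (\<epsilon> h f) (symbol g (h \<otimes> f \<otimes> inv h))) = 0"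
    using quotient_map_facts relation_mem[OF assms] assms
    by (auto simp: symbol_relations_def intro!: vs.span_base)
  then show ?thesis
    using linear_on_diff[OF q free_symbols_subspace m(1) vs.subspace_scale[OF free_symbols_subspace m(2)]]
      linear_on_scale[OF q m(2)] by (simp add: gen_def)
qed

text \<open>The universal property of generators and relations: \<open>\<phi>\<close> extends
  linearly to the free space, and \<open>rel\<close> makes the extension vanish on the
  relations.\<close>

lemma A_univ:
  fixes \<phi> :: "'a \<Rightarrow> 'a \<Rightarrow> ('j \<Rightarrow> 'k)"
  assumes rel: "\<And>g h f. g \<in> carrier G \<Longrightarrow> h \<in> K \<Longrightarrow> f \<in> F \<Longrightarrow> \<phi> (g \<otimes> h) f = fscale (\<epsilon> h f) (\<phi> g (h \<otimes> f \<otimes> inv h))"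
  obtains k where "linear_on AS k" "\<And>g f. g \<in> carrier G \<Longrightarrow> f \<in> F \<Longrightarrow> k (a g f) = \<phi> g f"
proof -
  define \<Phi> where "\<Phi> p = (\<Sum>s\<in>carrier G \<times> F. fscale (p s) (\<phi> (fst s) (snd s)))" for p :: "'a \<times> 'a \<Rightarrow> 'k"
  have \<Phi>: "linear_on V \<Phi>" for V
    by (rule linear_onI) (simp_all add: \<Phi>_def fun_eval fscale_eval vs.scale_left_distrib sum.distrib vs.scale_sum_right)
  have \<Phi>_sym: "\<Phi> (symbol g f) = \<phi> g f" if "g \<in> carrier G" "f \<in> F" for g f
  proof -
    have "\<Phi> (symbol g f) = (\<Sum>s\<in>carrier G \<times> F. if s = (g, f) then \<phi> g f else 0)"
      unfolding \<Phi>_def by (rule sum.cong) (auto simp: symbol_def)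
    then show ?thesis using that fin finite_F by simp
  qed
  have ker: "\<Phi> p = 0" if p: "p \<in> free_symbols G F" "quotient_map G K F \<epsilon> p = 0" for p
  proof -
    let ?R = "{symbol (g \<otimes> h) f - fscale (\<epsilon> h f) (symbol g (h \<otimes> f \<otimes> inv h)) | g h f.
       g \<in> carrier G \<and> h \<in> K \<and> f \<in> F} :: ('a \<times> 'a \<Rightarrow> 'k) set"
    have "p \<in> vs.span ?R" using quotient_map_facts p by (auto simp: symbol_relations_def)
    then show ?thesis
    proof (rule linear_on_eq_span[OF \<Phi> linear_on_const_zero, rotated])
      fix s assume "s \<in> ?R"
      then obtain g h f where s: "s = symbol (g \<otimes> h) f - fscale (\<epsilon> h f) (symbol g (h \<otimes> f \<otimes> inv h))"
        "g \<in> carrier G" "h \<in> K" "f \<in> F" by blast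
      then show "\<Phi> s = 0"
        using linear_on_diff[OF \<Phi>[of UNIV] vs.subspace_UNIV] linear_on_scale[OF \<Phi>[of UNIV]]
        by (simp add: \<Phi>_sym K_mem conj_F rel)
    qed
  qed
  obtain k where k: "linear_on AS k" "\<And>p. p \<in> free_symbols G F \<Longrightarrow> k (quotient_map G K F \<epsilon> p) = \<Phi> p"
    using linear_factor[OF quotient_map_linear \<Phi> free_symbols_subspace ker, folded A_space_def] by blast
  show thesis by (rule that[OF k(1)]) (simp add: gen_def k(2) symbol_mem \<Phi>_sym)
qed

lemma A_ext:
  fixes f k :: "'k vec \<Rightarrow> ('j \<Rightarrow> 'k)"
  assumes "linear_on AS f" "linear_on AS k" "\<And>g x. g \<in> carrier G \<Longrightarrow> x \<in> F \<Longrightarrow> f (a g x) = k (a g x)" "y \<in> AS"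
  shows "f y = k y"
  by (rule linear_on_eq_span[OF assms(1,2)[unfolded A_span] _ assms(4)[unfolded A_span]]) (use assms(3) in blast)

lemma A_mem:
  fixes f :: "'k vec \<Rightarrow> ('j \<Rightarrow> 'k)"
  assumes "linear_on AS f" "vs.subspace W" "\<And>g x. g \<in> carrier G \<Longrightarrow> x \<in> F \<Longrightarrow> f (a g x) \<in> W" "y \<in> AS"
  shows "f y \<in> W"
  by (rule linear_on_mem_span[OF assms(1)[unfolded A_span] assms(2) _ assms(4)[unfolded A_span]]) (use assms(3) in blast)

text \<open>Up to scalars the symbols over one coset of \<open>K\<close> only depend on a chosen representative.\<close>

lemma A_ext_coset:
  fixes f k :: "'k vec \<Rightarrow> ('j \<Rightarrow> 'k)"
  assumes f: "linear_on AS f" and k: "linear_on AS k" and g: "g \<in> carrier G"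
    and same: "\<And>x. x \<in> F \<Longrightarrow> f (a g x) = k (a g x)"
    and other: "\<And>g' x. g' \<in> carrier G \<Longrightarrow> inv g \<otimes> g' \<notin> K \<Longrightarrow> x \<in> F \<Longrightarrow> f (a g' x) = k (a g' x)"
    and y: "y \<in> AS"
  shows "f y = k y"
proof (rule A_ext[OF f k _ y])
  fix g' x assume g': "g' \<in> carrier G" and x: "x \<in> F"
  show "f (a g' x) = k (a g' x)"
  proof (cases "inv g \<otimes> g' \<in> K")
    case True
    let ?x = "(inv g \<otimes> g') \<otimes> x \<otimes> inv (inv g \<otimes> g')"
    have "a g' x = fscale (\<epsilon> (inv g \<otimes> g') x) (a g ?x)"
      using gen_rel[OF g True x] g g' by simp
    moreover have "?x \<in> F" by (rule conj_F[OF True x])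
    ultimately show ?thesis
      using same gen_mem[OF g] by (simp add: linear_on_scale[OF f] linear_on_scale[OF k])
  qed (use other g' x in blast)
qed

lemma
  assumes x: "x \<in> carrier G"
  shows A_act_linear: "linear_on AS (act AZ x)"
    and A_act_gen: "\<And>g f. g \<in> carrier G \<Longrightarrow> f \<in> F \<Longrightarrow> act AZ x (a g f) = a (x \<otimes> g) f"
proof -
  have "a (x \<otimes> (g \<otimes> h)) f = fscale (\<epsilon> h f) (a (x \<otimes> g) (h \<otimes> f \<otimes> inv h))"
    if "g \<in> carrier G" "h \<in> K" "f \<in> F" for g h f
    using gen_rel[of "x \<otimes> g" h f] that x K_mem by (simp add: m_assoc)
  then obtain k where k: "linear_on AS k" "\<And>g f. g \<in> carrier G \<Longrightarrow> f \<in> F \<Longrightarrow> k (a g f) = a (x \<otimes> g) f"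
    using A_univ[of "\<lambda>g f. a (x \<otimes> g) f"] by blast
  have "act AZ x = restrict k AS"
    unfolding A_zobj_def zobj.simps
  proof (rule the_linear_works[OF AS_subspace k(1)])
    fix h' :: "'k vec \<Rightarrow> 'k vec" assume h': "linear_on AS h'"
    show "(\<forall>g\<in>carrier G. \<forall>f\<in>F. h' (a g f) = a (x \<otimes> g) f) \<longleftrightarrow> (\<forall>y\<in>AS. h' y = k y)"
    proof
      assume *: "\<forall>g\<in>carrier G. \<forall>f\<in>F. h' (a g f) = a (x \<otimes> g) f"
      show "\<forall>y\<in>AS. h' y = k y"
      proof
        fix y assume y: "y \<in> AS"
        show "h' y = k y" by (rule A_ext[OF h' k(1) _ y]) (simp add: * k(2))
      qed
    qed (simp add: gen_mem k(2))
  qed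
  then show "linear_on AS (act AZ x)" "\<And>g f. g \<in> carrier G \<Longrightarrow> f \<in> F \<Longrightarrow> act AZ x (a g f) = a (x \<otimes> g) f"
    using k gen_mem by (simp_all add: linear_on_restrict[OF AS_subspace])
qed

lemma AZ_space [simp]: "space AZ = AS" by (simp add: A_zobj_def)

lemma AZ_deg: "deg AZ x = vs.span {a g f | g f. g \<in> carrier G \<and> f \<in> F \<and> g \<otimes> f \<otimes> inv g = x}"
  by (simp add: A_zobj_def)

lemma gen_deg: "g \<in> carrier G \<Longrightarrow> f \<in> F \<Longrightarrow> a g f \<in> deg AZ (g \<otimes> f \<otimes> inv g)"
  unfolding AZ_deg by (auto intro: vs.span_base)

lemma deg_sub: "deg AZ x \<subseteq> AS"
  unfolding AZ_deg A_span by (rule vs.span_mono) auto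

lemma deg_mem_ind:
  fixes f :: "'k vec \<Rightarrow> ('j \<Rightarrow> 'k)"
  assumes f: "linear_on AS f" and "vs.subspace W"
    and "\<And>g y. g \<in> carrier G \<Longrightarrow> y \<in> F \<Longrightarrow> g \<otimes> y \<otimes> inv g = x \<Longrightarrow> f (a g y) \<in> W" and y: "y \<in> deg AZ x"
  shows "f y \<in> W"
  by (rule linear_on_mem_span[OF linear_on_subset[OF f deg_sub[of x], unfolded AZ_deg] assms(2) _ y[unfolded AZ_deg]])
    (use assms(3) in blast)

lemma deg_ext:
  fixes f k :: "'k vec \<Rightarrow> ('j \<Rightarrow> 'k)"
  assumes f: "linear_on AS f" and k: "linear_on AS k"
    and "\<And>g y. g \<in> carrier G \<Longrightarrow> y \<in> F \<Longrightarrow> g \<otimes> y \<otimes> inv g = x \<Longrightarrow> f (a g y) = k (a g y)" and y: "y \<in> deg AZ x"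
  shows "f y = k y"
  by (rule linear_on_eq_span[OF linear_on_subset[OF f deg_sub[of x], unfolded AZ_deg]
        linear_on_subset[OF k deg_sub[of x], unfolded AZ_deg] _ y[unfolded AZ_deg]])
    (use assms(3) in blast)

text \<open>The projection to degree \<open>x\<close> keeps the symbols with
  \<open>g f g^-1 = x\<close>. It respects the relations because
  \<open>(g h) f (g h)^-1 = g (h f h^-1) g^-1\<close>.\<close>

lemma AZ_zobj: "is_zobj G AZ"
proof -
  have rel: "(if (g \<otimes> h) \<otimes> f \<otimes> inv (g \<otimes> h) = x then a (g \<otimes> h) f else 0) =
      fscale (\<epsilon> h f) (if g \<otimes> (h \<otimes> f \<otimes> inv h) \<otimes> inv g = x then a g (h \<otimes> f \<otimes> inv h) else 0)"
    if "g \<in> carrier G" "h \<in> K" "f \<in> F" for g h f x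
    using that K_mem F_mem conj_mult[of g h f] by (simp add: gen_rel)
  have "\<exists>k. linear_on AS k \<and> (\<forall>g\<in>carrier G. \<forall>f\<in>F. k (a g f) = (if g \<otimes> f \<otimes> inv g = x then a g f else 0))" for x
    by (rule A_univ[of "\<lambda>g f. if g \<otimes> f \<otimes> inv g = x then a g f else 0", OF rel]) auto
  then obtain p where p: "\<And>x. linear_on AS (p x)"
    "\<And>x g f. g \<in> carrier G \<Longrightarrow> f \<in> F \<Longrightarrow> p x (a g f) = (if g \<otimes> f \<otimes> inv g = x then a g f else 0)"
    by metis
  have D: "vs.subspace (deg AZ x)" for x by (simp add: AZ_deg)
  have conj: "g \<otimes> f \<otimes> inv g \<in> carrier G" if "g \<in> carrier G" "f \<in> F" for g f using that F_mem by simp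
  note al = A_act_linear
  have am: "act AZ x y \<in> AS" if "x \<in> carrier G" "y \<in> AS" for x y
    by (rule A_mem[OF al[OF that(1)] AS_subspace _ that(2)]) (simp add: A_act_gen that gen_mem)
  show ?thesis
  proof (rule is_zobjI[where p = p], unfold AZ_space)
    fix x y assume "x \<in> carrier G" "y \<in> AS"
    show "p x y \<in> deg AZ x"
      by (rule A_mem[OF p(1) D _ \<open>y \<in> AS\<close>]) (auto simp: p(2) gen_deg vs.subspace_0[OF D])
  next
    fix y assume y: "y \<in> AS"
    show "(\<Sum>x\<in>carrier G. p x y) = y"
      by (rule A_ext[OF linear_on_sum_fun[OF p(1)] linear_on_id _ y]) (simp add: p(2) fin conj)
  next
    fix x x' y assume "x \<noteq> x'" and y: "y \<in> deg AZ x'"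
    then show "p x y = 0"
      by (intro deg_ext[OF p(1) linear_on_const_zero _ y]) (simp add: p(2))
  next
    fix y assume y: "y \<in> AS"
    show "act AZ \<one> y = y"
      by (rule A_ext[OF al[OF one_closed] linear_on_id _ y]) (simp add: A_act_gen)
  next
    fix x x' y assume x: "x \<in> carrier G" "x' \<in> carrier G" and y: "y \<in> AS"
    show "act AZ (x \<otimes> x') y = act AZ x (act AZ x' y)"
      by (rule A_ext[OF al linear_on_comp[OF al[OF x(2)] al[OF x(1)] am] _ y])
        (use x in \<open>simp_all add: A_act_gen m_assoc\<close>)
  next
    fix x x' y assume x: "x \<in> carrier G" "x' \<in> carrier G" and y: "y \<in> deg AZ x'"
    show "act AZ x y \<in> deg AZ (x \<otimes> x' \<otimes> inv x)"
    proof (rule deg_mem_ind[OF al[OF x(1)] D _ y])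
      fix g f assume gf: "g \<in> carrier G" "f \<in> F" "g \<otimes> f \<otimes> inv g = x'"
      then show "act AZ x (a g f) \<in> deg AZ (x \<otimes> x' \<otimes> inv x)"
        using gen_deg[of "x \<otimes> g" f] x conj_mult[of x g f] F_mem by (simp add: A_act_gen)
    qed
  qed (use AS_fd D deg_sub p(1) am al in auto)
qed

end

section \<open>The multiplication on symbols\<close>

lemma (in group) conj_prod:
  "g \<in> carrier G \<Longrightarrow> f \<in> carrier G \<Longrightarrow> f' \<in> carrier G \<Longrightarrow>
    g \<otimes> (f \<otimes> f') \<otimes> inv g = (g \<otimes> f \<otimes> inv g) \<otimes> (g \<otimes> f' \<otimes> inv g)"
  using inv_solve_left'[of "f' \<otimes> inv g" g] by (simp add: m_assoc flip: m_assoc[of "inv g" g "f' \<otimes> inv g"])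

lemma (in group) l_coset_eq_iff:
  assumes H: "subgroup H G" and g: "g \<in> carrier G" "g' \<in> carrier G"
  shows "g <# H = g' <# H \<longleftrightarrow> inv g \<otimes> g' \<in> H"
proof
  assume "g <# H = g' <# H"
  moreover have "g' \<in> g' <# H" using g subgroup.one_closed[OF H] by (force simp: l_coset_def)
  ultimately obtain h where "h \<in> H" "g' = g \<otimes> h" by (auto simp: l_coset_def)
  then show "inv g \<otimes> g' \<in> H" using g subgroup.mem_carrier[OF H] by (simp flip: m_assoc)
next
  assume h: "inv g \<otimes> g' \<in> H"
  have "g <# H = (g \<otimes> (inv g \<otimes> g')) <# H"
  proof
    have HG: "x \<in> carrier G" if "x \<in> H" for x using that subgroup.mem_carrier[OF H] by blast
    show "g <# H \<subseteq> (g \<otimes> (inv g \<otimes> g')) <# H"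
    proof
      fix x assume "x \<in> g <# H"
      then obtain k where k: "k \<in> H" "x = g \<otimes> k" by (auto simp: l_coset_def)
      let ?k = "inv (inv g \<otimes> g') \<otimes> k"
      have "?k \<in> H" using k h H by (simp add: subgroup.m_closed subgroup.m_inv_closed)
      moreover have "x = (g \<otimes> (inv g \<otimes> g')) \<otimes> ?k"
        using k g HG[OF h] HG[OF k(1)] by (simp add: inv_mult_group m_assoc flip: m_assoc[of g' "inv g'"] m_assoc[of g "inv g"])
      ultimately show "x \<in> (g \<otimes> (inv g \<otimes> g')) <# H" by (auto simp: l_coset_def)
    qed
    show "(g \<otimes> (inv g \<otimes> g')) <# H \<subseteq> g <# H"
      using h g HG subgroup.m_closed[OF H h] by (force simp: l_coset_def m_assoc)
  qed
  then show "g <# H = g' <# H" using g by (simp flip: m_assoc)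
qed

text \<open>
  For \<open>F \<subseteq> K \<subseteq> H\<close> the symbols modulo \<open>K\<close> form a right module over the algebra of symbols modulo \<open>H\<close>,
  by the formula for the multiplication. The case \<open>K = H\<close> is the algebra itself, the case \<open>K = F\<close>
  is the local module that obstructs triviality when \<open>F \<noteq> H\<close>.
\<close>

locale crossed_data = finite_grp G for G (structure) +
  fixes H F :: "'a set" and \<gamma> \<epsilon> :: "'a \<Rightarrow> 'a \<Rightarrow> 'k::field_char_0" and K :: "'a set"
  assumes H: "subgroup H G" and K: "subgroup K G" and FK: "F \<subseteq> K" and KH: "K \<subseteq> H"
    and F_sub: "subgroup F G"
    and conj_H: "h \<in> H \<Longrightarrow> f \<in> F \<Longrightarrow> h \<otimes> f \<otimes> inv h \<in> F"
    and \<gamma>_nz: "f \<in> F \<Longrightarrow> f' \<in> F \<Longrightarrow> \<gamma> f f' \<noteq> 0"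
    and \<gamma>_cocycle: "f \<in> F \<Longrightarrow> f' \<in> F \<Longrightarrow> f'' \<in> F \<Longrightarrow> \<gamma> f f' * \<gamma> (f \<otimes> f') f'' = \<gamma> f' f'' * \<gamma> f (f' \<otimes> f'')"
    and \<gamma>_one: "f \<in> F \<Longrightarrow> \<gamma> \<one> f = 1" "f \<in> F \<Longrightarrow> \<gamma> f \<one> = 1"
    and \<epsilon>_nz: "h \<in> H \<Longrightarrow> f \<in> F \<Longrightarrow> \<epsilon> h f \<noteq> 0"
    and \<epsilon>_mult: "h \<in> H \<Longrightarrow> h' \<in> H \<Longrightarrow> f \<in> F \<Longrightarrow> \<epsilon> (h \<otimes> h') f = \<epsilon> h (h' \<otimes> f \<otimes> inv h') * \<epsilon> h' f"
    and \<epsilon>_\<gamma>: "h \<in> H \<Longrightarrow> f \<in> F \<Longrightarrow> f' \<in> F \<Longrightarrow>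
      \<gamma> f f' * \<epsilon> h (f \<otimes> f') = \<epsilon> h f * \<epsilon> h f' * \<gamma> (h \<otimes> f \<otimes> inv h) (h \<otimes> f' \<otimes> inv h)"
    and \<gamma>_comm: "f \<in> F \<Longrightarrow> f' \<in> F \<Longrightarrow> \<gamma> f f' = \<epsilon> f f' * \<gamma> (f \<otimes> f' \<otimes> inv f) f"
begin

lemma HG: "h \<in> H \<Longrightarrow> h \<in> carrier G" and FG: "f \<in> F \<Longrightarrow> f \<in> carrier G"
  and FH: "f \<in> F \<Longrightarrow> f \<in> H" and KH': "k \<in> K \<Longrightarrow> k \<in> H"
  using subgroup.subset[OF H] FK KH by auto

lemma F_closed [simp]: "\<one> \<in> F" "f \<in> F \<Longrightarrow> f' \<in> F \<Longrightarrow> f \<otimes> f' \<in> F" "f \<in> F \<Longrightarrow> inv f \<in> F"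
  and H_closed [simp]: "\<one> \<in> H" "h \<in> H \<Longrightarrow> h' \<in> H \<Longrightarrow> h \<otimes> h' \<in> H" "h \<in> H \<Longrightarrow> inv h \<in> H"
  using subgroup.one_closed subgroup.m_closed subgroup.m_inv_closed F_sub H by metis+

sublocale A: symbol_system G H F \<epsilon>
  by (intro symbol_system.intro symbol_system_axioms.intro finite_grp_axioms H) (use conj_H FG in auto)

sublocale N: symbol_system G K F \<epsilon>
  by (intro symbol_system.intro symbol_system_axioms.intro finite_grp_axioms K) (use conj_H FG KH' in auto)

text \<open>By the first condition this scalar is its own square, and it is nonzero.\<close>

lemma \<epsilon>_one: "f \<in> F \<Longrightarrow> \<epsilon> \<one> f = 1"
  using \<epsilon>_mult[of \<one> \<one> f] \<epsilon>_nz[of \<one> f] FG by simp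

lemma \<epsilon>_unit: "h \<in> H \<Longrightarrow> \<epsilon> h \<one> = 1"
  using \<epsilon>_\<gamma>[of h \<one> \<one>] \<epsilon>_nz[of h \<one>] HG by (simp add: \<gamma>_one)

text \<open>The product of two symbols once the second is rewritten over the representative
  \<open>g\<close> of the first: the relation for \<open>h = g^-1 g'\<close> contributes
  \<open>\<epsilon> h f'\<close> and replaces \<open>f'\<close> by \<open>h f' h^-1\<close>.\<close>

definition "nval g f g' f' = (if inv g \<otimes> g' \<in> H then
  fscale (\<epsilon> (inv g \<otimes> g') f' * \<gamma> f ((inv g \<otimes> g') \<otimes> f' \<otimes> inv (inv g \<otimes> g')))
    (N.a g (f \<otimes> ((inv g \<otimes> g') \<otimes> f' \<otimes> inv (inv g \<otimes> g')))) else 0)"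

lemma coset_mult:
  assumes "h \<in> H" "g \<in> carrier G"
  shows "h \<otimes> g \<in> H \<longleftrightarrow> g \<in> H" "g \<otimes> h \<in> H \<longleftrightarrow> g \<in> H"
proof -
  have "g = inv h \<otimes> (h \<otimes> g)" "g = (g \<otimes> h) \<otimes> inv h" using assms HG by (simp_all add: m_assoc)
  then show "h \<otimes> g \<in> H \<longleftrightarrow> g \<in> H" "g \<otimes> h \<in> H \<longleftrightarrow> g \<in> H" using assms H_closed by metis+
qed

text \<open>Passing from \<open>g\<close> to \<open>g k\<close> conjugates the second index
  \<open>p\<close> to \<open>q = k^-1 p k\<close>. The scalars \<open>\<epsilon> k q\<close> and
  \<open>\<epsilon> (inv k) p\<close> cancel, and the second condition converts
  \<open>\<gamma> f q\<close> into \<open>\<gamma>\<close> at the conjugates by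
  \<open>k\<close>.\<close>

lemma nval_rel_left:
  assumes g: "g \<in> carrier G" "g' \<in> carrier G" and k: "k \<in> K" and f: "f \<in> F" "f' \<in> F"
  shows "nval (g \<otimes> k) f g' f' = fscale (\<epsilon> k f) (nval g (k \<otimes> f \<otimes> inv k) g' f')"
proof -
  note kH = KH'[OF k] and kG = HG[OF KH'[OF k]]
  let ?h = "inv g \<otimes> g'"
  have h1: "inv (g \<otimes> k) \<otimes> g' = inv k \<otimes> ?h" using g kG by (simp add: inv_mult_group m_assoc)
  show ?thesis
  proof (cases "?h \<in> H")
    case False
    then have "inv k \<otimes> ?h \<notin> H" using coset_mult(1)[of "inv k" ?h] kH g by simp
    then show ?thesis using False by (simp add: nval_def h1)
  next
    case True
    let ?p = "?h \<otimes> f' \<otimes> inv ?h"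
    let ?q = "inv k \<otimes> ?p \<otimes> inv (inv k)"
    have p: "?p \<in> F" using conj_H True f by blast
    have q: "?q \<in> F" using conj_H[of "inv k" ?p] kH p by simp
    have pG: "?p \<in> carrier G" and fG: "f \<in> carrier G" using p f FG by auto
    have hG: "?h \<in> carrier G" using g by simp
    have cj: "(inv k \<otimes> ?h) \<otimes> f' \<otimes> inv (inv k \<otimes> ?h) = ?q"
      using conj_mult[of "inv k" ?h f'] kG hG FG[OF f(2)] by simp
    have kq: "k \<otimes> ?q \<otimes> inv k = ?p"
      using conj_mult[of k "inv k" ?p] kG pG by simp
    have "k \<otimes> (f \<otimes> ?q) \<otimes> inv k = (k \<otimes> f \<otimes> inv k) \<otimes> (k \<otimes> ?q \<otimes> inv k)"
      using kG fG FG[OF q] by (simp add: m_assoc)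
    then have kfq: "k \<otimes> (f \<otimes> ?q) \<otimes> inv k = (k \<otimes> f \<otimes> inv k) \<otimes> ?p" by (simp only: kq)
    have inH: "inv k \<otimes> ?h \<in> H" using True kH by simp
    have e1: "\<epsilon> (inv k \<otimes> ?h) f' = \<epsilon> (inv k) ?p * \<epsilon> ?h f'" using \<epsilon>_mult[of "inv k" ?h f'] True kH f by simp
    have e2: "\<epsilon> k ?q * \<epsilon> (inv k) ?p = 1"
      using \<epsilon>_mult[of k "inv k" ?p] kH p \<epsilon>_one[OF p] kG by simp
    have e3: "\<gamma> f ?q * \<epsilon> k (f \<otimes> ?q) = \<epsilon> k f * \<epsilon> k ?q * \<gamma> (k \<otimes> f \<otimes> inv k) ?p"
      using \<epsilon>_\<gamma>[OF kH f(1) q] by (simp only: kq)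
    have "\<epsilon> (inv k) ?p * \<epsilon> ?h f' * \<gamma> f ?q * \<epsilon> k (f \<otimes> ?q) = \<epsilon> (inv k) ?p * \<epsilon> ?h f' * (\<epsilon> k f * \<epsilon> k ?q * \<gamma> (k \<otimes> f \<otimes> inv k) ?p)"
      by (simp only: mult.assoc e3)
    also have "\<dots> = (\<epsilon> k ?q * \<epsilon> (inv k) ?p) * (\<epsilon> k f * (\<epsilon> ?h f' * \<gamma> (k \<otimes> f \<otimes> inv k) ?p))" by (simp only: ac_simps)
    finally have e: "\<epsilon> (inv k) ?p * \<epsilon> ?h f' * \<gamma> f ?q * \<epsilon> k (f \<otimes> ?q) = \<epsilon> k f * (\<epsilon> ?h f' * \<gamma> (k \<otimes> f \<otimes> inv k) ?p)"
      by (simp only: e2 mult_1)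
    have "nval (g \<otimes> k) f g' f' = fscale (\<epsilon> (inv k) ?p * \<epsilon> ?h f' * \<gamma> f ?q) (N.a (g \<otimes> k) (f \<otimes> ?q))"
      unfolding nval_def h1 cj e1 using inH by simp
    also have "N.a (g \<otimes> k) (f \<otimes> ?q) = fscale (\<epsilon> k (f \<otimes> ?q)) (N.a g ((k \<otimes> f \<otimes> inv k) \<otimes> ?p))"
      using N.gen_rel[OF g(1) k F_closed(2)[OF f(1) q]] by (simp only: kfq)
    also have "fscale (\<epsilon> (inv k) ?p * \<epsilon> ?h f' * \<gamma> f ?q) \<dots> = fscale (\<epsilon> k f) (nval g (k \<otimes> f \<otimes> inv k) g' f')"
      unfolding nval_def using True by (simp only: fscale_scale e if_True)
    finally show ?thesis .
  qed
qed

lemma nval_rel_right: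
  assumes g: "g \<in> carrier G" "g' \<in> carrier G" and h: "h \<in> H" and f: "f \<in> F" "f' \<in> F"
  shows "nval g f (g' \<otimes> h) f' = fscale (\<epsilon> h f') (nval g f g' (h \<otimes> f' \<otimes> inv h))"
proof -
  let ?h = "inv g \<otimes> g'"
  have h1: "inv g \<otimes> (g' \<otimes> h) = ?h \<otimes> h" using g HG[OF h] by (simp add: m_assoc)
  have iff: "?h \<otimes> h \<in> H \<longleftrightarrow> ?h \<in> H" using coset_mult(2)[OF h, of ?h] g by simp
  have cj: "(?h \<otimes> h) \<otimes> f' \<otimes> inv (?h \<otimes> h) = ?h \<otimes> (h \<otimes> f' \<otimes> inv h) \<otimes> inv ?h"
    using conj_mult[of ?h h f'] g HG[OF h] FG[OF f(2)] by simp
  show ?thesis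
    unfolding nval_def h1 iff cj using \<epsilon>_mult[OF _ h f(2), of ?h] by (simp add: mult_ac)
qed

text \<open>The universal property is used twice: in the left symbol for each fixed right symbol,
  and then in the right symbol for each fixed vector on the left.\<close>

lemma nprod_exists: "\<exists>b. bilinear_on N.AS A.AS b \<and>
  (\<forall>g\<in>carrier G. \<forall>f\<in>F. \<forall>g'\<in>carrier G. \<forall>f'\<in>F. b (N.a g f) (A.a g' f') = nval g f g' f')"
proof -
  have "\<exists>r. linear_on N.AS r \<and> (\<forall>g\<in>carrier G. \<forall>f\<in>F. r (N.a g f) = nval g f g' f')"
    if g': "g' \<in> carrier G" and f': "f' \<in> F" for g' f'
  proof -
    obtain r where "linear_on N.AS r" "\<And>g f. g \<in> carrier G \<Longrightarrow> f \<in> F \<Longrightarrow> r (N.a g f) = nval g f g' f'"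
      by (rule N.A_univ[of "\<lambda>g f. nval g f g' f'"]) (use nval_rel_left g' f' in auto)
    then show ?thesis by blast
  qed
  then obtain r where r: "\<And>g' f'. g' \<in> carrier G \<Longrightarrow> f' \<in> F \<Longrightarrow> linear_on N.AS (r g' f')"
    "\<And>g' f' g f. g' \<in> carrier G \<Longrightarrow> f' \<in> F \<Longrightarrow> g \<in> carrier G \<Longrightarrow> f \<in> F \<Longrightarrow> r g' f' (N.a g f) = nval g f g' f'"
    by metis
  have "\<exists>s. linear_on A.AS s \<and> (\<forall>g'\<in>carrier G. \<forall>f'\<in>F. s (A.a g' f') = r g' f' x)" if x: "x \<in> N.AS" for x
  proof -
    have "r (g' \<otimes> h) f' x = fscale (\<epsilon> h f') (r g' (h \<otimes> f' \<otimes> inv h) x)"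
      if "g' \<in> carrier G" "h \<in> H" "f' \<in> F" for g' h f'
      by (rule N.A_ext[OF r(1) linear_on_scale_fun[OF r(1)] _ x])
        (use that HG conj_H in \<open>simp_all add: r(2) nval_rel_right\<close>)
    then obtain s where "linear_on A.AS s" "\<And>g' f'. g' \<in> carrier G \<Longrightarrow> f' \<in> F \<Longrightarrow> s (A.a g' f') = r g' f' x"
      by (rule A.A_univ[of "\<lambda>g' f'. r g' f' x"]) auto
    then show ?thesis by blast
  qed
  then obtain s where s: "\<And>x. x \<in> N.AS \<Longrightarrow> linear_on A.AS (s x)"
    "\<And>x g' f'. x \<in> N.AS \<Longrightarrow> g' \<in> carrier G \<Longrightarrow> f' \<in> F \<Longrightarrow> s x (A.a g' f') = r g' f' x"
    by metis
  have "bilinear_on N.AS A.AS s"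
  proof (rule bilinear_onI[OF s(1)])
    fix y assume y: "y \<in> A.AS"
    show "linear_on N.AS (\<lambda>x. s x y)"
    proof (rule linear_onI)
      fix x x' assume x: "x \<in> N.AS" "x' \<in> N.AS"
      then have "x + x' \<in> N.AS" using N.AS_subspace by (simp add: vs.subspace_add)
      then show "s (x + x') y = s x y + s x' y"
        using x by (intro A.A_ext[OF s(1) linear_on_add_fun[OF s(1) s(1)] _ y])
          (simp_all add: s(2) linear_on_add[OF r(1)])
    next
      fix c x assume x: "x \<in> N.AS"
      then have "fscale c x \<in> N.AS" using N.AS_subspace by (simp add: vs.subspace_scale)
      then show "s (fscale c x) y = fscale c (s x y)"
        using x by (intro A.A_ext[OF s(1) linear_on_scale_fun[OF s(1)] _ y])
          (simp_all add: s(2) linear_on_scale[OF r(1)])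
    qed
  qed
  moreover have "s (N.a g f) (A.a g' f') = nval g f g' f'"
    if "g \<in> carrier G" "f \<in> F" "g' \<in> carrier G" "f' \<in> F" for g f g' f'
    using that by (simp add: s(2) N.gen_mem r(2))
  ultimately show ?thesis by blast
qed

definition "nprod = (SOME b. bilinear_on N.AS A.AS b \<and>
  (\<forall>g\<in>carrier G. \<forall>f\<in>F. \<forall>g'\<in>carrier G. \<forall>f'\<in>F. b (N.a g f) (A.a g' f') = nval g f g' f'))"

lemma nprod_bilinear: "bilinear_on N.AS A.AS nprod"
  and nprod_gen: "g \<in> carrier G \<Longrightarrow> f \<in> F \<Longrightarrow> g' \<in> carrier G \<Longrightarrow> f' \<in> F \<Longrightarrow> nprod (N.a g f) (A.a g' f') = nval g f g' f'"
  using someI_ex[OF nprod_exists] unfolding nprod_def by blast+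

lemmas nprod_linear = bilinear_onD[OF nprod_bilinear]

lemma nprod_same:
  "g \<in> carrier G \<Longrightarrow> f \<in> F \<Longrightarrow> f' \<in> F \<Longrightarrow> nprod (N.a g f) (A.a g f') = fscale (\<gamma> f f') (N.a g (f \<otimes> f'))"
  by (simp add: nprod_gen nval_def \<epsilon>_one FG)

lemma nprod_other:
  "g \<in> carrier G \<Longrightarrow> f \<in> F \<Longrightarrow> g' \<in> carrier G \<Longrightarrow> f' \<in> F \<Longrightarrow> inv g \<otimes> g' \<notin> H \<Longrightarrow> nprod (N.a g f) (A.a g' f') = 0"
  by (simp add: nprod_gen nval_def)

lemma nprod_mem: "x \<in> N.AS \<Longrightarrow> y \<in> A.AS \<Longrightarrow> nprod x y \<in> N.AS"
proof -
  assume x: "x \<in> N.AS" and y: "y \<in> A.AS"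
  have "nval g f g' f' \<in> N.AS" if "g \<in> carrier G" "f \<in> F" "g' \<in> carrier G" "f' \<in> F" for g f g' f'
    using that conj_H by (auto simp: nval_def vs.subspace_0[OF N.AS_subspace]
        intro!: vs.subspace_scale[OF N.AS_subspace] N.gen_mem)
  then have "nprod (N.a g f) y \<in> N.AS" if "g \<in> carrier G" "f \<in> F" for g f
    by (intro A.A_mem[OF nprod_linear(1)[OF N.gen_mem[OF that]] N.AS_subspace _ y]) (simp add: nprod_gen that)
  then show ?thesis
    by (intro N.A_mem[OF nprod_linear(2)[OF y] N.AS_subspace _ x])
qed

text \<open>With \<open>h = g^-1 g'\<close> one has \<open>g (h f' h^-1) g^-1 = g' f' g'^-1\<close>,
  so rewriting the second symbol over \<open>g\<close> keeps its degree and degrees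
  multiply.\<close>

lemma nprod_deg:
  assumes x: "x \<in> carrier G" "n \<in> deg N.AZ x" and y: "y \<in> carrier G" "b \<in> deg A.AZ y"
  shows "nprod n b \<in> deg N.AZ (x \<otimes> y)"
proof -
  have D: "vs.subspace (deg N.AZ (x \<otimes> y))" by (simp add: N.AZ_deg)
  have b: "b \<in> A.AS" using A.deg_sub y by blast
  have "nval g f g' f' \<in> deg N.AZ (x \<otimes> y)"
    if g: "g \<in> carrier G" "f \<in> F" "g \<otimes> f \<otimes> inv g = x" and g': "g' \<in> carrier G" "f' \<in> F" "g' \<otimes> f' \<otimes> inv g' = y" for g f g' f'
  proof (cases "inv g \<otimes> g' \<in> H")
    case True
    let ?h = "inv g \<otimes> g'"
    let ?p = "?h \<otimes> f' \<otimes> inv ?h"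
    have p: "?p \<in> F" using conj_H[OF True g'(2)] .
    have "g \<otimes> ?p \<otimes> inv g = y"
      using conj_mult[of g ?h f'] g g' FG[OF g'(2)] by simp
    then have "g \<otimes> (f \<otimes> ?p) \<otimes> inv g = x \<otimes> y"
      using conj_prod[OF g(1) FG[OF g(2)] FG[OF p]] by (simp only: g(3))
    then show ?thesis
      using N.gen_deg[OF g(1) F_closed(2)[OF g(2) p]] True by (simp add: nval_def vs.subspace_scale[OF D])
  next
    case False
    then show ?thesis using vs.subspace_0[OF D] by (simp add: nval_def)
  qed
  then have "nprod (N.a g f) b \<in> deg N.AZ (x \<otimes> y)"
    if g: "g \<in> carrier G" "f \<in> F" "g \<otimes> f \<otimes> inv g = x" for g f
    using g by (intro A.deg_mem_ind[OF nprod_linear(1)[OF N.gen_mem[OF g(1,2)]] D _ y(2)]) (simp add: nprod_gen)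
  then show ?thesis
    by (intro N.deg_mem_ind[OF nprod_linear(2)[OF b] D _ x(2)])
qed

text \<open>Scalars and indices of a product depend on the representatives only through
  \<open>g^-1 g'\<close>, which does not change when both are multiplied by \<open>x\<close> on the
  left.\<close>

lemma nprod_act:
  assumes x: "x \<in> carrier G" and n: "n \<in> N.AS" and b: "b \<in> A.AS"
  shows "nprod (act N.AZ x n) (act A.AZ x b) = act N.AZ x (nprod n b)"
proof -
  note Nl = N.A_act_linear[OF x] and Al = A.A_act_linear[OF x]
  have Nm: "act N.AZ x m \<in> N.AS" if "m \<in> N.AS" for m using act_mem[OF N.AZ_zobj x] that by simp
  have Am: "act A.AZ x m \<in> A.AS" if "m \<in> A.AS" for m using act_mem[OF A.AZ_zobj x] that by simp
  have base: "nprod (act N.AZ x (N.a g f)) (act A.AZ x (A.a g' f')) = act N.AZ x (nprod (N.a g f) (A.a g' f'))"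
    if g: "g \<in> carrier G" "f \<in> F" "g' \<in> carrier G" "f' \<in> F" for g f g' f'
  proof -
    have "inv (x \<otimes> g) \<otimes> (x \<otimes> g') = inv g \<otimes> g'" using x g by (simp add: inv_mult_group m_assoc)
    then have "nval (x \<otimes> g) f (x \<otimes> g') f' = act N.AZ x (nval g f g' f')"
      using g conj_H by (simp add: nval_def linear_on_zero[OF Nl N.AS_subspace] linear_on_scale[OF Nl] N.A_act_gen[OF x] N.gen_mem)
    then show ?thesis using g x by (simp add: N.A_act_gen A.A_act_gen nprod_gen)
  qed
  have "nprod (act N.AZ x (N.a g f)) (act A.AZ x b) = act N.AZ x (nprod (N.a g f) b)"
    if g: "g \<in> carrier G" "f \<in> F" for g f
    by (rule A.A_ext[OF linear_on_comp[OF Al nprod_linear(1)[OF Nm[OF N.gen_mem[OF g]]] Am]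
        linear_on_comp[OF nprod_linear(1)[OF N.gen_mem[OF g]] Nl nprod_mem[OF N.gen_mem[OF g]]] _ b])
      (assumption | rule base[OF g])+
  then show ?thesis
    by (intro N.A_ext[OF linear_on_comp[OF Nl nprod_linear(2)[OF Am[OF b]] Nm]
        linear_on_comp[OF nprod_linear(2)[OF b] Nl nprod_mem[OF _ b]] _ n])
qed

lemma card_coset: "g \<in> carrier G \<Longrightarrow> card {x \<in> carrier G. inv g \<otimes> x \<in> H} = card H"
proof -
  assume g: "g \<in> carrier G"
  have "bij_betw (\<lambda>h. g \<otimes> h) H {x \<in> carrier G. inv g \<otimes> x \<in> H}"
    by (rule bij_betw_byWitness[of _ "\<lambda>x. inv g \<otimes> x"]) (use g HG in auto)
  then show ?thesis using bij_betw_same_card by metis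
qed

lemma card_coset': "g \<in> carrier G \<Longrightarrow> card {x \<in> carrier G. inv x \<otimes> g \<in> H} = card H"
proof -
  assume g: "g \<in> carrier G"
  have "inv x \<otimes> g \<in> H \<longleftrightarrow> inv g \<otimes> x \<in> H" if "x \<in> carrier G" for x
    using H_closed(3)[of "inv x \<otimes> g"] H_closed(3)[of "inv g \<otimes> x"] that g by (auto simp: inv_mult_group)
  then have "{x \<in> carrier G. inv x \<otimes> g \<in> H} = {x \<in> carrier G. inv g \<otimes> x \<in> H}" by auto
  then show ?thesis using card_coset[OF g] by simp
qed

lemma sum_over: "(\<Sum>x\<in>carrier G. if P x then v else 0) = fscale (of_nat (card {x \<in> carrier G. P x})) v"
  for v :: "'k vec"
  using fin by (simp add: sum.If_cases vs.sum_constant_scale Int_def del: sum_constant)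

lemma card_H_nz: "of_nat (card H) \<noteq> (0 :: 'k)"
proof -
  have "finite H" using fin subgroup.subset[OF H] finite_subset by blast
  then show ?thesis using H_closed(1) card_eq_0_iff[of H] by (metis empty_iff of_nat_eq_0_iff)
qed

text \<open>The symbols \<open>(g, \<one>)\<close> depend only on the coset of \<open>g\<close>, so
  summing over all of \<open>G\<close> counts each coset \<open>card H\<close> times.\<close>

definition "aone = fscale (inverse (of_nat (card H))) (\<Sum>g\<in>carrier G. A.a g \<one>)"

lemma aone_mem: "aone \<in> A.AS"
  unfolding aone_def by (intro vs.subspace_scale[OF A.AS_subspace] vs.subspace_sum[OF A.AS_subspace] A.gen_mem) auto

lemma nprod_aone: "n \<in> N.AS \<Longrightarrow> nprod n aone = n"
proof -
  assume n: "n \<in> N.AS"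
  have "nprod (N.a g f) aone = N.a g f" if g: "g \<in> carrier G" "f \<in> F" for g f
  proof -
    note l = nprod_linear(1)[OF N.gen_mem[OF g]]
    have v: "nprod (N.a g f) (A.a x \<one>) = (if inv g \<otimes> x \<in> H then N.a g f else 0)" if "x \<in> carrier G" for x
      using g that HG FG by (simp add: nprod_gen nval_def \<epsilon>_unit \<gamma>_one)
    have "nprod (N.a g f) aone = fscale (inverse (of_nat (card H))) (\<Sum>x\<in>carrier G. nprod (N.a g f) (A.a x \<one>))"
      unfolding aone_def
      by (simp add: linear_on_scale[OF l] vs.subspace_sum[OF A.AS_subspace] A.gen_mem linear_on_sum[OF l A.AS_subspace])
    also have "(\<Sum>x\<in>carrier G. nprod (N.a g f) (A.a x \<one>)) = (\<Sum>x\<in>carrier G. if inv g \<otimes> x \<in> H then N.a g f else 0)"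
      by (rule sum.cong) (simp_all add: v)
    also have "\<dots> = fscale (of_nat (card H)) (N.a g f)"
      by (simp only: sum_over card_coset[OF g(1)])
    finally show ?thesis using card_H_nz by simp
  qed
  then show ?thesis by (intro N.A_ext[OF nprod_linear(2)[OF aone_mem] linear_on_id _ n])
qed

text \<open>With \<open>H\<close> in place of \<open>K\<close> the facts about the module become
  facts about the algebra itself.\<close>

lemma crossed_data_H: "crossed_data G H F \<gamma> \<epsilon> H"
  by (intro crossed_data.intro crossed_data_axioms.intro finite_grp_axioms H subset_refl F_sub)
    (fact conj_H \<gamma>_nz \<gamma>_cocycle \<gamma>_one \<epsilon>_nz \<epsilon>_mult \<epsilon>_\<gamma> \<gamma>_comm | use FH in blast)+

interpretation R: crossed_data G H F \<gamma> \<epsilon> H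
  by (rule crossed_data_H)

text \<open>Both sides vanish unless all three symbols lie over one coset of \<open>H\<close>.
  Written over a common representative the identity is the cocycle condition.\<close>

lemma nprod_assoc:
  assumes n: "n \<in> N.AS" and b: "b \<in> A.AS" and c: "c \<in> A.AS"
  shows "nprod (nprod n b) c = nprod n (R.nprod b c)"
proof -
  have lin_b: "linear_on A.AS (\<lambda>b. nprod (nprod n b) c)" "linear_on A.AS (\<lambda>b. nprod n (R.nprod b c))"
    if "n \<in> N.AS" "c \<in> A.AS" for n c
    using that by (auto intro: linear_on_comp[OF nprod_linear(1) nprod_linear(2)] nprod_mem
        linear_on_comp[OF R.nprod_linear(2) nprod_linear(1)] R.nprod_mem)
  have lin_c: "linear_on A.AS (\<lambda>c. nprod (nprod n b) c)" "linear_on A.AS (\<lambda>c. nprod n (R.nprod b c))"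
    if "n \<in> N.AS" "b \<in> A.AS" for n b
    using that by (auto intro: nprod_linear(1) nprod_mem
        linear_on_comp[OF R.nprod_linear(1) nprod_linear(1)] R.nprod_mem)
  have lin_n: "linear_on N.AS (\<lambda>n. nprod (nprod n b) c)" "linear_on N.AS (\<lambda>n. nprod n (R.nprod b c))"
    using b c by (auto intro: linear_on_comp[OF nprod_linear(2) nprod_linear(2)] nprod_mem
        nprod_linear(2) R.nprod_mem)
  have zero: "nprod 0 y = 0" if "y \<in> A.AS" for y using linear_on_zero[OF nprod_linear(2)[OF that] N.AS_subspace] .
  have zero': "nprod n 0 = 0" if "n \<in> N.AS" for n using linear_on_zero[OF nprod_linear(1)[OF that] A.AS_subspace] .
  have gen: "nprod (nprod (N.a g f) b) c = nprod (N.a g f) (R.nprod b c)" if g: "g \<in> carrier G" "f \<in> F" for g f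
  proof (rule A.A_ext_coset[OF lin_b[OF N.gen_mem[OF g] c] g(1) _ _ b])
    fix x assume x: "x \<in> F"
    show "nprod (nprod (N.a g f) (A.a g x)) c = nprod (N.a g f) (R.nprod (A.a g x) c)"
    proof (rule A.A_ext_coset[OF lin_c[OF N.gen_mem[OF g] A.gen_mem[OF g(1) x]] g(1) _ _ c])
      fix z assume z: "z \<in> F"
      show "nprod (nprod (N.a g f) (A.a g x)) (A.a g z) = nprod (N.a g f) (R.nprod (A.a g x) (A.a g z))"
        using g x z \<gamma>_cocycle[OF g(2) x z] FG
        by (simp add: nprod_same R.nprod_same linear_on_scale[OF nprod_linear(2)] linear_on_scale[OF nprod_linear(1)]
            A.gen_mem N.gen_mem m_assoc mult_ac)
    next
      fix g' z assume g': "g' \<in> carrier G" "inv g \<otimes> g' \<notin> H" and z: "z \<in> F"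
      then show "nprod (nprod (N.a g f) (A.a g x)) (A.a g' z) = nprod (N.a g f) (R.nprod (A.a g x) (A.a g' z))"
        using g x by (simp add: nprod_same R.nprod_other nprod_other zero' linear_on_scale[OF nprod_linear(2)] A.gen_mem N.gen_mem)
    qed
  next
    fix g' x assume g': "g' \<in> carrier G" "inv g \<otimes> g' \<notin> H" and x: "x \<in> F"
    have "nprod (N.a g f) (R.nprod (A.a g' x) c) = 0"
    proof (rule A.A_ext_coset[OF lin_c(2)[OF N.gen_mem[OF g] A.gen_mem[OF g'(1) x]] linear_on_const_zero g'(1) _ _ c])
      fix z assume z: "z \<in> F"
      then show "nprod (N.a g f) (R.nprod (A.a g' x) (A.a g' z)) = 0"
        using g g' x by (simp add: R.nprod_same linear_on_scale[OF nprod_linear(1)] A.gen_mem N.gen_mem nprod_other)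
    next
      fix g'' z assume "g'' \<in> carrier G" "inv g' \<otimes> g'' \<notin> H" "z \<in> F"
      then show "nprod (N.a g f) (R.nprod (A.a g' x) (A.a g'' z)) = 0"
        using g g' x by (simp add: R.nprod_other zero' N.gen_mem)
    qed
    then show "nprod (nprod (N.a g f) (A.a g' x)) c = nprod (N.a g f) (R.nprod (A.a g' x) c)"
      using g g' x by (simp add: nprod_other zero c)
  qed
  show ?thesis by (rule N.A_ext[OF lin_n _ n]) (rule gen)
qed

lemma aone_nprod: "b \<in> A.AS \<Longrightarrow> R.nprod aone b = b"
proof -
  assume b: "b \<in> A.AS"
  have "R.nprod aone (A.a g f) = A.a g f" if g: "g \<in> carrier G" "f \<in> F" for g f
  proof -
    note l = R.nprod_linear(2)[OF A.gen_mem[OF g]]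
    have v: "R.nprod (A.a x \<one>) (A.a g f) = (if inv x \<otimes> g \<in> H then A.a g f else 0)" if x: "x \<in> carrier G" for x
    proof (cases "inv x \<otimes> g \<in> H")
      case True
      let ?p = "(inv x \<otimes> g) \<otimes> f \<otimes> inv (inv x \<otimes> g)"
      have p: "?p \<in> F" using conj_H[OF True g(2)] .
      have "R.nprod (A.a x \<one>) (A.a g f) = fscale (\<epsilon> (inv x \<otimes> g) f) (A.a x ?p)"
        using True g x \<gamma>_one(1)[OF p] FG[OF p] by (simp add: R.nprod_gen R.nval_def)
      also have "\<dots> = A.a (x \<otimes> (inv x \<otimes> g)) f" using A.gen_rel[OF x True g(2)] by simp
      finally show ?thesis using True x g by simp
    next
      case False
      then show ?thesis using g x by (simp add: R.nprod_other)
    qed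
    have "R.nprod aone (A.a g f) = fscale (inverse (of_nat (card H))) (\<Sum>x\<in>carrier G. R.nprod (A.a x \<one>) (A.a g f))"
      unfolding aone_def
      by (simp add: linear_on_scale[OF l] vs.subspace_sum[OF A.AS_subspace] A.gen_mem linear_on_sum[OF l A.AS_subspace])
    also have "(\<Sum>x\<in>carrier G. R.nprod (A.a x \<one>) (A.a g f)) = (\<Sum>x\<in>carrier G. if inv x \<otimes> g \<in> H then A.a g f else 0)"
      by (rule sum.cong) (simp_all add: v)
    also have "\<dots> = fscale (of_nat (card H)) (A.a g f)"
      by (simp only: sum_over card_coset'[OF g(1)])
    finally show ?thesis using card_H_nz by simp
  qed
  then show ?thesis by (intro A.A_ext[OF R.nprod_linear(1)[OF aone_mem] linear_on_id _ b])
qed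

text \<open>Both sides only involve the coset of \<open>g\<close>, and there they agree by the third condition on \<open>\<gamma>\<close>.\<close>

lemma nprod_local:
  assumes x: "x \<in> carrier G" and y: "y \<in> carrier G" and n: "n \<in> deg N.AZ x" and b: "b \<in> deg A.AZ y"
  shows "nprod (act N.AZ (x \<otimes> y \<otimes> inv x) n) (act A.AZ x b) = nprod n b"
proof -
  have xy: "x \<otimes> y \<otimes> inv x \<in> carrier G" using x y by simp
  have bA: "b \<in> A.AS" using A.deg_sub b by blast
  note Nl = N.A_act_linear[OF xy] and Al = A.A_act_linear[OF x]
  have Nm: "act N.AZ (x \<otimes> y \<otimes> inv x) m \<in> N.AS" if "m \<in> N.AS" for m using act_mem[OF N.AZ_zobj xy] that by simp
  have Am: "act A.AZ x m \<in> A.AS" if "m \<in> A.AS" for m using act_mem[OF A.AZ_zobj x] that by simp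
  have same: "nprod (act N.AZ (x \<otimes> y \<otimes> inv x) (N.a g f)) (act A.AZ x (A.a g f')) = nprod (N.a g f) (A.a g f')"
    if g: "g \<in> carrier G" "f \<in> F" "g \<otimes> f \<otimes> inv g = x" and f': "f' \<in> F" "g \<otimes> f' \<otimes> inv g = y" for g f f'
  proof -
    note fG = FG[OF g(2)] FG[OF f'(1)]
    let ?p = "f \<otimes> f' \<otimes> inv f"
    have p: "?p \<in> F" using conj_H[OF FH[OF g(2)] f'(1)] .
    have pG: "?p \<in> carrier G" using FG[OF p] .
    \<comment> \<open>Acting by a conjugate \<open>g f g^-1\<close> only changes the representative
      \<open>g\<close> to \<open>g f\<close>, and the relations turn this change into a scalar and a
      conjugated index.\<close>
    have xg: "x \<otimes> g = g \<otimes> f" using g fG by (simp add: m_assoc flip: g(3))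
    have "inv x \<otimes> g = inv x \<otimes> ((x \<otimes> g) \<otimes> inv f)" using g fG by (simp add: xg m_assoc)
    then have ixg: "inv x \<otimes> g = g \<otimes> inv f" using x g fG by (simp add: m_assoc)
    have "x \<otimes> y \<otimes> inv x \<otimes> g = x \<otimes> y \<otimes> (g \<otimes> inv f)" using x y g fG by (simp add: m_assoc ixg)
    also have "\<dots> = x \<otimes> (g \<otimes> f' \<otimes> inv f)" using x g fG by (simp add: m_assoc flip: f'(2))
    also have "\<dots> = (x \<otimes> g) \<otimes> (f' \<otimes> inv f)" using x g fG by (simp add: m_assoc)
    also have "\<dots> = g \<otimes> ?p" using g fG by (simp add: xg m_assoc)
    finally have xyg: "x \<otimes> y \<otimes> inv x \<otimes> g = g \<otimes> ?p" .
    have pf: "?p \<otimes> f = f \<otimes> f'" using fG by (simp add: m_assoc)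
    let ?q = "?p \<otimes> f \<otimes> inv ?p"
    have q: "?q \<in> F" using conj_H[OF FH[OF p] g(2)] .
    have qp: "?q \<otimes> ?p = f \<otimes> f'"
    proof -
      have "?q \<otimes> ?p = ?p \<otimes> f" using pG fG(1) by (simp only: m_assoc inv_closed m_closed l_inv r_one)
      then show ?thesis by (simp only: pf)
    qed
    \<comment> \<open>The relations of the module run over \<open>K\<close> only; \<open>?p\<close>
      lies in \<open>F\<close> and so among them.\<close>
    have pK: "?p \<in> K" using p FK by blast
    have "nprod (act N.AZ (x \<otimes> y \<otimes> inv x) (N.a g f)) (act A.AZ x (A.a g f')) = nprod (N.a (g \<otimes> ?p) f) (A.a (g \<otimes> f) f')"
      using N.A_act_gen[OF xy g(1,2)] A.A_act_gen[OF x g(1) f'(1)] by (simp only: xyg xg)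
    also have "\<dots> = nprod (fscale (\<epsilon> ?p f) (N.a g ?q)) (fscale (\<epsilon> f f') (A.a g ?p))"
      by (simp only: N.gen_rel[OF g(1) pK g(2)] A.gen_rel[OF g(1) FH[OF g(2)] f'(1)])
    also have "\<dots> = fscale (\<epsilon> ?p f * \<epsilon> f f' * \<gamma> ?q ?p) (N.a g (?q \<otimes> ?p))"
      using A.gen_mem[OF g(1) p] N.gen_mem[OF g(1) q]
      by (simp add: linear_on_scale[OF nprod_linear(2)] linear_on_scale[OF nprod_linear(1)]
          vs.subspace_scale[OF A.AS_subspace] nprod_same[OF g(1) q p])
    \<comment> \<open>The third condition twice: at \<open>f\<close>, \<open>f'\<close> it produces
      \<open>\<gamma> ?p f\<close>, and at \<open>?p\<close>, \<open>f\<close> it turns this into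
      \<open>\<gamma> ?q ?p\<close>.\<close>
    also have "\<epsilon> ?p f * \<epsilon> f f' * \<gamma> ?q ?p = \<gamma> f f'"
      using \<gamma>_comm[OF p g(2)] \<gamma>_comm[OF g(2) f'(1)] by simp
    finally show ?thesis by (simp add: qp nprod_same[OF g(1,2) f'(1)])
  qed
  have gen: "nprod (act N.AZ (x \<otimes> y \<otimes> inv x) (N.a g f)) (act A.AZ x (A.a g' f')) = nprod (N.a g f) (A.a g' f')"
    if g: "g \<in> carrier G" "f \<in> F" "g \<otimes> f \<otimes> inv g = x" and g': "g' \<in> carrier G" "f' \<in> F" "g' \<otimes> f' \<otimes> inv g' = y" for g f g' f'
  proof (cases "inv g \<otimes> g' \<in> H")
    case True
    let ?h = "inv g \<otimes> g'"
    let ?p = "?h \<otimes> f' \<otimes> inv ?h"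
    have p: "?p \<in> F" using conj_H[OF True g'(2)] .
    have py: "g \<otimes> ?p \<otimes> inv g = y" using conj_mult[of g ?h f'] g g' FG[OF g'(2)] by simp
    have e: "A.a g' f' = fscale (\<epsilon> ?h f') (A.a g ?p)" using A.gen_rel[OF g(1) True g'(2)] g g' by simp
    show ?thesis
      using same[OF g p py] A.gen_mem[OF g(1) p] N.gen_mem[OF g(1,2)] Nm Am
      unfolding e by (simp add: linear_on_scale[OF Al] linear_on_scale[OF nprod_linear(1)])
  next
    case False
    let ?h = "inv g \<otimes> g'"
    note fG = FG[OF g(2)] FG[OF g'(2)]
    have hG: "?h \<in> carrier G" using g g' by simp
    have xg: "x \<otimes> g = g \<otimes> f" using g fG by (simp add: m_assoc flip: g(3))
    have xg': "x \<otimes> g' = g \<otimes> f \<otimes> ?h" using g g' fG by (simp add: m_assoc flip: g(3))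
    have yg': "y \<otimes> g' = g' \<otimes> f'" using g' fG by (simp add: m_assoc flip: g'(3))
    let ?u = "x \<otimes> y \<otimes> inv x \<otimes> g"
    have uG: "?u \<in> carrier G" using x y g by simp
    have "?u \<otimes> (f \<otimes> ?h) = x \<otimes> y \<otimes> inv x \<otimes> (x \<otimes> g')" unfolding xg' using x y g fG hG by (simp add: m_assoc)
    also have "\<dots> = x \<otimes> (y \<otimes> g')" using x y g' by (simp add: m_assoc)
    also have "\<dots> = x \<otimes> g' \<otimes> f'" unfolding yg' using x g' fG by (simp add: m_assoc)
    finally have "x \<otimes> g' = ?u \<otimes> (f \<otimes> ?h) \<otimes> inv f'" using x g' fG uG hG by (simp add: inv_solve_right)
    then have "inv ?u \<otimes> (x \<otimes> g') = f \<otimes> ?h \<otimes> inv f'" using uG fG hG by (simp add: m_assoc)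
    \<comment> \<open>The moved representatives differ by \<open>f h f'^-1\<close>, which lies in
      \<open>H\<close> only if \<open>h\<close> does; so both products vanish.\<close>
    moreover have "f \<otimes> ?h \<otimes> inv f' \<notin> H"
      using False coset_mult(2)[of "inv f'" "f \<otimes> ?h"] coset_mult(1)[of f ?h] FH g(2) g'(2) hG fG by simp
    ultimately have "inv ?u \<otimes> (x \<otimes> g') \<notin> H" by simp
    then show ?thesis
      using False g g' x uG N.A_act_gen[OF xy g(1,2)] by (simp add: nprod_other A.A_act_gen)
  qed
  have nA: "nprod (act N.AZ (x \<otimes> y \<otimes> inv x) (N.a g f)) (act A.AZ x b) = nprod (N.a g f) b"
    if g: "g \<in> carrier G" "f \<in> F" "g \<otimes> f \<otimes> inv g = x" for g f
    by (rule A.deg_ext[OF linear_on_comp[OF Al nprod_linear(1)[OF Nm[OF N.gen_mem[OF g(1,2)]]] Am]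
        nprod_linear(1)[OF N.gen_mem[OF g(1,2)]] _ b])
      (assumption | rule gen[OF g])+
  show ?thesis
    by (rule N.deg_ext[OF linear_on_comp[OF Nl nprod_linear(2)[OF Am[OF bA]] Nm] nprod_linear(2)[OF bA] _ n])
      (assumption | rule nA)+
qed

text \<open>Over one coset, \<open>g f g^-1\<close> takes the symbol \<open>(g, f')\<close> to
  \<open>\<epsilon> f f'\<close> times the symbol \<open>(g, f f' f^-1)\<close>, and the identity is
  the third condition on \<open>\<gamma>\<close>. Over different cosets both products are
  zero.\<close>

lemma nprod_comm:
  assumes x: "x \<in> carrier G" and b: "b \<in> deg A.AZ x" and c: "c \<in> A.AS"
  shows "R.nprod (act A.AZ x c) b = R.nprod b c"
proof -
  note Al = A.A_act_linear[OF x]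
  have bA: "b \<in> A.AS" using A.deg_sub b by blast
  have Am: "act A.AZ x m \<in> A.AS" if "m \<in> A.AS" for m using act_mem[OF A.AZ_zobj x] that by simp
  have "R.nprod (act A.AZ x c) (A.a g f) = R.nprod (A.a g f) c"
    if g: "g \<in> carrier G" "f \<in> F" "g \<otimes> f \<otimes> inv g = x" for g f
  proof (rule A.A_ext_coset[OF linear_on_comp[OF Al R.nprod_linear(2)[OF A.gen_mem[OF g(1,2)]] Am]
        R.nprod_linear(1)[OF A.gen_mem[OF g(1,2)]] g(1) _ _ c])
    fix f' assume f': "f' \<in> F"
    note fG = FG[OF g(2)] FG[OF f']
    let ?p = "f \<otimes> f' \<otimes> inv f"
    have p: "?p \<in> F" using conj_H[OF FH[OF g(2)] f'] .
    have xg: "x \<otimes> g = g \<otimes> f" using g fG by (simp add: m_assoc flip: g(3))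
    have pf: "?p \<otimes> f = f \<otimes> f'" using fG by (simp add: m_assoc)
    have "R.nprod (act A.AZ x (A.a g f')) (A.a g f) = R.nprod (fscale (\<epsilon> f f') (A.a g ?p)) (A.a g f)"
      using A.A_act_gen[OF x g(1) f'] A.gen_rel[OF g(1) FH[OF g(2)] f'] by (simp only: xg)
    also have "\<dots> = fscale (\<epsilon> f f' * \<gamma> ?p f) (A.a g (f \<otimes> f'))"
      using A.gen_mem[OF g(1) p] A.gen_mem[OF g(1,2)]
      by (simp add: linear_on_scale[OF R.nprod_linear(2)] R.nprod_same[OF g(1) p g(2)] pf)
    finally show "R.nprod (act A.AZ x (A.a g f')) (A.a g f) = R.nprod (A.a g f) (A.a g f')"
      using \<gamma>_comm[OF g(2) f'] by (simp add: R.nprod_same[OF g(1,2) f'])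
  next
    fix g' f' assume g': "g' \<in> carrier G" "inv g \<otimes> g' \<notin> H" and f': "f' \<in> F"
    note fG = FG[OF g(2)] and hG = m_closed[OF inv_closed[OF g(1)] g'(1)]
    have xg': "x \<otimes> g' = g \<otimes> (f \<otimes> (inv g \<otimes> g'))" using g g' fG by (simp add: m_assoc flip: g(3))
    have "inv (x \<otimes> g') \<otimes> g \<notin> H"
    proof
      assume "inv (x \<otimes> g') \<otimes> g \<in> H"
      then have "inv (inv (x \<otimes> g') \<otimes> g) \<in> H" by simp
      moreover have "inv (inv (x \<otimes> g') \<otimes> g) = f \<otimes> (inv g \<otimes> g')"
        using g g' x fG hG by (simp add: inv_mult_group) (simp add: xg' m_assoc flip: inv_mult_group)
      ultimately show False using coset_mult(1)[OF FH[OF g(2)] hG] g'(2) by simp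
    qed
    then show "R.nprod (act A.AZ x (A.a g' f')) (A.a g f) = R.nprod (A.a g f) (A.a g' f')"
      using g g' f' x by (simp add: A.A_act_gen R.nprod_other)
  qed
  then show ?thesis
    by (intro A.deg_ext[OF R.nprod_linear(1)[OF Am[OF c]] R.nprod_linear(2)[OF c] _ b])
qed

end

section \<open>The algebra of symbols\<close>

context crossed_data
begin

interpretation R: crossed_data G H F \<gamma> \<epsilon> H
  by (rule crossed_data_H)

abbreviation "\<A> \<equiv> A_alg G H F \<gamma> \<epsilon>"
abbreviation "amul \<equiv> R.nprod"

lemma alg_obj [simp]: "alg_obj \<A> = A.AZ"
  by (simp add: A_alg_def Let_def)

text \<open>The definition fixes products over equal representatives and over distinct cosets. The
  relations reach all remaining pairs, so it determines the same bilinear map as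
  \<open>amul\<close>.\<close>

lemma A_mult_map:
  shows A_mult_map_ext: "A_mult_map G H F \<gamma> \<epsilon> \<in> extensional (tensor_space A.AS A.AS)"
    and A_mult_map_linear: "linear_on (tensor_space A.AS A.AS) (A_mult_map G H F \<gamma> \<epsilon>)"
    and A_mult_map_apply: "x \<in> A.AS \<Longrightarrow> y \<in> A.AS \<Longrightarrow> A_mult_map G H F \<gamma> \<epsilon> (x \<otimes>\<^sub>v y) = amul x y"
proof -
  have iff: "(\<forall>g\<in>carrier G. \<forall>f\<in>F. \<forall>f'\<in>F. h (A.a g f \<otimes>\<^sub>v A.a g f') = fscale (\<gamma> f f') (A.a g (f \<otimes> f'))) \<and>
      (\<forall>g\<in>carrier G. \<forall>g'\<in>carrier G. \<forall>f\<in>F. \<forall>f'\<in>F. g <# H \<noteq> g' <# H \<longrightarrow> h (A.a g f \<otimes>\<^sub>v A.a g' f') = 0) \<longleftrightarrow>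
      (\<forall>x\<in>A.AS. \<forall>y\<in>A.AS. h (x \<otimes>\<^sub>v y) = amul x y)" (is "?P1 \<and> ?P2 \<longleftrightarrow> ?Q")
    if h: "linear_on (tensor_space A.AS A.AS) h" for h
  proof
    assume P: "?P1 \<and> ?P2"
    note l = bilinear_onD[OF bilinear_on_tensor[OF h]]
    show ?Q
    proof (intro ballI)
      fix x y assume x: "x \<in> A.AS" and y: "y \<in> A.AS"
      show "h (x \<otimes>\<^sub>v y) = amul x y"
      proof (rule A.A_ext[OF l(2)[OF y] R.nprod_linear(2)[OF y] _ x])
        fix g f assume g: "g \<in> carrier G" "f \<in> F"
        show "h (A.a g f \<otimes>\<^sub>v y) = amul (A.a g f) y"
          by (rule A.A_ext_coset[OF l(1)[OF A.gen_mem[OF g]] R.nprod_linear(1)[OF A.gen_mem[OF g]] g(1) _ _ y])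
            (use P g in \<open>simp_all add: R.nprod_same R.nprod_other l_coset_eq_iff[OF H]\<close>)
      qed
    qed
  qed (simp add: A.gen_mem R.nprod_same R.nprod_other l_coset_eq_iff[OF H])
  note t = the_linear_tensor[OF A.AS_fd A.AS_fd R.nprod_bilinear iff, folded A_mult_map_def]
  show "A_mult_map G H F \<gamma> \<epsilon> \<in> extensional (tensor_space A.AS A.AS)"
    "linear_on (tensor_space A.AS A.AS) (A_mult_map G H F \<gamma> \<epsilon>)"
    "x \<in> A.AS \<Longrightarrow> y \<in> A.AS \<Longrightarrow> A_mult_map G H F \<gamma> \<epsilon> (x \<otimes>\<^sub>v y) = amul x y"
    using t by blast+
qed

lemma mult_apply [simp]: "x \<in> A.AS \<Longrightarrow> y \<in> A.AS \<Longrightarrow> fn (alg_mult \<A>) (x \<otimes>\<^sub>v y) = amul x y"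
  by (simp add: A_alg_def Let_def A_mult_map_apply)

lemma A_one: "A_one G H F \<gamma> \<epsilon> = aone"
  unfolding A_one_def
proof (rule the_equality)
  fix v assume v: "v \<in> A.AS \<and> (\<forall>x\<in>A.AS. A_mult_map G H F \<gamma> \<epsilon> (v \<otimes>\<^sub>v x) = x \<and> A_mult_map G H F \<gamma> \<epsilon> (x \<otimes>\<^sub>v v) = x)"
  then have "amul v aone = aone" using aone_mem A_mult_map_apply by metis
  then show "v = aone" using v R.nprod_aone by metis
qed (use aone_mem A_mult_map_apply aone_nprod R.nprod_aone in auto)

lemma sum_gen_shift:
  assumes "x \<in> carrier G"
  shows "(\<Sum>y\<in>carrier G. P (y \<otimes> x)) = (\<Sum>y\<in>carrier G. P y)" "(\<Sum>y\<in>carrier G. P (x \<otimes> y)) = (\<Sum>y\<in>carrier G. P y)"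
proof -
  have b: "bij_betw (\<lambda>y. y \<otimes> x) (carrier G) (carrier G)" "bij_betw (\<lambda>y. x \<otimes> y) (carrier G) (carrier G)"
    by (rule bij_betw_byWitness[of _ "\<lambda>y. y \<otimes> inv x"] bij_betw_byWitness[of _ "\<lambda>y. inv x \<otimes> y"];
        use assms in \<open>auto simp: m_assoc\<close>)+
  show "(\<Sum>y\<in>carrier G. P (y \<otimes> x)) = (\<Sum>y\<in>carrier G. P y)" "(\<Sum>y\<in>carrier G. P (x \<otimes> y)) = (\<Sum>y\<in>carrier G. P y)"
    using sum.reindex_bij_betw[OF b(1)] sum.reindex_bij_betw[OF b(2)] by blast+
qed

lemma conj_eq_one: "g \<in> carrier G \<Longrightarrow> f \<in> carrier G \<Longrightarrow> g \<otimes> f \<otimes> inv g = \<one> \<longleftrightarrow> f = \<one>"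
  by (metis inv_equality inv_inv l_cancel_one' m_closed inv_closed r_inv m_assoc r_one)

lemma act_aone: "x \<in> carrier G \<Longrightarrow> act A.AZ x aone = aone"
proof -
  assume x: "x \<in> carrier G"
  note l = A.A_act_linear[OF x]
  have "(\<Sum>g\<in>carrier G. A.a (x \<otimes> g) \<one>) = (\<Sum>g\<in>carrier G. A.a g \<one>)"
    by (rule sum_gen_shift(2)[OF x])
  then show ?thesis
    using x unfolding aone_def
    by (simp add: linear_on_scale[OF l] vs.subspace_sum[OF A.AS_subspace] A.gen_mem
        linear_on_sum[OF l A.AS_subspace] A.A_act_gen)
qed

lemma aone_deg: "aone \<in> deg A.AZ \<one>"
  unfolding aone_def
proof (intro vs.subspace_scale vs.subspace_sum)
  fix g assume "g \<in> carrier G"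
  then show "A.a g \<one> \<in> deg A.AZ \<one>" using A.gen_deg[of g \<one>] by simp
qed (simp_all add: deg_subspace[OF A.AZ_zobj])

lemma unit_apply [simp]: "fn (alg_unit \<A>) one_vec = aone"
  by (simp add: A_alg_def Let_def the_linear_unit A_one)

lemma A_algebra: "algebra_in (ZG G) \<A>" "commutative_alg (ZG G) \<A>"
proof -
  have "zmap G (ztensor G A.AZ A.AZ) A.AZ (A_mult_map G H F \<gamma> \<epsilon>)"
    by (rule zmap_tensorI[OF A.AZ_zobj A.AZ_zobj A.AZ_zobj])
      (simp_all add: A_mult_map_linear A_mult_map_apply deg_in_space[OF A.AZ_zobj, simplified] R.nprod_deg
        act_mem[OF A.AZ_zobj, simplified] R.nprod_act)
  then have mult: "alg_mult \<A> \<in> zhom G (ztensor G A.AZ A.AZ) A.AZ"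
    using arrow_zhom[of "A_mult_map G H F \<gamma> \<epsilon>" "ztensor G A.AZ A.AZ" A.AZ] A_mult_map_ext
    by (simp add: A_alg_def Let_def)
  have "zmap G (zunit G) A.AZ (\<lambda>x. fscale (x 0) aone)"
    unfolding zmap_def
    using aone_mem aone_deg act_aone A.A_act_linear vs.subspace_scale[OF A.AS_subspace]
      vs.subspace_scale[OF deg_subspace[OF A.AZ_zobj one_closed]] vs.subspace_0[OF deg_subspace[OF A.AZ_zobj]]
    by (auto simp: unit_lift linear_on_scale[OF A.A_act_linear aone_mem] fun_eval)
  then have unit: "alg_unit \<A> \<in> zhom G (zunit G) A.AZ"
    using restrict_zhom[OF is_zobj_unit, of A.AZ "\<lambda>x. fscale (x 0) aone"]
    by (simp add: A_alg_def Let_def the_linear_unit A_one)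
  show "algebra_in (ZG G) \<A>"
    unfolding algebra_in_iff
    using mult unit A.AZ_zobj by (simp add: R.nprod_mem aone_mem R.nprod_assoc aone_nprod R.nprod_aone)
  show "commutative_alg (ZG G) \<A>"
    using commutative_alg_iff[of \<A>] mult A.AZ_zobj
    by (simp add: deg_in_space[OF A.AZ_zobj, simplified] act_mem[OF A.AZ_zobj, simplified] nprod_comm)
qed

sublocale Z: zalgebra G \<A>
  by (intro zalgebra.intro zalgebra_axioms.intro finite_grp_axioms A_algebra)

lemma sum_gen_one: "(\<Sum>x\<in>carrier G. A.a x \<one>) = fscale (of_nat (card H)) aone"
  using card_H_nz by (simp add: aone_def)

text \<open>\<open>R\<close> is the identity on invariants. A symbol \<open>(g, f)\<close> has
  degree \<open>\<one>\<close> only for \<open>f = \<one>\<close>; in that case \<open>R\<close>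
  sends it to a multiple of the sum over all of \<open>G\<close>, otherwise to zero.\<close>

lemma invs_N:
  assumes n: "n \<in> invs G N.AZ"
  shows "\<exists>c. n = fscale c (\<Sum>x\<in>carrier G. N.a x \<one>)"
proof -
  let ?w = "\<Sum>x\<in>carrier G. N.a x \<one>"
  have "reyn G N.AZ n \<in> vs.span {?w}"
  proof (rule N.A_mem[OF reyn_linear[OF N.AZ_zobj, simplified] vs.subspace_span])
    fix g f assume g: "g \<in> carrier G" "f \<in> F"
    have z: "zcomp G N.AZ \<one> (N.a g f) = (if f = \<one> then N.a g \<one> else 0)"
      using zcomp_homogeneous[OF N.AZ_zobj _ one_closed N.gen_deg[OF g]] conj_eq_one[OF g(1) FG[OF g(2)]] g FG[OF g(2)]
      by (auto simp: eq_commute)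
    show "reyn G N.AZ (N.a g f) \<in> vs.span {?w}"
    proof (cases "f = \<one>")
      case True
      have "(\<Sum>x\<in>carrier G. act N.AZ x (N.a g \<one>)) = (\<Sum>x\<in>carrier G. N.a (x \<otimes> g) \<one>)"
        by (rule sum.cong) (simp_all add: N.A_act_gen g)
      also have "\<dots> = ?w" using sum_gen_shift(1)[OF g(1)] .
      finally show ?thesis
        unfolding reyn_def z using True by (simp add: vs.span_scale vs.span_base)
    next
      case False
      have "(\<Sum>x\<in>carrier G. act N.AZ x (0 :: 'k vec)) = 0"
        by (rule sum.neutral) (use linear_on_zero[OF N.A_act_linear N.AS_subspace] in blast)
      then show ?thesis unfolding reyn_def z using False by (simp add: vs.span_zero)
    qed
  qed (use invs_mem[OF N.AZ_zobj n] in simp)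
  then show ?thesis using reyn_id[OF N.AZ_zobj n] by (auto simp: vs.span_singleton)
qed

end

section \<open>Nonvanishing of the unit, and the Casimir element of the algebra of symbols\<close>

context crossed_data
begin

interpretation R: crossed_data G H F \<gamma> \<epsilon> H
  by (rule crossed_data_H)

lemma invs_A: "b \<in> invs G A.AZ \<Longrightarrow> \<exists>c. b = fscale c aone"
  using R.invs_N[of b] by (auto simp: sum_gen_one)

text \<open>The functional that is \<open>1\<close> on the symbols \<open>(g, \<one>)\<close> and
  \<open>0\<close> on the others respects the relations, as \<open>\<epsilon> h \<one> = 1\<close>;
  on \<open>aone\<close> its value is the index of \<open>H\<close>.\<close>

lemma aone_neq_0: "aone \<noteq> 0"
proof
  assume 0: "aone = 0"
  define \<phi> :: "'a \<Rightarrow> 'a \<Rightarrow> 'k vec" where "\<phi> g f = (if f = \<one> then one_vec else 0)" for g f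
  have "\<phi> (g \<otimes> h) f = fscale (\<epsilon> h f) (\<phi> g (h \<otimes> f \<otimes> inv h))" if "g \<in> carrier G" "h \<in> H" "f \<in> F" for g h f
    using that conj_eq_one[OF HG FG] \<epsilon>_unit by (simp add: \<phi>_def)
  then obtain k where k: "linear_on A.AS k" "\<And>g f. g \<in> carrier G \<Longrightarrow> f \<in> F \<Longrightarrow> k (A.a g f) = \<phi> g f"
    by (rule A.A_univ) auto
  have "k aone = fscale (inverse (of_nat (card H))) (\<Sum>g\<in>carrier G. k (A.a g \<one>))"
    unfolding aone_def
    by (simp add: linear_on_scale[OF k(1)] vs.subspace_sum[OF A.AS_subspace] A.gen_mem linear_on_sum[OF k(1) A.AS_subspace])
  also have "\<dots> = fscale (inverse (of_nat (card H)) * of_nat (card (carrier G))) one_vec"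
    by (simp add: k(2) \<phi>_def vs.sum_constant_scale del: sum_constant)
  finally show False
    using linear_on_zero[OF k(1) A.AS_subspace] card_H_nz fin one_closed unfolding 0
    by (auto simp: card_eq_0_iff)
qed

text \<open>\<open>dn (g, f)\<close> is the inverse of the symbol \<open>(g, f)\<close> over its
  coset: their product is the symbol \<open>(g, \<one>)\<close>. The constant in \<open>up\<close>
  is the one that \<open>dual\<close> asks for: applying \<open>R\<close> yields a factor
  \<open>card H / card (carrier G)\<close>, and the remaining \<open>1 / card H\<close> averages the
  symbols \<open>(g, \<one>)\<close> into \<open>aone\<close>.\<close>

definition "up = (\<lambda>(g, f). fscale (of_nat (card (carrier G)) / of_nat (card H) ^ 2) (A.a g f))"
definition "dn = (\<lambda>(g, f). fscale (inverse (\<gamma> f (inv f))) (A.a g (inv f)))"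

lemma up_mem: "i \<in> carrier G \<times> F \<Longrightarrow> up i \<in> A.AS" and dn_mem: "i \<in> carrier G \<times> F \<Longrightarrow> dn i \<in> A.AS"
  by (auto simp: up_def dn_def intro!: vs.subspace_scale[OF A.AS_subspace] A.gen_mem)

text \<open>Three instances of the cocycle identity with \<open>y = (x f)^-1\<close>: at
  \<open>x, f, y\<close>, at \<open>f, y, x\<close> and at \<open>x, x^-1, x\<close>. It compares
  the coefficients of the Casimir element before and after substituting \<open>x f\<close> for
  \<open>f\<close>.\<close>

lemma \<gamma>_inv:
  assumes x: "x \<in> F" and f: "f \<in> F"
  shows "\<gamma> x f * inverse (\<gamma> f (inv f)) = \<gamma> (inv (x \<otimes> f)) x * inverse (\<gamma> (x \<otimes> f) (inv (x \<otimes> f)))"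
proof -
  let ?y = "inv f \<otimes> inv x"
  note G = FG[OF x] FG[OF f]
  have y: "inv (x \<otimes> f) = ?y" "?y \<in> F" using G x f by (simp_all add: inv_mult_group)
  have "\<gamma> x f * \<gamma> (x \<otimes> f) ?y = \<gamma> f ?y * \<gamma> x (inv x)" using \<gamma>_cocycle[OF x f y(2)] G by simp
  moreover have "\<gamma> f ?y * \<gamma> (inv x) x = \<gamma> ?y x * \<gamma> f (inv f)" using \<gamma>_cocycle[OF f y(2) x] G by (simp add: m_assoc)
  moreover have "\<gamma> x (inv x) = \<gamma> (inv x) x" using \<gamma>_cocycle[of x "inv x" x] x G by (simp add: \<gamma>_one)
  ultimately have "\<gamma> x f * \<gamma> (x \<otimes> f) ?y = \<gamma> ?y x * \<gamma> f (inv f)" by simp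
  then show ?thesis unfolding y(1) using \<gamma>_nz x f y(2) by (simp add: field_simps)
qed

lemma sum_F_shift: "x \<in> F \<Longrightarrow> (\<Sum>f\<in>F. P (x \<otimes> f)) = (\<Sum>f\<in>F. P f)"
proof (rule sum.reindex_bij_betw)
  assume "x \<in> F"
  then show "bij_betw (\<lambda>f. x \<otimes> f) F F"
    by (intro bij_betw_byWitness[of _ "\<lambda>f. inv x \<otimes> f"]) (auto simp: FG)
qed

text \<open>Multiplying by the symbol \<open>(g, x)\<close> permutes the summands by
  \<open>f\<close> |-> \<open>x f\<close>, with scalars matched by \<open>\<gamma>_inv\<close>;
  symbols over other cosets kill both sides.\<close>

lemma casimir_coset:
  assumes g: "g \<in> carrier G" and b: "b \<in> A.AS"
  shows "(\<Sum>f\<in>F. amul b (up (g, f)) \<otimes>\<^sub>v dn (g, f)) = (\<Sum>f\<in>F. up (g, f) \<otimes>\<^sub>v amul (dn (g, f)) b)"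
proof -
  let ?c = "of_nat (card (carrier G)) / of_nat (card H) ^ 2 :: 'k"
  have m: "up (g, f) \<in> A.AS" "dn (g, f) \<in> A.AS" if "f \<in> F" for f using up_mem dn_mem g that by auto
  have l: "linear_on A.AS (\<lambda>b. \<Sum>f\<in>F. amul b (up (g, f)) \<otimes>\<^sub>v dn (g, f))"
    by (rule linear_onI)
      (simp_all add: m linear_on_add[OF R.nprod_linear(2)] linear_on_scale[OF R.nprod_linear(2)] vtensor_add_left vtensor_scale_left
        sum.distrib vs.scale_sum_right)
  have r: "linear_on A.AS (\<lambda>b. \<Sum>f\<in>F. up (g, f) \<otimes>\<^sub>v amul (dn (g, f)) b)"
    by (rule linear_onI)
      (simp_all add: m linear_on_add[OF R.nprod_linear(1)] linear_on_scale[OF R.nprod_linear(1)] vtensor_add_right vtensor_scale_right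
        sum.distrib vs.scale_sum_right)
  show ?thesis
  proof (rule A.A_ext_coset[OF l r g _ _ b])
    fix x assume x: "x \<in> F"
    let ?t = "\<lambda>f. fscale (?c * (\<gamma> x f * inverse (\<gamma> f (inv f)))) (A.a g (x \<otimes> f) \<otimes>\<^sub>v A.a g (inv f))"
    have "(\<Sum>f\<in>F. amul (A.a g x) (up (g, f)) \<otimes>\<^sub>v dn (g, f)) = (\<Sum>f\<in>F. ?t f)"
      by (rule sum.cong)
        (simp_all add: up_def dn_def linear_on_scale[OF R.nprod_linear(1)] A.gen_mem g x R.nprod_same
          vtensor_scale_left vtensor_scale_right mult_ac)
    also have "\<dots> = (\<Sum>f\<in>F. up (g, x \<otimes> f) \<otimes>\<^sub>v amul (dn (g, x \<otimes> f)) (A.a g x))"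
    proof (rule sum.cong)
      fix f assume f: "f \<in> F"
      have e: "inv (x \<otimes> f) \<otimes> x = inv f" using FG[OF x] FG[OF f] by (simp add: inv_mult_group m_assoc)
      show "?t f = up (g, x \<otimes> f) \<otimes>\<^sub>v amul (dn (g, x \<otimes> f)) (A.a g x)"
        unfolding \<gamma>_inv[OF x f] using f x g
        by (simp add: up_def dn_def linear_on_scale[OF R.nprod_linear(2)] A.gen_mem R.nprod_same e
            vtensor_scale_left vtensor_scale_right mult_ac del: inverse_mult_distrib)
    qed simp
    also have "\<dots> = (\<Sum>f\<in>F. up (g, f) \<otimes>\<^sub>v amul (dn (g, f)) (A.a g x))"
      by (rule sum_F_shift[OF x])
    finally show "(\<Sum>f\<in>F. amul (A.a g x) (up (g, f)) \<otimes>\<^sub>v dn (g, f)) = \<dots>" .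
  next
    fix g' x assume g': "g' \<in> carrier G" "inv g \<otimes> g' \<notin> H" and x: "x \<in> F"
    have "inv g' \<otimes> g \<notin> H"
      using H_closed(3)[of "inv g' \<otimes> g"] g g' by (auto simp: inv_mult_group)
    then show "(\<Sum>f\<in>F. amul (A.a g' x) (up (g, f)) \<otimes>\<^sub>v dn (g, f)) = (\<Sum>f\<in>F. up (g, f) \<otimes>\<^sub>v amul (dn (g, f)) (A.a g' x))"
      using g g' x
      by (simp add: up_def dn_def linear_on_scale[OF R.nprod_linear(1)] linear_on_scale[OF R.nprod_linear(2)] A.gen_mem R.nprod_other)
  qed
qed

lemma sum_pairs: "(\<Sum>i\<in>X \<times> Y. P i) = (\<Sum>x\<in>X. \<Sum>y\<in>Y. P (x, y))"
  by (simp add: sum.cartesian_product split_def)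

lemma casimir:
  "b \<in> A.AS \<Longrightarrow> (\<Sum>i\<in>carrier G \<times> F. amul b (up i) \<otimes>\<^sub>v dn i) = (\<Sum>i\<in>carrier G \<times> F. up i \<otimes>\<^sub>v amul (dn i) b)"
  unfolding sum_pairs by (rule sum.cong) (simp_all add: casimir_coset)

text \<open>Each summand is the constant of \<open>up\<close> times the symbol
  \<open>(g, \<one>)\<close>. The total is a nonzero multiple of the unit, so a rescaled Casimir
  element splits the multiplication.\<close>

lemma up_dn: "(\<Sum>i\<in>carrier G \<times> F. amul (up i) (dn i)) =
    fscale (of_nat (card (carrier G)) / of_nat (card H) * of_nat (card F)) aone"
proof -
  let ?c = "of_nat (card (carrier G)) / of_nat (card H) ^ 2 :: 'k"
  have "amul (up (g, f)) (dn (g, f)) = fscale ?c (A.a g \<one>)" if "g \<in> carrier G" "f \<in> F" for g f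
    using that \<gamma>_nz[of f "inv f"] FG
    by (simp add: up_def dn_def linear_on_scale[OF R.nprod_linear(1)] linear_on_scale[OF R.nprod_linear(2)]
        vs.subspace_scale[OF A.AS_subspace] A.gen_mem R.nprod_same)
  then have "(\<Sum>i\<in>carrier G \<times> F. amul (up i) (dn i)) = (\<Sum>g\<in>carrier G. \<Sum>f\<in>F. fscale ?c (A.a g \<one>))"
    by (simp add: sum_pairs)
  also have "\<dots> = fscale (of_nat (card F) * ?c) (\<Sum>g\<in>carrier G. A.a g \<one>)"
    by (simp add: vs.sum_constant_scale vs.scale_sum_right del: sum_constant)
  also note sum_gen_one
  finally show ?thesis using card_H_nz by (simp add: power2_eq_square field_simps)
qed

end

section \<open>Separability\<close>

text \<open>Separability mentions the inverse associator as a definite description. A linear inverse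
  is built by rebracketing; it is a morphism by \<open>zmap_of_factor\<close>, since its composite
  with the associator is the identity.\<close>

lemma (in finite_grp)
  assumes X: "is_zobj G X" and Y: "is_zobj G Y" and Z: "is_zobj G Z"
  defines "\<alpha> \<equiv> inv_arrow (ZG G) (ztensor G (ztensor G X Y) Z) (ztensor G X (ztensor G Y Z)) (assoc (ZG G) X Y Z)"
  shows inv_assoc_zhom: "\<alpha> \<in> zhom G (ztensor G X (ztensor G Y Z)) (ztensor G (ztensor G X Y) Z)"
    and inv_assoc_apply: "x \<in> space X \<Longrightarrow> y \<in> space Y \<Longrightarrow> z \<in> space Z \<Longrightarrow> fn \<alpha> (x \<otimes>\<^sub>v (y \<otimes>\<^sub>v z)) = (x \<otimes>\<^sub>v y) \<otimes>\<^sub>v z"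
proof -
  let ?L = "ztensor G (ztensor G X Y) Z" and ?R = "ztensor G X (ztensor G Y Z)" and ?a = "assoc (ZG G) X Y Z"
  note L = is_zobj_tensor[OF is_zobj_tensor[OF X Y] Z] and R = is_zobj_tensor[OF X is_zobj_tensor[OF Y Z]]
  note a = assoc_zhom[OF X Y Z]
  note al = zmapD(2)[OF zhomD(4)[OF a(1)], simplified ztensor_simps]
  obtain h where h: "linear_on (tensor_space (space X) (tensor_space (space Y) (space Z))) h"
    "\<And>x y z. x \<in> space X \<Longrightarrow> y \<in> space Y \<Longrightarrow> z \<in> space Z \<Longrightarrow> h (x \<otimes>\<^sub>v (y \<otimes>\<^sub>v z)) = (x \<otimes>\<^sub>v y) \<otimes>\<^sub>v z"
    by (rule tensor_lift3'[OF zobj_fd[OF X] zobj_fd[OF Y] zobj_fd[OF Z], of "\<lambda>x y z. (x \<otimes>\<^sub>v y) \<otimes>\<^sub>v z"])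
      (auto intro!: bilinear_onI linear_onI simp: vtensor_add_left vtensor_add_right vtensor_scale_left vtensor_scale_right)
  have hm: "h t \<in> space ?L" if t: "t \<in> space ?R" for t
  proof (rule tensor_mem[OF h(1) zobj_subspace[OF L] _ t[simplified]])
    fix x s assume x: "x \<in> space X" and s: "s \<in> tensor_space (space Y) (space Z)"
    show "h (x \<otimes>\<^sub>v s) \<in> space ?L"
      by (rule tensor_mem[OF bilinear_onD(1)[OF bilinear_on_tensor[OF h(1)] x] zobj_subspace[OF L] _ s])
        (simp add: h(2) x vtensor_mem)
  qed
  have ha: "h (fn ?a t) = t" if t: "t \<in> space ?L" for t
    using tensor_ext3[OF _ linear_on_id, of _ _ _ "\<lambda>t. h (fn ?a t)" t]
      linear_on_comp[OF al h(1)] zmapD(1)[OF zhomD(4)[OF a(1)]] h(2) a(2) t by simp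
  have ah: "fn ?a (h t) = t" if t: "t \<in> space ?R" for t
    using tensor_ext3'[OF linear_on_comp[OF h(1) al] linear_on_id, of t] hm h(2) a(2) t by simp
  have surj: "fn ?a ` space ?L = space ?R"
    using zmapD(1)[OF zhomD(4)[OF a(1)]] hm ah by (auto simp: image_iff) metis
  have hz: "zmap G ?R ?L h"
    by (rule zmap_of_factor[OF L R L zhomD(4)[OF a(1)] surj zmap_id _ ha]) (use h(1) in simp)
  let ?h = "Arrow ?R ?L (restrict h (space ?R))"
  have zh: "?h \<in> zhom G ?R ?L" by (rule restrict_zhom[OF R hz])
  have inv: "inverse_arrows (ZG G) ?L ?R ?a k \<longleftrightarrow> k = ?h" for k
  proof
    assume k: "inverse_arrows (ZG G) ?L ?R ?a k"
    then have kz: "k \<in> zhom G ?R ?L" and ka: "comp (ZG G) k ?a = ident (ZG G) ?L" by (auto simp: inverse_arrows_def simp del: ZG_arrows)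
    show "k = ?h"
    proof (rule zhom_eqI[OF kz zh])
      fix t assume t: "t \<in> space ?R"
      have "fn k (fn ?a (h t)) = h t"
        using comp_zhom(2)[OF L a(1) kz hm[OF t]] id_zhom(2)[OF L hm[OF t]] ka by simp
      then show "fn k t = fn ?h t" using ah[OF t] t by simp
    qed
  next
    assume "k = ?h"
    moreover have "comp (ZG G) ?h ?a = ident (ZG G) ?L"
    proof (rule zhom_eqI[OF comp_zhom(1)[OF L a(1) zh] id_zhom(1)[OF L]])
      fix t assume t: "t \<in> space ?L"
      show "fn (comp (ZG G) ?h ?a) t = fn (ident (ZG G) ?L) t"
        using comp_zhom(2)[OF L a(1) zh t] id_zhom(2)[OF L t] ha[OF t] zmapD(1)[OF zhomD(4)[OF a(1)] t]
        by (simp del: ZG_arrows)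
    qed
    moreover have "comp (ZG G) ?a ?h = ident (ZG G) ?R"
    proof (rule zhom_eqI[OF comp_zhom(1)[OF R zh a(1)] id_zhom(1)[OF R]])
      fix t assume t: "t \<in> space ?R"
      show "fn (comp (ZG G) ?a ?h) t = fn (ident (ZG G) ?R) t"
        using comp_zhom(2)[OF R zh a(1) t] id_zhom(2)[OF R t] ah[OF t] t by (simp del: ZG_arrows)
    qed
    ultimately show "inverse_arrows (ZG G) ?L ?R ?a k" using zh a(1) by (simp add: inverse_arrows_def del: ZG_arrows)
  qed
  have "\<alpha> = ?h" unfolding \<alpha>_def inv_arrow_def inv by simp
  then show "\<alpha> \<in> zhom G ?R ?L" "x \<in> space X \<Longrightarrow> y \<in> space Y \<Longrightarrow> z \<in> space Z \<Longrightarrow> fn \<alpha> (x \<otimes>\<^sub>v (y \<otimes>\<^sub>v z)) = (x \<otimes>\<^sub>v y) \<otimes>\<^sub>v z"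
    using zh h(2) by (simp_all add: vtensor_mem)
qed

context crossed_data
begin

interpretation R: crossed_data G H F \<gamma> \<epsilon> H
  by (rule crossed_data_H)

definition "casimir_map b = (\<Sum>i\<in>carrier G \<times> F. amul b (up i) \<otimes>\<^sub>v dn i)"

lemma casimir_map_linear: "linear_on A.AS casimir_map"
  by (rule linear_onI)
    (simp_all add: casimir_map_def up_mem linear_on_add[OF R.nprod_linear(2)] linear_on_scale[OF R.nprod_linear(2)]
      vtensor_add_left vtensor_scale_left sum.distrib vs.scale_sum_right)

text \<open>\<open>up (g, f)\<close> and \<open>dn (g, f)\<close> have mutually inverse degrees, so
  each summand keeps the degree of \<open>b\<close>; the action permutes the summands through
  \<open>g\<close> |-> \<open>x g\<close>.\<close>

lemma casimir_map_zmap: "zmap G A.AZ (ztensor G A.AZ A.AZ) casimir_map"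
  unfolding zmap_def
proof (intro conjI ballI funcsetI)
  show "linear_on (space A.AZ) casimir_map" using casimir_map_linear by simp
  show m: "casimir_map b \<in> space (ztensor G A.AZ A.AZ)" if "b \<in> space A.AZ" for b
    using that up_mem dn_mem R.nprod_mem by (auto simp: casimir_map_def intro!: vs.subspace_sum vtensor_mem)
  fix x assume x: "x \<in> carrier G"
  {
    fix b assume b: "b \<in> deg A.AZ x"
    have "amul b (up (g, f)) \<otimes>\<^sub>v dn (g, f) \<in> deg (ztensor G A.AZ A.AZ) x" if g: "g \<in> carrier G" and f: "f \<in> F" for g f
    proof -
      let ?y = "g \<otimes> f \<otimes> inv g"
      have fG: "f \<in> carrier G" and y: "?y \<in> carrier G" "g \<otimes> inv f \<otimes> inv g = inv ?y" "x \<otimes> ?y \<otimes> inv ?y = x"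
        using g FG[OF f] x by (simp_all add: inv_mult_group m_assoc)
      have "up (g, f) \<in> deg A.AZ ?y" "dn (g, f) \<in> deg A.AZ (inv ?y)"
        using A.gen_deg[OF g f] A.gen_deg[OF g F_closed(3)[OF f]] y(1) unfolding y(2)
        by (simp_all add: up_def dn_def vs.subspace_scale[OF deg_subspace[OF A.AZ_zobj]])
      then show ?thesis
        using ztensor_deg[of "x \<otimes> ?y" "inv ?y" "amul b (up (g, f))" A.AZ "dn (g, f)" A.AZ] R.nprod_deg[OF x b y(1)] x y
        by simp
    qed
    then show "casimir_map b \<in> deg (ztensor G A.AZ A.AZ) x"
      unfolding casimir_map_def
      by (intro vs.subspace_sum deg_subspace[OF is_zobj_tensor[OF A.AZ_zobj A.AZ_zobj] x]) auto
  next
    fix b assume b: "b \<in> space A.AZ"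
    note T = tensor_map_linear[OF A.AS_fd A.AS_fd A.A_act_linear[OF x] A.A_act_linear[OF x]]
      tensor_map_apply[OF A.AS_fd A.AS_fd A.A_act_linear[OF x] A.A_act_linear[OF x]]
    have ud: "act A.AZ x (up (g, f)) = up (x \<otimes> g, f)" "act A.AZ x (dn (g, f)) = dn (x \<otimes> g, f)"
      if "g \<in> carrier G" "f \<in> F" for g f
      using that x by (simp_all add: up_def dn_def linear_on_scale[OF A.A_act_linear[OF x]] A.gen_mem A.A_act_gen)
    have "act (ztensor G A.AZ A.AZ) x (casimir_map b) =
      (\<Sum>i\<in>carrier G \<times> F. tensor_map A.AS A.AS (act A.AZ x) (act A.AZ x) (amul b (up i) \<otimes>\<^sub>v dn i))"
      using b up_mem dn_mem R.nprod_mem by (simp add: casimir_map_def linear_on_sum[OF T(1)] vtensor_mem)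
    also have "\<dots> = (\<Sum>i\<in>carrier G \<times> F. amul (act A.AZ x b) (act A.AZ x (up i)) \<otimes>\<^sub>v act A.AZ x (dn i))"
      using b by (intro sum.cong) (simp_all add: T(2) up_mem dn_mem R.nprod_mem R.nprod_act[OF x])
    also have "\<dots> = (\<Sum>g\<in>carrier G. \<Sum>f\<in>F. amul (act A.AZ x b) (up (x \<otimes> g, f)) \<otimes>\<^sub>v dn (x \<otimes> g, f))"
      unfolding sum_pairs by (intro sum.cong) (simp_all add: ud)
    also have "\<dots> = casimir_map (act A.AZ x b)"
      unfolding casimir_map_def sum_pairs
      by (rule sum_gen_shift(2)[OF x, of "\<lambda>g. \<Sum>f\<in>F. amul (act A.AZ x b) (up (g, f)) \<otimes>\<^sub>v dn (g, f)"])
    finally show "casimir_map (act A.AZ x b) = act (ztensor G A.AZ A.AZ) x (casimir_map b)" by simp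
  }
qed

text \<open>The splitting multiplies \<open>b\<close> into the Casimir element and divides by
  \<open>\<kappa>\<close>. Linearity on the left is associativity; on the right it is
  \<open>casimir\<close>.\<close>

lemma separable: "separable_alg (ZG G) \<A>"
proof -
  let ?A = "A.AZ" and ?T = "tensor_space A.AS A.AS"
  note Z = A.AZ_zobj and ZZ = is_zobj_tensor[OF A.AZ_zobj A.AZ_zobj]
  have mult: "alg_mult \<A> \<in> zhom G (ztensor G ?A ?A) ?A" using Z.mult_zhom by simp
  define \<kappa> :: 'k where "\<kappa> = of_nat (card (carrier G)) / of_nat (card H) * of_nat (card F)"
  have "card F \<noteq> 0" "card (carrier G) \<noteq> 0" using A.finite_F fin F_closed(1) one_closed by (metis card_0_eq empty_iff)+
  then have \<kappa>: "\<kappa> \<noteq> 0" using card_H_nz by (simp add: \<kappa>_def)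
  let ?s = "\<lambda>b. fscale (inverse \<kappa>) (casimir_map b)"
  define \<sigma> where "\<sigma> = Arrow ?A (ztensor G ?A ?A) (restrict ?s (space ?A))"
  have "zmap G ?A (ztensor G ?A ?A) ?s"
    using casimir_map_zmap unfolding zmap_def
    by (auto simp: linear_on_scale_fun vs.subspace_scale[OF deg_subspace[OF ZZ]] vs.subspace_scale[OF zobj_subspace[OF ZZ]]
        linear_on_scale[OF act_linear[OF ZZ]] Pi_iff simp del: ztensor_simps)
  then have \<sigma>: "\<sigma> \<in> zhom G ?A (ztensor G ?A ?A)" unfolding \<sigma>_def by (rule restrict_zhom[OF Z])
  have \<sigma>_apply: "fn \<sigma> b = (\<Sum>i\<in>carrier G \<times> F. fscale (inverse \<kappa>) (amul b (up i)) \<otimes>\<^sub>v dn i)" if "b \<in> A.AS" for b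
    using that by (simp add: \<sigma>_def casimir_map_def vs.scale_sum_right vtensor_scale_left)
  have sm: "fscale c x \<in> A.AS" if "x \<in> A.AS" for c x using vs.subspace_scale[OF A.AS_subspace that] .
  have mult_lin: "linear_on ?T (fn (alg_mult \<A>))" using zmapD(2)[OF zhomD(4)[OF mult]] by simp
  have one: "comp (ZG G) (alg_mult \<A>) \<sigma> = ident (ZG G) ?A"
  proof (rule zhom_eqI[OF comp_zhom(1)[OF Z \<sigma> mult] id_zhom(1)[OF Z]])
    fix b assume b: "b \<in> space ?A"
    have "fn (alg_mult \<A>) (fn \<sigma> b) = (\<Sum>i\<in>carrier G \<times> F. fscale (inverse \<kappa>) (amul b (amul (up i) (dn i))))"
      using b by (simp add: \<sigma>_apply linear_on_sum[OF mult_lin] vtensor_mem sm R.nprod_mem up_mem dn_mem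
          linear_on_scale[OF R.nprod_linear(2)] R.nprod_assoc)
    also have "\<dots> = fscale (inverse \<kappa>) (amul b (\<Sum>i\<in>carrier G \<times> F. amul (up i) (dn i)))"
      using b by (simp add: linear_on_sum[OF R.nprod_linear(1) A.AS_subspace] R.nprod_mem up_mem dn_mem vs.scale_sum_right)
    also have "\<dots> = b" using b \<kappa> unfolding up_dn \<kappa>_def[symmetric] by (simp add: linear_on_scale[OF R.nprod_linear(1)] aone_mem R.nprod_aone)
    finally show "fn (comp (ZG G) (alg_mult \<A>) \<sigma>) b = fn (ident (ZG G) ?A) b"
      using b by (simp add: comp_zhom(2)[OF Z \<sigma> mult] id_zhom(2)[OF Z] del: ZG_arrows)
  qed
  let ?id = "ident (ZG G) ?A" and ?a = "assoc (ZG G) ?A ?A ?A"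
    and ?\<alpha> = "inv_arrow (ZG G) (ztensor G (ztensor G ?A ?A) ?A) (ztensor G ?A (ztensor G ?A ?A)) (assoc (ZG G) ?A ?A ?A)"
  note id = id_zhom[OF Z] and as = assoc_zhom[OF Z Z Z] and ias = inv_assoc_zhom[OF Z Z Z] inv_assoc_apply[OF Z Z Z]
  note mi = tens_zhom[OF ZZ Z Z Z mult id(1)] and im = tens_zhom[OF Z ZZ Z Z id(1) mult]
  note idsig = tens_zhom[OF Z Z Z ZZ id(1) \<sigma>] and si = tens_zhom[OF Z Z ZZ Z \<sigma> id(1)]
  note sm' = comp_zhom[OF ZZ mult \<sigma>]
  note l1 = comp_zhom[OF ZZ idsig(1) ias(1)] note l2 = comp_zhom[OF ZZ l1(1) mi(1)]
  note r1 = comp_zhom[OF ZZ si(1) as(1)] note r2 = comp_zhom[OF ZZ r1(1) im(1)]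
  have lin: "linear_on ?T (fn f)" if "f \<in> zhom G (ztensor G ?A ?A) (ztensor G ?A ?A)" for f
    using zmapD(2)[OF zhomD(4)[OF that]] by simp
  have Lz: "linear_on (tensor_space A.AS ?T) (fn f)" if "f \<in> zhom G (ztensor G ?A (ztensor G ?A ?A)) Y" for f Y
    using zmapD(2)[OF zhomD(4)[OF that]] by simp
  have Rz: "linear_on (tensor_space ?T A.AS) (fn f)" if "f \<in> zhom G (ztensor G (ztensor G ?A ?A) ?A) Y" for f Y
    using zmapD(2)[OF zhomD(4)[OF that]] by simp
  have ts: "(\<Sum>i\<in>I. t i) \<in> tensor_space V W" if "\<And>i. i \<in> I \<Longrightarrow> t i \<in> tensor_space V W" for I :: "('a \<times> 'a) set" and t and V W :: "'k vec set"
    using that by (intro vs.subspace_sum) auto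
  note mem = vtensor_mem sm R.nprod_mem up_mem dn_mem ts
  have v: "fn (comp (ZG G) \<sigma> (alg_mult \<A>)) (b \<otimes>\<^sub>v c) = (\<Sum>i\<in>carrier G \<times> F. fscale (inverse \<kappa>) (amul (amul b c) (up i)) \<otimes>\<^sub>v dn i)"
    if "b \<in> A.AS" "c \<in> A.AS" for b c
    using that by (simp add: sm'(2) vtensor_mem \<sigma>_apply R.nprod_mem del: ZG_arrows)
  have two: "comp (ZG G) \<sigma> (alg_mult \<A>) = comp (ZG G) (tens_arr (ZG G) (alg_mult \<A>) ?id) (comp (ZG G) ?\<alpha> (tens_arr (ZG G) ?id \<sigma>))"
  proof (rule zhom_eqI[OF sm'(1) l2(1)])
    fix t assume t: "t \<in> space (ztensor G ?A ?A)"
    show "fn (comp (ZG G) \<sigma> (alg_mult \<A>)) t = fn (comp (ZG G) (tens_arr (ZG G) (alg_mult \<A>) ?id) (comp (ZG G) ?\<alpha> (tens_arr (ZG G) ?id \<sigma>))) t"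
    proof (rule tensor_ext[OF lin[OF sm'(1)] lin[OF l2(1)] _ t[simplified]])
      fix b c assume bc: "b \<in> A.AS" "c \<in> A.AS"
      then have "fn (comp (ZG G) (tens_arr (ZG G) (alg_mult \<A>) ?id) (comp (ZG G) ?\<alpha> (tens_arr (ZG G) ?id \<sigma>))) (b \<otimes>\<^sub>v c) =
        fn (tens_arr (ZG G) (alg_mult \<A>) ?id) (fn ?\<alpha> (\<Sum>i\<in>carrier G \<times> F. b \<otimes>\<^sub>v (fscale (inverse \<kappa>) (amul c (up i)) \<otimes>\<^sub>v dn i)))"
        by (simp add: l2(2) l1(2) vtensor_mem idsig(2) id(2) \<sigma>_apply vtensor_sum_right del: ZG_arrows)
      also have "\<dots> = (\<Sum>i\<in>carrier G \<times> F. amul b (fscale (inverse \<kappa>) (amul c (up i))) \<otimes>\<^sub>v dn i)"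
        using bc by (simp add: linear_on_sum[OF Lz[OF ias(1)]] linear_on_sum[OF Rz[OF mi(1)]] mem ias(2) mi(2) id(2) del: ZG_arrows)
      finally show "fn (comp (ZG G) \<sigma> (alg_mult \<A>)) (b \<otimes>\<^sub>v c) =
          fn (comp (ZG G) (tens_arr (ZG G) (alg_mult \<A>) ?id) (comp (ZG G) ?\<alpha> (tens_arr (ZG G) ?id \<sigma>))) (b \<otimes>\<^sub>v c)"
        using bc by (simp add: v linear_on_scale[OF R.nprod_linear(1)] mem R.nprod_assoc del: ZG_arrows)
    qed
  qed
  have three: "comp (ZG G) \<sigma> (alg_mult \<A>) = comp (ZG G) (tens_arr (ZG G) ?id (alg_mult \<A>)) (comp (ZG G) ?a (tens_arr (ZG G) \<sigma> ?id))"
  proof (rule zhom_eqI[OF sm'(1) r2(1)])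
    fix t assume t: "t \<in> space (ztensor G ?A ?A)"
    show "fn (comp (ZG G) \<sigma> (alg_mult \<A>)) t = fn (comp (ZG G) (tens_arr (ZG G) ?id (alg_mult \<A>)) (comp (ZG G) ?a (tens_arr (ZG G) \<sigma> ?id))) t"
    proof (rule tensor_ext[OF lin[OF sm'(1)] lin[OF r2(1)] _ t[simplified]])
      fix b c assume bc: "b \<in> A.AS" "c \<in> A.AS"
      have f: "linear_on A.AS (\<lambda>x. fscale (inverse \<kappa>) (amul b x))"
        using linear_on_scale_fun[OF R.nprod_linear(1)[OF bc(1)]] .
      note tm = tensor_map_linear[OF A.AS_fd A.AS_fd f linear_on_id] tensor_map_apply[OF A.AS_fd A.AS_fd f linear_on_id]
      from bc have "fn (comp (ZG G) (tens_arr (ZG G) ?id (alg_mult \<A>)) (comp (ZG G) ?a (tens_arr (ZG G) \<sigma> ?id))) (b \<otimes>\<^sub>v c) =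
        fn (tens_arr (ZG G) ?id (alg_mult \<A>)) (fn ?a (\<Sum>i\<in>carrier G \<times> F. (fscale (inverse \<kappa>) (amul b (up i)) \<otimes>\<^sub>v dn i) \<otimes>\<^sub>v c))"
        by (simp add: r2(2) r1(2) vtensor_mem si(2) id(2) \<sigma>_apply vtensor_sum_left del: ZG_arrows)
      also have "\<dots> = (\<Sum>i\<in>carrier G \<times> F. fscale (inverse \<kappa>) (amul b (up i)) \<otimes>\<^sub>v amul (dn i) c)"
        using bc by (simp add: linear_on_sum[OF Rz[OF as(1)]] linear_on_sum[OF Lz[OF im(1)]] mem as(2) im(2) id(2) del: ZG_arrows)
      \<comment> \<open>The factor \<open>b\<close> is pulled out as a map on the first tensor
        factor, so that \<open>casimir\<close> can be applied to \<open>c\<close> alone.\<close>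
      also have "\<dots> = tensor_map A.AS A.AS (\<lambda>x. fscale (inverse \<kappa>) (amul b x)) (\<lambda>x. x) (\<Sum>i\<in>carrier G \<times> F. up i \<otimes>\<^sub>v amul (dn i) c)"
        using bc by (simp add: linear_on_sum[OF tm(1)] mem tm(2))
      also have "\<dots> = tensor_map A.AS A.AS (\<lambda>x. fscale (inverse \<kappa>) (amul b x)) (\<lambda>x. x) (\<Sum>i\<in>carrier G \<times> F. amul c (up i) \<otimes>\<^sub>v dn i)"
        by (simp only: casimir[OF bc(2)])
      also have "\<dots> = (\<Sum>i\<in>carrier G \<times> F. fscale (inverse \<kappa>) (amul (amul b c) (up i)) \<otimes>\<^sub>v dn i)"
        using bc by (simp add: linear_on_sum[OF tm(1)] mem tm(2) R.nprod_assoc)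
      finally show "fn (comp (ZG G) \<sigma> (alg_mult \<A>)) (b \<otimes>\<^sub>v c) =
          fn (comp (ZG G) (tens_arr (ZG G) ?id (alg_mult \<A>)) (comp (ZG G) ?a (tens_arr (ZG G) \<sigma> ?id))) (b \<otimes>\<^sub>v c)"
        using bc by (simp add: v del: ZG_arrows)
    qed
  qed
  show ?thesis
    unfolding separable_alg_def Let_def alg_obj ZG_simps using \<sigma> one two three by blast
qed

end

section \<open>The case \<open>F = H\<close>\<close>

context crossed_data
begin

interpretation R: crossed_data G H F \<gamma> \<epsilon> H
  by (rule crossed_data_H)

context
  fixes M
  assumes M: "local_module (ZG G) \<A> M"
begin

lemmas M_pre = Z.lm_pre[OF M]
lemmas M_zobj = Z.pm_zobj[OF M_pre]
lemmas M_mem = Z.mact_mem[OF M_pre, unfolded alg_obj A.AZ_space]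
lemmas M_linear = Z.mact_linear[OF M_pre, unfolded alg_obj A.AZ_space]
lemmas M_assoc = Z.mact_assoc[OF M, unfolded alg_obj A.AZ_space]
lemmas M_act = Z.mact_act[OF M_pre, unfolded alg_obj A.AZ_space]

lemma mact_prod:
  "m \<in> space (fst M) \<Longrightarrow> b \<in> A.AS \<Longrightarrow> c \<in> A.AS \<Longrightarrow> mact M (mact M m b) c = mact M m (amul b c)"
  by (simp add: M_assoc)

lemma gen_inverse: "g \<in> carrier G \<Longrightarrow> f \<in> F \<Longrightarrow>
    amul (A.a g f) (fscale (inverse (\<gamma> f (inv f))) (A.a g (inv f))) = A.a g \<one>"
  using \<gamma>_nz[of f "inv f"] FG by (simp add: linear_on_scale[OF R.nprod_linear(1)] A.gen_mem R.nprod_same)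

lemma gen_idem: "g \<in> carrier G \<Longrightarrow> f \<in> F \<Longrightarrow> amul (A.a g f) (A.a g \<one>) = A.a g f"
  "g \<in> carrier G \<Longrightarrow> f \<in> F \<Longrightarrow> amul (A.a g \<one>) (A.a g f) = A.a g f"
  using FG by (simp_all add: R.nprod_same \<gamma>_one)

text \<open>This is where \<open>F = H\<close> acts: every \<open>h\<close> in \<open>H\<close> has
  a symbol \<open>(g, h)\<close>, of degree \<open>y = g h g^-1\<close> and invertible over its
  coset. Locality gives that \<open>y m\<close> and \<open>m\<close> agree after multiplication by
  it; cancelling the symbol and using that \<open>y\<close> fixes the symbol
  \<open>(g, \<one>)\<close> leaves \<open>y m = m\<close>.\<close>

lemma stabiliser_act:
  assumes FeqH: "F = H" and g: "g \<in> carrier G" and m: "m \<in> deg (fst M) \<one>" "mact M m (A.a g \<one>) = m" and h: "h \<in> H"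
  shows "act (fst M) (g \<otimes> h \<otimes> inv g) m = m"
proof -
  let ?y = "g \<otimes> h \<otimes> inv g" and ?b = "fscale (inverse (\<gamma> h (inv h))) (A.a g (inv h))"
  have hF: "h \<in> F" and y: "?y \<in> carrier G" using h g HG FeqH by auto
  let ?m = "act (fst M) ?y m"
  have ms: "m \<in> space (fst M)" using deg_in_space[OF M_zobj _ m(1)] by simp
  have ms': "?m \<in> space (fst M)" using act_mem[OF M_zobj y ms] .
  have b: "?b \<in> A.AS" using vs.subspace_scale[OF A.AS_subspace A.gen_mem[OF g F_closed(3)[OF hF]]] .
  have "mact M ?m (A.a g h) = mact M m (A.a g h)"
    using Z.mact_local[OF M one_closed y m(1), of "A.a g h"] A.gen_deg[OF g hF] y act_one[OF A.AZ_zobj, of "A.a g h"]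
      A.gen_mem[OF g hF] by simp
  then have "mact M (mact M ?m (A.a g h)) ?b = mact M (mact M m (A.a g h)) ?b" by simp
  then have "mact M ?m (A.a g \<one>) = mact M m (A.a g \<one>)"
    using ms ms' b by (simp only: mact_prod A.gen_mem[OF g hF] gen_inverse[OF g hF])
  moreover have "mact M ?m (A.a g \<one>) = ?m"
  proof -
    have yg: "?y \<otimes> g = g \<otimes> h" using g HG[OF h] by (simp add: m_assoc)
    have "A.a (?y \<otimes> g) \<one> = A.a g \<one>"
      unfolding yg using A.gen_rel[OF g h F_closed(1)] HG[OF h] by (simp add: \<epsilon>_unit[OF h])
    then have "act A.AZ ?y (A.a g \<one>) = A.a g \<one>" using A.A_act_gen[OF y g F_closed(1)] by simp
    then show ?thesis using M_act[OF y ms A.gen_mem[OF g F_closed(1)]] m(2) by simp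
  qed
  ultimately show ?thesis using m(2) by simp
qed

text \<open>The elements of \<open>g H g^-1\<close> fix \<open>m\<close> and contribute
  \<open>card H\<close> equal terms; any other \<open>y\<close> moves \<open>m\<close> to the symbol
  \<open>(y g, \<one>)\<close>, which is orthogonal to \<open>(g, \<one>)\<close>.\<close>

lemma reyn_gen:
  assumes FeqH: "F = H" and g: "g \<in> carrier G" and m: "m \<in> deg (fst M) \<one>" "mact M m (A.a g \<one>) = m"
  shows "mact M (reyn G (fst M) m) (A.a g \<one>) = fscale (of_nat (card H) / of_nat (card (carrier G))) m"
proof -
  note gm = A.gen_mem[OF g F_closed(1)]
  have ms: "m \<in> space (fst M)" using deg_in_space[OF M_zobj _ m(1)] by simp
  note l = M_linear(2)[OF gm]
  have v: "mact M (act (fst M) y m) (A.a g \<one>) = (if inv (y \<otimes> g) \<otimes> g \<in> H then m else 0)" if y: "y \<in> carrier G" for y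
  proof (cases "inv (y \<otimes> g) \<otimes> g \<in> H")
    case True
    let ?h = "inv (inv (y \<otimes> g) \<otimes> g)"
    have h: "?h \<in> H" using True by simp
    have "g \<otimes> ?h \<otimes> inv g = y" using y g by (simp add: inv_mult_group m_assoc)
    then have "act (fst M) y m = m" using stabiliser_act[OF FeqH g m h] by simp
    then show ?thesis using True m(2) by simp
  next
    case False
    have "act (fst M) y m = mact M (act (fst M) y m) (A.a (y \<otimes> g) \<one>)"
      using M_act[OF y ms gm] m(2) A.A_act_gen[OF y g F_closed(1)] by simp
    then have "mact M (act (fst M) y m) (A.a g \<one>) = mact M (act (fst M) y m) (amul (A.a (y \<otimes> g) \<one>) (A.a g \<one>))"
      using mact_prod[OF act_mem[OF M_zobj y ms] A.gen_mem[OF m_closed[OF y g] F_closed(1)] gm] by simp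
    also have "\<dots> = 0"
      using False y g by (simp add: R.nprod_other linear_on_zero[OF M_linear(1)[OF act_mem[OF M_zobj y ms]] A.AS_subspace])
    finally show ?thesis using False by simp
  qed
  have "mact M (reyn G (fst M) m) (A.a g \<one>) =
      fscale (inverse (of_nat (card (carrier G)))) (\<Sum>y\<in>carrier G. if inv (y \<otimes> g) \<otimes> g \<in> H then m else 0)"
    using zcomp_homogeneous[OF M_zobj _ _ m(1), of \<one>] ms
    by (simp add: reyn_def linear_on_scale[OF l] linear_on_sum[OF l zobj_subspace[OF M_zobj]]
        vs.subspace_sum[OF zobj_subspace[OF M_zobj]] act_mem[OF M_zobj] v)
  also have "(\<Sum>y\<in>carrier G. if inv (y \<otimes> g) \<otimes> g \<in> H then m else 0) = (\<Sum>x\<in>carrier G. if inv x \<otimes> g \<in> H then m else 0)"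
    by (rule sum_gen_shift(1)[OF g, of "\<lambda>x. if inv x \<otimes> g \<in> H then m else 0"])
  also have "\<dots> = fscale (of_nat (card H)) m" by (simp only: sum_over card_coset'[OF g])
  finally show ?thesis by (simp add: field_simps)
qed

lemma reyn_deg: "x \<in> carrier G \<Longrightarrow> m \<in> deg (fst M) x \<Longrightarrow> x \<noteq> \<one> \<Longrightarrow> reyn G (fst M) m = 0"
  using zcomp_homogeneous[OF M_zobj, of x \<one> m] linear_on_zero[OF act_linear[OF M_zobj] zobj_subspace[OF M_zobj]]
  by (simp add: reyn_def)

text \<open>Only \<open>f = g^-1 x^-1 g\<close> brings \<open>m\<close> to degree
  \<open>\<one>\<close>, so at most one summand survives \<open>R\<close>, and
  \<open>reyn_gen\<close> evaluates it. If this \<open>f\<close> is not in \<open>F = H\<close>,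
  locality makes the right-hand side vanish as well.\<close>

lemma dual_coset:
  assumes FeqH: "F = H" and x: "x \<in> carrier G" and m: "m \<in> deg (fst M) x" and g: "g \<in> carrier G"
  shows "(\<Sum>f\<in>F. mact M (reyn G (fst M) (mact M m (up (g, f)))) (dn (g, f))) =
    fscale (inverse (of_nat (card H))) (mact M m (A.a g \<one>))" (is "(\<Sum>f\<in>F. ?t f) = ?v")
proof -
  let ?f = "inv g \<otimes> inv x \<otimes> g" and ?c = "of_nat (card (carrier G)) / of_nat (card H) ^ 2 :: 'k"
  have ms: "m \<in> space (fst M)" using deg_in_space[OF M_zobj x m] .
  note rl = reyn_linear[OF M_zobj] and rm = invs_mem[OF M_zobj reyn_invs[OF M_zobj]]
  have G0: "of_nat (card (carrier G)) \<noteq> (0 :: 'k)" using fin one_closed by (metis card_0_eq empty_iff of_nat_eq_0_iff)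
  have t: "?t f = (if f = ?f then ?v else 0)" if f: "f \<in> F" for f
  proof -
    note fG = FG[OF f] and gm = A.gen_mem[OF g f] and gm' = A.gen_mem[OF g F_closed(3)[OF f]]
    let ?m = "mact M m (A.a g f)" and ?b = "fscale (inverse (\<gamma> f (inv f))) (A.a g (inv f))"
    have b: "?b \<in> A.AS" using vs.subspace_scale[OF A.AS_subspace gm'] .
    have mm: "?m \<in> space (fst M)" using M_mem[OF ms gm] .
    have md: "?m \<in> deg (fst M) (x \<otimes> (g \<otimes> f \<otimes> inv g))"
      using Z.mact_deg[OF M_pre x _ m, of "g \<otimes> f \<otimes> inv g" "A.a g f"] A.gen_deg[OF g f] g fG by simp
    have tv: "?t f = fscale ?c (mact M (reyn G (fst M) ?m) ?b)"
      by (simp add: up_def dn_def linear_on_scale[OF M_linear(1)[OF ms] gm] linear_on_scale[OF rl mm]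
          linear_on_scale[OF M_linear(2)] rm[OF mm] vs.subspace_scale[OF A.AS_subspace] gm')
    have iff: "x \<otimes> (g \<otimes> f \<otimes> inv g) = \<one> \<longleftrightarrow> f = ?f"
    proof
      assume "x \<otimes> (g \<otimes> f \<otimes> inv g) = \<one>"
      then have "g \<otimes> f \<otimes> inv g = inv x" using x g fG by (metis inv_equality inv_comm m_closed inv_closed)
      then have "inv g \<otimes> (g \<otimes> f \<otimes> inv g) \<otimes> g = ?f" by simp
      then show "f = ?f" using g fG by (simp add: m_assoc)
    qed (use x g in \<open>simp add: m_assoc\<close>)
    show ?thesis
    proof (cases "f = ?f")
      case True
      then have m1: "?m \<in> deg (fst M) \<one>" using md iff by simp
      have id: "mact M ?m (A.a g \<one>) = ?m"
        using mact_prod[OF ms gm A.gen_mem[OF g F_closed(1)]] gen_idem(1)[OF g f] by simp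
      have bb: "amul (A.a g \<one>) ?b = ?b"
        by (simp add: linear_on_scale[OF R.nprod_linear(1)] A.gen_mem g gm' gen_idem(2) f)
      have "mact M (reyn G (fst M) ?m) ?b = mact M (mact M (reyn G (fst M) ?m) (A.a g \<one>)) ?b"
        using mact_prod[OF rm[OF mm] A.gen_mem[OF g F_closed(1)] b] bb by simp
      also have "\<dots> = fscale (of_nat (card H) / of_nat (card (carrier G))) (mact M ?m ?b)"
        by (simp only: reyn_gen[OF FeqH g m1 id] linear_on_scale[OF M_linear(2)[OF b] mm])
      also have "mact M ?m ?b = mact M m (A.a g \<one>)"
        using mact_prod[OF ms gm b] gen_inverse[OF g f] by simp
      finally have "?t f = fscale (?c * (of_nat (card H) / of_nat (card (carrier G)))) (mact M m (A.a g \<one>))"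
        unfolding tv by (simp only: fscale_scale)
      also have "?c * (of_nat (card H) / of_nat (card (carrier G))) = inverse (of_nat (card H))"
        using G0 card_H_nz by (simp add: field_simps power2_eq_square)
      finally show ?thesis using True by simp
    next
      case False
      then have "reyn G (fst M) ?m = 0" using reyn_deg[OF _ md] iff x g fG by simp
      then show ?thesis
        using False linear_on_zero[OF M_linear(2)[OF b] zobj_subspace[OF M_zobj]] unfolding tv by simp
    qed
  qed
  have "(\<Sum>f\<in>F. ?t f) = (if ?f \<in> F then ?v else 0)" using A.finite_F by (simp add: t)
  \<comment> \<open>By locality, \<open>m\<close> times the symbol \<open>(x g, \<one>)\<close>
    equals \<open>m\<close> times \<open>(g, \<one>)\<close>. Over distinct cosets these two
    idempotents are orthogonal, so the common value is zero.\<close>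
  moreover have "mact M m (A.a g \<one>) = 0" if "?f \<notin> F"
  proof -
    note gm = A.gen_mem[OF g F_closed(1)] and gm' = A.gen_mem[OF m_closed[OF x g] F_closed(1)]
    have "inv (x \<otimes> g) \<otimes> g \<notin> H" using that FeqH x g by (simp add: inv_mult_group)
    then have 0: "amul (A.a (x \<otimes> g) \<one>) (A.a g \<one>) = 0" using x g by (simp add: R.nprod_other)
    have "mact M m (A.a (x \<otimes> g) \<one>) = mact M m (A.a g \<one>)"
      using Z.mact_local[OF M x one_closed m, of "A.a g \<one>"] A.gen_deg[OF g F_closed(1)] g x act_one[OF M_zobj ms]
        A.A_act_gen[OF x g F_closed(1)] by simp
    then have "mact M m (A.a g \<one>) = mact M (mact M m (A.a (x \<otimes> g) \<one>)) (A.a g \<one>)"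
      using mact_prod[OF ms gm gm] gen_idem(1)[OF g F_closed(1)] by simp
    also have "\<dots> = 0" using mact_prod[OF ms gm' gm] 0 linear_on_zero[OF M_linear(1)[OF ms] A.AS_subspace] by simp
    finally show ?thesis .
  qed
  ultimately show ?thesis by auto
qed

lemma dual:
  assumes FeqH: "F = H" and m: "m \<in> space (fst M)"
  shows "(\<Sum>i\<in>carrier G \<times> F. mact M (reyn G (fst M) (mact M m (up i))) (dn i)) = m"
proof (rule zspace_ext[OF M_zobj _ linear_on_id _ m])
  show "linear_on (space (fst M)) (\<lambda>m. \<Sum>i\<in>carrier G \<times> F. mact M (reyn G (fst M) (mact M m (up i))) (dn i))"
  proof (rule linear_onI)
    fix m n assume mn: "m \<in> space (fst M)" "n \<in> space (fst M)"
    have "mact M (reyn G (fst M) (mact M (m + n) (up i))) (dn i) =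
      mact M (reyn G (fst M) (mact M m (up i))) (dn i) + mact M (reyn G (fst M) (mact M n (up i))) (dn i)"
      if i: "i \<in> carrier G \<times> F" for i
      using mn M_mem[OF mn(1) up_mem[OF i]] M_mem[OF mn(2) up_mem[OF i]]
      by (simp add: linear_on_add[OF M_linear(2)[OF up_mem[OF i]]] linear_on_add[OF M_linear(2)[OF dn_mem[OF i]]]
          linear_on_add[OF reyn_linear[OF M_zobj]] invs_mem[OF M_zobj reyn_invs[OF M_zobj]])
    then show "(\<Sum>i\<in>carrier G \<times> F. mact M (reyn G (fst M) (mact M (m + n) (up i))) (dn i)) =
      (\<Sum>i\<in>carrier G \<times> F. mact M (reyn G (fst M) (mact M m (up i))) (dn i)) +
      (\<Sum>i\<in>carrier G \<times> F. mact M (reyn G (fst M) (mact M n (up i))) (dn i))"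
      by (simp add: sum.distrib)
  next
    fix c m assume m: "m \<in> space (fst M)"
    have "mact M (reyn G (fst M) (mact M (fscale c m) (up i))) (dn i) = fscale c (mact M (reyn G (fst M) (mact M m (up i))) (dn i))"
      if i: "i \<in> carrier G \<times> F" for i
      using m M_mem[OF m up_mem[OF i]]
      by (simp add: linear_on_scale[OF M_linear(2)[OF up_mem[OF i]]] linear_on_scale[OF M_linear(2)[OF dn_mem[OF i]]]
          linear_on_scale[OF reyn_linear[OF M_zobj]] invs_mem[OF M_zobj reyn_invs[OF M_zobj]])
    then show "(\<Sum>i\<in>carrier G \<times> F. mact M (reyn G (fst M) (mact M (fscale c m) (up i))) (dn i)) =
      fscale c (\<Sum>i\<in>carrier G \<times> F. mact M (reyn G (fst M) (mact M m (up i))) (dn i))"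
      by (simp add: vs.scale_sum_right)
  qed
next
  fix x m assume x: "x \<in> carrier G" and m: "m \<in> deg (fst M) x"
  have ms: "m \<in> space (fst M)" using deg_in_space[OF M_zobj x m] .
  have "(\<Sum>i\<in>carrier G \<times> F. mact M (reyn G (fst M) (mact M m (up i))) (dn i)) =
      (\<Sum>g\<in>carrier G. fscale (inverse (of_nat (card H))) (mact M m (A.a g \<one>)))"
    unfolding sum_pairs by (rule sum.cong) (simp_all add: dual_coset[OF FeqH x m])
  \<comment> \<open>Averaged with weight \<open>1 / card H\<close>, the symbols
    \<open>(g, \<one>)\<close> add up to the unit.\<close>
  also have "\<dots> = mact M m aone"
    unfolding aone_def vs.scale_sum_right[symmetric]
    by (simp add: linear_on_scale[OF M_linear(1)[OF ms]] vs.subspace_sum[OF A.AS_subspace] A.gen_mem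
        linear_on_sum[OF M_linear(1)[OF ms] A.AS_subspace])
  also have "\<dots> = m" using Z.mact_unit[OF M ms] by simp
  finally show "(\<Sum>i\<in>carrier G \<times> F. mact M (reyn G (fst M) (mact M m (up i))) (dn i)) = m" .
qed

end

lemma trivialising_if: "F = H \<Longrightarrow> trivialising G \<A>"
proof -
  assume FeqH: "F = H"
  interpret T: triv_algebra G \<A> "carrier G \<times> F" up dn
  proof (intro triv_algebra.intro triv_algebra_axioms.intro Z.zalgebra_axioms, unfold alg_obj A.AZ_space unit_apply)
    fix b assume b: "b \<in> A.AS"
    show "(\<Sum>i\<in>carrier G \<times> F. fn (alg_mult \<A>) (b \<otimes>\<^sub>v up i) \<otimes>\<^sub>v dn i) =
        (\<Sum>i\<in>carrier G \<times> F. up i \<otimes>\<^sub>v fn (alg_mult \<A>) (dn i \<otimes>\<^sub>v b))"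
      using casimir[OF b] b by (simp add: up_mem dn_mem)
  qed (fact up_mem dn_mem dual[OF _ FeqH] invs_A aone_neq_0)+
  show ?thesis
    unfolding trivialising_def
    using A_algebra separable T.indecomposable T.local_modules_equivalent_Vect by blast
qed

end

section \<open>The case \<open>F \<noteq> H\<close>\<close>

context crossed_data
begin

interpretation R: crossed_data G H F \<gamma> \<epsilon> H
  by (rule crossed_data_H)

context
  assumes KF: "K = F"
begin

definition "\<nu> = (SOME h. linear_on (tensor_space N.AS A.AS) h \<and> (\<forall>n\<in>N.AS. \<forall>b\<in>A.AS. h (n \<otimes>\<^sub>v b) = nprod n b))"

lemma \<nu>_linear: "linear_on (tensor_space N.AS A.AS) \<nu>"
  and \<nu>_apply: "n \<in> N.AS \<Longrightarrow> b \<in> A.AS \<Longrightarrow> \<nu> (n \<otimes>\<^sub>v b) = nprod n b"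
proof -
  obtain h where "linear_on (tensor_space N.AS A.AS) h" "\<And>n b. n \<in> N.AS \<Longrightarrow> b \<in> A.AS \<Longrightarrow> h (n \<otimes>\<^sub>v b) = nprod n b"
    using tensor_lift[OF N.AS_fd A.AS_subspace nprod_bilinear] by blast
  then have "\<exists>h. linear_on (tensor_space N.AS A.AS) h \<and> (\<forall>n\<in>N.AS. \<forall>b\<in>A.AS. h (n \<otimes>\<^sub>v b) = nprod n b)" by blast
  from someI_ex[OF this, folded \<nu>_def] show "linear_on (tensor_space N.AS A.AS) \<nu>"
    "n \<in> N.AS \<Longrightarrow> b \<in> A.AS \<Longrightarrow> \<nu> (n \<otimes>\<^sub>v b) = nprod n b" by blast+
qed

definition "\<N> = (N.AZ, Arrow (ztensor G N.AZ A.AZ) N.AZ (restrict \<nu> (tensor_space N.AS A.AS)))"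

lemma fst_\<N> [simp]: "fst \<N> = N.AZ" and mact_\<N>: "n \<in> N.AS \<Longrightarrow> b \<in> A.AS \<Longrightarrow> mact \<N> n b = nprod n b"
  by (simp_all add: \<N>_def mact_def \<nu>_apply vtensor_mem)

lemma local_\<N>: "local_module (ZG G) \<A> \<N>"
proof -
  have "zmap G (ztensor G N.AZ A.AZ) N.AZ \<nu>"
    by (rule zmap_tensorI[OF N.AZ_zobj A.AZ_zobj N.AZ_zobj])
      (simp_all add: \<nu>_linear \<nu>_apply deg_in_space[OF A.AZ_zobj, simplified] deg_in_space[OF N.AZ_zobj, simplified] nprod_deg
        act_mem[OF A.AZ_zobj, simplified] act_mem[OF N.AZ_zobj, simplified] nprod_act)
  then have "Z.pre_module \<N>"
    using restrict_zhom[OF is_zobj_tensor[OF N.AZ_zobj A.AZ_zobj], of N.AZ \<nu>] N.AZ_zobj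
    by (simp add: Z.pre_module_def \<N>_def)
  moreover have "mact \<N> (act N.AZ (x \<otimes> y \<otimes> inv x) n) (act A.AZ x b) = mact \<N> n b"
    if "x \<in> carrier G" "y \<in> carrier G" "n \<in> deg N.AZ x" "b \<in> deg A.AZ y" for x y n b
    using that act_mem[OF N.AZ_zobj, of "x \<otimes> y \<otimes> inv x" n] act_mem[OF A.AZ_zobj that(1), of b]
      deg_in_space[OF N.AZ_zobj that(1,3)] deg_in_space[OF A.AZ_zobj that(2,4)] nprod_local[OF that]
    by (simp add: mact_\<N>)
  ultimately show ?thesis
    unfolding Z.local_module_iff Z.right_module_iff
    by (simp add: mact_\<N> nprod_mem R.nprod_mem nprod_assoc nprod_aone aone_mem)
qed

text \<open>Scalars as endomorphisms of the regular module; proportional maps out of it factor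
  through one another by these.\<close>

lemma scalar_hom: "Arrow (regular_module \<A>) (regular_module \<A>) (Arrow A.AZ A.AZ (restrict (fscale c) A.AS)) \<in>
    module_hom_arrows (ZG G) \<A> (regular_module \<A>) (regular_module \<A>)"
proof -
  note pre = Z.lm_pre[OF Z.regular_local]
  have "zmap G A.AZ A.AZ (fscale c)"
    unfolding zmap_def
    by (auto simp: vs.subspace_scale[OF A.AS_subspace] vs.subspace_scale[OF deg_subspace[OF A.AZ_zobj]]
        linear_on_scale[OF A.A_act_linear] intro!: linear_onI simp: vs.scale_right_distrib mult.commute)
  from restrict_zhom[OF A.AZ_zobj this]
  have z: "Arrow A.AZ A.AZ (restrict (fscale c) A.AS) \<in> zhom G A.AZ A.AZ" by simp
  have "fst (regular_module \<A>) = A.AZ" by (simp add: regular_module_def)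
  then show ?thesis
    by (intro Z.module_homI[OF pre pre])
      (use z in \<open>simp_all add: Z.mact_regular R.nprod_mem vs.subspace_scale[OF A.AS_subspace]
        linear_on_scale[OF R.nprod_linear(2)]\<close>)
qed

text \<open>A map from the regular module to \<open>\<N>\<close> is determined by the image of the
  unit, an invariant and hence a multiple of \<open>?w\<close>. Any two such maps are therefore
  proportional, and \<open>factors_through_unit\<close> factors the identity of \<open>\<N>\<close>
  through the regular module.\<close>

lemma cyclic_if_equivalent:
  assumes "braided_monoidal_equivalent (local_modules (ZG G) \<A>) (Vect :: ('k vec set, ('k vec set, 'k vec \<Rightarrow> 'k vec) arrow) braided_monoidal)"
    and n: "n \<in> N.AS"
  shows "\<exists>b\<in>A.AS. n = nprod (\<Sum>x\<in>carrier G. N.a x \<one>) b"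
proof -
  let ?R = "regular_module \<A>" and ?w = "\<Sum>x\<in>carrier G. N.a x \<one>" and ?hom = "module_hom_arrows (ZG G) \<A>"
  note pR = Z.lm_pre[OF Z.regular_local] and pN = Z.lm_pre[OF local_\<N>]
  have fR [simp]: "fst ?R = A.AZ" by (simp add: regular_module_def)
  have w: "?w \<in> N.AS" by (intro vs.subspace_sum[OF N.AS_subspace] N.gen_mem) auto
  have hom: "\<exists>c. \<forall>b\<in>A.AS. fn (fn f) b = fscale c (nprod ?w b)" if f: "f \<in> ?hom ?R \<N>" for f
  proof -
    have "aone \<in> invs G A.AZ" using aone_deg act_aone by (simp add: invs_def)
    then have "fn (fn f) aone \<in> invs G N.AZ" using Z.module_hom_invs[OF pR pN f, of aone] by simp
    then obtain c where c: "fn (fn f) aone = fscale c ?w" using invs_N by blast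
    have "fn (fn f) b = fscale c (nprod ?w b)" if b: "b \<in> A.AS" for b
      using Z.module_homD(4)[OF pR pN f, of aone b] b aone_mem w
      by (simp add: Z.mact_regular aone_nprod c mact_\<N> vs.subspace_scale[OF N.AS_subspace]
          linear_on_scale[OF nprod_linear(2)])
    then show ?thesis by blast
  qed
  have "\<exists>s\<in>?hom ?R ?R. f = comp Z.LM g s \<or> g = comp Z.LM f s" if f: "f \<in> ?hom ?R \<N>" and g: "g \<in> ?hom ?R \<N>" for f g
  proof -
    obtain c d where c: "\<And>b. b \<in> A.AS \<Longrightarrow> fn (fn f) b = fscale c (nprod ?w b)"
      and d: "\<And>b. b \<in> A.AS \<Longrightarrow> fn (fn g) b = fscale d (nprod ?w b)"
      using hom[OF f] hom[OF g] by blast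
    let ?s = "\<lambda>t. Arrow ?R ?R (Arrow A.AZ A.AZ (restrict (fscale t) A.AS))"
    have *: "f' = comp Z.LM g' (?s t)"
      if f': "f' \<in> ?hom ?R \<N>" "\<And>b. b \<in> A.AS \<Longrightarrow> fn (fn f') b = fscale c' (nprod ?w b)"
        and g': "g' \<in> ?hom ?R \<N>" "\<And>b. b \<in> A.AS \<Longrightarrow> fn (fn g') b = fscale d' (nprod ?w b)" and t: "c' = d' * t"
      for f' g' c' d' t
      by (rule Z.module_hom_eqI[OF pR pN f'(1) Z.LM_comp(1)[OF pR pR pN scalar_hom g'(1)]])
        (simp add: Z.LM_comp(2)[OF pR pR pN scalar_hom g'(1)] f'(2) g'(2) t vs.subspace_scale[OF A.AS_subspace]
          linear_on_scale[OF nprod_linear(1)[OF w]] del: Z.LM_simps)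
    show ?thesis
    \<comment> \<open>The direction of the factorisation depends on which coefficient can be
      inverted; for \<open>d = 0\<close> the map \<open>g\<close> is zero and factors through
      \<open>f\<close>.\<close>
    proof (cases "d = 0")
      case True
      have "g = comp Z.LM f (?s 0)" by (rule *[OF g d f c]) (simp_all add: True)
      then show ?thesis using scalar_hom by blast
    next
      case False
      have "f = comp Z.LM g (?s (c / d))" by (rule *[OF f c g d]) (simp_all add: False)
      then show ?thesis using scalar_hom by blast
    qed
  qed
  then obtain f g where f: "f \<in> ?hom ?R \<N>" and g: "g \<in> ?hom \<N> ?R" and fg: "comp Z.LM f g = ident Z.LM \<N>"
    using Z.factors_through_unit[OF assms(1) local_\<N>] by blast
  have gn: "fn (fn g) n \<in> A.AS" using Z.module_hom_mem[OF pN pR g, of n] n by simp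
  obtain c where c: "\<And>b. b \<in> A.AS \<Longrightarrow> fn (fn f) b = fscale c (nprod ?w b)" using hom[OF f] by blast
  have "n = fn (fn f) (fn (fn g) n)"
    using Z.LM_comp(2)[OF pN pR pN g f, of n] Z.LM_ident(2)[OF pN, of n] n by (simp add: fg del: Z.LM_simps)
  also have "\<dots> = nprod ?w (fscale c (fn (fn g) n))" by (simp add: c gn linear_on_scale[OF nprod_linear(1)[OF w]])
  finally show ?thesis using vs.subspace_scale[OF A.AS_subspace gn] by blast
qed

text \<open>In the product of \<open>?w\<close> with a symbol over \<open>g'\<close> only the
  \<open>g\<close> in the coset \<open>g' H\<close> contribute, each with weight
  \<open>\<delta> g\<close>, and \<open>\<delta>\<close> is supported on \<open>H\<close>. So
  \<open>\<psi>\<close> of the product is zero or a multiple of the full sum of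
  \<open>\<delta>\<close>, which vanishes too.\<close>

lemma not_cyclic:
  assumes h1: "h1 \<in> H" "h1 \<notin> F" and b: "b \<in> A.AS"
  shows "N.a \<one> \<one> \<noteq> nprod (\<Sum>x\<in>carrier G. N.a x \<one>) b"
proof
  let ?w = "\<Sum>x\<in>carrier G. N.a x \<one>"
  assume eq: "N.a \<one> \<one> = nprod ?w b"
  have w: "?w \<in> N.AS" by (intro vs.subspace_sum[OF N.AS_subspace] N.gen_mem) auto
  define \<chi> :: "'a \<Rightarrow> 'k" where "\<chi> g = (if g \<in> F then 1 else 0)" for g
  \<comment> \<open>The difference of the indicators of \<open>F\<close> and \<open>h1 F\<close>:
    constant on left cosets of \<open>F\<close>, as the relations of the module demand, but not on
    the coset \<open>H\<close>.\<close>
  define \<delta> where "\<delta> g = \<chi> g - \<chi> (inv h1 \<otimes> g)" for g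
  have \<chi>_mult: "\<chi> (g \<otimes> k) = \<chi> g" if "g \<in> carrier G" "k \<in> F" for g k
  proof -
    have "g = (g \<otimes> k) \<otimes> inv k" using that FG by (simp add: m_assoc)
    then have "g \<otimes> k \<in> F \<longleftrightarrow> g \<in> F" using that F_closed by metis
    then show ?thesis by (simp add: \<chi>_def)
  qed
  have \<delta>_mult: "\<delta> (g \<otimes> k) = \<delta> g" if "g \<in> carrier G" "k \<in> F" for g k
    using that \<chi>_mult[of g k] \<chi>_mult[of "inv h1 \<otimes> g" k] HG[OF h1(1)] FG by (simp add: \<delta>_def m_assoc)
  have \<delta>_H: "g \<in> H" if "g \<in> carrier G" "\<delta> g \<noteq> 0" for g
  proof (rule ccontr)
    assume "g \<notin> H"
    then have "g \<notin> F" "inv h1 \<otimes> g \<notin> F" using FH coset_mult(1)[of "inv h1" g] h1 that by auto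
    then show False using that by (simp add: \<delta>_def \<chi>_def)
  qed
  have \<delta>_sum: "(\<Sum>g\<in>carrier G. \<delta> g) = 0"
    using sum_gen_shift(2)[of "inv h1" \<chi>] HG[OF h1(1)] by (simp add: \<delta>_def sum_subtractf)
  define \<phi> :: "'a \<Rightarrow> 'a \<Rightarrow> 'k vec" where "\<phi> g f = (if f = \<one> then fscale (\<delta> g) one_vec else 0)" for g f
  have "\<phi> (g \<otimes> k) f = fscale (\<epsilon> k f) (\<phi> g (k \<otimes> f \<otimes> inv k))" if "g \<in> carrier G" "k \<in> K" "f \<in> F" for g k f
    using that conj_eq_one[OF FG FG] \<epsilon>_unit[OF FH] \<delta>_mult KF by (simp add: \<phi>_def)
  then obtain \<psi> where \<psi>: "linear_on N.AS \<psi>" "\<And>g f. g \<in> carrier G \<Longrightarrow> f \<in> F \<Longrightarrow> \<psi> (N.a g f) = \<phi> g f"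
    by (rule N.A_univ) auto
  have "\<psi> (nprod ?w b) = 0"
  proof (rule A.A_ext[OF linear_on_comp[OF nprod_linear(1)[OF w] \<psi>(1) nprod_mem[OF w]] linear_on_const_zero _ b])
    fix g' f' assume g': "g' \<in> carrier G" and f': "f' \<in> F"
    have v: "\<psi> (nprod (N.a g \<one>) (A.a g' f')) = (if f' = \<one> \<and> g' \<in> H then fscale (\<delta> g) one_vec else 0)"
      if g: "g \<in> carrier G" for g
    proof (cases "inv g \<otimes> g' \<in> H")
      case True
      let ?h = "inv g \<otimes> g'"
      let ?p = "?h \<otimes> f' \<otimes> inv ?h"
      have p: "?p \<in> F" using conj_H[OF True f'] .
      have "\<psi> (nprod (N.a g \<one>) (A.a g' f')) = fscale (\<epsilon> ?h f') (\<phi> g ?p)"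
        using True g g' f' p
        by (simp add: nprod_gen nval_def \<gamma>_one FG[OF p] linear_on_scale[OF \<psi>(1)] N.gen_mem \<psi>(2) del: m_closed)
      also have "\<dots> = (if f' = \<one> then fscale (\<delta> g) one_vec else 0)"
        using conj_eq_one[OF HG[OF True] FG[OF f']] \<epsilon>_unit[OF True] by (simp add: \<phi>_def)
      also have "\<dots> = (if f' = \<one> \<and> g' \<in> H then fscale (\<delta> g) one_vec else 0)"
        using \<delta>_H[OF g] coset_mult(2)[OF True g] coset_mult(1)[of "inv g" g'] True g g' by (cases "\<delta> g = 0") auto
      finally show ?thesis .
    next
      case False
      have "\<delta> g = 0" if "g' \<in> H" using \<delta>_H[OF g] False that H_closed by blast
      then show ?thesis using False g g' f' linear_on_zero[OF \<psi>(1) N.AS_subspace] by (simp add: nprod_other)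
    qed
    have "\<psi> (nprod ?w (A.a g' f')) = (\<Sum>g\<in>carrier G. \<psi> (nprod (N.a g \<one>) (A.a g' f')))"
      using A.gen_mem[OF g' f']
      by (simp add: linear_on_sum[OF nprod_linear(2) N.AS_subspace] linear_on_sum[OF \<psi>(1) N.AS_subspace] N.gen_mem nprod_mem)
    also have "\<dots> = (\<Sum>g\<in>carrier G. if f' = \<one> \<and> g' \<in> H then fscale (\<delta> g) one_vec else 0)"
      by (rule sum.cong) (simp_all only: v)
    also have "\<dots> = (if f' = \<one> \<and> g' \<in> H then fscale (\<Sum>g\<in>carrier G. \<delta> g) one_vec else 0)"
      by (cases "f' = \<one> \<and> g' \<in> H") (simp_all only: if_True if_False vs.scale_sum_left sum.neutral_const simp_thms)
    finally show "\<psi> (nprod ?w (A.a g' f')) = 0" by (simp add: \<delta>_sum)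
  qed
  moreover have "\<psi> (N.a \<one> \<one>) = one_vec"
  proof -
    have "inv h1 \<notin> F" using h1 F_closed(3)[of "inv h1"] HG by auto
    then show ?thesis using HG[OF h1(1)] by (simp add: \<psi>(2) \<phi>_def \<delta>_def \<chi>_def)
  qed
  ultimately show False using eq by simp
qed

lemma trivialising_only_if:
  assumes "trivialising G \<A>"
  shows "F = H"
proof (rule ccontr)
  assume "F \<noteq> H"
  then obtain h1 where "h1 \<in> H" "h1 \<notin> F" using FH by blast
  then show False
    using cyclic_if_equivalent[of "N.a \<one> \<one>"] not_cyclic N.gen_mem[of \<one> \<one>] assms unfolding trivialising_def by auto
qed

end

end

theorem theorem3p5p3:
  fixes G :: "('g, 'm) monoid_scheme"
    and H F :: "'g set"
    and \<gamma> \<epsilon> :: "'g \<Rightarrow> 'g \<Rightarrow> 'k::{alg_closed_field, field_char_0}"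
  assumes "group G" and "finite (carrier G)"
    and "subgroup H G"
    and "F \<lhd> G\<lparr>carrier := H\<rparr>"
    and "normalised_2cocycle G F \<gamma>"
    and "\<And>h f. h \<in> H \<Longrightarrow> f \<in> F \<Longrightarrow> \<epsilon> h f \<noteq> 0"
    and "\<And>g h f. g \<in> H \<Longrightarrow> h \<in> H \<Longrightarrow> f \<in> F \<Longrightarrow>
           \<epsilon> (g \<otimes>\<^bsub>G\<^esub> h) f = \<epsilon> g (h \<otimes>\<^bsub>G\<^esub> f \<otimes>\<^bsub>G\<^esub> inv\<^bsub>G\<^esub> h) * \<epsilon> h f"
    and "\<And>h f g. h \<in> H \<Longrightarrow> f \<in> F \<Longrightarrow> g \<in> F \<Longrightarrow>
           \<gamma> f g * \<epsilon> h (f \<otimes>\<^bsub>G\<^esub> g) =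
           \<epsilon> h f * \<epsilon> h g * \<gamma> (h \<otimes>\<^bsub>G\<^esub> f \<otimes>\<^bsub>G\<^esub> inv\<^bsub>G\<^esub> h) (h \<otimes>\<^bsub>G\<^esub> g \<otimes>\<^bsub>G\<^esub> inv\<^bsub>G\<^esub> h)"
    and "\<And>f g. f \<in> F \<Longrightarrow> g \<in> F \<Longrightarrow>
           \<gamma> f g = \<epsilon> f g * \<gamma> (f \<otimes>\<^bsub>G\<^esub> g \<otimes>\<^bsub>G\<^esub> inv\<^bsub>G\<^esub> f) f"
  shows "trivialising G (A_alg G H F \<gamma> \<epsilon>) \<longleftrightarrow> F = H"
proof -
  interpret group G by fact
  interpret H: group "G\<lparr>carrier := H\<rparr>" by (rule subgroup.subgroup_is_group[OF assms(3,1)])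
  interpret F: normal F "G\<lparr>carrier := H\<rparr>" by fact
  have FH: "F \<subseteq> H" using F.subset by simp
  have F: "subgroup F G" using incl_subgroup[OF assms(3) F.subgroup_axioms] .
  have conj: "h \<otimes>\<^bsub>G\<^esub> f \<otimes>\<^bsub>G\<^esub> inv\<^bsub>G\<^esub> h \<in> F" if "h \<in> H" "f \<in> F" for h f
    using F.inv_op_closed2[of h f] that m_inv_consistent[OF assms(3)] by simp
  \<comment> \<open>The relations of the module are taken over \<open>F\<close>; sufficiency
    concerns the algebra, necessity the module modulo \<open>F\<close>.\<close>
  have data: "crossed_data G H F \<gamma> \<epsilon> F"
    using assms(5) unfolding normalised_2cocycle_def
    by (intro crossed_data.intro crossed_data_axioms.intro finite_grp.intro finite_grp_axioms.intro)
      (simp_all add: assms(1-3,6-8) FH F conj assms(9)[symmetric])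
  show ?thesis
    using crossed_data.trivialising_if[OF data] crossed_data.trivialising_only_if[OF data refl] by blast
qed

end
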